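(* Let $\omega:\mathbb T\to\mathbb R$ be a non-constant real-valued function with $\omega\in L^1(\mathbb T)$ and $\gamma_1=\operatorname{ess\,inf}\omega>-\infty$; put $\gamma_2=\operatorname{ess\,sup}\omega\le+\infty$. Let $\Lambda\subset(\gamma_1,\gamma_2)$ be an interval such that for a.e. $\lambda\in\Lambda$ the set $\Gamma(\lambda)=\{\zeta\in\mathbb T:\omega(\zeta)<\lambda\}$ is (up to a set of measure zero) a union of finitely many open arcs whose closures are pairwise disjoint: $$\Gamma(\lambda)=\bigcup_{j=1}^m(\alpha_j(\lambda),\beta_j(\lambda)),\qquad m<\infty,$$ with $m$ independent of $\lambda$. For $j=1,\dots,m$, $z\in\mathbb D$ and a.e. $\lambda\in\Lambda$ put $$\varphi_j(z;\lambda)=\rho_j(\lambda)\,\xi(z;\lambda)\,\big(1-z\overline{\beta_j(\lambda)}\big)^{-1}\prod_{l=1}^m\big(1-z\overline{\alpha_l(\lambda)}\big)^{-1/2}\big(1-z\overline{\beta_l(\lambda)}\big)^{1/2},$$ where $$\xi(z;\lambda)=\exp\Big(-\frac12\int_{\mathbb T}\ln|\omega(\zeta)-\lambda|\,H(z\overline\zeta)\,d\mathbf m(\zeta)\Big),$$ $$\rho_j(\lambda)=\sqrt{c_j(\lambda)},\qquad c_j(\lambda)=\frac1{2\pi}\Big(\prod_{l=1}^m|\beta_j(\lambda)-\alpha_l(\lambda)|\Big)\Big(\prod_{l\ne j}|\beta_j(\lambda)-\beta_l(\lambda)|^{-1}\Big).$$ Let $E(\lambda)$ be the spectral family of the self-adjoint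 Toeplitz operator $T=T(\omega)$. Then for all $u,v\in\mathbb D$ and a.e. $\lambda\in\Lambda$, $$\frac{d(E(\lambda)K_u,K_v)}{d\lambda}=\sum_{j=1}^m\overline{\varphi_j(u;\lambda)}\,\varphi_j(v;\lambda).$$
   Context: $\mathbb D$ is the open unit disk, $\mathbb T$ the unit circle with normalized Lebesgue measure $d\mathbf m(\zeta)=(2\pi i\zeta)^{-1}d\zeta$; $(\zeta_1,\zeta_2)\subset\mathbb T$ denotes the open arc joining $\zeta_1$ to $\zeta_2$ counterclockwise. $\mathbb H^2\subset L^2(\mathbb T)$ is the Hardy space with inner product $(f,g)=\int_{\mathbb T}f\overline g\,d\mathbf m$. $H(z)=\frac{1+z}{1-z}$, and $K_u(z)=(1-\overline uz)^{-1}$ for $u\in\mathbb D$. Powers $(1+w)^{\pm1/2}=\exp(\pm\frac12\ln(1+w))$, $w\in\mathbb D$, use the branch of $\ln(1+w)$ analytic in $\mathbb D$ with $\ln1=0$. For a.e. $\lambda\in\mathbb R$ one has $\ln|\omega(\cdot)-\lambda|\in L^1(\mathbb T)$, so $\xi(z;\lambda)$ is well defined. Definition of $T(\omega)$: for $\lambda<\gamma_1$ let $F_\lambda(z)=\exp\big(\frac12\int_{\mathbb T}\ln(\omega(\zeta)-\lambda)H(z\overline\zeta)\,d\mathbf m(\zeta)\big)$, $z\in\mathbb D$; this is an outer function in $\mathbb H^2$ with $|F_\lambda(\zeta)|^2=\omega(\zeta)-\lambda$ a.e. on $\mathbb T$. The form $T[f,g]=\int_{\mathbb T}\omega f\overline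 g\,d\mathbf m$ on the domain $D[T]=\{f\in\mathbb H^2: F_\lambda f\in\mathbb H^2\}$ (independent of $\lambda<\gamma_1$) is densely defined, closed and bounded below by $\gamma_1$; $T=T(\omega)$ is the associated self-adjoint operator in $\mathbb H^2$. (If $\omega$ is bounded, $Tf=\mathbb P(\omega f)$ with $\mathbb P$ the orthogonal projection of $L^2(\mathbb T)$ onto $\mathbb H^2$.) $E(\lambda)=E((-\infty,\lambda))$ where $E$ is the spectral measure of $T$. *)

theory Defs
  imports "HOL-Probability.Probability"
begin

text \<open>Functions on the unit circle are represented by functions on the whole complex plane; only
  their values on the circle matter, because \<open>circle_measure\<close> is concentrated there. Elements of
  \<open>L\<^sup>2\<close> are represented by functions rather than by equivalence classes, so equalities
  between them are stated almost everywhere.\<close>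

definition circle_measure :: "complex measure" where
  "circle_measure = distr (uniform_measure lborel {0..<2 * pi}) borel cis"

definition ess_inf :: "'a measure \<Rightarrow> ('a \<Rightarrow> ereal) \<Rightarrow> ereal" where
  "ess_inf M f = - esssup M (\<lambda>x. - f x)"

text \<open>The open arc from \<open>a\<close> counterclockwise to \<open>b\<close>, for \<open>a \<noteq> b\<close> on the unit circle.\<close>

definition open_arc :: "complex \<Rightarrow> complex \<Rightarrow> complex set" where
  "open_arc a b = {a * cis t | t. 0 < t \<and> t < Arg2pi (b / a)}"


subsection \<open>The Hardy space\<close>

definition L2_circle :: "(complex \<Rightarrow> complex) set" where
  "L2_circle = {f \<in> borel_measurable circle_measure.
     integrable circle_measure (\<lambda>\<zeta>. (cmod (f \<zeta>))\<^sup>2)}"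

text \<open>On the circle \<open>\<zeta> ^ n\<close> is the conjugate of \<open>\<zeta> powi (- n)\<close>, so the integral below is the
  Fourier coefficient of \<open>f\<close> of index \<open>- n\<close>.\<close>

definition Hardy2 :: "(complex \<Rightarrow> complex) set" where
  "Hardy2 = {f \<in> L2_circle. \<forall>n::nat. n \<ge> 1 \<longrightarrow> (LINT \<zeta>|circle_measure. f \<zeta> * \<zeta> ^ n) = 0}"

definition hinner :: "(complex \<Rightarrow> complex) \<Rightarrow> (complex \<Rightarrow> complex) \<Rightarrow> complex" where
  "hinner f g = (LINT \<zeta>|circle_measure. f \<zeta> * cnj (g \<zeta>))"

definition K :: "complex \<Rightarrow> complex \<Rightarrow> complex" where
  "K u z = inverse (1 - cnj u * z)"

definition H :: "complex \<Rightarrow> complex" where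
  "H z = (1 + z) / (1 - z)"

definition radial_limit :: "(complex \<Rightarrow> complex) \<Rightarrow> complex \<Rightarrow> complex" where
  "radial_limit f \<zeta> = Lim (at_left 1) (\<lambda>r::real. f (of_real r * \<zeta>))"


subsection \<open>The Toeplitz operator\<close>

definition outer_F :: "(complex \<Rightarrow> real) \<Rightarrow> real \<Rightarrow> complex \<Rightarrow> complex" where
  "outer_F \<omega> \<mu> z =
     exp (1/2 * (LINT \<zeta>|circle_measure. of_real (ln (\<omega> \<zeta> - \<mu>)) * H (z * cnj \<zeta>)))"

definition form_dom :: "(complex \<Rightarrow> real) \<Rightarrow> (complex \<Rightarrow> complex) set" where
  "form_dom \<omega> = {f \<in> Hardy2. \<forall>\<mu>::real. ereal \<mu> < ess_inf circle_measure (\<lambda>\<zeta>. ereal (\<omega> \<zeta>)) \<longrightarrow>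
     (\<lambda>\<zeta>. radial_limit (outer_F \<omega> \<mu>) \<zeta> * f \<zeta>) \<in> Hardy2}"

definition toeplitz_form ::
    "(complex \<Rightarrow> real) \<Rightarrow> (complex \<Rightarrow> complex) \<Rightarrow> (complex \<Rightarrow> complex) \<Rightarrow> complex" where
  "toeplitz_form \<omega> f g = (LINT \<zeta>|circle_measure. of_real (\<omega> \<zeta>) * f \<zeta> * cnj (g \<zeta>))"

text \<open>The operator associated with the form (first representation theorem), as a graph:
  \<open>toeplitz_graph \<omega> f h\<close> means that \<open>f\<close> is in the domain of \<open>T(\<omega>)\<close> and \<open>T(\<omega>) f = h\<close>.\<close>

definition toeplitz_graph ::
    "(complex \<Rightarrow> real) \<Rightarrow> (complex \<Rightarrow> complex) \<Rightarrow> (complex \<Rightarrow> complex) \<Rightarrow> bool" where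
  "toeplitz_graph \<omega> f h \<longleftrightarrow> f \<in> form_dom \<omega> \<and> h \<in> Hardy2 \<and>
     (\<forall>g \<in> form_dom \<omega>. toeplitz_form \<omega> f g = hinner h g)"


subsection \<open>Spectral measures\<close>

text \<open>Linearity (almost everywhere) and compatibility with almost-everywhere equality are
  consequences of the symmetry condition.\<close>

definition orth_projection :: "((complex \<Rightarrow> complex) \<Rightarrow> (complex \<Rightarrow> complex)) \<Rightarrow> bool" where
  "orth_projection P \<longleftrightarrow>
     (\<forall>f \<in> Hardy2. P f \<in> Hardy2) \<and>
     (\<forall>f \<in> Hardy2. AE \<zeta> in circle_measure. P (P f) \<zeta> = P f \<zeta>) \<and>
     (\<forall>f \<in> Hardy2. \<forall>g \<in> Hardy2. hinner (P f) g = hinner f (P g))"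

definition resolution_of_identity ::
    "(real set \<Rightarrow> (complex \<Rightarrow> complex) \<Rightarrow> (complex \<Rightarrow> complex)) \<Rightarrow> bool" where
  "resolution_of_identity E \<longleftrightarrow>
     (\<forall>B \<in> sets borel. orth_projection (E B)) \<and>
     (\<forall>f \<in> Hardy2. AE \<zeta> in circle_measure. E {} f \<zeta> = 0) \<and>
     (\<forall>f \<in> Hardy2. AE \<zeta> in circle_measure. E UNIV f \<zeta> = f \<zeta>) \<and>
     (\<forall>A \<in> sets borel. \<forall>B \<in> sets borel. \<forall>f \<in> Hardy2.
        AE \<zeta> in circle_measure. E (A \<inter> B) f \<zeta> = E A (E B f) \<zeta>) \<and>
     (\<forall>A :: nat \<Rightarrow> real set. range A \<subseteq> sets borel \<longrightarrow> disjoint_family A \<longrightarrow>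
        (\<forall>f \<in> Hardy2. \<forall>g \<in> Hardy2.
           (\<lambda>n. hinner (E (A n) f) g) sums hinner (E (\<Union>n. A n) f) g))"

definition scalar_measure ::
    "(real set \<Rightarrow> (complex \<Rightarrow> complex) \<Rightarrow> (complex \<Rightarrow> complex)) \<Rightarrow> (complex \<Rightarrow> complex) \<Rightarrow> real measure" where
  "scalar_measure E f = measure_of UNIV (sets borel) (\<lambda>B. ennreal (Re (hinner (E B f) f)))"

text \<open>\<open>A = \<integral> x dE(x)\<close> for the operator \<open>A\<close> in \<open>Hardy2\<close> given by its graph: the domain of \<open>A\<close> consists
  of the \<open>f\<close> with \<open>\<integral> x\<^sup>2 d(E f, f) < \<infinity>\<close>, and \<open>(A f, f) = \<integral> x d(E f, f)\<close> there. By polarization the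
  latter gives \<open>(A f, g) = \<integral> x d(E f, g)\<close>.\<close>

definition is_spectral_measure ::
    "((complex \<Rightarrow> complex) \<Rightarrow> (complex \<Rightarrow> complex) \<Rightarrow> bool) \<Rightarrow>
     (real set \<Rightarrow> (complex \<Rightarrow> complex) \<Rightarrow> (complex \<Rightarrow> complex)) \<Rightarrow> bool" where
  "is_spectral_measure A E \<longleftrightarrow>
     resolution_of_identity E \<and>
     (\<forall>f \<in> Hardy2. (\<exists>h. A f h) \<longleftrightarrow> integrable (scalar_measure E f) (\<lambda>x. x\<^sup>2)) \<and>
     (\<forall>f h. A f h \<longrightarrow> hinner h f = of_real (LINT x|scalar_measure E f. x))"


subsection \<open>The functions $\varphi_j$\<close>

definition \<xi> :: "(complex \<Rightarrow> real) \<Rightarrow> complex \<Rightarrow> real \<Rightarrow> complex" where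
  "\<xi> \<omega> z \<mu> =
     exp (- 1/2 * (LINT \<zeta>|circle_measure. of_real (ln \<bar>\<omega> \<zeta> - \<mu>\<bar>) * H (z * cnj \<zeta>)))"

text \<open>\<open>a l\<close> and \<open>b l\<close> (\<open>1 \<le> l \<le> m\<close>) are the endpoints of the arcs forming the sublevel set.\<close>

definition c_coeff :: "nat \<Rightarrow> (nat \<Rightarrow> complex) \<Rightarrow> (nat \<Rightarrow> complex) \<Rightarrow> nat \<Rightarrow> real" where
  "c_coeff m a b j = 1 / (2 * pi) * (\<Prod>l = 1..m. cmod (b j - a l)) *
     (\<Prod>l \<in> {1..m} - {j}. inverse (cmod (b j - b l)))"

definition \<rho> :: "nat \<Rightarrow> (nat \<Rightarrow> complex) \<Rightarrow> (nat \<Rightarrow> complex) \<Rightarrow> nat \<Rightarrow> real" where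
  "\<rho> m a b j = sqrt (c_coeff m a b j)"

text \<open>For \<open>\<bar>w\<bar> < 1\<close>, \<open>(1 + w) powr s = exp (s * Ln (1 + w))\<close> with the principal branch, which is the
  branch of \<open>ln (1 + w)\<close> analytic in the disk and vanishing at \<open>w = 0\<close>.\<close>

definition \<phi> :: "(complex \<Rightarrow> real) \<Rightarrow> nat \<Rightarrow> (nat \<Rightarrow> complex) \<Rightarrow> (nat \<Rightarrow> complex) \<Rightarrow>
    nat \<Rightarrow> complex \<Rightarrow> real \<Rightarrow> complex" where
  "\<phi> \<omega> m a b j z \<mu> = of_real (\<rho> m a b j) * \<xi> \<omega> z \<mu> * inverse (1 - z * cnj (b j)) *
     (\<Prod>l = 1..m. (1 - z * cnj (a l)) powr (- 1/2) * (1 - z * cnj (b l)) powr (1/2))"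

end

theory Submission
  imports Defs "HOL-Complex_Analysis.Complex_Analysis" "HOL-Real_Asymp.Real_Asymp"
begin

text \<open>For real \<open>c\<close> below \<open>\<gamma>1\<close> the operator \<open>T - c\<close> factors through the outer function \<open>F\<close> with
  \<open>|F|\<^sup>2 = \<omega> - c\<close>, so that \<open>(T - c)\<^sup>-\<^sup>1 K\<^sub>u\<close> is a multiple of \<open>K\<^sub>u / F\<close> and
  \<open>((T - c)\<^sup>-\<^sup>1 K\<^sub>u, K\<^sub>v) = K\<^sub>u(v) exp(-1/2 \<integral> ln(\<omega>(\<zeta>) - c) W(\<zeta>) dm(\<zeta>))\<close> with
  \<open>W(\<zeta>) = cnj (H(u cnj \<zeta>)) + H(v cnj \<zeta>)\<close>.  Both sides continue analytically in \<open>c\<close>: the left one is the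
  Cauchy transform of the spectral measure of the pair \<open>K\<^sub>u, K\<^sub>v\<close>, whose jump across the real line at
  \<open>\<mu>\<close> is, for almost every \<open>\<mu>\<close>, \<open>2 \<pi> \<i>\<close> times the derivative of the spectral family (Fatou).  On the right, the
  boundary values exist whenever \<open>ln |\<omega> - \<mu>|\<close> is integrable and differ only in the sign of the phase
  \<open>\<pm>\<pi>\<close> that the logarithm takes on \<open>{\<omega> < \<mu>}\<close>.  When this set is a finite union of arcs, the
  exponential of the integral of \<open>H\<close> over it is algebraic, and the partial fraction expansion of
  \<open>\<Prod>l. (1 - z cnj a\<^sub>l) / (1 - z cnj b\<^sub>l)\<close> turns the jump into the sum over \<open>j\<close>; the disjointness of the
  arcs makes all its coefficients positive multiples of one common phase.\<close>

subsection \<open>Differentiation of finite measures on the line\<close>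

text \<open>The spectral measure may have a singular part as far as the proof knows, so the
  derivative comes from Lebesgue differentiation of arbitrary finite measures, applied to the four
  positive measures of the vectors \<open>K u + s * K v\<close> with \<open>s\<close> in
  \<open>{1, -1, \<i>, -\<i>}\<close>; polarization then yields the pair \<open>K u\<close>,
  \<open>K v\<close>. Differentiation, combined with one abstract statement on approximate
  identities, is used twice. With the Poisson kernel of the disc it gives boundary values of outer
  functions: \<open>F\<close> is unbounded in general, but \<open>1 / F\<close> is bounded because
  \<omega> - c stays away from zero, so Fatou's theorem for bounded functions is enough. With the
  Poisson kernel of the half-plane it turns the jump of the Cauchy transform into a derivative. The
  other obstacle is that \<open>E\<close> is tied to the operator only by its domain and its
  quadratic form. That resolvent matrix elements are Cauchy transforms must be extracted from these
  two facts; polarization would lead to signed measures, so each identity is rearranged until only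
  nonnegative integrals are compared.\<close>

lemma emeasure_UN_countable_le:
  assumes "countable C" and [measurable]: "\<And>i. i \<in> C \<Longrightarrow> X i \<in> sets M"
  shows "emeasure M (\<Union>i\<in>C. X i) \<le> (\<integral>\<^sup>+i. emeasure M (X i) \<partial>count_space C)"
proof -
  have [measurable]: "(\<Union>i\<in>C. X i) \<in> sets M" using assms by (intro sets.countable_UN'') auto
  have "emeasure M (\<Union>i\<in>C. X i) = (\<integral>\<^sup>+x. indicator (\<Union>i\<in>C. X i) x \<partial>M)" by simp
  also have "\<dots> \<le> (\<integral>\<^sup>+x. \<integral>\<^sup>+i. indicator (X i) x \<partial>count_space C \<partial>M)"
  proof (intro nn_integral_mono)
    fix x
    show "indicator (\<Union>i\<in>C. X i) x \<le> (\<integral>\<^sup>+i. indicator (X i) x \<partial>count_space C :: ennreal)"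
    proof (cases "x \<in> (\<Union>i\<in>C. X i)")
      case True
      then obtain i where i: "i \<in> C" "x \<in> X i" by auto
      have "(1::ennreal) = (\<integral>\<^sup>+j. indicator {i} j \<partial>count_space C)" using i by simp
      also have "\<dots> \<le> (\<integral>\<^sup>+j. indicator (X j) x \<partial>count_space C)"
        using i by (intro nn_integral_mono) (auto simp: indicator_def)
      finally show ?thesis using True by simp
    qed simp
  qed
  also have "\<dots> = (\<integral>\<^sup>+i. \<integral>\<^sup>+x. indicator (X i) x \<partial>M \<partial>count_space C)"
    using assms by (intro nn_integral_count_space_nn_integral) auto
  also have "\<dots> = (\<integral>\<^sup>+i. emeasure M (X i) \<partial>count_space C)"
    by (intro nn_integral_cong) auto
  finally show ?thesis .
qed

text \<open>Vitali covering argument. Let \<open>S k\<close> be the set of points of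
  \<open>A\<close> around which arbitrarily small balls carry more mass than their radius divided by
  k + 1. By outer regularity \<open>A\<close> lies in an open \<open>U\<close> of tiny mass; a
  disjoint family of such balls inside \<open>U\<close> has total radius at most (k + 1) times that
  mass, and the enlarged balls still cover \<open>S k\<close>. So each \<open>S k\<close> is
  Lebesgue negligible.\<close>

lemma AE_upper_density_zero:
  fixes M :: "real measure"
  assumes M: "sets M = sets borel" "finite_measure M" and A: "A \<in> sets borel" "emeasure M A = 0"
  shows "AE x in lborel. x \<in> A \<longrightarrow> ((\<lambda>h. measure M (ball x h) / h) \<longlongrightarrow> 0) (at_right 0)"
proof -
  interpret finite_measure M by fact
  define S where "S k = {x\<in>A. \<forall>d>0. \<exists>h. 0 < h \<and> h < d \<and> measure M (ball x h) > h / real (Suc k)}" for k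
  have neg: "negligible (S k)" for k
  proof (unfold negligible_outer_le, intro allI impI)
    fix e :: real assume e: "e > 0"
    \<comment> \<open>The covering lemma enlarges balls five times, so a ball of radius r costs
      Lebesgue measure 10 r, and r is below (k + 1) times the mass of the ball; \<open>e'\<close>
      makes the total cost \<open>e\<close>.\<close>
    define e' where "e' = e / (10 * real (Suc k))"
    have e': "e' > 0" using e by (simp add: e'_def)
    have "emeasure M A = (INF U\<in>{U. A \<subseteq> U \<and> open U}. emeasure M U)"
      by (rule outer_regular) (use M A in auto)
    hence "(INF U\<in>{U. A \<subseteq> U \<and> open U}. emeasure M U) < ennreal e'" using e' A(2) by simp
    then obtain U where U: "A \<subseteq> U" "open U" "emeasure M U < ennreal e'"
      by (auto simp: INF_less_iff)
    have Us: "U \<in> sets M" using U M by auto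
    have mU: "measure M U < e'" using U(3) e' by (simp add: emeasure_eq_measure ennreal_less_iff)
    \<comment> \<open>Radii are kept below 1 because the covering lemma asks for bounded
      radii.\<close>
    have "\<exists>h. 0 < h \<and> h < 1 \<and> ball x h \<subseteq> U \<and> measure M (ball x h) > h / real (Suc k)" if x: "x \<in> S k" for x
    proof -
      have "x \<in> U" using x U by (auto simp: S_def)
      then obtain d where d: "d > 0" "ball x d \<subseteq> U" using U(2) open_contains_ball by blast
      obtain h where "0 < h" "h < min d 1" "measure M (ball x h) > h / real (Suc k)"
        using x d by (auto simp: S_def dest!: spec[of _ "min d 1"])
      thus ?thesis using d by (intro exI[of _ h]) (auto intro: subset_trans[OF subset_ball])
    qed
    then obtain r where r: "\<And>x. x \<in> S k \<Longrightarrow> 0 < r x \<and> r x < 1 \<and> ball x (r x) \<subseteq> U \<and> measure M (ball x (r x)) > r x / real (Suc k)"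
      by metis
    obtain C where C: "countable C" "C \<subseteq> S k" "pairwise (\<lambda>i j. disjnt (ball i (r i)) (ball j (r j))) C"
      and cov: "S k \<subseteq> (\<Union>i\<in>C. ball i (5 * r i))"
      by (rule Vitali_covering_lemma_balls[of "S k" "\<lambda>x. x" r "S k" 1]) (use r in \<open>force+\<close>)
    have disj: "disjoint_family_on (\<lambda>i. ball i (r i)) C"
      using C(3) by (auto simp: disjoint_family_on_def pairwise_def disjnt_def)
    define T where "T = (\<Union>i\<in>C. ball i (5 * r i))"
    have Tb: "T \<in> sets borel" unfolding T_def using C(1) by (intro sets.countable_UN'') auto
    have "emeasure lborel T \<le> (\<integral>\<^sup>+i. emeasure lborel (ball i (5 * r i)) \<partial>count_space C)"
      unfolding T_def using C(1) by (intro emeasure_UN_countable_le) auto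
    also have "\<dots> \<le> (\<integral>\<^sup>+i. ennreal (10 * real (Suc k)) * emeasure M (ball i (r i)) \<partial>count_space C)"
    proof (intro nn_integral_mono)
      fix i assume "i \<in> space (count_space C)"
      hence i: "i \<in> S k" using C by auto
      have "emeasure lborel (ball i (5 * r i)) = ennreal (10 * r i)"
        using r[OF i] by (simp add: ball_eq_greaterThanLessThan)
      also have "\<dots> \<le> ennreal (10 * real (Suc k) * measure M (ball i (r i)))"
        using r[OF i] by (intro ennreal_leI) (simp add: field_simps)
      finally show "emeasure lborel (ball i (5 * r i)) \<le> ennreal (10 * real (Suc k)) * emeasure M (ball i (r i))"
        by (simp add: emeasure_eq_measure ennreal_mult)
    qed
    also have "\<dots> = ennreal (10 * real (Suc k)) * (\<integral>\<^sup>+i. emeasure M (ball i (r i)) \<partial>count_space C)"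
      by (rule nn_integral_cmult) auto
    also have "(\<integral>\<^sup>+i. emeasure M (ball i (r i)) \<partial>count_space C) = emeasure M (\<Union>i\<in>C. ball i (r i))"
      by (rule emeasure_UN_countable[symmetric]) (use disj C M in auto)
    also have "\<dots> \<le> emeasure M U"
      by (rule emeasure_mono) (use r C Us in \<open>auto simp: subset_iff\<close>)
    also have "emeasure M U = ennreal (measure M U)" by (simp add: emeasure_eq_measure)
    also have "ennreal (10 * real (Suc k)) * ennreal (measure M U) \<le> ennreal (10 * real (Suc k)) * ennreal e'"
      using mU by (intro mult_left_mono ennreal_leI) auto
    also have "\<dots> = ennreal e"
      using e by (simp add: e'_def ennreal_mult[symmetric] del: of_nat_Suc)
    finally have le: "emeasure lborel T \<le> ennreal e" by (simp add: mult_left_mono)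
    have "emeasure lebesgue T \<le> ennreal e" using le Tb by simp
    moreover have "T \<in> sets lebesgue" using Tb by simp
    ultimately show "\<exists>T. S k \<subseteq> T \<and> T \<in> lmeasurable \<and> measure lebesgue T \<le> e"
      using cov e by (intro exI[of _ T] conjI)
        (auto simp: T_def[symmetric] fmeasurable_def measure_def intro: enn2real_leI order_le_less_trans)
  qed
  have "negligible (\<Union>k. S k)" using neg by (intro negligible_countable_Union) auto
  hence "(\<Union>k. S k) \<in> null_sets lebesgue" by (simp add: negligible_iff_null_sets)
  hence "AE x in lebesgue. x \<notin> (\<Union>k. S k)" by (rule AE_not_in)
  hence "AE x in lborel. x \<notin> (\<Union>k. S k)" by (simp add: AE_completion_iff)
  thus ?thesis
  proof eventually_elim
    case (elim x)
    show ?case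
    proof (intro impI tendstoI)
      fix e :: real assume x: "x \<in> A" and e: "e > 0"
      obtain k where k: "inverse (real (Suc k)) < e" using reals_Archimedean[OF e] by blast
      from elim x have "x \<notin> S k" by auto
      then obtain d where d: "d > 0" "\<And>h. 0 < h \<Longrightarrow> h < d \<Longrightarrow> measure M (ball x h) \<le> h / real (Suc k)"
        using x unfolding S_def by (simp del: of_nat_Suc) (meson not_less)
      show "\<forall>\<^sub>F h in at_right 0. dist (measure M (ball x h) / h) 0 < e"
        unfolding eventually_at_right_field
      proof (intro exI[of _ d] conjI allI impI d(1))
        fix h :: real assume h: "0 < h" "h < d"
        have "measure M (ball x h) / h \<le> inverse (real (Suc k))"
          using d(2)[OF h] h by (simp add: field_simps)
        thus "dist (measure M (ball x h) / h) 0 < e" using k h by (simp add: dist_real_def)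
      qed
    qed
  qed
qed

lemma measure_density_lborel:
  fixes g :: "'a::euclidean_space \<Rightarrow> real"
  assumes g: "integrable lborel g" "\<And>s. 0 \<le> g s" and [measurable]: "B \<in> sets borel"
  shows "measure (density lborel (\<lambda>s. ennreal (g s))) B = (LINT s:B|lborel. g s)"
proof -
  have [measurable]: "g \<in> borel_measurable borel" using g by auto
  have "emeasure (density lborel (\<lambda>s. ennreal (g s))) B = (\<integral>\<^sup>+s. ennreal (g s) * indicator B s \<partial>lborel)"
    by (rule emeasure_density) auto
  also have "\<dots> = (\<integral>\<^sup>+s. ennreal (indicator B s * g s) \<partial>lborel)"
    by (intro nn_integral_cong) (auto simp: indicator_def)
  also have "\<dots> = ennreal (LINT s|lborel. indicator B s * g s)"
    using g by (intro nn_integral_eq_integral) (auto intro: integrable_mult_indicator[OF _ g(1), of B, simplified])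
  finally show ?thesis unfolding measure_def set_lebesgue_integral_def
    using g by (simp add: Bochner_Integration.integral_nonneg)
qed

lemma finite_measure_density_lborel:
  fixes g :: "'a::euclidean_space \<Rightarrow> real"
  assumes g: "integrable lborel g" "\<And>s. 0 \<le> g s"
  shows "finite_measure (density lborel (\<lambda>s. ennreal (g s)))"
  by (rule finite_measureI) (use g in \<open>auto simp: emeasure_density nn_integral_eq_integral\<close>)

text \<open>Upper half of Lebesgue's differentiation theorem. For rational \<open>q\<close> the
  excess of \<open>f\<close> over \<open>q\<close> defines a measure without mass on the set where
  \<open>f\<close> is at most \<open>q\<close>, hence of density zero at almost every point there;
  near such a point the mean of \<open>f\<close> exceeds \<open>q\<close> by arbitrarily little, and
  \<open>q\<close> can be taken just above \<open>f x\<close>.\<close>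

lemma AE_slope_upper:
  fixes f :: "real \<Rightarrow> real"
  assumes f[measurable]: "integrable lborel f"
  defines "F \<equiv> \<lambda>t. LINT s:{..<t}|lborel. f s"
  shows "AE x in lborel. \<forall>e>0. \<forall>\<^sub>F y in at x. (F y - F x) / (y - x) < f x + e"
proof -
  have [measurable]: "f \<in> borel_measurable lborel" using f by auto
  \<comment> \<open>For negative \<open>q\<close> the excess is not integrable on the whole line,
    hence the cut-off to a ball.\<close>
  define g where "g q n s = max 0 (f s - q) * indicator (ball 0 (real n)) s" for q n s
  have g_int: "integrable lborel (g q n)" for q n
  proof (rule Bochner_Integration.integrable_bound)
    show "integrable lborel (\<lambda>s. norm (f s) + \<bar>q\<bar> * indicator (ball 0 (real n)) s)"
      by (intro Bochner_Integration.integrable_add integrable_norm f integrable_mult_right integrable_real_indicator)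
         (auto simp: ball_eq_greaterThanLessThan)
  next
    have [measurable]: "ball 0 (real n) \<in> sets (borel :: real measure)" by simp
    show "g q n \<in> borel_measurable lborel" unfolding g_def by measurable
  qed (auto simp: g_def indicator_def)
  have g0: "g q n s \<ge> 0" for q n s by (simp add: g_def)
  have [measurable]: "g q n \<in> borel_measurable lborel" for q n using g_int by auto
  have "AE x in lborel. x \<in> {x. f x \<le> q} \<longrightarrow> ((\<lambda>h. measure (density lborel (\<lambda>s. ennreal (g q n s))) (ball x h) / h) \<longlongrightarrow> 0) (at_right 0)" for q n
  proof (rule AE_upper_density_zero)
    show "finite_measure (density lborel (\<lambda>s. ennreal (g q n s)))"
      using g_int g0 by (rule finite_measure_density_lborel)
    have "emeasure (density lborel (\<lambda>s. ennreal (g q n s))) {x. f x \<le> q} = (\<integral>\<^sup>+s. ennreal (g q n s) * indicator {x. f x \<le> q} s \<partial>lborel)"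
      by (rule emeasure_density) auto
    also have "\<dots> = (\<integral>\<^sup>+s. 0 \<partial>(lborel::real measure))"
      by (intro nn_integral_cong) (auto simp: g_def indicator_def max_def)
    finally show "emeasure (density lborel (\<lambda>s. ennreal (g q n s))) {x. f x \<le> q} = 0" by simp
  qed auto
  hence "AE x in lborel. \<forall>q\<in>\<rat>. \<forall>n. x \<in> {x. f x \<le> q} \<longrightarrow> ((\<lambda>h. measure (density lborel (\<lambda>s. ennreal (g q n s))) (ball x h) / h) \<longlongrightarrow> 0) (at_right 0)"
    unfolding AE_all_countable by (intro AE_ball_countable[THEN iffD2] countable_rat ballI AE_all_countable[THEN iffD2] allI) blast
  thus ?thesis
  proof eventually_elim
    case (elim x)
    show ?case
    proof (intro allI impI)
      fix e :: real assume e: "e > 0"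
      obtain q where q: "q \<in> \<rat>" "f x < q" "q < f x + e / 2" using Rats_dense_in_real[of "f x" "f x + e/2"] e by auto
      obtain n :: nat where n: "\<bar>x\<bar> + 1 < real n" using reals_Archimedean2 by blast
      have "((\<lambda>h. measure (density lborel (\<lambda>s. ennreal (g q n s))) (ball x h) / h) \<longlongrightarrow> 0) (at_right 0)"
        using elim q by auto
      from tendstoD[OF this, of "e / 4"] e have "\<forall>\<^sub>F h in at_right 0. \<bar>measure (density lborel (\<lambda>s. ennreal (g q n s))) (ball x h) / h\<bar> < e / 4"
        by (simp add: dist_real_def)
      then obtain d where d: "d > 0" "\<And>h. 0 < h \<Longrightarrow> h < d \<Longrightarrow> \<bar>measure (density lborel (\<lambda>s. ennreal (g q n s))) (ball x h) / h\<bar> < e / 4"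
        unfolding eventually_at_right_field by auto
      \<comment> \<open>One estimate for intervals to the right and to the left of \<open>x\<close>;
        the radius \<open>h\<close> is twice the length, so that the open ball also contains the far
        endpoint on the left.\<close>
      have key: "(LINT s:{a..<b}|lborel. f s) < (f x + e) * (b - a)"
        if ab: "a < b" "a = x \<or> b = x" "b - a < min (d / 2) (1/2)" for a b
      proof -
        define h where "h = 2 * (b - a)"
        have h: "0 < h" "h < d" "h < 1" using ab by (auto simp: h_def)
        have sub: "{a..<b} \<subseteq> ball x h" using ab by (auto simp: h_def dist_real_def)
        have subn: "ball x h \<subseteq> ball 0 (real n)"
        proof
          fix y assume "y \<in> ball x h"
          hence "\<bar>x - y\<bar> < 1" using h by (simp add: dist_real_def)
          thus "y \<in> ball 0 (real n)" using n by (simp add: dist_real_def)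
        qed
        have gi: "set_integrable lborel (ball x h) (g q n)"
          unfolding set_integrable_def by (rule integrable_mult_indicator[OF _ g_int]) auto
        have "(LINT s:{a..<b}|lborel. f s) \<le> (LINT s|lborel. indicator {a..<b} s * q + indicator (ball x h) s * g q n s)"
          unfolding set_lebesgue_integral_def
        proof (rule integral_mono)
          show "integrable lborel (\<lambda>s. indicator {a..<b} s *\<^sub>R f s)" by (rule integrable_mult_indicator[OF _ f]) auto
          show "integrable lborel (\<lambda>s. indicator {a..<b} s * q + indicator (ball x h) s * g q n s)"
            using gi ab(1) by (intro Bochner_Integration.integrable_add integrable_mult_left integrable_real_indicator)
                (simp_all add: set_integrable_def)
          fix s show "indicator {a..<b} s *\<^sub>R f s \<le> indicator {a..<b} s * q + indicator (ball x h) s * g q n s"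
            using sub subn g0 by (auto simp: indicator_def g_def subset_iff)
        qed
        also have "\<dots> = q * (b - a) + (LINT s:ball x h|lborel. g q n s)"
        proof -
          have "emeasure lborel {a..<b} < \<infinity>" "measure lborel {a..<b} = b - a" using ab by auto
          thus ?thesis using gi
            by (subst Bochner_Integration.integral_add) (auto simp: set_integrable_def set_lebesgue_integral_def)
        qed
        also have "(LINT s:ball x h|lborel. g q n s) = measure (density lborel (\<lambda>s. ennreal (g q n s))) (ball x h)"
          using g_int g0 by (intro measure_density_lborel[symmetric]) auto
        also have "\<dots> < e / 4 * h" using d(2)[OF h(1,2)] h by (simp add: abs_less_iff field_simps)
        also have "q * (b - a) + e / 4 * h \<le> (f x + e / 2) * (b - a) + e / 2 * (b - a)"
        proof -
          have "q * (b - a) \<le> (f x + e / 2) * (b - a)" using q ab by (intro mult_right_mono) auto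
          moreover have "e / 4 * h = e / 2 * (b - a)" by (simp add: h_def)
          ultimately show ?thesis by linarith
        qed
        finally show ?thesis by (simp add: field_simps)
      qed
      have diff: "F b - F a = (LINT s:{a..<b}|lborel. f s)" if "a < b" for a b
      proof -
        have "F b = (LINT s:{..<a} \<union> {a..<b}|lborel. f s)"
          unfolding F_def using that by (intro arg_cong2[where f="\<lambda>A f. set_lebesgue_integral lborel A f"]) (auto simp: ivl_disj_un)
        also have "\<dots> = F a + (LINT s:{a..<b}|lborel. f s)"
          unfolding F_def by (rule set_integral_Un) (auto simp: set_integrable_def simp del: real_scaleR_def intro!: integrable_mult_indicator f)
        finally show ?thesis by simp
      qed
      show "\<forall>\<^sub>F y in at x. (F y - F x) / (y - x) < f x + e"
        unfolding eventually_at
      proof (intro exI[of _ "min (d / 2) (1 / 2)"] conjI ballI impI)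
        show "min (d / 2) (1 / 2) > 0" using d by simp
        fix y assume y: "y \<noteq> x \<and> dist y x < min (d / 2) (1 / 2)"
        show "(F y - F x) / (y - x) < f x + e"
        proof (cases "x < y")
          case True
          thus ?thesis using key[of x y] diff[of x y] y by (simp add: dist_real_def pos_divide_less_eq)
        next
          case False
          hence l: "y < x" using y by auto
          have "F x - F y < (f x + e) * (x - y)" using key[of y x] diff[of y x] y l by (simp add: dist_real_def)
          moreover have "(F y - F x) / (y - x) = (F x - F y) / (x - y)" using l by (simp add: field_simps)
          ultimately show ?thesis using l by (simp add: pos_divide_less_eq)
        qed
      qed
    qed
  qed
qed

lemma AE_has_real_derivative_primitive:
  fixes f :: "real \<Rightarrow> real"
  assumes f: "integrable lborel f"
  shows "AE x in lborel. ((\<lambda>t. LINT s:{..<t}|lborel. f s) has_real_derivative f x) (at x)"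
proof -
  let ?F = "\<lambda>t. LINT s:{..<t}|lborel. f s"
  have "AE x in lborel. \<forall>e>0. \<forall>\<^sub>F y in at x. (?F y - ?F x) / (y - x) < f x + e"
    by (rule AE_slope_upper[OF f])
  moreover have "AE x in lborel. \<forall>e>0. \<forall>\<^sub>F y in at x.
      ((LINT s:{..<y}|lborel. - f s) - (LINT s:{..<x}|lborel. - f s)) / (y - x) < - f x + e"
    by (rule AE_slope_upper) (use f in auto)
  ultimately show ?thesis
  proof eventually_elim
    case (elim x)
    show ?case unfolding has_field_derivative_iff
    proof (rule tendstoI)
      fix e :: real assume e: "e > 0"
      have "\<forall>\<^sub>F y in at x. (?F y - ?F x) / (y - x) < f x + e" using elim(1) e by blast
      moreover have "\<forall>\<^sub>F y in at x. ((LINT s:{..<y}|lborel. - f s) - (LINT s:{..<x}|lborel. - f s)) / (y - x) < - f x + e"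
        using elim(2) e by blast
      ultimately show "\<forall>\<^sub>F y in at x. dist ((?F y - ?F x) / (y - x)) (f x) < e"
      proof eventually_elim
        case (elim y)
        have "((LINT s:{..<y}|lborel. - f s) - (LINT s:{..<x}|lborel. - f s)) / (y - x) = - ((?F y - ?F x) / (y - x))"
          by (simp add: set_lebesgue_integral_def minus_divide_left)
        with elim show ?case by (simp add: dist_real_def abs_less_iff)
      qed
    qed
  qed
qed

text \<open>The masses that null sets of \<open>L\<close> can carry have a supremum, attained by the
  union \<open>N\<close> of a maximizing sequence. A null set with mass outside \<open>N\<close>
  would push \<open>N\<close> beyond the supremum. So \<open>N\<close> carries the singular part of
  the Lebesgue decomposition.\<close>

lemma absolutely_continuous_off_null_set:
  fixes M :: "'a measure" and L :: "'a measure"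
  assumes "sets M = sets L" "finite_measure M"
  obtains N where "N \<in> null_sets L" "\<And>B. B \<in> null_sets L \<Longrightarrow> emeasure M (B - N) = 0"
proof -
  interpret finite_measure M by fact
  define s where "s = (SUP B\<in>null_sets L. measure M B)"
  have bdd: "bdd_above (measure M ` null_sets L)" by (auto intro!: bdd_aboveI[of _ "measure M (space M)"] bounded_measure)
  have "\<exists>B\<in>null_sets L. measure M B > s - inverse (real (Suc n))" for n
    unfolding s_def using less_cSUP_iff[of "null_sets L" "measure M", OF _ bdd, of "s - inverse (real (Suc n))"]
    by (force simp: s_def)
  then obtain B where B: "\<And>n. B n \<in> null_sets L" "\<And>n. measure M (B n) > s - inverse (real (Suc n))" by metis
  define N where "N = (\<Union>n. B n)"
  have N: "N \<in> null_sets L" unfolding N_def using B by auto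
  have Ns: "N \<in> sets M" using N assms by auto
  have ge: "measure M N \<ge> s"
  proof (rule field_le_epsilon)
    fix e :: real assume "e > 0"
    then obtain n where "inverse (real (Suc n)) < e" using reals_Archimedean by blast
    moreover have "measure M (B n) \<le> measure M N" using Ns by (intro finite_measure_mono) (auto simp: N_def)
    ultimately show "s \<le> measure M N + e" using B(2)[of n] by simp
  qed
  show ?thesis
  proof (rule that[OF N])
    fix C assume C: "C \<in> null_sets L"
    have Cs: "C \<in> sets M" using C assms by auto
    have "N \<union> C \<in> null_sets L" using N C by auto
    hence "measure M (N \<union> C) \<le> s" unfolding s_def using bdd by (intro cSUP_upper) auto
    moreover have "measure M (N \<union> (C - N)) = measure M N + measure M (C - N)"
      using Ns Cs by (intro finite_measure_Union) auto
    ultimately have "measure M (C - N) = 0" using ge measure_nonneg[of M "C - N"] unfolding Un_Diff_cancel by linarith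
    thus "emeasure M (C - N) = 0" by (simp add: emeasure_eq_measure)
  qed
qed

text \<open>Outside \<open>N\<close> the measure has a density, whose primitive is differentiable
  almost everywhere; the rest lives on the null set \<open>N\<close>, so its density vanishes at
  almost every point off \<open>N\<close>. Open rays \<open>{..<t}\<close> are used because the
  spectral family is defined with them.\<close>

lemma AE_differentiable_cdf:
  fixes M :: "real measure"
  assumes M: "sets M = sets borel" "finite_measure M"
  shows "AE x in lborel. \<exists>D. ((\<lambda>t. measure M {..<t}) has_real_derivative D) (at x)"
proof -
  interpret finite_measure M by fact
  obtain N where N: "N \<in> null_sets lborel" "\<And>B. B \<in> null_sets lborel \<Longrightarrow> emeasure M (B - N) = 0"
    using absolutely_continuous_off_null_set[of M lborel] M by auto
  have Ns[measurable]: "N \<in> sets borel" using N by auto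
  define M1 where "M1 = density M (indicator (-N))"
  define M2 where "M2 = density M (indicator N)"
  have e1: "emeasure M1 B = emeasure M (B - N)" and e2: "emeasure M2 B = emeasure M (B \<inter> N)" if "B \<in> sets borel" for B
  proof -
    have "emeasure M1 B = (\<integral>\<^sup>+x. indicator (-N) x * indicator B x \<partial>M)"
      unfolding M1_def using that M by (intro emeasure_density) auto
    also have "\<dots> = (\<integral>\<^sup>+x. indicator (B - N) x \<partial>M)" by (intro nn_integral_cong) (auto simp: indicator_def)
    finally show "emeasure M1 B = emeasure M (B - N)" using that M by simp
    have "emeasure M2 B = (\<integral>\<^sup>+x. indicator N x * indicator B x \<partial>M)"
      unfolding M2_def using that M by (intro emeasure_density) auto
    also have "\<dots> = (\<integral>\<^sup>+x. indicator (B \<inter> N) x \<partial>M)" by (intro nn_integral_cong) (auto simp: indicator_def)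
    finally show "emeasure M2 B = emeasure M (B \<inter> N)" using that M by simp
  qed
  have s12: "sets M1 = sets borel" "sets M2 = sets borel" "space M1 = UNIV" "space M2 = UNIV"
    using M sets_eq_imp_space_eq[OF M(1)] by (auto simp: M1_def M2_def)
  interpret M1: finite_measure M1 by (rule finite_measureI) (auto simp: e1 s12)
  interpret M2: finite_measure M2 by (rule finite_measureI) (auto simp: e2 s12)
  have mM: "measure M B = measure M1 B + measure M2 B" if "B \<in> sets borel" for B
  proof -
    have "measure M ((B - N) \<union> (B \<inter> N)) = measure M (B - N) + measure M (B \<inter> N)"
      using that M by (intro finite_measure_Union) auto
    moreover have "(B - N) \<union> (B \<inter> N) = B" by auto
    ultimately show ?thesis using e1[OF that] e2[OF that] by (simp add: measure_def)
  qed
  have "absolutely_continuous lborel M1"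
    unfolding absolutely_continuous_def
    using N(2) s12 by (auto simp: null_sets_def e1)
  then obtain f where f: "f \<in> borel_measurable lborel" "density lborel f = M1"
    using sigma_finite_measure.Radon_Nikodym[OF sigma_finite_lborel, of M1] s12 by auto
  have [measurable]: "f \<in> borel_measurable borel" using f by simp
  have "(\<integral>\<^sup>+x. f x \<partial>lborel) = emeasure M1 UNIV" using f(2)[symmetric] by (simp add: emeasure_density)
  hence fin: "(\<integral>\<^sup>+x. f x \<partial>lborel) \<noteq> \<infinity>" using M1.emeasure_finite[of UNIV] by simp
  have "AE x in lborel. f x \<noteq> \<infinity>" by (rule nn_integral_PInf_AE) (use fin in auto)
  \<comment> \<open>The total mass is finite, so the Radon-Nikodym density is finite almost
    everywhere and may be replaced by a real function.\<close>
  hence fe: "AE x in lborel. f x = ennreal (enn2real (f x))" by eventually_elim (simp add: less_top)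
  define g where "g x = enn2real (f x)" for x
  have [measurable]: "g \<in> borel_measurable borel" unfolding g_def by measurable
  have ng: "(\<integral>\<^sup>+x. ennreal (g x) * indicator B x \<partial>lborel) = emeasure M1 B" if [measurable]: "B \<in> sets borel" for B
  proof -
    have "(\<integral>\<^sup>+x. ennreal (g x) * indicator B x \<partial>lborel) = (\<integral>\<^sup>+x. f x * indicator B x \<partial>lborel)"
      by (rule nn_integral_cong_AE) (use fe in \<open>auto simp: g_def\<close>)
    also have "\<dots> = emeasure (density lborel f) B" by (rule emeasure_density[symmetric]) auto
    finally show ?thesis using f by simp
  qed
  have gi: "integrable lborel g"
  proof (rule integrableI_nonneg)
    show "(\<integral>\<^sup>+x. ennreal (g x) \<partial>lborel) < \<infinity>" using ng[of UNIV] M1.emeasure_finite[of UNIV] by (simp add: less_top[symmetric])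
  qed (auto simp: g_def)
  have m1: "measure M1 {..<t} = (LINT s:{..<t}|lborel. g s)" for t
  proof -
    have "emeasure M1 {..<t} = (\<integral>\<^sup>+x. ennreal (indicator {..<t} x * g x) \<partial>lborel)"
      by (subst ng[symmetric]) (auto intro!: nn_integral_cong simp: indicator_def)
    also have "\<dots> = ennreal (LINT s|lborel. indicator {..<t} s * g s)"
      by (intro nn_integral_eq_integral) (auto simp: g_def intro: integrable_mult_indicator[OF _ gi, of "{..<t}", simplified, unfolded g_def])
    finally show ?thesis unfolding measure_def set_lebesgue_integral_def
      by (simp add: Bochner_Integration.integral_nonneg g_def)
  qed
  have "AE x in lborel. ((\<lambda>t. LINT s:{..<t}|lborel. g s) has_real_derivative g x) (at x)"
    by (rule AE_has_real_derivative_primitive[OF gi])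
  moreover have "AE x in lborel. x \<in> -N \<longrightarrow> ((\<lambda>h. measure M2 (ball x h) / h) \<longlongrightarrow> 0) (at_right 0)"
    by (rule AE_upper_density_zero) (use s12 M2.finite_measure_axioms in \<open>auto simp: e2\<close>)
  moreover have "AE x in lborel. x \<notin> N" using N(1) by (rule AE_not_in)
  ultimately show ?thesis
  proof eventually_elim
    case (elim x)
    have lim: "((\<lambda>h. measure M2 (ball x h) / h) \<longlongrightarrow> 0) (at_right 0)" using elim by auto
    have "((\<lambda>t. measure M2 {..<t}) has_real_derivative 0) (at x)"
      unfolding has_field_derivative_iff
    proof (rule tendstoI)
      fix e :: real assume e: "e > 0"
      from tendstoD[OF lim, of "e / 2"] e obtain d where d: "d > 0"
        "\<And>h. 0 < h \<Longrightarrow> h < d \<Longrightarrow> \<bar>measure M2 (ball x h) / h\<bar> < e / 2"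
        unfolding eventually_at_right_field dist_real_def by auto
      show "\<forall>\<^sub>F y in at x. dist ((measure M2 {..<y} - measure M2 {..<x}) / (y - x)) 0 < e"
        unfolding eventually_at
      proof (intro exI[of _ "d / 2"] conjI ballI impI)
        fix y assume y: "y \<noteq> x \<and> dist y x < d / 2"
        define a b where "a = min x y" "b = max x y"
        have ab: "a < b" "b - a = \<bar>y - x\<bar>" using y by (auto simp: a_b_def min_def max_def)
        have "measure M2 ({..<a} \<union> {a..<b}) = measure M2 {..<a} + measure M2 {a..<b}"
          by (rule M2.finite_measure_Union) (auto simp: s12)
        moreover have "{..<a} \<union> {a..<b} = {..<b}" using ab by auto
        ultimately have "\<bar>measure M2 {..<y} - measure M2 {..<x}\<bar> = measure M2 {a..<b}"
          by (cases "x < y") (auto simp: a_b_def min_def max_def)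
        also have "\<dots> \<le> measure M2 (ball x (2 * \<bar>y - x\<bar>))"
        proof (rule M2.finite_measure_mono)
          show "{a..<b} \<subseteq> ball x (2 * \<bar>y - x\<bar>)" using y by (auto simp: a_b_def dist_real_def min_def max_def split: if_splits)
        qed (auto simp: s12)
        also have "\<dots> < e / 2 * (2 * \<bar>y - x\<bar>)"
          using d(2)[of "2 * \<bar>y - x\<bar>"] y by (simp add: dist_real_def abs_mult field_simps)
        finally show "dist ((measure M2 {..<y} - measure M2 {..<x}) / (y - x)) 0 < e"
          using y by (simp add: dist_real_def divide_less_eq abs_divide)
      qed (use d in auto)
    qed
    with elim(1) have "((\<lambda>t. measure M1 {..<t} + measure M2 {..<t}) has_real_derivative (g x + 0)) (at x)"
      unfolding m1 by (rule DERIV_add)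
    thus ?case by (auto simp: mM)
  qed
qed

subsection \<open>Approximate identities\<close>

text \<open>Tonelli for the region under the graph of \<open>u\<close>. It reduces statements on
  integrals to statements on superlevel sets, which for a radially decreasing kernel are
  balls.\<close>

lemma nn_integral_layer_cake:
  fixes u :: "'a \<Rightarrow> real"
  assumes "sigma_finite_measure M" and u[measurable]: "u \<in> borel_measurable M" and u0: "\<And>x. x \<in> space M \<Longrightarrow> 0 \<le> u x"
  shows "(\<integral>\<^sup>+x. ennreal (u x) \<partial>M) = (\<integral>\<^sup>+y. emeasure M {x\<in>space M. y < u x} * indicator {0..} y \<partial>lborel)"
proof -
  interpret M: sigma_finite_measure M by fact
  interpret pair_sigma_finite M "lborel :: real measure" ..
  have "(\<integral>\<^sup>+x. ennreal (u x) \<partial>M) = (\<integral>\<^sup>+x. \<integral>\<^sup>+y. indicator {0..<u x} y \<partial>lborel \<partial>M)"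
    using u0 by (intro nn_integral_cong) simp
  also have "\<dots> = (\<integral>\<^sup>+x. \<integral>\<^sup>+y. (if 0 \<le> y \<and> y < u x then 1 else 0) \<partial>lborel \<partial>M)"
    by (intro nn_integral_cong) (auto simp: indicator_def)
  also have "\<dots> = (\<integral>\<^sup>+y. \<integral>\<^sup>+x. (if 0 \<le> y \<and> y < u x then 1 else 0) \<partial>M \<partial>lborel)"
    by (rule Fubini'[symmetric]) measurable
  also have "\<dots> = (\<integral>\<^sup>+y. emeasure M {x\<in>space M. y < u x} * indicator {0..} y \<partial>lborel)"
  proof (intro nn_integral_cong)
    fix y :: real
    have "(\<integral>\<^sup>+x. (if 0 \<le> y \<and> y < u x then 1 else 0) \<partial>M) = (\<integral>\<^sup>+x. indicator {0..} y * indicator {x\<in>space M. y < u x} x \<partial>M)"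
      by (intro nn_integral_cong) (auto simp: indicator_def)
    also have "\<dots> = indicator {0..} y * emeasure M {x\<in>space M. y < u x}"
      by (subst nn_integral_cmult) auto
    finally show "(\<integral>\<^sup>+x. (if 0 \<le> y \<and> y < u x then 1 else 0) \<partial>M) = emeasure M {x\<in>space M. y < u x} * indicator {0..} y"
      by (simp add: mult.commute)
  qed
  finally show ?thesis .
qed

lemma measurable_emeasure_superlevel:
  fixes u :: "'a \<Rightarrow> real"
  assumes "sigma_finite_measure M" and [measurable]: "u \<in> borel_measurable M"
  shows "(\<lambda>y. emeasure M {x\<in>space M. y < u x}) \<in> borel_measurable borel"
proof -
  interpret sigma_finite_measure M by fact
  have "{z \<in> space (borel \<Otimes>\<^sub>M M). fst z < u (snd z)} \<in> sets (borel \<Otimes>\<^sub>M M)" by measurable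
  from measurable_emeasure_Pair[OF this] show ?thesis by (simp add: vimage_def space_pair_measure)
qed

text \<open>\<open>r\<close> is the least point of \<open>{0..d}\<close> at which the profile drops
  to \<open>y\<close>; it exists by continuity and compactness, and its minimality makes the
  superlevel set an open ball. The value 0 is allowed and gives the empty set.\<close>

lemma superlevel_antimono_eq_ball:
  fixes \<psi> :: "real \<Rightarrow> real"
  assumes d: "0 < d" and am: "antimono_on {0..d} \<psi>" and cont: "continuous_on {0..d} \<psi>" and y: "\<psi> d \<le> y"
  shows "\<exists>r. 0 \<le> r \<and> r \<le> d \<and> {t. y < \<psi> (min \<bar>t - x\<bar> d)} = ball x r"
proof -
  define Z where "Z = {s\<in>{0..d}. \<psi> s \<le> y}"
  have "closed Z" unfolding Z_def by (rule continuous_on_closed_Collect_le[OF cont]) auto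
  hence "compact ({0..d} \<inter> Z)" by (intro compact_Int_closed) auto
  moreover have "{0..d} \<inter> Z = Z" by (auto simp: Z_def)
  ultimately have cp: "compact Z" by simp
  have "d \<in> Z" using d y by (simp add: Z_def)
  hence ne: "Z \<noteq> {}" by blast
  obtain r where r: "r \<in> Z" "\<And>s. s \<in> Z \<Longrightarrow> r \<le> s" using compact_attains_inf[OF cp ne] by blast
  have "y < \<psi> (min \<bar>t - x\<bar> d) \<longleftrightarrow> \<bar>t - x\<bar> < r" for t
  proof
    assume "\<bar>t - x\<bar> < r"
    moreover from this have "\<bar>t - x\<bar> \<notin> Z" using r(2)[of "\<bar>t - x\<bar>"] by linarith
    moreover have "r \<le> d" using r(1) by (auto simp: Z_def)
    ultimately have "\<bar>t - x\<bar> \<notin> Z" "\<bar>t - x\<bar> < d" by auto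
    hence "y < \<psi> \<bar>t - x\<bar>" "min \<bar>t - x\<bar> d = \<bar>t - x\<bar>" by (simp_all add: Z_def)
    thus "y < \<psi> (min \<bar>t - x\<bar> d)" by simp
  next
    assume a: "y < \<psi> (min \<bar>t - x\<bar> d)"
    show "\<bar>t - x\<bar> < r"
    proof (rule ccontr)
      assume "\<not> \<bar>t - x\<bar> < r"
      hence "\<psi> (min \<bar>t - x\<bar> d) \<le> \<psi> r" using r(1) d by (intro monotone_onD[OF am]) (auto simp: Z_def)
      thus False using a r(1) by (auto simp: Z_def)
    qed
  qed
  hence "{t. y < \<psi> (min \<bar>t - x\<bar> d)} = ball x r" by (simp add: ball_def dist_real_def abs_minus_commute[of x])
  moreover have "0 \<le> r" "r \<le> d" using r(1) by (auto simp: Z_def)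
  ultimately show ?thesis by blast
qed

text \<open>A radially decreasing kernel is a mixture of centred balls, so the estimate for balls is
  inherited by integration over the levels. Subtracting the value at \<open>d\<close> makes the
  kernel vanish outside the ball of radius \<open>d\<close>, beyond which nothing is assumed about
  the balls.\<close>

lemma kernel_integral_bound:
  fixes M :: "real measure" and \<psi> :: "real \<Rightarrow> real"
  assumes M: "sets M = sets borel" "finite_measure M"
    and d: "0 < d" and am: "antimono_on {0..d} \<psi>" and cont: "continuous_on {0..d} \<psi>"
    and D: "0 \<le> D" and \<eta>: "0 \<le> \<eta>"
    and est: "\<And>r. 0 < r \<Longrightarrow> r \<le> d \<Longrightarrow> \<bar>measure M (ball x r) - 2 * r * D\<bar> \<le> 2 * r * \<eta>"
  defines "u \<equiv> \<lambda>t. \<psi> (min \<bar>t - x\<bar> d) - \<psi> d"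
  shows "integrable M u" "integrable lborel u" "\<bar>(LINT t|M. u t) - D * (LINT t|lborel. u t)\<bar> \<le> \<eta> * (LINT t|lborel. u t)"
proof -
  interpret finite_measure M by fact
  have sp: "space M = UNIV" using sets_eq_imp_space_eq[OF M(1)] by simp
  have cu: "continuous_on UNIV u" unfolding u_def
    by (intro continuous_on_diff continuous_on_compose2[OF cont] continuous_intros) (use d in auto)
  have ub[measurable]: "u \<in> borel_measurable borel" using cu by (rule borel_measurable_continuous_onI)
  have uM[measurable]: "u \<in> borel_measurable M" using ub M by (simp cong: measurable_cong_sets)
  have u0: "0 \<le> u t" for t unfolding u_def using d by (auto intro!: monotone_onD[OF am])
  have u1: "u t \<le> \<psi> 0 - \<psi> d" for t unfolding u_def using d by (auto intro!: monotone_onD[OF am])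
  have us: "u t = 0" if "t \<notin> ball x d" for t using that by (auto simp: u_def dist_real_def min_def abs_minus_commute)
  show iM: "integrable M u" by (rule integrable_const_bound[of _ "\<psi> 0 - \<psi> d"]) (use u0 u1 in auto)
  show iL: "integrable lborel u"
  proof (rule Bochner_Integration.integrable_bound)
    show "integrable lborel (\<lambda>t. (\<psi> 0 - \<psi> d) * indicator (ball x d) t)"
      using d by (intro integrable_mult_right integrable_real_indicator) (auto simp: ball_eq_greaterThanLessThan)
    show "AE t in lborel. norm (u t) \<le> norm ((\<psi> 0 - \<psi> d) * indicator (ball x d) t)"
    proof (rule AE_I2)
      fix t show "norm (u t) \<le> norm ((\<psi> 0 - \<psi> d) * indicator (ball x d) t)"
        using u0[of t] u1[of t] us[of t] by (cases "t \<in> ball x d") auto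
    qed
  qed auto
  define I where "I = (LINT t|M. u t)"
  define L where "L = (LINT t|lborel. u t)"
  have I0: "0 \<le> I" and L0: "0 \<le> L" unfolding I_def L_def using u0 by auto
  have nI: "(\<integral>\<^sup>+t. ennreal (u t) \<partial>M) = ennreal I" unfolding I_def using iM u0 by (intro nn_integral_eq_integral) auto
  have nL: "(\<integral>\<^sup>+t. ennreal (u t) \<partial>lborel) = ennreal L" unfolding L_def using iL u0 by (intro nn_integral_eq_integral) auto
  have lI: "ennreal I = (\<integral>\<^sup>+y. emeasure M {t. y < u t} * indicator {0..} y \<partial>lborel)"
    unfolding nI[symmetric] by (subst nn_integral_layer_cake) (use u0 sp sigma_finite_measure_axioms in auto)
  have lL: "ennreal L = (\<integral>\<^sup>+y. emeasure lborel {t. y < u t} * indicator {0..} y \<partial>lborel)"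
    unfolding nL[symmetric] by (subst nn_integral_layer_cake) (use u0 sigma_finite_lborel in auto)
  have meas: "(\<lambda>y. emeasure M {t. y < u t}) \<in> borel_measurable borel" "(\<lambda>y. emeasure lborel {t. y < u t}) \<in> borel_measurable borel"
    using measurable_emeasure_superlevel[OF sigma_finite_measure_axioms uM]
      measurable_emeasure_superlevel[OF sigma_finite_lborel, of u] sp by simp_all
  note [measurable] = meas
  have lev: "\<exists>r. 0 \<le> r \<and> r \<le> d \<and> {t. y < u t} = ball x r" if "0 \<le> y" for y
    using superlevel_antimono_eq_ball[OF d am cont, of "y + \<psi> d" x] that
    by (auto simp: u_def algebra_simps)
  have up: "emeasure M {t. y < u t} \<le> ennreal (D + \<eta>) * emeasure lborel {t. y < u t}"
    and lo: "ennreal D * emeasure lborel {t. y < u t} \<le> emeasure M {t. y < u t} + ennreal \<eta> * emeasure lborel {t. y < u t}"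
    if y: "0 \<le> y" for y
  proof -
    obtain r where r: "0 \<le> r" "r \<le> d" "{t. y < u t} = ball x r" using lev[OF y] by blast
    have e: "\<bar>measure M (ball x r) - 2 * r * D\<bar> \<le> 2 * r * \<eta>" using est[of r] r by (cases "r = 0") auto
    have lb: "emeasure lborel (ball x r) = ennreal (2 * r)" using r by (simp add: ball_eq_greaterThanLessThan)
    have "measure M (ball x r) \<le> (D + \<eta>) * (2 * r)" using e by (simp add: algebra_simps abs_le_iff)
    thus "emeasure M {t. y < u t} \<le> ennreal (D + \<eta>) * emeasure lborel {t. y < u t}"
      unfolding r(3) lb emeasure_eq_measure using D \<eta> r by (simp add: ennreal_mult[symmetric] ennreal_leI del: ennreal_plus)
    \<comment> \<open>Stated with a sum on the right, since subtraction of extended nonnegative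
      reals is truncated.\<close>
    have "D * (2 * r) \<le> measure M (ball x r) + \<eta> * (2 * r)" using e by (simp add: algebra_simps abs_le_iff)
    thus "ennreal D * emeasure lborel {t. y < u t} \<le> emeasure M {t. y < u t} + ennreal \<eta> * emeasure lborel {t. y < u t}"
      unfolding r(3) lb emeasure_eq_measure using D \<eta> r by (simp add: ennreal_mult[symmetric] ennreal_plus[symmetric] ennreal_leI del: ennreal_plus)
  qed
  have "ennreal I \<le> (\<integral>\<^sup>+y. ennreal (D + \<eta>) * (emeasure lborel {t. y < u t} * indicator {0..} y) \<partial>lborel)"
    unfolding lI using up by (intro nn_integral_mono) (auto simp: indicator_def)
  also have "\<dots> = ennreal (D + \<eta>) * ennreal L" unfolding lL by (rule nn_integral_cmult) measurable
  finally have 1: "I \<le> (D + \<eta>) * L" using D \<eta> L0 by (simp add: ennreal_mult[symmetric] del: ennreal_plus)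
  have "ennreal D * ennreal L = (\<integral>\<^sup>+y. ennreal D * (emeasure lborel {t. y < u t} * indicator {0..} y) \<partial>lborel)"
    unfolding lL by (rule nn_integral_cmult[symmetric]) measurable
  also have "\<dots> \<le> (\<integral>\<^sup>+y. (emeasure M {t. y < u t} * indicator {0..} y) + ennreal \<eta> * (emeasure lborel {t. y < u t} * indicator {0..} y) \<partial>lborel)"
    using lo by (intro nn_integral_mono) (auto simp: indicator_def)
  also have "\<dots> = ennreal I + ennreal \<eta> * ennreal L"
    unfolding lI lL by (subst nn_integral_add) (auto simp: nn_integral_cmult)
  finally have 2: "D * L \<le> I + \<eta> * L" using D \<eta> L0 I0 by (simp add: ennreal_mult[symmetric] ennreal_plus[symmetric] del: ennreal_plus)
  show "\<bar>(LINT t|M. u t) - D * (LINT t|lborel. u t)\<bar> \<le> \<eta> * (LINT t|lborel. u t)"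
    using 1 2 unfolding I_def[symmetric] L_def[symmetric] by (simp add: abs_le_iff algebra_simps)
qed

text \<open>The derivative controls the half-open interval \<open>{x - r..<x + r}\<close>. The open
  ball is smaller, possibly by an atom at the left endpoint; slightly shorter intervals inside the
  ball recover the lower bound in the limit.\<close>

lemma cdf_derivative_imp_symmetric:
  fixes M :: "real measure"
  assumes M: "sets M = sets borel" "finite_measure M"
    and der: "((\<lambda>t. measure M {..<t}) has_real_derivative D) (at x)" and \<eta>: "\<eta> > 0"
  shows "0 \<le> D" "\<exists>d>0. \<forall>r. 0 < r \<and> r \<le> d \<longrightarrow> \<bar>measure M (ball x r) - 2 * r * D\<bar> \<le> 2 * r * \<eta>"
proof -
  interpret finite_measure M by fact
  let ?F = "\<lambda>t. measure M {..<t}"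
  have mono: "?F a \<le> ?F b" if "a \<le> b" for a b using that by (intro finite_measure_mono) (auto simp: M)
  have D1: "\<exists>d>0. \<forall>y. y \<noteq> x \<and> dist y x < d \<longrightarrow> dist ((?F y - ?F x) / (y - x)) D < e" if "e > 0" for e
    using tendstoD[OF der[unfolded has_field_derivative_iff] that] unfolding eventually_at by auto
  show "0 \<le> D"
  proof (rule ccontr)
    assume "\<not> 0 \<le> D"
    then obtain d where d: "d > 0" "\<And>y. y \<noteq> x \<and> dist y x < d \<Longrightarrow> dist ((?F y - ?F x) / (y - x)) D < - D"
      using D1[of "-D"] by auto
    have "dist ((?F (x + d/2) - ?F x) / (x + d/2 - x)) D < - D" using d(1) by (intro d(2)) (auto simp: dist_real_def)
    moreover have "(?F (x + d/2) - ?F x) / (x + d/2 - x) \<ge> 0" using mono[of x "x + d/2"] d by simp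
    ultimately show False unfolding dist_real_def by linarith
  qed
  obtain d where d: "d > 0" "\<And>y. y \<noteq> x \<and> dist y x < d \<Longrightarrow> dist ((?F y - ?F x) / (y - x)) D < \<eta> / 2"
    using D1[of "\<eta> / 2"] \<eta> by auto
  have F: "\<bar>(?F y - ?F x) - D * (y - x)\<bar> \<le> \<eta> / 2 * \<bar>y - x\<bar>" if "dist y x < d" for y
  proof (cases "y = x")
    case False
    have "\<bar>(?F y - ?F x) - D * (y - x)\<bar> = \<bar>((?F y - ?F x) / (y - x) - D) * (y - x)\<bar>"
    proof -
      have "((?F y - ?F x) / (y - x) - D) * (y - x) = (?F y - ?F x) / (y - x) * (y - x) - D * (y - x)"
        by (rule left_diff_distrib)
      thus ?thesis using False by simp
    qed
    also have "\<dots> = \<bar>(?F y - ?F x) / (y - x) - D\<bar> * \<bar>y - x\<bar>" by (rule abs_mult)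
    also have "\<dots> \<le> \<eta> / 2 * \<bar>y - x\<bar>"
      using d(2)[of y] False that by (intro mult_right_mono) (auto simp: dist_real_def)
    finally show ?thesis .
  qed auto
  have d2: "?F b - ?F a = measure M {a..<b}" if "a \<le> b" for a b
  proof -
    have "measure M ({..<a} \<union> {a..<b}) = ?F a + measure M {a..<b}" by (rule finite_measure_Union) (auto simp: M)
    moreover have "{..<a} \<union> {a..<b} = {..<b}" using that by auto
    ultimately show ?thesis by simp
  qed
  have up: "measure M {x - r..<x + r} \<le> 2 * r * (D + \<eta>) - \<eta> * r" and lo: "measure M {x - r..<x + r} \<ge> 2 * r * (D - \<eta>) + \<eta> * r"
    if "0 < r" "r < d" for r
  proof -
    have "\<bar>(?F (x + r) - ?F x) - D * r\<bar> \<le> \<eta> / 2 * r" "\<bar>(?F (x - r) - ?F x) - D * (- r)\<bar> \<le> \<eta> / 2 * r"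
      using F[of "x + r"] F[of "x - r"] that by (simp_all add: dist_real_def)
    moreover have "?F (x + r) - ?F (x - r) = measure M {x - r..<x + r}" using that by (intro d2) auto
    ultimately have "\<bar>measure M {x - r..<x + r} - 2 * (D * r)\<bar> \<le> \<eta> * r" by linarith
    thus "measure M {x - r..<x + r} \<le> 2 * r * (D + \<eta>) - \<eta> * r" "measure M {x - r..<x + r} \<ge> 2 * r * (D - \<eta>) + \<eta> * r"
      by (simp_all add: abs_le_iff distrib_left right_diff_distrib mult.commute mult.left_commute)
  qed
  have "\<bar>measure M (ball x r) - 2 * r * D\<bar> \<le> 2 * r * \<eta>" if r: "0 < r" "r \<le> d / 2" for r
  proof -
    have "measure M (ball x r) \<le> measure M {x - r..<x + r}"
      by (rule finite_measure_mono) (auto simp: M ball_eq_greaterThanLessThan)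
    also have "\<dots> \<le> 2 * r * (D + \<eta>) - \<eta> * r" using r by (intro up) auto
    also have "\<dots> \<le> 2 * r * (D + \<eta>)" using r \<eta> by simp
    finally have 1: "measure M (ball x r) \<le> 2 * r * (D + \<eta>)" .
    have "2 * (r * q) * (D - \<eta>) + \<eta> * (r * q) \<le> measure M (ball x r)" if "0 < q" "q < 1" for q
    proof -
      have rq: "r * q < r" using that r by simp
      have "2 * (r * q) * (D - \<eta>) + \<eta> * (r * q) \<le> measure M {x - r * q..<x + r * q}"
      proof (rule lo)
        show "r * q < d" using rq r d(1) by linarith
      qed (use r that in simp)
      also have "\<dots> \<le> measure M (ball x r)" using rq by (intro finite_measure_mono) (auto simp: M ball_eq_greaterThanLessThan)
      finally show ?thesis .
    qed
    hence "\<forall>\<^sub>F q in at_left 1. 2 * (r * q) * (D - \<eta>) + \<eta> * (r * q) \<le> measure M (ball x r)"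
      unfolding eventually_at_left_field by (intro exI[of _ 0]) auto
    moreover have "((\<lambda>q. 2 * (r * q) * (D - \<eta>) + \<eta> * (r * q)) \<longlongrightarrow> 2 * (r * 1) * (D - \<eta>) + \<eta> * (r * 1)) (at_left 1)"
      by (intro tendsto_intros)
    ultimately have "2 * (r * 1) * (D - \<eta>) + \<eta> * (r * 1) \<le> measure M (ball x r)"
      by (intro tendsto_upperbound) auto
    moreover have "0 \<le> \<eta> * r" using r \<eta> by simp
    ultimately have 2: "measure M (ball x r) \<ge> 2 * r * (D - \<eta>)" unfolding mult_1_right by linarith
    show ?thesis using 1 2 unfolding abs_le_iff right_diff_distrib distrib_left by linarith
  qed
  thus "\<exists>d>0. \<forall>r. 0 < r \<and> r \<le> d \<longrightarrow> \<bar>measure M (ball x r) - 2 * r * D\<bar> \<le> 2 * r * \<eta>"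
    using d(1) by (intro exI[of _ "d / 2"]) auto
qed

text \<open>Approximate identities recover the derivative of a measure at a point where it exists.
  Near \<open>x\<close> the kernel is the radial profile; after subtraction of its value at
  \<open>d\<close> it falls under the estimate for balls, and what remains lies between 0 and
  \<open>\<psi> i d\<close>, which tends to 0. The filter is arbitrary to cover both a radius
  tending to 1 and a sequence. The far condition is only asked almost everywhere, because the disc
  kernel is periodic and decays only on the range of angles where the measure lives.\<close>

lemma kernel_integral_tendsto:
  fixes M :: "real measure" and \<psi> :: "'i \<Rightarrow> real \<Rightarrow> real" and \<kappa> :: "'i \<Rightarrow> real \<Rightarrow> real"
  assumes M: "sets M = sets borel" "finite_measure M"
    and der: "((\<lambda>t. measure M {..<t}) has_real_derivative D) (at x)"
    and d0: "0 < d0" and F: "F \<noteq> bot"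
    and am: "\<forall>\<^sub>F i in F. antimono_on {0..d0} (\<psi> i) \<and> continuous_on {0..d0} (\<psi> i) \<and> \<kappa> i \<in> borel_measurable borel \<and> (\<forall>s\<in>{0..d0}. 0 \<le> \<psi> i s)"
    and near: "\<forall>\<^sub>F i in F. \<forall>t. \<bar>t - x\<bar> < d0 \<longrightarrow> \<kappa> i t = \<psi> i \<bar>t - x\<bar>"
    and far: "\<And>d. 0 < d \<Longrightarrow> d < d0 \<Longrightarrow> \<forall>\<^sub>F i in F. AE t in M. d \<le> \<bar>t - x\<bar> \<longrightarrow> 0 \<le> \<kappa> i t \<and> \<kappa> i t \<le> \<psi> i d"
    and small: "\<And>d. 0 < d \<Longrightarrow> d < d0 \<Longrightarrow> ((\<lambda>i. \<psi> i d) \<longlongrightarrow> 0) F"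
    and mass: "\<And>d. 0 < d \<Longrightarrow> d < d0 \<Longrightarrow> ((\<lambda>i. LINT t:{-d..d}|lborel. \<psi> i \<bar>t\<bar>) \<longlongrightarrow> 1) F"
  shows "((\<lambda>i. LINT t|M. \<kappa> i t) \<longlongrightarrow> D) F"
proof (rule tendstoI)
  fix e :: real assume e: "e > 0"
  interpret finite_measure M by fact
  have sp: "space M = UNIV" using sets_eq_imp_space_eq[OF M(1)] by simp
  define \<eta> where "\<eta> = e / 4"
  have \<eta>: "\<eta> > 0" using e by (simp add: \<eta>_def)
  have D: "0 \<le> D" by (rule cdf_derivative_imp_symmetric(1)[OF M der \<eta>])
  obtain d1 where d1: "d1 > 0" "\<And>r. 0 < r \<Longrightarrow> r \<le> d1 \<Longrightarrow> \<bar>measure M (ball x r) - 2 * r * D\<bar> \<le> 2 * r * \<eta>"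
    using cdf_derivative_imp_symmetric(2)[OF M der \<eta>] by auto
  define d where "d = min d1 d0 / 2"
  have d: "0 < d" "d < d0" "d \<le> d1" using d1(1) d0 by (auto simp: d_def)
  define m where "m = measure M UNIV"
  \<comment> \<open>This will be the Lebesgue integral of the truncated profile \<open>u\<close>:
    the mass on \<open>{-d..d}\<close> less the constant subtracted there.\<close>
  define L where "L i = (LINT t:{-d..d}|lborel. \<psi> i \<bar>t\<bar>) - 2 * d * \<psi> i d" for i
  have Llim: "(L \<longlongrightarrow> 1 - 2 * d * 0) F" unfolding L_def
    by (intro tendsto_intros mass small d)
  have ev1: "\<forall>\<^sub>F i in F. dist (D * L i) D < e / 4"
    using tendsto_mult_left[OF Llim, of D] e by (intro tendstoD) auto
  have ev2: "\<forall>\<^sub>F i in F. \<eta> * L i < e / 2"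
    using tendsto_mult_left[OF Llim, of \<eta>] e by (intro order_tendstoD(2)) (auto simp: \<eta>_def)
  have ev3: "\<forall>\<^sub>F i in F. \<psi> i d * m < e / 4"
    using tendsto_mult_right[OF small[OF d(1,2)], of m] e by (intro order_tendstoD(2)) auto
  show "\<forall>\<^sub>F i in F. dist (LINT t|M. \<kappa> i t) D < e"
    using ev1 ev2 ev3 am near far[OF d(1,2)]
  proof eventually_elim
    case (elim i)
    have am': "antimono_on {0..d} (\<psi> i)" using elim(4) d by (auto intro: monotone_on_subset)
    have ct': "continuous_on {0..d} (\<psi> i)" using elim(4) d by (auto intro: continuous_on_subset)
    have [measurable]: "\<kappa> i \<in> borel_measurable M" using elim(4) M by (simp cong: measurable_cong_sets)
    define u where "u t = \<psi> i (min \<bar>t - x\<bar> d) - \<psi> i d" for t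
    have est: "\<bar>measure M (ball x r) - 2 * r * D\<bar> \<le> 2 * r * \<eta>" if "0 < r" "r \<le> d" for r using d1(2) that d by auto
    note kb = kernel_integral_bound[OF M d(1) am' ct' D less_imp_le[OF \<eta>] est, folded u_def]
    have Lu: "(LINT t|lborel. u t) = L i"
    proof -
      have "(LINT t|lborel. u t) = (LINT t|lborel. u (x + 1 * t))"
        by (subst lborel_integral_real_affine[of 1 u x]) auto
      also have "\<dots> = (LINT t|lborel. indicator {-d..d} t * \<psi> i \<bar>t\<bar> - indicator {-d..d} t * \<psi> i d)"
        by (intro Bochner_Integration.integral_cong) (auto simp: u_def indicator_def min_def)
      also have "\<dots> = (LINT t|lborel. indicator {-d..d} t * \<psi> i \<bar>t\<bar>) - (LINT t|lborel. indicator {-d..d} t * \<psi> i d)"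
      proof (rule Bochner_Integration.integral_diff)
        have "set_integrable lborel {-d..d} (\<lambda>t. \<psi> i \<bar>t\<bar>)"
          by (rule borel_integrable_atLeastAtMost') (intro continuous_on_compose2[OF ct'] continuous_intros, auto)
        thus "integrable lborel (\<lambda>t. indicator {-d..d} t * \<psi> i \<bar>t\<bar>)" by (simp add: set_integrable_def)
      qed (use d in \<open>intro integrable_mult_left integrable_real_indicator, auto\<close>)
      also have "\<dots> = L i" using d unfolding L_def set_lebesgue_integral_def by simp
      finally show ?thesis .
    qed
    have diff: "AE t in M. 0 \<le> \<kappa> i t - u t \<and> \<kappa> i t - u t \<le> \<psi> i d"
      using elim(6)
    proof eventually_elim
      case (elim t)
      show ?case
      proof (cases "\<bar>t - x\<bar> < d")
        case True
        hence "\<kappa> i t - u t = \<psi> i d" using \<open>\<forall>t. \<bar>t - x\<bar> < d0 \<longrightarrow> \<kappa> i t = \<psi> i \<bar>t - x\<bar>\<close> d by (auto simp: u_def)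
        moreover have "0 \<le> \<psi> i d" using \<open>antimono_on {0..d0} (\<psi> i) \<and> _ \<and> _ \<and> _\<close> d by auto
        ultimately show ?thesis by simp
      qed (use elim in \<open>auto simp: u_def min_def\<close>)
    qed
    have [measurable]: "u \<in> borel_measurable M" using kb(1) by auto
    have idiff: "integrable M (\<lambda>t. \<kappa> i t - u t)"
      by (rule integrable_const_bound[of _ "\<psi> i d"]) (use diff in auto)
    have "(LINT t|M. \<kappa> i t) = (LINT t|M. (\<kappa> i t - u t) + u t)" by simp
    also have "\<dots> = (LINT t|M. \<kappa> i t - u t) + (LINT t|M. u t)" using idiff kb(1) by (rule Bochner_Integration.integral_add)
    finally have eq: "(LINT t|M. \<kappa> i t) = (LINT t|M. \<kappa> i t - u t) + (LINT t|M. u t)" .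
    have "(LINT t|M. \<kappa> i t - u t) \<ge> 0" by (rule integral_nonneg_AE) (use diff in auto)
    moreover have "(LINT t|M. \<kappa> i t - u t) \<le> (LINT t|M. \<psi> i d)" using diff idiff by (intro integral_mono_AE) auto
    ultimately have "\<bar>(LINT t|M. \<kappa> i t - u t)\<bar> \<le> \<psi> i d * m" by (simp add: m_def sp mult.commute)
    with eq kb(3)[unfolded Lu] elim(1,2,3) show ?case unfolding dist_real_def by linarith
  qed
qed

subsection \<open>The normalized Lebesgue measure on the circle\<close>

lemma measurable_cis[measurable]: "cis \<in> borel_measurable borel"
  by (intro borel_measurable_continuous_onI continuous_intros)

lemma measurable_cnj[measurable]: "cnj \<in> borel_measurable borel"
  by (intro borel_measurable_continuous_onI continuous_intros)

lemma measurable_Arg2pi[measurable]: "Arg2pi \<in> borel_measurable borel"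
  unfolding borel_measurable_iff_greater using open_Arg2pi2pi_gt by auto

lemma sets_circle_measure[simp, measurable_cong]: "sets circle_measure = sets borel"
  by (simp add: circle_measure_def)

lemma space_circle_measure[simp]: "space circle_measure = UNIV"
  by (simp add: circle_measure_def)

lemma uniform_2pi_eq_density:
  "uniform_measure lborel {0..<2 * pi} = density lborel (\<lambda>t. ennreal (indicator {0..<2 * pi} t / (2 * pi)))"
  unfolding uniform_measure_def
proof (intro density_cong AE_I2)
  fix t :: real
  have "indicator {0..<2 * pi} t / ennreal (2 * pi) = ennreal (indicator {0..<2 * pi} t) / ennreal (2 * pi)"
    by (simp add: indicator_def)
  also have "\<dots> = ennreal (indicator {0..<2 * pi} t / (2 * pi))" by (rule divide_ennreal) auto
  finally show "indicator {0..<2 * pi} t / emeasure lborel {0..<2 * pi} = ennreal (indicator {0..<2 * pi} t / (2 * pi))"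
    by simp
qed measurable

lemma prob_space_circle_measure: "prob_space circle_measure"
  unfolding circle_measure_def
  by (intro prob_space.prob_space_distr prob_space_uniform_measure) auto

interpretation circle: prob_space circle_measure by (rule prob_space_circle_measure)

lemma integrable_circle_iff:
  fixes f :: "complex \<Rightarrow> 'a::{banach, second_countable_topology}"
  assumes [measurable]: "f \<in> borel_measurable borel"
  shows "integrable circle_measure f \<longleftrightarrow> set_integrable lborel {0..<2 * pi} (\<lambda>t. f (cis t))"
proof -
  have "integrable circle_measure f \<longleftrightarrow> integrable (uniform_measure lborel {0..<2 * pi}) (\<lambda>t. f (cis t))"
    unfolding circle_measure_def by (rule integrable_distr_eq) auto
  also have "\<dots> \<longleftrightarrow> integrable lborel (\<lambda>t. (indicator {0..<2 * pi} t / (2 * pi)) *\<^sub>R f (cis t))"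
    unfolding uniform_2pi_eq_density by (rule integrable_density) (auto simp: indicator_def)
  also have "(\<lambda>t. (indicator {0..<2 * pi} t / (2 * pi)) *\<^sub>R f (cis t)) = (\<lambda>t. (1 / (2 * pi)) *\<^sub>R (indicator {0..<2 * pi} t *\<^sub>R f (cis t)))"
    by simp
  also have "integrable lborel \<dots> \<longleftrightarrow> set_integrable lborel {0..<2 * pi} (\<lambda>t. f (cis t))"
    unfolding set_integrable_def
  proof
    let ?g = "\<lambda>t. indicator {0..<2 * pi} t *\<^sub>R f (cis t)"
    assume A: "integrable lborel (\<lambda>t. (1 / (2 * pi)) *\<^sub>R ?g t)"
    have "integrable lborel (\<lambda>t. (2 * pi) *\<^sub>R ((1 / (2 * pi)) *\<^sub>R ?g t))"
      by (rule integrable_scaleR_right) (rule A)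
    moreover have "(\<lambda>t. (2 * pi) *\<^sub>R ((1 / (2 * pi)) *\<^sub>R ?g t)) = ?g" by (simp only: scaleR_scaleR) simp
    ultimately show "integrable lborel ?g" by (simp only:)
  qed (intro integrable_scaleR_right)
  finally show ?thesis .
qed

lemma integral_circle:
  fixes f :: "complex \<Rightarrow> 'a::{banach, second_countable_topology}"
  assumes [measurable]: "f \<in> borel_measurable borel"
  shows "(LINT \<zeta>|circle_measure. f \<zeta>) = (1 / (2 * pi)) *\<^sub>R (LINT t:{0..<2 * pi}|lborel. f (cis t))"
proof -
  have "(LINT \<zeta>|circle_measure. f \<zeta>) = (LINT t|uniform_measure lborel {0..<2 * pi}. f (cis t))"
    unfolding circle_measure_def by (rule integral_distr) auto
  also have "\<dots> = (LINT t|lborel. (indicator {0..<2 * pi} t / (2 * pi)) *\<^sub>R f (cis t))"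
    unfolding uniform_2pi_eq_density by (rule integral_density) (auto simp: indicator_def)
  also have "(\<lambda>t. (indicator {0..<2 * pi} t / (2 * pi)) *\<^sub>R f (cis t)) = (\<lambda>t. (1 / (2 * pi)) *\<^sub>R (indicator {0..<2 * pi} t *\<^sub>R f (cis t)))"
    by simp
  finally show ?thesis by (simp only: set_lebesgue_integral_def integral_scaleR_right)
qed

lemma AE_circle_norm_1: "AE \<zeta> in circle_measure. cmod \<zeta> = 1"
  unfolding circle_measure_def by (subst AE_distr_iff) auto

text \<open>\<open>P\<close> is not assumed measurable, which matters when it asserts the existence
  of a limit. Pushing the circle measure forward by \<open>Arg2pi\<close> gives back the uniform
  measure, so the transfer can use the direction of pushforward that holds for arbitrary predicates.
  The angle 0 is dropped as a null point.\<close>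

lemma AE_circleI:
  assumes "AE t in lborel. 0 < t \<and> t < 2 * pi \<longrightarrow> P (cis t)"
  shows "AE \<zeta> in circle_measure. P \<zeta>"
proof -
  have "AE t in lborel. (t::real) \<noteq> 0" by (rule AE_lborel_singleton)
  with assms have "AE t in lborel. t \<in> {0..<2 * pi} \<longrightarrow> P (cis t)" by eventually_elim auto
  hence a: "AE t in uniform_measure lborel {0..<2 * pi}. P (cis t)" by (intro AE_uniform_measureI) auto
  have "distr circle_measure borel Arg2pi = distr (uniform_measure lborel {0..<2 * pi}) borel (\<lambda>t. Arg2pi (cis t))"
    unfolding circle_measure_def by (subst distr_distr) (auto simp: o_def)
  also have "\<dots> = distr (uniform_measure lborel {0..<2 * pi}) borel (\<lambda>t. t)"
  proof (rule distr_cong_AE)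
    have "AE t in uniform_measure lborel {0..<2 * pi}. t \<in> {0..<2 * pi}" by (intro AE_uniform_measureI) auto
    thus "AE t in uniform_measure lborel {0..<2 * pi}. Arg2pi (cis t) = t"
      by eventually_elim (auto simp: cis_conv_exp Arg2pi_exp)
  qed auto
  also have "\<dots> = uniform_measure lborel {0..<2 * pi}"
    by (rule distr_id2) auto
  finally have "AE t in distr circle_measure borel Arg2pi. P (cis t)" using a by (simp only:)
  hence "AE \<zeta> in circle_measure. P (cis (Arg2pi \<zeta>))" by (rule AE_distrD[rotated]) auto
  with AE_circle_norm_1 show ?thesis
  proof eventually_elim
    case (elim \<zeta>)
    thus ?case using complex_norm_eq_1_exp[of \<zeta>] by (simp add: cis_conv_exp)
  qed
qed

subsection \<open>The Poisson kernel of the disc\<close>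

definition poisson_kernel :: "real \<Rightarrow> real \<Rightarrow> real" where
  "poisson_kernel r s = (1 - r\<^sup>2) / (1 - 2 * r * cos s + r\<^sup>2)"

lemma poisson_denom_pos: "0 \<le> r \<Longrightarrow> r < 1 \<Longrightarrow> 0 < 1 - 2 * r * cos s + (r::real)\<^sup>2"
proof -
  assume r: "0 \<le> r" "r < 1"
  have "0 < (1 - r)\<^sup>2" using r by simp
  also have "(1 - r)\<^sup>2 \<le> 1 - 2 * r * cos s + r\<^sup>2"
    using mult_left_mono[OF cos_le_one r(1), of s] by (simp add: power2_eq_square algebra_simps)
  finally show ?thesis .
qed

lemma poisson_kernel_nonneg: "0 \<le> r \<Longrightarrow> r < 1 \<Longrightarrow> 0 \<le> poisson_kernel r s"
  unfolding poisson_kernel_def using poisson_denom_pos[of r s] by (simp add: abs_square_le_1)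

lemma Re_H: "Re (H w) = (1 - (cmod w)\<^sup>2) / (cmod (1 - w))\<^sup>2"
  unfolding H_def Re_divide cmod_power2 by (simp add: power2_eq_square algebra_simps)

lemma Re_H_eq_poisson_kernel:
  assumes "0 \<le> r" "r < 1"
  shows "Re (H (of_real r * cis x * cnj (cis t))) = poisson_kernel r (t - x)"
proof -
  have e: "of_real r * cis x * cnj (cis t) = of_real r * cis (x - t)" by (simp add: cis_cnj cis_mult mult.assoc)
  have "(cmod (1 - of_real r * cis (x - t)))\<^sup>2 = (1 - r * cos (x - t))\<^sup>2 + (r * sin (x - t))\<^sup>2"
    by (simp only: cmod_power2) simp
  also have "\<dots> = 1 - 2 * r * cos (x - t) + r\<^sup>2 * ((sin (x - t))\<^sup>2 + (cos (x - t))\<^sup>2)"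
    by algebra
  finally have "(cmod (1 - of_real r * cis (x - t)))\<^sup>2 = 1 - 2 * r * cos (t - x) + r\<^sup>2"
    by (simp only: sin_cos_squared_add mult_1_right) (metis cos_minus minus_diff_eq)
  moreover have "cmod (of_real r * cis (x - t)) = r" using assms by (simp add: norm_mult)
  ultimately show ?thesis unfolding e using assms by (subst Re_H) (auto simp: poisson_kernel_def)
qed

lemma poisson_kernel_le: 
  assumes "0 \<le> r" "r < 1" "cos s \<le> cos d"
  shows "poisson_kernel r s \<le> poisson_kernel r d"
  unfolding poisson_kernel_def
  using assms poisson_denom_pos[of r s] poisson_denom_pos[of r d] mult_left_mono[OF assms(3,1)]
  by (intro divide_left_mono mult_pos_pos) (auto simp: abs_square_le_1)

lemma continuous_on_poisson_kernel: "0 \<le> r \<Longrightarrow> r < 1 \<Longrightarrow> continuous_on A (poisson_kernel r)"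
  unfolding poisson_kernel_def
  by (intro continuous_intros ballI less_imp_neq[OF poisson_denom_pos, symmetric])

lemma poisson_kernel_tendsto_0:
  assumes "0 < d" "d < pi"
  shows "((\<lambda>r. poisson_kernel r d) \<longlongrightarrow> 0) (at_left 1)"
proof -
  have "cos d < 1" using assms cos_monotone_0_pi[of 0 d] by simp
  hence "((\<lambda>r. poisson_kernel r d) \<longlongrightarrow> (1 - 1\<^sup>2) / (1 - 2 * 1 * cos d + 1\<^sup>2)) (at_left 1)"
    unfolding poisson_kernel_def by (intro tendsto_intros) auto
  thus ?thesis by simp
qed

text \<open>The half-angle substitution gives the primitive
  \<open>arctan (c * tan (s / 2)) / pi\<close> with \<open>c = (1 + r) / (1 - r)\<close>, valid
  inside \<open>{-pi<..<pi}\<close>. As \<open>r\<close> tends to 1, \<open>c\<close> tends to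
  infinity and the arctangent at \<open>d\<close> to \<open>pi / 2\<close>.\<close>

lemma poisson_kernel_mass:
  assumes d: "0 < d" "d < pi"
  shows "((\<lambda>r. LINT t:{-d..d}|lborel. poisson_kernel r \<bar>t\<bar> / (2 * pi)) \<longlongrightarrow> 1) (at_left 1)"
proof -
  have eq: "(LINT t:{-d..d}|lborel. poisson_kernel r \<bar>t\<bar> / (2 * pi)) = (2 / pi) * arctan ((1 + r) / (1 - r) * tan (d / 2))"
    if r: "0 < r" "r < 1" for r
  proof -
    define c where "c = (1 + r) / (1 - r)"
    have der: "((\<lambda>s. arctan (c * tan (s / 2)) / pi) has_vector_derivative (poisson_kernel r \<bar>s\<bar> / (2 * pi))) (at s within {-d..d})"
      if s: "-d \<le> s" "s \<le> d" for s
    proof -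
      have "cos (s / 2) > 0" using s d by (intro cos_gt_zero_pi) auto
      hence c0: "cos (s / 2) \<noteq> 0" by simp
      have cs: "cos s = 2 * (cos (s / 2))\<^sup>2 - 1" using cos_double_cos[of "s / 2"] by simp
      have sc: "(sin (s / 2))\<^sup>2 = 1 - (cos (s / 2))\<^sup>2" by (simp add: sin_squared_eq)
      have eqd: "(1 - r)\<^sup>2 * (cos (s / 2))\<^sup>2 + (1 + r)\<^sup>2 * (sin (s / 2))\<^sup>2 = 1 - 2 * r * cos s + r\<^sup>2"
        unfolding cs sc by (simp add: power2_eq_square algebra_simps)
      have pos: "0 < 1 - 2 * r * cos s + r\<^sup>2" using poisson_denom_pos r by auto
      have t1: "1 + (c * tan (s / 2))\<^sup>2 = (1 - 2 * r * cos s + r\<^sup>2) / ((1 - r)\<^sup>2 * (cos (s / 2))\<^sup>2)"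
      proof -
        have "(c * tan (s / 2))\<^sup>2 = ((1 + r)\<^sup>2 * (sin (s / 2))\<^sup>2) / ((1 - r)\<^sup>2 * (cos (s / 2))\<^sup>2)"
          by (simp add: c_def tan_def power_mult_distrib power_divide)
        moreover have "(1 - r)\<^sup>2 * (cos (s / 2))\<^sup>2 \<noteq> 0" using c0 r by simp
        note divide_self[OF this]
        ultimately show ?thesis unfolding eqd[symmetric] by (simp only: add_divide_distrib)
      qed
      have "((\<lambda>s. arctan (c * tan (s / 2)) / pi) has_real_derivative
          (inverse (1 + (c * tan (s / 2))\<^sup>2) * (c * (inverse ((cos (s / 2))\<^sup>2) * (1 / 2)))) / pi) (at s within {-d..d})"
        using c0 by (auto intro!: derivative_eq_intros)
      also have "(inverse (1 + (c * tan (s / 2))\<^sup>2) * (c * (inverse ((cos (s / 2))\<^sup>2) * (1 / 2)))) / pi = poisson_kernel r \<bar>s\<bar> / (2 * pi)"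
      proof -
        have "inverse (1 + (c * tan (s / 2))\<^sup>2) * (c * (inverse ((cos (s / 2))\<^sup>2) * (1 / 2))) = ((1 - r)\<^sup>2 * c) / (2 * (1 - 2 * r * cos s + r\<^sup>2))"
          unfolding t1 using c0 by (simp add: divide_simps)
        also have "(1 - r)\<^sup>2 * c = 1 - r\<^sup>2" unfolding c_def using r by (simp add: power2_eq_square field_simps)
        finally show ?thesis
          by (simp only: poisson_kernel_def cos_abs_real divide_divide_eq_left mult.assoc mult.commute mult.left_commute)
      qed
      finally show ?thesis by (simp add: has_real_derivative_iff_has_vector_derivative)
    qed
    have cont: "continuous_on {-d..d} (\<lambda>s. poisson_kernel r \<bar>s\<bar> / (2 * pi))"
      by (intro continuous_on_divide continuous_on_compose2[OF continuous_on_poisson_kernel[of r UNIV]] continuous_intros) (use r in auto)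
    have "has_bochner_integral lborel (\<lambda>s. indicator {-d..d} s *\<^sub>R (poisson_kernel r \<bar>s\<bar> / (2 * pi)))
        (arctan (c * tan (d / 2)) / pi - arctan (c * tan (-d / 2)) / pi)"
      by (rule has_bochner_integral_FTC_Icc[OF _ der cont]) (use d in auto)
    hence "(LINT t:{-d..d}|lborel. poisson_kernel r \<bar>t\<bar> / (2 * pi)) = arctan (c * tan (d / 2)) / pi - arctan (c * tan (-d / 2)) / pi"
      unfolding set_lebesgue_integral_def by (rule has_bochner_integral_integral_eq)
    thus ?thesis by (simp add: arctan_minus c_def)
  qed
  have "tan (d / 2) > 0" using d by (intro tan_gt_zero) auto
  moreover have "LIM r at_left (1::real). (1 + r) / (1 - r) :> at_top"
    by real_asymp
  ultimately have "LIM r at_left (1::real). tan (d / 2) * ((1 + r) / (1 - r)) :> at_top"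
    by (intro filterlim_tendsto_pos_mult_at_top[OF tendsto_const])
  from filterlim_compose[OF tendsto_arctan_at_top this]
  have "((\<lambda>r. (2 / pi) * arctan ((1 + r) / (1 - r) * tan (d / 2))) \<longlongrightarrow> (2 / pi) * (pi / 2)) (at_left 1)"
    by (intro tendsto_intros) (simp only: mult.commute)
  moreover have "\<forall>\<^sub>F r in at_left 1. (2 / pi) * arctan ((1 + r) / (1 - r) * tan (d / 2)) = (LINT t:{-d..d}|lborel. poisson_kernel r \<bar>t\<bar> / (2 * pi))"
    unfolding eventually_at_left_field by (intro exI[of _ 0] conjI allI impI eq[symmetric]) auto
  ultimately have "((\<lambda>r. LINT t:{-d..d}|lborel. poisson_kernel r \<bar>t\<bar> / (2 * pi)) \<longlongrightarrow> (2 / pi) * (pi / 2)) (at_left 1)"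
    by (rule Lim_transform_eventually)
  thus ?thesis by simp
qed

lemma poisson_integral_tendsto:
  fixes M :: "real measure"
  assumes M: "sets M = sets borel" "finite_measure M" and conc: "AE t in M. 0 \<le> t \<and> t \<le> 2 * pi"
    and der: "((\<lambda>t. measure M {..<t}) has_real_derivative D) (at x)" and x: "0 < x" "x < 2 * pi"
  shows "((\<lambda>r. LINT t|M. poisson_kernel r (t - x) / (2 * pi)) \<longlongrightarrow> D) (at_left 1)"
proof (rule kernel_integral_tendsto[OF M der, where \<psi>="\<lambda>r s. poisson_kernel r s / (2 * pi)" and ?d0.0="min pi (min x (2 * pi - x))"])
  \<comment> \<open>Within this distance of \<open>x\<close> the angles do not pass the ends of
    \<open>{0..2 * pi}\<close>, and the kernel stays on the half period where it decreases.\<close>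
  let ?d0 = "min pi (min x (2 * pi - x))"
  have ev: "\<forall>\<^sub>F r in at_left (1::real). 0 < r \<and> r < 1" unfolding eventually_at_left_field by (intro exI[of _ 0]) auto
  show "?d0 > 0" using x by auto
  show "at_left (1::real) \<noteq> bot" by simp
  show "\<forall>\<^sub>F r in at_left 1. antimono_on {0..?d0} (\<lambda>s. poisson_kernel r s / (2 * pi)) \<and>
      continuous_on {0..?d0} (\<lambda>s. poisson_kernel r s / (2 * pi)) \<and>
      (\<lambda>t. poisson_kernel r (t - x) / (2 * pi)) \<in> borel_measurable borel \<and> (\<forall>s\<in>{0..?d0}. 0 \<le> poisson_kernel r s / (2 * pi))"
    using ev
  proof eventually_elim
    case (elim r)
    show ?case
    proof (intro conjI)
      show "antimono_on {0..?d0} (\<lambda>s. poisson_kernel r s / (2 * pi))"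
        using elim by (intro monotone_onI divide_right_mono poisson_kernel_le) (auto intro: cos_monotone_0_pi_le)
      show "continuous_on {0..?d0} (\<lambda>s. poisson_kernel r s / (2 * pi))"
        using elim by (intro continuous_on_divide continuous_on_poisson_kernel continuous_intros) auto
      show "(\<lambda>t. poisson_kernel r (t - x) / (2 * pi)) \<in> borel_measurable borel"
        unfolding poisson_kernel_def by measurable
      show "\<forall>s\<in>{0..?d0}. 0 \<le> poisson_kernel r s / (2 * pi)" using elim poisson_kernel_nonneg by auto
    qed
  qed
  have P_abs: "poisson_kernel r \<bar>s\<bar> = poisson_kernel r s" for r s by (simp add: poisson_kernel_def)
  show "\<forall>\<^sub>F r in at_left 1. \<forall>t. \<bar>t - x\<bar> < ?d0 \<longrightarrow> poisson_kernel r (t - x) / (2 * pi) = poisson_kernel r \<bar>t - x\<bar> / (2 * pi)"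
    by (simp add: P_abs)
  fix d assume d: "0 < d" "d < ?d0"
  show "\<forall>\<^sub>F r in at_left 1. AE t in M. d \<le> \<bar>t - x\<bar> \<longrightarrow> 0 \<le> poisson_kernel r (t - x) / (2 * pi) \<and> poisson_kernel r (t - x) / (2 * pi) \<le> poisson_kernel r d / (2 * pi)"
    using ev
  proof eventually_elim
    case (elim r)
    show ?case using conc
    proof eventually_elim
      case (elim t)
      show ?case
      proof
        assume a: "d \<le> \<bar>t - x\<bar>"
        have "cos \<bar>t - x\<bar> \<le> cos d"
        proof (cases "\<bar>t - x\<bar> \<le> pi")
          case True thus ?thesis using a d by (intro cos_monotone_0_pi_le) auto
        next
          \<comment> \<open>Beyond half a period the kernel grows again; the choice of
            \<open>?d0\<close> keeps the distance at most \<open>2 * pi - d\<close>, and reflection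
            leads back to the first case.\<close>
          case False
          have "\<bar>t - x\<bar> \<le> 2 * pi - d" using elim d x by auto
          hence "cos (2 * pi - \<bar>t - x\<bar>) \<le> cos d" using False d by (intro cos_monotone_0_pi_le) auto
          thus ?thesis by (simp add: cos_diff)
        qed
        hence "cos (t - x) \<le> cos d" by simp
        thus "0 \<le> poisson_kernel r (t - x) / (2 * pi) \<and> poisson_kernel r (t - x) / (2 * pi) \<le> poisson_kernel r d / (2 * pi)"
          using \<open>0 < r \<and> r < 1\<close> by (intro conjI divide_nonneg_pos divide_right_mono poisson_kernel_nonneg poisson_kernel_le) auto
      qed
    qed
  qed
  show "((\<lambda>r. poisson_kernel r d / (2 * pi)) \<longlongrightarrow> 0) (at_left 1)"
    using tendsto_divide[OF poisson_kernel_tendsto_0 tendsto_const[of "2 * pi"]] d by auto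
  show "((\<lambda>r. LINT t:{-d..d}|lborel. poisson_kernel r \<bar>t\<bar> / (2 * pi)) \<longlongrightarrow> 1) (at_left 1)"
    using d by (intro poisson_kernel_mass) auto
qed

subsection \<open>Holomorphic parameter integrals\<close>

text \<open>Cauchy's inequality on discs of radius \<open>d\<close> bounds the difference quotients
  by \<open>w t / d\<close>, so dominated convergence applies. Holomorphy is assumed for almost
  every \<open>t\<close> only, and the pointwise derivative is not known to be measurable; it is
  replaced by the limit \<open>g\<close> of the difference quotients along one fixed
  sequence.\<close>

lemma holomorphic_on_lebesgue_integral:
  fixes k :: "complex \<Rightarrow> 'b \<Rightarrow> complex"
  assumes U: "open U" and meas: "\<And>z. z \<in> U \<Longrightarrow> k z \<in> borel_measurable N"
    and hol: "AE t in N. (\<lambda>z. k z t) holomorphic_on U"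
    and bd: "\<And>z0. z0 \<in> U \<Longrightarrow> \<exists>r>0. \<exists>w::_ \<Rightarrow> real. integrable N w \<and> (AE t in N. \<forall>z\<in>ball z0 r \<inter> U. cmod (k z t) \<le> w t)"
  shows "(\<lambda>z. LINT t|N. k z t) holomorphic_on U"
  unfolding holomorphic_on_def
proof
  fix z0 assume z0: "z0 \<in> U"
  obtain r1 w where r1: "r1 > 0" and w: "integrable N w" and kw: "AE t in N. \<forall>z\<in>ball z0 r1 \<inter> U. cmod (k z t) \<le> w t"
    using bd[OF z0] by blast
  obtain r2 where r2: "r2 > 0" "ball z0 r2 \<subseteq> U" using U z0 open_contains_ball by blast
  \<comment> \<open>A third, so that closed discs of radius \<open>d\<close> around points of
    \<open>ball z0 d\<close> stay where both the bound and holomorphy hold.\<close>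
  define d where "d = min r1 r2 / 3"
  have d: "d > 0" "2 * d < r1" "2 * d < r2" using r1 r2 by (auto simp: d_def)
  have sub: "cball z d \<subseteq> ball z0 r1 \<inter> U" if "z \<in> ball z0 d" for z
  proof
    fix y assume "y \<in> cball z d"
    hence "dist z0 y < 2 * d" using that dist_triangle[of z0 y z] by auto
    thus "y \<in> ball z0 r1 \<inter> U" using d r2 by auto
  qed
  have int: "integrable N (k z)" if "z \<in> ball z0 d" for z
  proof (rule Bochner_Integration.integrable_bound[OF w])
    have "z \<in> cball z d" using d by simp
    hence "z \<in> ball z0 r1 \<inter> U" using sub[OF that] by blast
    thus "k z \<in> borel_measurable N" using meas by auto
    show "AE t in N. norm (k z t) \<le> norm (w t)" using kw
      by eventually_elim (use \<open>z \<in> ball z0 r1 \<inter> U\<close> in \<open>force intro: order_trans[OF _ abs_ge_self]\<close>)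
  qed
  have dq: "AE t in N. \<forall>z\<in>ball z0 d. cmod (k z t - k z0 t) \<le> w t / d * cmod (z - z0)"
    using hol kw
  proof eventually_elim
    case (elim t)
    have h: "(\<lambda>z. k z t) holomorphic_on ball z0 r1 \<inter> U" using elim(1) by (rule holomorphic_on_subset) auto
    show ?case
    proof
      fix z assume z: "z \<in> ball z0 d"
      show "cmod (k z t - k z0 t) \<le> w t / d * cmod (z - z0)"
      proof (rule field_differentiable_bound[where S="ball z0 d" and f="\<lambda>z. k z t" and f'="deriv (\<lambda>z. k z t)"])
        fix y assume y: "y \<in> ball z0 d"
        have hy: "(\<lambda>z. k z t) holomorphic_on cball y d" using h sub[OF y] by (rule holomorphic_on_subset)
        have "(\<lambda>z. k z t) field_differentiable (at y)"
        proof (rule holomorphic_on_imp_differentiable_at[OF elim(1) U])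
          have "y \<in> cball y d" using d by simp
          thus "y \<in> U" using sub[OF y] by blast
        qed
        thus "((\<lambda>z. k z t) has_field_derivative deriv (\<lambda>z. k z t) y) (at y within ball z0 d)"
          using DERIV_deriv_iff_field_differentiable has_field_derivative_at_within by blast
        have "cmod ((deriv ^^ 1) (\<lambda>z. k z t) y) \<le> fact 1 * w t / d ^ 1"
        proof (rule Cauchy_inequality)
          fix x assume "cmod (y - x) = d"
          hence "x \<in> cball y d" by (simp add: dist_norm)
          thus "cmod (k x t) \<le> w t" using elim(2) sub[OF y] by blast
        qed (use hy d holomorphic_on_subset[OF hy ball_subset_cball] in \<open>auto intro: holomorphic_on_imp_continuous_on\<close>)
        thus "cmod (deriv (\<lambda>z. k z t) y) \<le> w t / d" by simp
      qed (use z d in auto)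
    qed
  qed
  have quot_lim: "AE t in N. (\<lambda>n. (k (Y n) t - k z0 t) / (Y n - z0)) \<longlonglongrightarrow> deriv (\<lambda>z. k z t) z0"
    and quot_meas: "(\<lambda>t. (k (Y n) t - k z0 t) / (Y n - z0)) \<in> borel_measurable N"
    if Y: "\<And>n. Y n \<in> ball z0 d" "\<And>n. Y n \<noteq> z0" and Yl: "Y \<longlonglongrightarrow> z0" for Y :: "nat \<Rightarrow> complex" and n
  proof -
    show "AE t in N. (\<lambda>n. (k (Y n) t - k z0 t) / (Y n - z0)) \<longlonglongrightarrow> deriv (\<lambda>z. k z t) z0"
      using hol
    proof eventually_elim
      case (elim t)
      have "((\<lambda>z. k z t) has_field_derivative deriv (\<lambda>z. k z t) z0) (at z0)"
        using holomorphic_derivI[OF elim U z0] .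
      hence "((\<lambda>z. (k z t - k z0 t) / (z - z0)) \<longlongrightarrow> deriv (\<lambda>z. k z t) z0) (at z0)"
        by (simp add: has_field_derivative_iff)
      thus ?case using Y Yl unfolding tendsto_at_iff_sequentially o_def by auto
    qed
    have "k z0 \<in> borel_measurable N" "k (Y n) \<in> borel_measurable N"
      using int[of z0] int[OF Y(1)] d by auto
    thus "(\<lambda>t. (k (Y n) t - k z0 t) / (Y n - z0)) \<in> borel_measurable N" by measurable
  qed
  define Z where "Z n = z0 + of_real (d / real (n + 2))" for n
  have Z: "Z n \<in> ball z0 d" "Z n \<noteq> z0" for n
    using d by (auto simp: Z_def dist_norm norm_divide field_simps simp flip: of_real_add of_nat_Suc)
  have "(\<lambda>n. d / real (n + 2)) \<longlonglongrightarrow> 0" by real_asymp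
  hence "(\<lambda>n. z0 + complex_of_real (d / real (n + 2))) \<longlonglongrightarrow> z0 + of_real 0"
    by (intro tendsto_add tendsto_const tendsto_of_real)
  hence Zl: "Z \<longlonglongrightarrow> z0" unfolding Z_def by simp
  define g where "g t = lim (\<lambda>n. (k (Z n) t - k z0 t) / (Z n - z0))" for t
  have g[measurable]: "g \<in> borel_measurable N"
    unfolding g_def using quot_meas[OF Z Zl] by (rule borel_measurable_lim_metric)
  have ge: "AE t in N. deriv (\<lambda>z. k z t) z0 = g t"
    using quot_lim[OF Z Zl] by eventually_elim (simp add: g_def limI)
  have "((\<lambda>z. ((LINT t|N. k z t) - (LINT t|N. k z0 t)) / (z - z0)) \<longlongrightarrow> (LINT t|N. g t)) (at z0)"
    unfolding tendsto_at_iff_sequentially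
  proof (intro allI impI)
    fix X assume X0: "\<forall>i. X i \<in> UNIV - {z0}" and X: "X \<longlonglongrightarrow> z0"
    have "\<forall>\<^sub>F n in sequentially. X n \<in> ball z0 d" using X d by (intro topological_tendstoD) auto
    then obtain n0 where n0: "\<And>n. X (n + n0) \<in> ball z0 d" unfolding eventually_sequentially by (metis le_add2)
    define Y where "Y n = X (n + n0)" for n
    have Y: "Y n \<in> ball z0 d" "Y n \<noteq> z0" for n using n0 X0 by (auto simp: Y_def)
    have Yl: "Y \<longlonglongrightarrow> z0" unfolding Y_def using X by (rule LIMSEQ_ignore_initial_segment)
    note lim = quot_lim[OF Y Yl] and quot_meas[OF Y Yl, measurable]
    have "(\<lambda>n. LINT t|N. (k (Y n) t - k z0 t) / (Y n - z0)) \<longlonglongrightarrow> (LINT t|N. g t)"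
    proof (rule integral_dominated_convergence[where w="\<lambda>t. w t / d"])
      show "AE t in N. (\<lambda>n. (k (Y n) t - k z0 t) / (Y n - z0)) \<longlonglongrightarrow> g t" using lim ge by eventually_elim simp
      show "AE t in N. cmod ((k (Y n) t - k z0 t) / (Y n - z0)) \<le> w t / d" for n
        using dq
      proof eventually_elim
        case (elim t)
        hence "cmod (k (Y n) t - k z0 t) \<le> w t / d * cmod (Y n - z0)" using Y by auto
        thus ?case using Y(2)[of n] by (simp add: norm_divide pos_divide_le_eq)
      qed
    qed (use w in auto)
    also have "(\<lambda>n. LINT t|N. (k (Y n) t - k z0 t) / (Y n - z0)) = (\<lambda>n. ((LINT t|N. k (Y n) t) - (LINT t|N. k z0 t)) / (Y n - z0))"
      using int[OF Y(1)] int[of z0] d by (auto simp: fun_eq_iff)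
    finally have "(\<lambda>n. ((\<lambda>z. ((LINT t|N. k z t) - (LINT t|N. k z0 t)) / (z - z0)) \<circ> X) (n + n0)) \<longlonglongrightarrow> (LINT t|N. g t)"
      by (simp add: Y_def o_def)
    thus "((\<lambda>z. ((LINT t|N. k z t) - (LINT t|N. k z0 t)) / (z - z0)) \<circ> X) \<longlonglongrightarrow> (LINT t|N. g t)"
      by (rule LIMSEQ_offset)
  qed
  hence "((\<lambda>z. LINT t|N. k z t) has_field_derivative (LINT t|N. g t)) (at z0)"
    by (simp add: has_field_derivative_iff)
  thus "(\<lambda>z. LINT t|N. k z t) field_differentiable (at z0 within U)"
    using field_differentiable_def field_differentiable_at_within by blast
qed

subsection \<open>Radial limits\<close>

text \<open>A nonnegative \<open>k\<close> is the density of a finite measure on the line of angles,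
  whose derivative is \<open>k (cis x)\<close> almost everywhere by Lebesgue; the Poisson integral
  converges to this derivative.\<close>

lemma AE_poisson_integral_L1_nonneg:
  fixes k :: "complex \<Rightarrow> real"
  assumes k: "integrable circle_measure k" and k0: "\<And>\<zeta>. 0 \<le> k \<zeta>"
  shows "AE \<zeta> in circle_measure. ((\<lambda>r. LINT \<eta>|circle_measure. k \<eta> * Re (H (of_real r * \<zeta> * cnj \<eta>))) \<longlongrightarrow> k \<zeta>) (at_left 1)"
proof (rule AE_circleI)
  have [measurable]: "k \<in> borel_measurable borel" using borel_measurable_integrable[OF k] by simp
  define f where "f t = indicator {0..<2 * pi} t * k (cis t)" for t
  have [measurable]: "f \<in> borel_measurable borel" unfolding f_def by measurable
  have f: "integrable lborel f" using k unfolding f_def by (simp add: integrable_circle_iff set_integrable_def)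
  have f0: "0 \<le> f t" for t using k0 by (simp add: f_def)
  define M where "M = density lborel (\<lambda>t. ennreal (f t))"
  have M: "sets M = sets borel" "finite_measure M"
    unfolding M_def using finite_measure_density_lborel[OF f f0] by auto
  have conc: "AE t in M. 0 \<le> t \<and> t \<le> 2 * pi"
    unfolding M_def by (subst AE_density) (auto simp: f_def indicator_def)
  have "AE x in lborel. ((\<lambda>t. LINT s:{..<t}|lborel. f s) has_real_derivative f x) (at x)"
    by (rule AE_has_real_derivative_primitive[OF f])
  moreover have "(LINT s:{..<t}|lborel. f s) = measure M {..<t}" for t
    unfolding M_def using f f0 by (intro measure_density_lborel[symmetric]) auto
  ultimately have "AE x in lborel. ((\<lambda>t. measure M {..<t}) has_real_derivative f x) (at x)" by simp
  thus "AE x in lborel. 0 < x \<and> x < 2 * pi \<longrightarrow>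
      ((\<lambda>r. LINT \<eta>|circle_measure. k \<eta> * Re (H (of_real r * cis x * cnj \<eta>))) \<longlongrightarrow> k (cis x)) (at_left 1)"
  proof eventually_elim
    case (elim x)
    show ?case
    proof
      assume x: "0 < x \<and> x < 2 * pi"
      have "((\<lambda>r. LINT t|M. poisson_kernel r (t - x) / (2 * pi)) \<longlongrightarrow> f x) (at_left 1)"
        using x by (intro poisson_integral_tendsto[OF M conc elim]) auto
      moreover have "\<forall>\<^sub>F r in at_left 1. (LINT t|M. poisson_kernel r (t - x) / (2 * pi)) = (LINT \<eta>|circle_measure. k \<eta> * Re (H (of_real r * cis x * cnj \<eta>)))"
        unfolding eventually_at_left_field
      proof (intro exI[of _ 0] conjI allI impI)
        fix r :: real assume r: "0 < r" "r < 1"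
        have [measurable]: "H \<in> borel_measurable borel" unfolding H_def by measurable
        have "(LINT \<eta>|circle_measure. k \<eta> * Re (H (of_real r * cis x * cnj \<eta>))) = 
            1 / (2 * pi) * (LINT t:{0..<2 * pi}|lborel. k (cis t) * Re (H (of_real r * cis x * cnj (cis t))))"
          by (subst integral_circle) auto
        also have "\<dots> = 1 / (2 * pi) * (LINT t|lborel. f t * poisson_kernel r (t - x))"
          unfolding set_lebesgue_integral_def using r by (subst Re_H_eq_poisson_kernel) (auto simp: f_def mult.assoc)
        also have "\<dots> = (LINT t|lborel. f t *\<^sub>R (poisson_kernel r (t - x) / (2 * pi)))"
          by (subst integral_mult_right_zero[symmetric]) simp
        also have "\<dots> = (LINT t|M. poisson_kernel r (t - x) / (2 * pi))"
          unfolding M_def by (rule integral_density[symmetric]) (use f0 in \<open>auto simp: poisson_kernel_def\<close>)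
        finally show "(LINT t|M. poisson_kernel r (t - x) / (2 * pi)) = (LINT \<eta>|circle_measure. k \<eta> * Re (H (of_real r * cis x * cnj \<eta>)))" by simp
      qed auto
      ultimately have "((\<lambda>r. LINT \<eta>|circle_measure. k \<eta> * Re (H (of_real r * cis x * cnj \<eta>))) \<longlongrightarrow> f x) (at_left 1)"
        by (rule Lim_transform_eventually)
      thus "((\<lambda>r. LINT \<eta>|circle_measure. k \<eta> * Re (H (of_real r * cis x * cnj \<eta>))) \<longlongrightarrow> k (cis x)) (at_left 1)"
        using x by (simp add: f_def)
    qed
  qed
qed

lemma norm_H_le: 
  assumes "cmod w \<noteq> 1"
  shows "cmod (H w) \<le> (1 + cmod w) / \<bar>1 - cmod w\<bar>"
proof -
  have "\<bar>1 - cmod w\<bar> \<le> cmod (1 - w)" using norm_triangle_ineq3[of 1 w] by simp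
  moreover have "cmod (1 + w) \<le> 1 + cmod w" using norm_triangle_ineq[of 1 w] by simp
  ultimately show ?thesis using assms unfolding H_def norm_divide by (intro frac_le) auto
qed

lemma measurable_H[measurable]: "H \<in> borel_measurable borel"
  unfolding H_def by measurable

lemma AE_norm_H_circle_le:
  assumes "cmod z \<noteq> 1"
  shows "AE \<zeta> in circle_measure. cmod (H (z * cnj \<zeta>)) \<le> (1 + cmod z) / \<bar>1 - cmod z\<bar>"
  using AE_circle_norm_1
proof eventually_elim
  case (elim \<zeta>)
  show ?case using norm_H_le[of "z * cnj \<zeta>"] elim assms by (simp add: norm_mult)
qed

lemma integrable_mult_H:
  fixes k :: "complex \<Rightarrow> complex"
  assumes k: "integrable circle_measure k" and z: "cmod z \<noteq> 1"
  shows "integrable circle_measure (\<lambda>\<zeta>. k \<zeta> * H (z * cnj \<zeta>))"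
proof (rule Bochner_Integration.integrable_bound)
  show "integrable circle_measure (\<lambda>\<zeta>. (1 + cmod z) / \<bar>1 - cmod z\<bar> * cmod (k \<zeta>))"
    using k by (intro integrable_mult_right integrable_norm)
  have [measurable]: "k \<in> borel_measurable borel" using borel_measurable_integrable[OF k] by simp
  show "(\<lambda>\<zeta>. k \<zeta> * H (z * cnj \<zeta>)) \<in> borel_measurable circle_measure" by measurable
  show "AE \<zeta> in circle_measure. norm (k \<zeta> * H (z * cnj \<zeta>)) \<le> norm ((1 + cmod z) / \<bar>1 - cmod z\<bar> * cmod (k \<zeta>))"
    using AE_norm_H_circle_le[OF z]
  proof eventually_elim
    case (elim \<zeta>)
    have "cmod (k \<zeta>) * cmod (H (z * cnj \<zeta>)) \<le> cmod (k \<zeta>) * ((1 + cmod z) / \<bar>1 - cmod z\<bar>)"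
      using elim by (intro mult_left_mono) auto
    thus ?case by (simp add: norm_mult abs_mult mult.commute)
  qed
qed

lemma integrable_mult_Re_H:
  fixes k :: "complex \<Rightarrow> real"
  assumes k: "integrable circle_measure k" and z: "cmod z \<noteq> 1"
  shows "integrable circle_measure (\<lambda>\<zeta>. k \<zeta> * Re (H (z * cnj \<zeta>)))"
proof -
  have "integrable circle_measure (\<lambda>\<zeta>. Re (of_real (k \<zeta>) * H (z * cnj \<zeta>)))"
    using k z by (intro integrable_Re integrable_mult_H) auto
  thus ?thesis by simp
qed

lemma AE_poisson_integral_L1:
  fixes k :: "complex \<Rightarrow> real"
  assumes k: "integrable circle_measure k"
  shows "AE \<zeta> in circle_measure. ((\<lambda>r. LINT \<eta>|circle_measure. k \<eta> * Re (H (of_real r * \<zeta> * cnj \<eta>))) \<longlongrightarrow> k \<zeta>) (at_left 1)"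
proof -
  have i: "integrable circle_measure (\<lambda>\<zeta>. max 0 (k \<zeta>))" "integrable circle_measure (\<lambda>\<zeta>. max 0 (- k \<zeta>))"
    using k by auto
  note a1 = AE_poisson_integral_L1_nonneg[OF i(1) max.cobounded1]
  note a2 = AE_poisson_integral_L1_nonneg[OF i(2) max.cobounded1]
  show ?thesis using a1 a2 AE_circle_norm_1
  proof eventually_elim
    case (elim \<zeta>)
    hence "((\<lambda>r. (LINT \<eta>|circle_measure. max 0 (k \<eta>) * Re (H (of_real r * \<zeta> * cnj \<eta>))) - (LINT \<eta>|circle_measure. max 0 (- k \<eta>) * Re (H (of_real r * \<zeta> * cnj \<eta>))))
        \<longlongrightarrow> max 0 (k \<zeta>) - max 0 (- k \<zeta>)) (at_left 1)" by (intro tendsto_diff) auto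
    moreover have "max 0 (k \<zeta>) - max 0 (- k \<zeta>) = k \<zeta>" by simp
    moreover have "\<forall>\<^sub>F r in at_left 1. (LINT \<eta>|circle_measure. max 0 (k \<eta>) * Re (H (of_real r * \<zeta> * cnj \<eta>))) - (LINT \<eta>|circle_measure. max 0 (- k \<eta>) * Re (H (of_real r * \<zeta> * cnj \<eta>))) = (LINT \<eta>|circle_measure. k \<eta> * Re (H (of_real r * \<zeta> * cnj \<eta>)))"
      unfolding eventually_at_left_field
    proof (intro exI[of _ 0] conjI allI impI)
      fix r :: real assume "0 < r" "r < 1"
      hence z: "cmod (of_real r * \<zeta>) \<noteq> 1" using elim by (simp add: norm_mult)
      show "(LINT \<eta>|circle_measure. max 0 (k \<eta>) * Re (H (of_real r * \<zeta> * cnj \<eta>))) - (LINT \<eta>|circle_measure. max 0 (- k \<eta>) * Re (H (of_real r * \<zeta> * cnj \<eta>))) = (LINT \<eta>|circle_measure. k \<eta> * Re (H (of_real r * \<zeta> * cnj \<eta>)))"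
      proof -
        have "(LINT \<eta>|circle_measure. max 0 (k \<eta>) * Re (H (of_real r * \<zeta> * cnj \<eta>))) - (LINT \<eta>|circle_measure. max 0 (- k \<eta>) * Re (H (of_real r * \<zeta> * cnj \<eta>)))
            = (LINT \<eta>|circle_measure. max 0 (k \<eta>) * Re (H (of_real r * \<zeta> * cnj \<eta>)) - max 0 (- k \<eta>) * Re (H (of_real r * \<zeta> * cnj \<eta>)))"
          by (rule Bochner_Integration.integral_diff[symmetric]) (rule integrable_mult_Re_H[OF i(1) z] integrable_mult_Re_H[OF i(2) z])+
        also have "\<dots> = (LINT \<eta>|circle_measure. k \<eta> * Re (H (of_real r * \<zeta> * cnj \<eta>)))"
          by (intro Bochner_Integration.integral_cong refl) (simp add: max_def)
        finally show ?thesis .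
      qed
    qed auto
    ultimately show ?case by (auto dest: Lim_transform_eventually)
  qed
qed

text \<open>The differential on the circle is \<i> \<zeta> dt, whence the division by the variable
  under the contour integral; dropping the endpoint \<open>2 * pi\<close> changes nothing.\<close>

lemma integral_circle_contour:
  fixes g :: "complex \<Rightarrow> complex"
  assumes [measurable]: "g \<in> borel_measurable borel" and cont: "continuous_on (sphere 0 1) g"
    and cint: "((\<lambda>u. g u / u) has_contour_integral I) (circlepath 0 1)"
  shows "(LINT \<zeta>|circle_measure. g \<zeta>) = I / (2 * of_real pi * \<i>)"
proof -
  have "((\<lambda>t. g (0 + 1 * cis t) / (0 + 1 * cis t) * 1 * \<i> * cis t) has_integral I) {0..2 * pi}"
    using cint unfolding circlepath_def by (subst (asm) has_contour_integral_part_circlepath_iff) auto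
  moreover have "(\<lambda>t. g (0 + 1 * cis t) / (0 + 1 * cis t) * 1 * \<i> * cis t) = (\<lambda>t. \<i> * g (cis t))" by (simp add: fun_eq_iff)
  ultimately have "((\<lambda>t. \<i> * g (cis t)) has_integral I) {0..2 * pi}" by simp
  from has_integral_mult_right[OF this, of "-\<i>"] have 1: "((\<lambda>t. g (cis t)) has_integral (I / \<i>)) {0..2 * pi}" by (simp add: field_simps)
  have cc: "continuous_on {0..2 * pi} (\<lambda>t. g (cis t))"
    by (intro continuous_on_compose2[OF cont] continuous_intros) auto
  have si: "set_integrable lborel {0..2 * pi} (\<lambda>t. g (cis t))" by (rule borel_integrable_atLeastAtMost'[OF cc])
  have "(LINT t:{0..2 * pi}|lborel. g (cis t)) = I / \<i>"
    using set_borel_integral_eq_integral(2)[OF si] 1 by (simp add: integral_unique)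
  moreover have "(LINT t:{0..<2 * pi}|lborel. g (cis t)) = (LINT t:{0..2 * pi}|lborel. g (cis t))"
    unfolding set_lebesgue_integral_def
    by (rule integral_cong_AE) (use AE_lborel_singleton[of "2 * pi"] in \<open>auto elim!: eventually_mono simp: indicator_def\<close>)
  ultimately have "(LINT t:{0..<2 * pi}|lborel. g (cis t)) = I / \<i>" by simp
  hence "(LINT \<zeta>|circle_measure. g \<zeta>) = of_real (1 / (2 * pi)) * (I / \<i>)"
    by (subst integral_circle) (simp_all only: scaleR_conv_of_real assms)
  also have "\<dots> = I / (2 * of_real pi * \<i>)"
    by (simp only: of_real_divide of_real_mult of_real_numeral of_real_1 times_divide_times_eq mult_1_left)
  finally show ?thesis .
qed

text \<open>On the circle the Poisson kernel is the sum of \<open>u / (u - z)\<close> and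
  \<open>u * cnj z / (1 - cnj z * u)\<close>. The first reproduces \<open>f z\<close> by Cauchy's
  formula; the second yields an integrand holomorphic across the closed disc, which contributes
  nothing.\<close>

lemma poisson_formula:
  fixes f :: "complex \<Rightarrow> complex"
  assumes [measurable]: "f \<in> borel_measurable borel" and hol: "f holomorphic_on ball 0 R" and R: "1 < R" and z: "cmod z < 1"
  shows "(LINT \<zeta>|circle_measure. f \<zeta> * of_real (Re (H (z * cnj \<zeta>)))) = f z"
proof -
  have hc: "f holomorphic_on cball 0 1" using hol R by (auto intro: holomorphic_on_subset)
  have ne: "1 - cnj z * u \<noteq> 0" if "cmod u * cmod z < 1" for u
  proof
    assume "1 - cnj z * u = 0"
    hence "cmod (cnj z * u) = 1" by simp
    thus False using that by (simp add: norm_mult mult.commute)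
  qed
  have c1: "((\<lambda>u. f u / (u - z)) has_contour_integral (2 * of_real pi * \<i> * f z)) (circlepath 0 1)"
    using hc z by (intro Cauchy_integral_circlepath_simple) auto
  \<comment> \<open>The radius does not exceed \<open>1 / cmod z\<close>, the distance of the pole
    of the second kernel from the origin.\<close>
  define R' where "R' = min R (if z = 0 then 2 else 1 / cmod z)"
  have R': "1 < R'" using R z by (auto simp: R'_def)
  have c2: "((\<lambda>u. f u * cnj z / (1 - cnj z * u)) has_contour_integral 0) (circlepath 0 1)"
  proof (rule Cauchy_theorem_disc_simple[where a=0 and e=R'])
    have lt: "cmod u * cmod z < 1" if "u \<in> ball 0 R'" for u
      using that by (cases "z = 0") (auto simp: R'_def field_simps)
    show "(\<lambda>u. f u * cnj z / (1 - cnj z * u)) holomorphic_on ball 0 R'"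
      by (intro holomorphic_intros holomorphic_on_subset[OF hol] ne lt) (auto simp: R'_def)
    show "path_image (circlepath 0 1) \<subseteq> ball 0 R'" using R' by auto
  qed auto
  have eqK: "f u / (u - z) + f u * cnj z / (1 - cnj z * u) = f u * of_real (Re (H (z * cnj u))) / u" if u: "cmod u = 1" for u
  proof -
    have uu: "u * cnj u = 1" using u by (simp add: complex_norm_square[symmetric])
    have u0: "u \<noteq> 0" "u - z \<noteq> 0" using u z by auto
    have n2: "1 - cnj z * u \<noteq> 0" using ne u z by simp
    have cu: "cnj u = 1 / u" using uu u0 by (simp add: field_simps)
    have Hz: "H (z * cnj u) = (u + z) / (u - z)" unfolding H_def cu using u0 by (simp add: field_simps)
    have "cnj (H (z * cnj u)) = (1 + cnj z * u) / (1 - cnj z * u)" unfolding H_def by simp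
    hence "2 * of_real (Re (H (z * cnj u))) = (u + z) / (u - z) + (1 + cnj z * u) / (1 - cnj z * u)"
      using complex_add_cnj[of "H (z * cnj u)"] Hz by (metis of_real_mult of_real_numeral)
    also have "\<dots> = 2 * (u / (u - z) + u * cnj z / (1 - cnj z * u))"
      using u0 n2 by (simp add: divide_simps) (simp add: algebra_simps)
    finally have "of_real (Re (H (z * cnj u))) = u / (u - z) + u * cnj z / (1 - cnj z * u)"
      by (subst (asm) mult_cancel_left) simp
    thus ?thesis using u0 by (simp add: divide_simps) (simp add: algebra_simps)
  qed
  have "((\<lambda>u. f u * of_real (Re (H (z * cnj u))) / u) has_contour_integral (2 * of_real pi * \<i> * f z + 0)) (circlepath 0 1)"
    by (rule has_contour_integral_eq[OF has_contour_integral_add[OF c1 c2]]) (simp add: eqK)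
  moreover have "continuous_on (sphere 0 1) (\<lambda>u. f u * of_real (Re (H (z * cnj u))))"
  proof (intro continuous_intros)
    show "continuous_on (sphere 0 1) f" using hc by (intro holomorphic_on_imp_continuous_on) (auto intro: holomorphic_on_subset)
    show "continuous_on (sphere 0 1) (\<lambda>u. H (z * cnj u))" unfolding H_def
    proof (intro continuous_intros ballI)
      fix u assume "u \<in> sphere (0::complex) 1"
      hence "cmod (z * cnj u) < 1" using z by (simp add: norm_mult)
      thus "1 - z * cnj u \<noteq> 0" by auto
    qed
  qed
  ultimately have "(LINT \<zeta>|circle_measure. f \<zeta> * of_real (Re (H (z * cnj \<zeta>)))) = (2 * of_real pi * \<i> * f z + 0) / (2 * of_real pi * \<i>)"
    by (intro integral_circle_contour) auto
  thus ?thesis by simp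
qed

lemma poisson_formula_Re:
  fixes f :: "complex \<Rightarrow> complex"
  assumes [measurable]: "f \<in> borel_measurable borel" and hol: "f holomorphic_on ball 0 R" and R: "1 < R" and z: "cmod z < 1"
  shows "(LINT \<zeta>|circle_measure. Re (f \<zeta>) * Re (H (z * cnj \<zeta>))) = Re (f z)"
    "integrable circle_measure f"
proof -
  have "compact (f ` cball 0 1)" using hol R
    by (intro compact_continuous_image holomorphic_on_imp_continuous_on) (auto intro: holomorphic_on_subset)
  then obtain B where B: "\<And>u. cmod u \<le> 1 \<Longrightarrow> cmod (f u) \<le> B"
    unfolding bounded_iff by (force dest: compact_imp_bounded simp: bounded_iff)
  show fi: "integrable circle_measure f"
    by (rule circle.integrable_const_bound[of _ B]) (use AE_circle_norm_1 in \<open>auto elim!: eventually_mono intro: B\<close>)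
  have "Re (f z) = Re (LINT \<zeta>|circle_measure. f \<zeta> * of_real (Re (H (z * cnj \<zeta>))))"
    using poisson_formula[OF assms] by simp
  also have "\<dots> = (LINT \<zeta>|circle_measure. Re (f \<zeta> * of_real (Re (H (z * cnj \<zeta>)))))"
  proof (rule integral_Re[symmetric])
    show "integrable circle_measure (\<lambda>\<zeta>. f \<zeta> * of_real (Re (H (z * cnj \<zeta>))))"
    proof (rule Bochner_Integration.integrable_bound[OF integrable_mult_H[OF fi, of z]])
      show "AE \<zeta> in circle_measure. norm (f \<zeta> * of_real (Re (H (z * cnj \<zeta>)))) \<le> norm (f \<zeta> * H (z * cnj \<zeta>))"
        by (intro AE_I2) (auto simp: norm_mult intro!: mult_left_mono abs_Re_le_cmod)
    qed (use z in auto)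
  qed
  also have "\<dots> = (LINT \<zeta>|circle_measure. Re (f \<zeta>) * Re (H (z * cnj \<zeta>)))" by simp
  finally show "(LINT \<zeta>|circle_measure. Re (f \<zeta>) * Re (H (z * cnj \<zeta>))) = Re (f z)" ..
qed

text \<open>Weak convergence is tested with a bounded continuous nonnegative function that vanishes
  exactly on the interval.\<close>

lemma weak_conv_AE_closed_interval:
  assumes rd: "\<And>n. real_distribution (\<mu> n)" "real_distribution M" and wc: "weak_conv_m \<mu> M"
    and conc: "\<And>n. AE t in \<mu> n. a \<le> t \<and> t \<le> b"
  shows "AE t in M. a \<le> t \<and> t \<le> b"
proof -
  interpret M: real_distribution M by fact
  define g where "g t = min 1 (max 0 (max (a - t) (t - b)))" for t :: real
  have gm[measurable]: "g \<in> borel_measurable borel" unfolding g_def by measurable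
  have "(\<lambda>n. integral\<^sup>L (\<mu> n) g) \<longlonglongrightarrow> integral\<^sup>L M g"
  proof (rule weak_conv_imp_integral_bdd_continuous_conv[OF rd wc, where B=1])
    show "isCont g x" for x unfolding g_def by (intro continuous_intros)
  qed (auto simp: g_def)
  moreover have "integral\<^sup>L (\<mu> n) g = 0" for n
  proof (rule integral_eq_zero_AE)
    show "AE t in \<mu> n. g t = 0" using conc[of n] by eventually_elim (simp add: g_def)
  qed
  ultimately have "integral\<^sup>L M g = 0" by (simp add: LIMSEQ_const_iff)
  moreover have "integrable M g" by (rule M.integrable_const_bound[of _ 1]) (auto simp: g_def)
  ultimately have "AE t in M. g t = 0" by (subst (asm) integral_nonneg_eq_0_iff_AE) (auto simp: g_def)
  thus ?thesis by eventually_elim (auto simp: g_def min_def max_def split: if_splits)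
qed

text \<open>Fatou's theorem by weak compactness. On the circle of radius \<open>s n\<close> the
  shifted real part is positive and, divided by its value at the centre, the density of a
  probability measure by the mean value property. A weak limit \<open>M\<close> exists by tightness,
  its Poisson integral is the normalized shifted real part, and the radial limit exists wherever the
  distribution function of \<open>M\<close> is differentiable. Only existence is claimed; for outer
  functions the modulus of the limit is identified later.\<close>

lemma bounded_holomorphic_radial_limit_Re:
  fixes Q :: "complex \<Rightarrow> complex"
  assumes [measurable]: "Q \<in> borel_measurable borel" and hol: "Q holomorphic_on ball 0 1"
    and bd: "\<And>z. cmod z < 1 \<Longrightarrow> cmod (Q z) \<le> C"
  shows "AE \<zeta> in circle_measure. \<exists>l. ((\<lambda>r. Re (Q (of_real r * \<zeta>))) \<longlongrightarrow> l) (at_left 1)"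
proof (rule AE_circleI)
  define s where "s n = 1 - 1 / (real n + 2)" for n
  have s: "0 < s n" "s n < 1" for n by (auto simp: s_def field_simps)
  have sl: "s \<longlonglongrightarrow> 1" unfolding s_def by real_asymp
  \<comment> \<open>\<open>C\<close> bounds the modulus, so adding \<open>C + 1\<close> makes the
    real part at least 1 and the normalizing constant positive.\<close>
  define a where "a = Re (Q 0) + C + 1"
  have C: "\<bar>Re (Q z)\<bar> \<le> C" if "cmod z < 1" for z using bd[OF that] abs_Re_le_cmod order_trans by blast
  have a: "a > 0" using C[of 0] by (simp add: a_def)
  define q where "q n t = indicator {0..<2 * pi} t * ((Re (Q (of_real (s n) * cis t)) + C + 1) / (2 * pi * a))" for n t
  have q0: "0 \<le> q n t" for n t
    using C[of "of_real (s n) * cis t"] a s[of n] by (auto simp: q_def norm_mult intro!: divide_nonneg_pos)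
  have [measurable]: "q n \<in> borel_measurable borel" for n unfolding q_def by measurable
  have sh: "(\<lambda>\<zeta>. Q (of_real (s n) * \<zeta>)) holomorphic_on ball 0 (1 / s n)" for n
    by (intro holomorphic_on_compose_gen[OF _ hol, unfolded o_def] holomorphic_intros) (use s[of n] in \<open>auto simp: norm_mult field_simps\<close>)
  have s1: "1 < 1 / s n" for n using s[of n] by simp
  have pois: "(LINT \<zeta>|circle_measure. (Re (Q (of_real (s n) * \<zeta>)) + C + 1) * Re (H (z * cnj \<zeta>))) = Re (Q (of_real (s n) * z)) + C + 1"
    and qint: "integrable circle_measure (\<lambda>\<zeta>. Re (Q (of_real (s n) * \<zeta>)) + C + 1)"
    if z: "cmod z < 1" for n z
  proof -
    have m: "(\<lambda>\<zeta>. Q (of_real (s n) * \<zeta>) + of_real (C + 1)) \<in> borel_measurable borel" by measurable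
    have h: "(\<lambda>\<zeta>. Q (of_real (s n) * \<zeta>) + of_real (C + 1)) holomorphic_on ball 0 (1 / s n)"
      by (intro holomorphic_on_add sh holomorphic_on_const)
    show "(LINT \<zeta>|circle_measure. (Re (Q (of_real (s n) * \<zeta>)) + C + 1) * Re (H (z * cnj \<zeta>))) = Re (Q (of_real (s n) * z)) + C + 1"
      using poisson_formula_Re(1)[OF m h s1 z] by (simp add: add.assoc)
    show "integrable circle_measure (\<lambda>\<zeta>. Re (Q (of_real (s n) * \<zeta>)) + C + 1)"
      using integrable_Re[OF poisson_formula_Re(2)[OF m h s1 z]] by (simp add: add.assoc)
  qed
  have qi: "integrable lborel (q n)" for n
  proof -
    have "set_integrable lborel {0..<2 * pi} (\<lambda>t. Re (Q (of_real (s n) * cis t)) + C + 1)"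
      using qint[of 0 n] integrable_circle_iff[of "\<lambda>\<zeta>. Re (Q (of_real (s n) * \<zeta>)) + C + 1"] by simp
    hence "integrable lborel (\<lambda>t. (indicator {0..<2 * pi} t * (Re (Q (of_real (s n) * cis t)) + C + 1)) / (2 * pi * a))"
      unfolding set_integrable_def by (intro integrable_divide) simp
    thus ?thesis by (simp add: q_def[abs_def])
  qed
  define \<mu> where "\<mu> n = density lborel (\<lambda>t. ennreal (q n t))" for n
  have int_mu: "(LINT t|\<mu> n. poisson_kernel r (t - x)) = (Re (Q (of_real (s n) * (of_real r * cis x))) + C + 1) / a"
    if r: "0 \<le> r" "r < 1" for n r x
  proof -
    have "(LINT t|\<mu> n. poisson_kernel r (t - x)) = (LINT t|lborel. q n t *\<^sub>R poisson_kernel r (t - x))"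
      unfolding \<mu>_def by (rule integral_density) (use q0 in \<open>auto simp: poisson_kernel_def\<close>)
    also have "\<dots> = (LINT t|lborel. (1 / a) * ((1 / (2 * pi)) * (indicator {0..<2 * pi} t * ((Re (Q (of_real (s n) * cis t)) + C + 1) * Re (H (of_real r * cis x * cnj (cis t)))))))"
      unfolding q_def Re_H_eq_poisson_kernel[OF r] by (intro Bochner_Integration.integral_cong refl) (simp add: mult_ac)
    also have "\<dots> = (1 / a) * (LINT \<zeta>|circle_measure. (Re (Q (of_real (s n) * \<zeta>)) + C + 1) * Re (H (of_real r * cis x * cnj \<zeta>)))"
      by (subst integral_circle) (auto simp: set_lebesgue_integral_def)
    also have "\<dots> = (1 / a) * (Re (Q (of_real (s n) * (of_real r * cis x))) + C + 1)"
      by (subst pois) (use r in \<open>auto simp: norm_mult\<close>)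
    finally show ?thesis by simp
  qed
  have rd: "real_distribution (\<mu> n)" for n
  proof -
    interpret finite_measure "\<mu> n" unfolding \<mu>_def using qi q0 by (rule finite_measure_density_lborel)
    have "measure (\<mu> n) (space (\<mu> n)) = (LINT t|\<mu> n. poisson_kernel 0 (t - 0))" by (simp add: poisson_kernel_def)
    also have "\<dots> = 1" by (subst int_mu) (use a in \<open>auto simp: a_def\<close>)
    finally have "emeasure (\<mu> n) (space (\<mu> n)) = 1" by (simp add: emeasure_eq_measure)
    thus ?thesis unfolding real_distribution_def real_distribution_axioms_def
      by (auto intro!: prob_spaceI simp: \<mu>_def)
  qed
  have conc: "AE t in \<mu> n. 0 \<le> t \<and> t \<le> 2 * pi" for n
    unfolding \<mu>_def by (subst AE_density) (auto simp: q_def indicator_def)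
  have "tight \<mu>" unfolding tight_def
  proof (intro conjI allI impI rd)
    fix e :: real assume e: "e > 0"
    show "\<exists>a b. a < b \<and> (\<forall>n. 1 - e < measure (\<mu> n) {a<..b})"
    \<comment> \<open>Tightness is stated with intervals open on the left; starting at -1 includes
      the angle 0.\<close>
    proof (rule exI[of _ "-1"], rule exI[of _ "2 * pi"], intro conjI allI)
      show "(-1::real) < 2 * pi" using pi_gt_zero by linarith
      fix n
      interpret real_distribution "\<mu> n" by (rule rd)
      have "AE t in \<mu> n. t \<in> {-1<..2 * pi}" using conc[of n] by eventually_elim auto
      hence "measure (\<mu> n) {-1<..2 * pi} = 1" by (subst prob_eq_1) auto
      thus "1 - e < measure (\<mu> n) {-1<..2 * pi}" using e by simp
    qed
  qed
  from tight_imp_convergent_subsubsequence[OF this strict_mono_id] obtain \<sigma> M where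
    \<sigma>: "strict_mono \<sigma>" and M: "real_distribution M" and wc: "weak_conv_m (\<lambda>n. \<mu> (\<sigma> n)) M"
    by (auto simp: o_def id_def)
  interpret M: real_distribution M by (rule M)
  have concM: "AE t in M. 0 \<le> t \<and> t \<le> 2 * pi"
    by (rule weak_conv_AE_closed_interval[OF rd M wc conc])
  have ker: "(LINT t|M. poisson_kernel r (t - x)) = (Re (Q (of_real r * cis x)) + C + 1) / a" if r: "0 < r" "r < 1" for r x
  proof -
    have "(\<lambda>n. LINT t|\<mu> (\<sigma> n). poisson_kernel r (t - x)) \<longlonglongrightarrow> (LINT t|M. poisson_kernel r (t - x))"
    proof (rule weak_conv_imp_integral_bdd_continuous_conv[OF rd M wc, where B="poisson_kernel r 0"])
      have "continuous_on UNIV (\<lambda>t. poisson_kernel r (t - x))"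
        by (intro continuous_on_compose2[OF continuous_on_poisson_kernel[of r UNIV]] continuous_intros) (use r in auto)
      thus "isCont (\<lambda>t. poisson_kernel r (t - x)) y" for y by (simp add: continuous_on_eq_continuous_at)
      show "norm (poisson_kernel r (t - x)) \<le> poisson_kernel r 0" for t
        using r poisson_kernel_nonneg[of r "t - x"] poisson_kernel_le[of r "t - x" 0] by simp
    qed
    moreover have "(\<lambda>n. LINT t|\<mu> (\<sigma> n). poisson_kernel r (t - x)) \<longlonglongrightarrow> (Re (Q (of_real 1 * (of_real r * cis x))) + C + 1) / a"
    proof -
      have "isCont Q (of_real 1 * (of_real r * cis x))"
        using hol r by (intro continuous_on_interior[OF holomorphic_on_imp_continuous_on[OF hol]]) (auto simp: norm_mult)
      moreover have "(\<lambda>n. of_real (s (\<sigma> n)) * (of_real r * cis x)) \<longlonglongrightarrow> complex_of_real 1 * (of_real r * cis x)"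
        by (intro tendsto_intros LIMSEQ_subseq_LIMSEQ[OF sl \<sigma>, unfolded o_def])
      ultimately have "(\<lambda>n. Q (of_real (s (\<sigma> n)) * (of_real r * cis x))) \<longlonglongrightarrow> Q (of_real 1 * (of_real r * cis x))"
        by (rule isCont_tendsto_compose)
      thus ?thesis using r by (subst int_mu) (auto intro!: tendsto_intros simp: a[THEN less_imp_neq, symmetric])
    qed
    ultimately show ?thesis by (auto dest: LIMSEQ_unique)
  qed
  have "AE x in lborel. \<exists>D. ((\<lambda>t. measure M {..<t}) has_real_derivative D) (at x)"
    by (rule AE_differentiable_cdf) (auto intro: M.finite_measure_axioms)
  thus "AE x in lborel. 0 < x \<and> x < 2 * pi \<longrightarrow> (\<exists>l. ((\<lambda>r. Re (Q (of_real r * cis x))) \<longlongrightarrow> l) (at_left 1))"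
  proof eventually_elim
    case (elim x)
    show ?case
    proof
      assume x: "0 < x \<and> x < 2 * pi"
      obtain D where D: "((\<lambda>t. measure M {..<t}) has_real_derivative D) (at x)" using elim by blast
      have "((\<lambda>r. LINT t|M. poisson_kernel r (t - x) / (2 * pi)) \<longlongrightarrow> D) (at_left 1)"
        using x by (intro poisson_integral_tendsto[OF _ _ concM D]) (auto intro: M.finite_measure_axioms)
      hence "((\<lambda>r. a * ((2 * pi) * (LINT t|M. poisson_kernel r (t - x) / (2 * pi))) - C - 1) \<longlongrightarrow> a * ((2 * pi) * D) - C - 1) (at_left 1)"
        by (intro tendsto_intros)
      moreover have "\<forall>\<^sub>F r in at_left 1. a * ((2 * pi) * (LINT t|M. poisson_kernel r (t - x) / (2 * pi))) - C - 1 = Re (Q (of_real r * cis x))"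
        unfolding eventually_at_left_field
        by (intro exI[of _ 0] conjI allI impI) (use a in \<open>auto simp: ker\<close>)
      ultimately show "\<exists>l. ((\<lambda>r. Re (Q (of_real r * cis x))) \<longlongrightarrow> l) (at_left 1)"
        by (intro exI) (rule Lim_transform_eventually)
    qed
  qed
qed

text \<open>The imaginary part is the real part of \<open>- \<i> * Q\<close>, which satisfies the
  same bound.\<close>

lemma bounded_holomorphic_radial_limit:
  fixes Q :: "complex \<Rightarrow> complex"
  assumes m[measurable]: "Q \<in> borel_measurable borel" and hol: "Q holomorphic_on ball 0 1"
    and bd: "\<And>z. cmod z < 1 \<Longrightarrow> cmod (Q z) \<le> C"
  shows "AE \<zeta> in circle_measure. \<exists>l. ((\<lambda>r. Q (of_real r * \<zeta>)) \<longlongrightarrow> l) (at_left 1)"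
proof -
  have "AE \<zeta> in circle_measure. \<exists>l. ((\<lambda>r. Re (Q (of_real r * \<zeta>))) \<longlongrightarrow> l) (at_left 1)"
    by (rule bounded_holomorphic_radial_limit_Re[OF m hol bd])
  moreover have "AE \<zeta> in circle_measure. \<exists>l. ((\<lambda>r. Re (- \<i> * Q (of_real r * \<zeta>))) \<longlongrightarrow> l) (at_left 1)"
    by (rule bounded_holomorphic_radial_limit_Re[where C=C]) (auto intro!: holomorphic_intros hol bd simp: norm_mult)
  ultimately show ?thesis
  proof eventually_elim
    case (elim \<zeta>)
    then obtain l1 l2 where "((\<lambda>r. Re (Q (of_real r * \<zeta>))) \<longlongrightarrow> l1) (at_left 1)" "((\<lambda>r. Im (Q (of_real r * \<zeta>))) \<longlongrightarrow> l2) (at_left 1)"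
      by auto
    hence "((\<lambda>r. Complex (Re (Q (of_real r * \<zeta>))) (Im (Q (of_real r * \<zeta>)))) \<longlongrightarrow> Complex l1 l2) (at_left 1)"
      by (intro tendsto_Complex)
    thus ?case by auto
  qed
qed

lemma measurable_circle_iff[simp]: "f \<in> borel_measurable circle_measure \<longleftrightarrow> f \<in> borel_measurable borel"
  by (simp cong: measurable_cong_sets)

subsection \<open>Outer functions\<close>

text \<open>The outer function with boundary modulus \<open>exp (k / 2)\<close>: \<open>k\<close>
  stands for the logarithm of the squared modulus, hence the factor one half.\<close>

definition outer :: "(complex \<Rightarrow> real) \<Rightarrow> complex \<Rightarrow> complex" where
  "outer k z = exp (1/2 * (LINT \<zeta>|circle_measure. of_real (k \<zeta>) * H (z * cnj \<zeta>)))"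

lemma outer_uminus: "outer (\<lambda>\<zeta>. - k \<zeta>) z = inverse (outer k z)"
  by (simp add: outer_def exp_minus)

lemma outer_add:
  assumes "integrable circle_measure k" "integrable circle_measure l" "cmod z \<noteq> 1"
  shows "outer (\<lambda>\<zeta>. k \<zeta> + l \<zeta>) z = outer k z * outer l z"
proof -
  have "(LINT \<zeta>|circle_measure. of_real (k \<zeta> + l \<zeta>) * H (z * cnj \<zeta>))
      = (LINT \<zeta>|circle_measure. of_real (k \<zeta>) * H (z * cnj \<zeta>)) + (LINT \<zeta>|circle_measure. of_real (l \<zeta>) * H (z * cnj \<zeta>))"
    unfolding of_real_add distrib_right
    by (rule Bochner_Integration.integral_add) (use assms in \<open>auto intro!: integrable_mult_H\<close>)
  thus ?thesis unfolding outer_def exp_add[symmetric] by (simp only: distrib_left)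
qed

text \<open>The exterior of the disc is included because boundary functions are total on the plane
  and have to be Borel measurable there.\<close>

lemma holomorphic_on_H_integral:
  fixes k :: "complex \<Rightarrow> complex"
  assumes k: "integrable circle_measure k"
  shows "(\<lambda>z. LINT \<zeta>|circle_measure. k \<zeta> * H (z * cnj \<zeta>)) holomorphic_on - sphere 0 1"
proof (rule holomorphic_on_lebesgue_integral)
  have [measurable]: "k \<in> borel_measurable borel" using borel_measurable_integrable[OF k] by simp
  show "(\<lambda>\<zeta>. k \<zeta> * H (z * cnj \<zeta>)) \<in> borel_measurable circle_measure" for z by measurable
  show "AE \<zeta> in circle_measure. (\<lambda>z. k \<zeta> * H (z * cnj \<zeta>)) holomorphic_on - sphere 0 1"
    using AE_circle_norm_1
  proof eventually_elim
    case (elim \<zeta>)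
    show ?case unfolding H_def
    proof (intro holomorphic_intros)
      fix z assume "z \<in> - sphere (0::complex) 1"
      hence "cmod (z * cnj \<zeta>) \<noteq> 1" using elim by (simp add: norm_mult)
      thus "1 - z * cnj \<zeta> \<noteq> 0" by auto
    qed
  qed
  fix z0 :: complex assume z0: "z0 \<in> - sphere 0 1"
  define r where "r = \<bar>1 - cmod z0\<bar> / 2"
  have r: "r > 0" using z0 by (auto simp: r_def)
  show "\<exists>r>0. \<exists>w. integrable circle_measure w \<and> (AE \<zeta> in circle_measure. \<forall>z\<in>ball z0 r \<inter> - sphere 0 1. cmod (k \<zeta> * H (z * cnj \<zeta>)) \<le> w \<zeta>)"
  proof (intro exI conjI)
    show "r > 0" by fact
    show "integrable circle_measure (\<lambda>\<zeta>. (1 + (cmod z0 + r)) / r * cmod (k \<zeta>))"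
      using k by (intro integrable_mult_right integrable_norm)
    show "AE \<zeta> in circle_measure. \<forall>z\<in>ball z0 r \<inter> - sphere 0 1. cmod (k \<zeta> * H (z * cnj \<zeta>)) \<le> (1 + (cmod z0 + r)) / r * cmod (k \<zeta>)"
      using AE_circle_norm_1
    proof eventually_elim
      case (elim \<zeta>)
      show ?case
      proof
        fix z assume z: "z \<in> ball z0 r \<inter> - sphere 0 1"
        have d: "cmod (z - z0) < r" using z by (simp add: dist_norm norm_minus_commute)
        have "\<bar>cmod z - cmod z0\<bar> \<le> cmod (z - z0)" by (rule norm_triangle_ineq3)
        moreover have "\<bar>1 - cmod z0\<bar> \<le> \<bar>1 - cmod z\<bar> + \<bar>cmod z - cmod z0\<bar>"
          using abs_triangle_ineq[of "1 - cmod z" "cmod z - cmod z0"] by simp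
        moreover have "\<bar>1 - cmod z0\<bar> = 2 * r" by (simp add: r_def)
        ultimately have n: "cmod z \<le> cmod z0 + r" "r \<le> \<bar>1 - cmod z\<bar>" using d by linarith+
        have "cmod (H (z * cnj \<zeta>)) \<le> (1 + cmod z) / \<bar>1 - cmod z\<bar>"
          using norm_H_le[of "z * cnj \<zeta>"] z elim by (simp add: norm_mult)
        also have "\<dots> \<le> (1 + (cmod z0 + r)) / r" using n r by (intro frac_le) auto
        finally have "cmod (H (z * cnj \<zeta>)) * cmod (k \<zeta>) \<le> (1 + (cmod z0 + r)) / r * cmod (k \<zeta>)" by (intro mult_right_mono) auto
        thus "cmod (k \<zeta> * H (z * cnj \<zeta>)) \<le> (1 + (cmod z0 + r)) / r * cmod (k \<zeta>)" by (simp add: norm_mult mult.commute)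
      qed
    qed
  qed
qed (intro open_Compl closed_sphere)

lemma holomorphic_on_outer:
  assumes "integrable circle_measure k"
  shows "outer k holomorphic_on - sphere 0 1"
  unfolding outer_def
  using assms by (intro holomorphic_intros holomorphic_on_H_integral) auto

lemma measurable_outer:
  assumes [measurable]: "k \<in> borel_measurable borel"
  shows "outer k \<in> borel_measurable borel"
proof -
  have "(\<lambda>z. LINT \<zeta>|circle_measure. of_real (k \<zeta>) * H (z * cnj \<zeta>)) \<in> borel_measurable borel"
    by (rule circle.borel_measurable_lebesgue_integral) measurable
  thus ?thesis unfolding outer_def by measurable
qed

lemma Re_H_integral:
  assumes k: "integrable circle_measure k" and z: "cmod z \<noteq> 1"
  shows "Re (LINT \<zeta>|circle_measure. of_real (k \<zeta>) * H (z * cnj \<zeta>)) = (LINT \<zeta>|circle_measure. k \<zeta> * Re (H (z * cnj \<zeta>)))"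
  using integral_Re[OF integrable_mult_H[of "\<lambda>\<zeta>. of_real (k \<zeta>)", OF _ z]] k by simp

lemma norm_outer_sq:
  assumes "integrable circle_measure k" "cmod z \<noteq> 1"
  shows "(cmod (outer k z))\<^sup>2 = exp (LINT \<zeta>|circle_measure. k \<zeta> * Re (H (z * cnj \<zeta>)))"
  unfolding outer_def norm_exp_eq_Re power2_eq_square exp_add[symmetric]
  using Re_H_integral[OF assms] by simp

lemma integral_Re_H:
  assumes "cmod z < 1"
  shows "(LINT \<zeta>|circle_measure. Re (H (z * cnj \<zeta>))) = 1"
  using poisson_formula_Re(1)[of "\<lambda>_. 1" 2 z] assms by simp

lemma Re_H_nonneg: "cmod w \<le> 1 \<Longrightarrow> 0 \<le> Re (H w)"
  by (simp add: Re_H abs_square_le_1)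

lemma norm_outer_le:
  assumes k: "integrable circle_measure k" and C: "AE \<zeta> in circle_measure. k \<zeta> \<le> C" and z: "cmod z < 1"
  shows "cmod (outer k z) \<le> exp (C / 2)"
proof -
  have "(LINT \<zeta>|circle_measure. k \<zeta> * Re (H (z * cnj \<zeta>))) \<le> (LINT \<zeta>|circle_measure. C * Re (H (z * cnj \<zeta>)))"
  proof (rule integral_mono_AE)
    show "AE \<zeta> in circle_measure. k \<zeta> * Re (H (z * cnj \<zeta>)) \<le> C * Re (H (z * cnj \<zeta>))"
      using C AE_circle_norm_1
    proof eventually_elim
      case (elim \<zeta>)
      thus ?case using z by (intro mult_right_mono Re_H_nonneg) (auto simp: norm_mult)
    qed
  qed (use z k in \<open>intro integrable_mult_Re_H; simp\<close>)+
  also have "\<dots> = C" using integral_Re_H[OF z] by simp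
  finally have "(cmod (outer k z))\<^sup>2 \<le> exp C" using z by (simp add: norm_outer_sq[OF k])
  also have "exp C = (exp (C / 2))\<^sup>2" by (simp add: power2_eq_square exp_add[symmetric])
  finally show ?thesis by (rule power2_le_imp_le) simp
qed

lemma radial_limitI:
  assumes "((\<lambda>r. f (of_real r * \<zeta>)) \<longlongrightarrow> l) (at_left 1)"
  shows "radial_limit f \<zeta> = l"
  unfolding radial_limit_def using assms by (intro tendsto_Lim) auto

text \<open>An upper bound on \<open>k\<close> bounds the outer function, so Fatou gives the radial
  limit; its modulus is read off from the Poisson integral of \<open>k\<close>, which is the
  logarithm of the squared modulus in the disc.\<close>

lemma AE_outer_radial_limit_upper:
  assumes k: "integrable circle_measure k" and C: "AE \<zeta> in circle_measure. k \<zeta> \<le> C"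
  shows "AE \<zeta> in circle_measure. ((\<lambda>r. outer k (of_real r * \<zeta>)) \<longlongrightarrow> radial_limit (outer k) \<zeta>) (at_left 1) \<and>
    (cmod (radial_limit (outer k) \<zeta>))\<^sup>2 = exp (k \<zeta>)"
proof -
  have [measurable]: "k \<in> borel_measurable borel" using borel_measurable_integrable[OF k] by simp
  have "AE \<zeta> in circle_measure. \<exists>l. ((\<lambda>r. outer k (of_real r * \<zeta>)) \<longlongrightarrow> l) (at_left 1)"
    by (rule bounded_holomorphic_radial_limit[OF measurable_outer holomorphic_on_subset[OF holomorphic_on_outer[OF k]] norm_outer_le[OF k C]]) auto
  with AE_poisson_integral_L1[OF k] AE_circle_norm_1 show ?thesis
  proof eventually_elim
    case (elim \<zeta>)
    then obtain l where l: "((\<lambda>r. outer k (of_real r * \<zeta>)) \<longlongrightarrow> l) (at_left 1)" by blast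
    hence "((\<lambda>r. (cmod (outer k (of_real r * \<zeta>)))\<^sup>2) \<longlongrightarrow> (cmod l)\<^sup>2) (at_left 1)" by (intro tendsto_intros)
    moreover have "((\<lambda>r. exp (LINT \<eta>|circle_measure. k \<eta> * Re (H (of_real r * \<zeta> * cnj \<eta>)))) \<longlongrightarrow> exp (k \<zeta>)) (at_left 1)"
      using elim by (intro tendsto_intros)
    moreover have "\<forall>\<^sub>F r in at_left 1. exp (LINT \<eta>|circle_measure. k \<eta> * Re (H (of_real r * \<zeta> * cnj \<eta>))) = (cmod (outer k (of_real r * \<zeta>)))\<^sup>2"
      unfolding eventually_at_left_field
      by (intro exI[of _ 0]) (use elim in \<open>auto simp: norm_outer_sq[OF k] norm_mult\<close>)
    ultimately have "(cmod l)\<^sup>2 = exp (k \<zeta>)"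
      by (intro tendsto_unique[OF _ _ Lim_transform_eventually]) auto
    with l show ?case by (simp add: radial_limitI[OF l])
  qed
qed

text \<open>The case of \<open>F\<close> itself, whose logarithm is bounded only from below. The
  reciprocal falls under the bounded case, and its limit is nonzero because its squared modulus is
  an exponential.\<close>

lemma AE_outer_radial_limit_lower:
  assumes k: "integrable circle_measure k" and C: "AE \<zeta> in circle_measure. C \<le> k \<zeta>"
  shows "AE \<zeta> in circle_measure. ((\<lambda>r. outer k (of_real r * \<zeta>)) \<longlongrightarrow> radial_limit (outer k) \<zeta>) (at_left 1) \<and>
    (cmod (radial_limit (outer k) \<zeta>))\<^sup>2 = exp (k \<zeta>)"
proof -
  have n: "AE \<zeta> in circle_measure. - k \<zeta> \<le> - C" using C by eventually_elim simp
  have "integrable circle_measure (\<lambda>\<zeta>. - k \<zeta>)" using k by simp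
  from AE_outer_radial_limit_upper[OF this n] show ?thesis
  proof eventually_elim
    case a: (elim \<zeta>)
    define l where "l = radial_limit (outer (\<lambda>\<zeta>. - k \<zeta>)) \<zeta>"
    have l: "((\<lambda>r. inverse (outer k (of_real r * \<zeta>))) \<longlongrightarrow> l) (at_left 1)" "(cmod l)\<^sup>2 = exp (- k \<zeta>)"
      using a by (simp_all add: l_def outer_uminus)
    have l0: "l \<noteq> 0" using l(2) by auto
    have t: "((\<lambda>r. outer k (of_real r * \<zeta>)) \<longlongrightarrow> inverse l) (at_left 1)"
      using tendsto_inverse[OF l(1) l0] by simp
    show "((\<lambda>r. outer k (of_real r * \<zeta>)) \<longlongrightarrow> radial_limit (outer k) \<zeta>) (at_left 1) \<and>
      (cmod (radial_limit (outer k) \<zeta>))\<^sup>2 = exp (k \<zeta>)"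
      using t l(2) unfolding radial_limitI[OF t] by (simp add: norm_inverse power_inverse exp_minus)
  qed
qed

text \<open>Existence of a limit is expressed with countable quantifiers only, so that the set of
  points where it holds is visibly Borel. Continuity carries the Cauchy condition from rational to
  real radii; the bound is nonstrict so that it survives the passage to the limit.\<close>

lemma tendsto_at_left_rational_Cauchy:
  fixes g :: "real \<Rightarrow> complex"
  assumes cont: "continuous_on {0<..<1} g"
  shows "(\<exists>l. (g \<longlongrightarrow> l) (at_left 1)) \<longleftrightarrow>
    (\<forall>k::nat. \<exists>N::nat. \<forall>p q::rat. 1 - 1 / (real N + 2) < of_rat p \<and> of_rat p < (1::real) \<and> 1 - 1 / (real N + 2) < of_rat q \<and> of_rat q < (1::real) \<longrightarrow> dist (g (of_rat p)) (g (of_rat q)) \<le> 1 / (real k + 1))"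
    (is "?L \<longleftrightarrow> ?R")
proof
  assume ?L
  then obtain l where l: "(g \<longlongrightarrow> l) (at_left 1)" by blast
  show ?R
  proof
    fix k :: nat
    from tendstoD[OF l, of "1 / (real k + 1) / 2"] obtain b where b: "b < 1" "\<And>y. b < y \<Longrightarrow> y < 1 \<Longrightarrow> dist (g y) l < 1 / (real k + 1) / 2"
      unfolding eventually_at_left_field by auto
    obtain N :: nat where N: "1 / (1 - b) < real N" using reals_Archimedean2 by blast
    have "1 < (1 - b) * (real N + 2)" using N b(1) by (simp add: field_simps)
    hence Nb: "b < 1 - 1 / (real N + 2)" by (simp add: field_simps)
    show "\<exists>N::nat. \<forall>p q::rat. 1 - 1 / (real N + 2) < of_rat p \<and> of_rat p < (1::real) \<and> 1 - 1 / (real N + 2) < of_rat q \<and> of_rat q < (1::real) \<longrightarrow> dist (g (of_rat p)) (g (of_rat q)) \<le> 1 / (real k + 1)"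
    proof (intro exI[of _ N] allI impI)
      fix p' q' :: rat
      define p q :: real where "p = of_rat p'" and "q = of_rat q'"
      assume "1 - 1 / (real N + 2) < of_rat p' \<and> of_rat p' < (1::real) \<and> 1 - 1 / (real N + 2) < of_rat q' \<and> of_rat q' < (1::real)"
      hence a: "1 - 1 / (real N + 2) < p \<and> p < 1 \<and> 1 - 1 / (real N + 2) < q \<and> q < 1" by (simp add: p_def q_def)
      have "dist (g p) l < 1 / (real k + 1) / 2" "dist (g q) l < 1 / (real k + 1) / 2" using a Nb by (intro b(2); linarith)+
      hence "dist (g p) (g q) \<le> 1 / (real k + 1)" using dist_triangle2[of "g p" "g q" l] by linarith
      thus "dist (g (of_rat p')) (g (of_rat q')) \<le> 1 / (real k + 1)" by (simp add: p_def q_def)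
    qed
  qed
next
  assume R: ?R
  have key: "\<exists>N::nat. \<forall>p q. 1 - 1 / (real N + 2) < p \<and> p < 1 \<and> 1 - 1 / (real N + 2) < q \<and> q < 1 \<longrightarrow> dist (g p) (g q) \<le> 1 / (real k + 1)" for k :: nat
  proof -
    from R obtain N :: nat where N': "\<And>p q::rat. 1 - 1 / (real N + 2) < of_rat p \<Longrightarrow> of_rat p < (1::real) \<Longrightarrow> 1 - 1 / (real N + 2) < of_rat q \<Longrightarrow> of_rat q < (1::real) \<Longrightarrow>
        dist (g (of_rat p)) (g (of_rat q)) \<le> 1 / (real k + 1)"
      by meson
    have N: "dist (g p) (g q) \<le> 1 / (real k + 1)"
      if "p \<in> \<rat>" "q \<in> \<rat>" "1 - 1 / (real N + 2) < p" "p < 1" "1 - 1 / (real N + 2) < q" "q < 1" for p q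
    proof -
      obtain p' q' where "p = of_rat p'" "q = of_rat q'" using \<open>p \<in> \<rat>\<close> \<open>q \<in> \<rat>\<close> by (elim Rats_cases) blast
      thus ?thesis using N'[of p' q'] that by simp
    qed
    define b where "b = 1 - 1 / (real N + 2)"
    have b: "0 < b" "b < 1" by (auto simp: b_def field_simps)
    have rat: "\<exists>X. (\<forall>n. X n \<in> \<rat> \<and> b < X n \<and> X n < 1) \<and> X \<longlonglongrightarrow> p" if p: "b < p" "p < 1" for p
    proof -
      have "\<exists>x\<in>\<rat>. max b (p - 1 / (real n + 1)) < x \<and> x < p" for n
        using Rats_dense_in_real[of "max b (p - 1 / (real n + 1))" p] p by auto
      then obtain X where X: "\<And>n. X n \<in> \<rat>" "\<And>n. max b (p - 1 / (real n + 1)) < X n" "\<And>n. X n < p" by metis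
      have "X \<longlonglongrightarrow> p"
      proof (rule tendsto_sandwich[of "\<lambda>n. p - 1 / (real n + 1)" _ _ "\<lambda>_. p"])
        show "(\<lambda>n. p - 1 / (real n + 1)) \<longlonglongrightarrow> p" by real_asymp
        have "p - 1 / (real n + 1) \<le> X n" for n using X(2)[of n] by simp
        thus "\<forall>\<^sub>F n in sequentially. p - 1 / (real n + 1) \<le> X n" by simp
        show "\<forall>\<^sub>F n in sequentially. X n \<le> p" using X(3) by (simp add: less_imp_le)
      qed simp
      moreover have "\<forall>n. X n \<in> \<rat> \<and> b < X n \<and> X n < 1" using X p by (metis less_trans max_less_iff_conj)
      ultimately show ?thesis by blast
    qed
    show ?thesis
    proof (intro exI[of _ N] allI impI)
      fix p q assume a: "1 - 1 / (real N + 2) < p \<and> p < 1 \<and> 1 - 1 / (real N + 2) < q \<and> q < 1"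
      obtain X where X: "\<And>n. X n \<in> \<rat> \<and> b < X n \<and> X n < 1" "X \<longlonglongrightarrow> p" using rat[of p] a by (auto simp: b_def)
      obtain Y where Y: "\<And>n. Y n \<in> \<rat> \<and> b < Y n \<and> Y n < 1" "Y \<longlonglongrightarrow> q" using rat[of q] a by (auto simp: b_def)
      have "b < p" "p < 1" "b < q" "q < 1" using a by (simp_all add: b_def)
      hence "p \<in> {0<..<1}" "q \<in> {0<..<1}" using b(1) by simp_all
      hence "isCont g p" "isCont g q" using cont by (simp_all add: continuous_on_eq_continuous_at)
      hence "(\<lambda>n. dist (g (X n)) (g (Y n))) \<longlonglongrightarrow> dist (g p) (g q)"
        using X(2) Y(2) by (intro tendsto_dist) (auto intro: isCont_tendsto_compose)
      moreover have "dist (g (X n)) (g (Y n)) \<le> 1 / (real k + 1)" for n using X(1)[of n] Y(1)[of n] by (intro N) (auto simp: b_def)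
      ultimately show "dist (g p) (g q) \<le> 1 / (real k + 1)" by (intro LIMSEQ_le_const2) auto
    qed
  qed
  define x where "x n = 1 - 1 / (real n + 3)" for n
  have x: "1 - 1 / (real N + 2) < x n" "x n < 1" if "n \<ge> N" for n N :: nat
    using that by (auto simp: x_def field_simps)
  have "Cauchy (\<lambda>n. g (x n))"
  proof (rule metric_CauchyI)
    fix e :: real assume "e > 0"
    then obtain k :: nat where k: "1 / (real k + 1) < e" using reals_Archimedean[of e] by (auto simp: inverse_eq_divide add.commute)
    obtain N :: nat where N: "\<And>p q. 1 - 1 / (real N + 2) < p \<and> p < 1 \<and> 1 - 1 / (real N + 2) < q \<and> q < 1 \<Longrightarrow> dist (g p) (g q) \<le> 1 / (real k + 1)"
      using key[of k] by blast
    show "\<exists>M. \<forall>m\<ge>M. \<forall>n\<ge>M. dist (g (x m)) (g (x n)) < e"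
    proof (intro exI[of _ N] allI impI)
      fix m n assume "N \<le> m" "N \<le> n"
      thus "dist (g (x m)) (g (x n)) < e" using x by (intro le_less_trans[OF N k]) blast
    qed
  qed
  then obtain l where l: "(\<lambda>n. g (x n)) \<longlonglongrightarrow> l" using convergent_eq_Cauchy convergent_def by metis
  have "(g \<longlongrightarrow> l) (at_left 1)"
  proof (rule tendstoI)
    fix e :: real assume "e > 0"
    then obtain k :: nat where k: "1 / (real k + 1) < e" using reals_Archimedean[of e] by (auto simp: inverse_eq_divide add.commute)
    obtain N :: nat where N: "\<And>p q. 1 - 1 / (real N + 2) < p \<and> p < 1 \<and> 1 - 1 / (real N + 2) < q \<and> q < 1 \<Longrightarrow> dist (g p) (g q) \<le> 1 / (real k + 1)"
      using key[of k] by blast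
    show "\<forall>\<^sub>F r in at_left 1. dist (g r) l < e" unfolding eventually_at_left_field
    proof (intro exI[of _ "1 - 1 / (real N + 2)"] conjI allI impI)
      fix r assume r: "1 - 1 / (real N + 2) < r" "r < 1"
      have "(\<lambda>n. dist (g r) (g (x n))) \<longlonglongrightarrow> dist (g r) l" using l by (intro tendsto_intros)
      moreover have "\<exists>M. \<forall>n\<ge>M. dist (g r) (g (x n)) \<le> 1 / (real k + 1)"
        using r x by (intro exI[of _ N] allI impI N) auto
      ultimately have "dist (g r) l \<le> 1 / (real k + 1)" by (intro LIMSEQ_le_const2)
      thus "dist (g r) l < e" using k by simp
    qed auto
  qed
  thus ?L by blast
qed

text \<open>Membership in \<open>L2_circle\<close> asks for measurability, while
  \<open>radial_limit\<close> is a choice of limit at every point of the plane. Off the circle it is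
  \<open>outer k\<close> by continuity, on the set \<open>S\<close> of convergence it is a limit
  along one sequence, elsewhere it is a constant.\<close>

lemma measurable_radial_limit_outer:
  assumes k: "integrable circle_measure k"
  shows "radial_limit (outer k) \<in> borel_measurable borel"
proof -
  have [measurable]: "k \<in> borel_measurable borel" using borel_measurable_integrable[OF k] by simp
  note measurable_outer[measurable]
  have off: "radial_limit (outer k) \<zeta> = outer k \<zeta>" if "cmod \<zeta> \<noteq> 1" for \<zeta>
  proof (rule radial_limitI)
    have "isCont (outer k) \<zeta>"
    proof (rule continuous_on_interior[OF holomorphic_on_imp_continuous_on[OF holomorphic_on_outer[OF k]]])
      have "open (- sphere (0::complex) 1)" by (intro open_Compl closed_sphere)
      thus "\<zeta> \<in> interior (- sphere 0 1)" using that by (simp only: interior_open) simp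
    qed
    moreover have "((\<lambda>r. complex_of_real r * \<zeta>) \<longlongrightarrow> of_real 1 * \<zeta>) (at_left 1)" by (intro tendsto_intros)
    ultimately show "((\<lambda>r. outer k (of_real r * \<zeta>)) \<longlongrightarrow> outer k \<zeta>) (at_left 1)"
      using isCont_tendsto_compose[of "of_real 1 * \<zeta>" "outer k" "\<lambda>r. of_real r * \<zeta>" "at_left 1"] by simp
  qed
  define S where "S = {\<zeta>. cmod \<zeta> = 1 \<and> (\<forall>j::nat. \<exists>N::nat. \<forall>p q::rat. 1 - 1 / (real N + 2) < of_rat p \<and> of_rat p < (1::real) \<and> 1 - 1 / (real N + 2) < of_rat q \<and> of_rat q < (1::real) \<longrightarrow>
      dist (outer k (of_real (of_rat p) * \<zeta>)) (outer k (of_real (of_rat q) * \<zeta>)) \<le> 1 / (real j + 1))}"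
  have S_iff: "\<zeta> \<in> S \<longleftrightarrow> (\<exists>l. ((\<lambda>r. outer k (of_real r * \<zeta>)) \<longlongrightarrow> l) (at_left 1))" if z: "cmod \<zeta> = 1" for \<zeta>
  proof -
    have "continuous_on {0<..<1} (\<lambda>r. outer k (of_real r * \<zeta>))"
      by (intro continuous_on_compose2[OF holomorphic_on_imp_continuous_on[OF holomorphic_on_outer[OF k]]] continuous_intros)
         (use z in \<open>auto simp: norm_mult\<close>)
    from tendsto_at_left_rational_Cauchy[OF this] z show ?thesis unfolding S_def mem_Collect_eq by simp
  qed
  have [measurable]: "S \<in> sets borel"
  proof -
    have "{\<zeta> \<in> space borel. cmod \<zeta> = 1 \<and> (\<forall>j::nat. \<exists>N::nat. \<forall>p q::rat. 1 - 1 / (real N + 2) < of_rat p \<and> of_rat p < (1::real) \<and> 1 - 1 / (real N + 2) < of_rat q \<and> of_rat q < (1::real) \<longrightarrow>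
      dist (outer k (of_real (of_rat p) * \<zeta>)) (outer k (of_real (of_rat q) * \<zeta>)) \<le> 1 / (real j + 1))} \<in> sets borel"
      by measurable
    thus ?thesis by (simp only: S_def space_borel UNIV_I simp_thms)
  qed
  define x where "x n = 1 - 1 / (real n + 3)" for n
  \<comment> \<open>The default value of \<open>Lim\<close> where no limit exists: a definite
    description of an unsatisfiable predicate, hence the same at all such points.\<close>
  define c where "c = (THE l::complex. False)"
  have eq: "radial_limit (outer k) \<zeta> = (if cmod \<zeta> \<noteq> 1 then outer k \<zeta> else if \<zeta> \<in> S then lim (\<lambda>n. outer k (of_real (x n) * \<zeta>)) else c)" for \<zeta>
  proof (cases "cmod \<zeta> = 1 \<and> \<zeta> \<in> S")
    case True
    then obtain l where l: "((\<lambda>r. outer k (of_real r * \<zeta>)) \<longlongrightarrow> l) (at_left 1)" using S_iff by blast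
    have "filterlim x (at_left 1) sequentially" unfolding x_def by real_asymp
    from filterlim_compose[OF l this] have "lim (\<lambda>n. outer k (of_real (x n) * \<zeta>)) = l" by (rule limI)
    thus ?thesis using True radial_limitI[OF l] by simp
  next
    case False
    show ?thesis
    proof (cases "cmod \<zeta> = 1")
      case True
      hence "\<not> ((\<lambda>r. outer k (of_real r * \<zeta>)) \<longlongrightarrow> l) (at_left 1)" for l using False S_iff by blast
      hence "radial_limit (outer k) \<zeta> = c" unfolding radial_limit_def c_def by (simp add: Topological_Spaces.t2_space_class.Lim_def)
      thus ?thesis using True False by simp
    qed (simp add: off)
  qed
  have "(\<lambda>\<zeta>. if cmod \<zeta> \<noteq> 1 then outer k \<zeta> else if \<zeta> \<in> S then lim (\<lambda>n. outer k (of_real (x n) * \<zeta>)) else c) \<in> borel_measurable borel"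
    by measurable
  thus ?thesis by (subst measurable_cong[OF eq]) 
qed

section \<open>Square-integrable functions on the circle and their inner product\<close>

lemma L2_circle_iff:
  "f \<in> L2_circle \<longleftrightarrow> f \<in> borel_measurable borel \<and> integrable circle_measure (\<lambda>\<zeta>. (cmod (f \<zeta>))\<^sup>2)"
  by (simp add: L2_circle_def)

lemma L2_circle_measurable[measurable_dest]: "f \<in> L2_circle \<Longrightarrow> f \<in> borel_measurable borel"
  by (simp add: L2_circle_iff)

lemma L2_circle_dominated:
  assumes "integrable circle_measure w" and "f \<in> borel_measurable borel"
    and "AE \<zeta> in circle_measure. (cmod (f \<zeta>))\<^sup>2 \<le> w \<zeta>"
  shows "f \<in> L2_circle"
  unfolding L2_circle_iff
proof
  have [measurable]: "f \<in> borel_measurable borel" by fact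
  show "integrable circle_measure (\<lambda>\<zeta>. (cmod (f \<zeta>))\<^sup>2)"
  proof (rule Bochner_Integration.integrable_bound[OF assms(1)])
    show "AE \<zeta> in circle_measure. norm ((cmod (f \<zeta>))\<^sup>2) \<le> norm (w \<zeta>)" using assms(3) by eventually_elim simp
  qed measurable
qed fact

lemma L2_circle_add: 
  assumes f: "f \<in> L2_circle" and g: "g \<in> L2_circle"
  shows "(\<lambda>\<zeta>. f \<zeta> + g \<zeta>) \<in> L2_circle"
proof (rule L2_circle_dominated)
  note [measurable] = L2_circle_measurable[OF f] L2_circle_measurable[OF g]
  show "(\<lambda>\<zeta>. f \<zeta> + g \<zeta>) \<in> borel_measurable borel" by measurable
  show "integrable circle_measure (\<lambda>\<zeta>. 2 * (cmod (f \<zeta>))\<^sup>2 + 2 * (cmod (g \<zeta>))\<^sup>2)"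
    using f g by (simp add: L2_circle_iff)
  show "AE \<zeta> in circle_measure. (cmod (f \<zeta> + g \<zeta>))\<^sup>2 \<le> 2 * (cmod (f \<zeta>))\<^sup>2 + 2 * (cmod (g \<zeta>))\<^sup>2"
  proof (rule AE_I2)
    fix \<zeta>
    have "(cmod (f \<zeta> + g \<zeta>))\<^sup>2 \<le> (cmod (f \<zeta>) + cmod (g \<zeta>))\<^sup>2" by (intro power_mono norm_triangle_ineq) auto
    also have "\<dots> \<le> 2 * (cmod (f \<zeta>))\<^sup>2 + 2 * (cmod (g \<zeta>))\<^sup>2"
      using sum_squares_bound[of "cmod (f \<zeta>)" "cmod (g \<zeta>)"] by (simp add: power2_sum)
    finally show "(cmod (f \<zeta> + g \<zeta>))\<^sup>2 \<le> 2 * (cmod (f \<zeta>))\<^sup>2 + 2 * (cmod (g \<zeta>))\<^sup>2" .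
  qed
qed

lemma L2_circle_bounded_mult:
  assumes f: "f \<in> L2_circle" and [measurable]: "b \<in> borel_measurable borel" and B: "AE \<zeta> in circle_measure. cmod (b \<zeta>) \<le> B"
  shows "(\<lambda>\<zeta>. b \<zeta> * f \<zeta>) \<in> L2_circle"
proof (rule L2_circle_dominated)
  note [measurable] = L2_circle_measurable[OF f]
  show "(\<lambda>\<zeta>. b \<zeta> * f \<zeta>) \<in> borel_measurable borel" by measurable
  show "integrable circle_measure (\<lambda>\<zeta>. B\<^sup>2 * (cmod (f \<zeta>))\<^sup>2)" using f by (simp add: L2_circle_iff)
  show "AE \<zeta> in circle_measure. (cmod (b \<zeta> * f \<zeta>))\<^sup>2 \<le> B\<^sup>2 * (cmod (f \<zeta>))\<^sup>2"
    using B
  proof eventually_elim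
    case (elim \<zeta>)
    hence "(cmod (b \<zeta>))\<^sup>2 \<le> B\<^sup>2" by (intro power_mono) auto
    thus ?case by (simp add: norm_mult power_mult_distrib mult_right_mono)
  qed
qed

lemma L2_circle_scale: "f \<in> L2_circle \<Longrightarrow> (\<lambda>\<zeta>. c * f \<zeta>) \<in> L2_circle"
  by (rule L2_circle_bounded_mult[of _ "\<lambda>_. c" "cmod c"]) auto

lemma L2_circle_const: "(\<lambda>_. c) \<in> L2_circle"
  by (simp add: L2_circle_iff)

lemma integrable_L2_mult:
  assumes f: "f \<in> L2_circle" and g: "g \<in> L2_circle"
  shows "integrable circle_measure (\<lambda>\<zeta>. f \<zeta> * cnj (g \<zeta>))"
proof (rule Bochner_Integration.integrable_bound)
  note [measurable] = L2_circle_measurable[OF f] L2_circle_measurable[OF g]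
  show "integrable circle_measure (\<lambda>\<zeta>. (cmod (f \<zeta>))\<^sup>2 + (cmod (g \<zeta>))\<^sup>2)"
    using f g by (simp add: L2_circle_iff)
  show "(\<lambda>\<zeta>. f \<zeta> * cnj (g \<zeta>)) \<in> borel_measurable circle_measure" by measurable
  show "AE \<zeta> in circle_measure. norm (f \<zeta> * cnj (g \<zeta>)) \<le> norm ((cmod (f \<zeta>))\<^sup>2 + (cmod (g \<zeta>))\<^sup>2)"
  proof (rule AE_I2)
    fix \<zeta>
    have "2 * (cmod (f \<zeta>) * cmod (g \<zeta>)) \<le> (cmod (f \<zeta>))\<^sup>2 + (cmod (g \<zeta>))\<^sup>2"
      using sum_squares_bound[of "cmod (f \<zeta>)" "cmod (g \<zeta>)"] by (simp add: mult.assoc)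
    moreover have "0 \<le> cmod (f \<zeta>) * cmod (g \<zeta>)" by simp
    ultimately have "cmod (f \<zeta>) * cmod (g \<zeta>) \<le> (cmod (f \<zeta>))\<^sup>2 + (cmod (g \<zeta>))\<^sup>2" by linarith
    thus "norm (f \<zeta> * cnj (g \<zeta>)) \<le> norm ((cmod (f \<zeta>))\<^sup>2 + (cmod (g \<zeta>))\<^sup>2)" by (simp add: norm_mult)
  qed
qed

lemma L2_circle_monomial: "(\<lambda>\<zeta>. cnj \<zeta> ^ n) \<in> L2_circle"
proof (rule L2_circle_dominated[of "\<lambda>_. 1"])
  show "AE \<zeta> in circle_measure. (cmod (cnj \<zeta> ^ n))\<^sup>2 \<le> 1"
    using AE_circle_norm_1 by eventually_elim (simp add: norm_power)
qed auto

lemma integrable_L2_monomial: "f \<in> L2_circle \<Longrightarrow> integrable circle_measure (\<lambda>\<zeta>. f \<zeta> * \<zeta> ^ n)"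
  using integrable_L2_mult[OF _ L2_circle_monomial[of n], of f] by simp

lemma hinner_add_left: "f \<in> L2_circle \<Longrightarrow> g \<in> L2_circle \<Longrightarrow> h \<in> L2_circle \<Longrightarrow>
    hinner (\<lambda>\<zeta>. f \<zeta> + g \<zeta>) h = hinner f h + hinner g h"
  unfolding hinner_def distrib_right by (intro Bochner_Integration.integral_add integrable_L2_mult)

lemma hinner_add_right: "f \<in> L2_circle \<Longrightarrow> g \<in> L2_circle \<Longrightarrow> h \<in> L2_circle \<Longrightarrow>
    hinner h (\<lambda>\<zeta>. f \<zeta> + g \<zeta>) = hinner h f + hinner h g"
  unfolding hinner_def complex_cnj_add distrib_left by (intro Bochner_Integration.integral_add integrable_L2_mult)

lemma hinner_scale_left: "hinner (\<lambda>\<zeta>. c * f \<zeta>) h = c * hinner f h"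
  unfolding hinner_def mult.assoc by simp

lemma hinner_scale_right: "hinner h (\<lambda>\<zeta>. c * f \<zeta>) = cnj c * hinner h f"
  unfolding hinner_def by (simp add: mult.left_commute)

lemma hinner_commute: "hinner f g = cnj (hinner g f)"
proof -
  have "cnj (hinner g f) = (LINT \<zeta>|circle_measure. cnj (g \<zeta> * cnj (f \<zeta>)))"
    unfolding hinner_def by (rule Bochner_Integration.integral_cnj[symmetric])
  thus ?thesis by (simp add: hinner_def mult.commute)
qed

lemma hinner_cong_AE:
  assumes "f \<in> borel_measurable borel" "f' \<in> borel_measurable borel" "g \<in> borel_measurable borel" "g' \<in> borel_measurable borel"
    "AE \<zeta> in circle_measure. f \<zeta> = f' \<zeta>" "AE \<zeta> in circle_measure. g \<zeta> = g' \<zeta>"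
  shows "hinner f g = hinner f' g'"
  unfolding hinner_def
proof (rule integral_cong_AE)
  note [measurable] = assms(1-4)
  show "(\<lambda>\<zeta>. f \<zeta> * cnj (g \<zeta>)) \<in> borel_measurable circle_measure" "(\<lambda>\<zeta>. f' \<zeta> * cnj (g' \<zeta>)) \<in> borel_measurable circle_measure" by measurable
  show "AE \<zeta> in circle_measure. f \<zeta> * cnj (g \<zeta>) = f' \<zeta> * cnj (g' \<zeta>)" using assms(5,6) by eventually_elim simp
qed

lemma hinner_self: "hinner f f = of_real (LINT \<zeta>|circle_measure. (cmod (f \<zeta>))\<^sup>2)"
  unfolding hinner_def by (simp add: complex_norm_square[symmetric] flip: integral_complex_of_real)

subsection \<open>The Hardy space\<close>

lemma Hardy2_L2: "f \<in> Hardy2 \<Longrightarrow> f \<in> L2_circle"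
  by (simp add: Hardy2_def)

lemma Hardy2_measurable[measurable_dest]: "f \<in> Hardy2 \<Longrightarrow> f \<in> borel_measurable borel"
  by (simp add: Hardy2_L2 L2_circle_measurable)

lemma Hardy2_add: "f \<in> Hardy2 \<Longrightarrow> g \<in> Hardy2 \<Longrightarrow> (\<lambda>\<zeta>. f \<zeta> + g \<zeta>) \<in> Hardy2"
  by (auto simp: Hardy2_def L2_circle_add distrib_right integrable_L2_monomial)

lemma Hardy2_scale: "f \<in> Hardy2 \<Longrightarrow> (\<lambda>\<zeta>. c * f \<zeta>) \<in> Hardy2"
  by (auto simp: Hardy2_def L2_circle_scale mult.assoc)

lemma Hardy2_cong_AE:
  assumes f: "f \<in> Hardy2" and [measurable]: "g \<in> borel_measurable borel" and eq: "AE \<zeta> in circle_measure. f \<zeta> = g \<zeta>"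
  shows "g \<in> Hardy2"
  unfolding Hardy2_def
proof (intro CollectI conjI allI impI)
  note [measurable] = Hardy2_measurable[OF f]
  show "g \<in> L2_circle"
  proof (rule L2_circle_dominated)
    show "integrable circle_measure (\<lambda>\<zeta>. (cmod (f \<zeta>))\<^sup>2)" using Hardy2_L2[OF f] by (simp add: L2_circle_iff)
    show "AE \<zeta> in circle_measure. (cmod (g \<zeta>))\<^sup>2 \<le> (cmod (f \<zeta>))\<^sup>2" using eq by eventually_elim simp
  qed fact
  fix n :: nat assume n: "n \<ge> 1"
  have "(LINT \<zeta>|circle_measure. g \<zeta> * \<zeta> ^ n) = (LINT \<zeta>|circle_measure. f \<zeta> * \<zeta> ^ n)"
    by (rule integral_cong_AE) (use eq in \<open>auto elim: eventually_mono\<close>)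
  thus "(LINT \<zeta>|circle_measure. g \<zeta> * \<zeta> ^ n) = 0" using f n by (simp add: Hardy2_def)
qed

section \<open>Reproducing kernels and bounded multipliers\<close>

lemma measurable_K[measurable]: "K u \<in> borel_measurable borel"
  unfolding K_def by measurable

lemma K_bound: 
  assumes "cmod u < 1" "cmod \<zeta> = 1"
  shows "cmod (K u \<zeta>) \<le> 1 / (1 - cmod u)"
proof -
  have "1 - cmod u \<le> cmod (1 - cnj u * \<zeta>)" using norm_triangle_ineq2[of 1 "cnj u * \<zeta>"] assms by (simp add: norm_mult)
  hence "inverse (cmod (1 - cnj u * \<zeta>)) \<le> inverse (1 - cmod u)" using assms by (intro le_imp_inverse_le) auto
  thus ?thesis unfolding K_def norm_inverse by (simp add: inverse_eq_divide)
qed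

lemma AE_K_bound: "cmod u < 1 \<Longrightarrow> AE \<zeta> in circle_measure. cmod (K u \<zeta>) \<le> 1 / (1 - cmod u)"
  using AE_circle_norm_1 by eventually_elim (rule K_bound)

lemma K_L2: "cmod u < 1 \<Longrightarrow> K u \<in> L2_circle"
  using L2_circle_bounded_mult[OF L2_circle_const[of 1] measurable_K AE_K_bound, of u] by simp

text \<open>Termwise integration of the Taylor series of \<open>Q\<close>, legitimate because the
  dilation by \<open>r\<close> below 1 makes the coefficients absolutely summable with the common
  factor \<open>cmod (F \<zeta>)\<close>.\<close>

lemma integral_power_series_sums:
  assumes F: "integrable circle_measure F" and hol: "Q holomorphic_on ball 0 1" and r: "0 \<le> r" "r < 1"
    and [measurable]: "Q \<in> borel_measurable borel"
  shows "(\<lambda>j. ((deriv ^^ j) Q 0 / fact j) * of_real r ^ j * (LINT \<zeta>|circle_measure. F \<zeta> * \<zeta> ^ j)) sums (LINT \<zeta>|circle_measure. F \<zeta> * Q (of_real r * \<zeta>))"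
proof -
  define a where "a j = (deriv ^^ j) Q 0 / fact j" for j
  have [measurable]: "F \<in> borel_measurable borel" using borel_measurable_integrable[OF F] by simp
  have ps: "(\<lambda>j. a j * w ^ j) sums Q w" if "cmod w < 1" for w
    using holomorphic_power_series[OF hol, of w] that by (simp add: a_def)
  have sa: "summable (\<lambda>j. cmod (a j) * r ^ j)"
  proof -
    define s where "s = (1 + r) / 2"
    have s: "r < s" "s < 1" "0 < s" using r by (auto simp: s_def)
    have "summable (\<lambda>j. a j * of_real s ^ j)" using ps[of "of_real s"] s by (auto simp: sums_iff)
    hence "summable (\<lambda>j. norm (a j * of_real r ^ j))" by (rule powser_insidea) (use s r in auto)
    thus ?thesis using r by (simp add: norm_mult norm_power)
  qed
  define f where "f j \<zeta> = a j * of_real r ^ j * (F \<zeta> * \<zeta> ^ j)" for j \<zeta>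
  have nf: "AE \<zeta> in circle_measure. \<forall>j. norm (f j \<zeta>) = cmod (a j) * r ^ j * cmod (F \<zeta>)"
    using AE_circle_norm_1 by eventually_elim (use r in \<open>simp add: f_def norm_mult norm_power\<close>)
  have Fi: "integrable circle_measure (\<lambda>\<zeta>. F \<zeta> * \<zeta> ^ j)" for j
    by (rule Bochner_Integration.integrable_bound[OF F]) (use AE_circle_norm_1 in \<open>auto elim!: eventually_mono simp: norm_mult norm_power\<close>)
  have fi: "integrable circle_measure (f j)" for j unfolding f_def using Fi by (intro integrable_mult_right)
  have "(\<lambda>j. LINT \<zeta>|circle_measure. f j \<zeta>) sums (LINT \<zeta>|circle_measure. (\<Sum>j. f j \<zeta>))"
  proof (rule sums_integral[OF fi])
    show "AE \<zeta> in circle_measure. summable (\<lambda>j. norm (f j \<zeta>))"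
      using nf by eventually_elim (simp add: summable_mult2[OF sa])
    have "(LINT \<zeta>|circle_measure. norm (f j \<zeta>)) = cmod (a j) * r ^ j * (LINT \<zeta>|circle_measure. cmod (F \<zeta>))" for j
    proof -
      have "(LINT \<zeta>|circle_measure. norm (f j \<zeta>)) = (LINT \<zeta>|circle_measure. cmod (a j) * r ^ j * cmod (F \<zeta>))"
        by (rule integral_cong_AE) (use nf fi in \<open>auto elim: eventually_mono simp: f_def[abs_def]\<close>)
      thus ?thesis by simp
    qed
    thus "summable (\<lambda>j. LINT \<zeta>|circle_measure. norm (f j \<zeta>))" by (simp add: summable_mult2[OF sa])
  qed
  moreover have "(LINT \<zeta>|circle_measure. (\<Sum>j. f j \<zeta>)) = (LINT \<zeta>|circle_measure. F \<zeta> * Q (of_real r * \<zeta>))"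
  proof (rule integral_cong_AE)
    show "AE \<zeta> in circle_measure. (\<Sum>j. f j \<zeta>) = F \<zeta> * Q (of_real r * \<zeta>)"
      using AE_circle_norm_1
    proof eventually_elim
      case (elim \<zeta>)
      have "(\<lambda>j. F \<zeta> * (a j * (of_real r * \<zeta>) ^ j)) sums (F \<zeta> * Q (of_real r * \<zeta>))"
        using elim r by (intro sums_mult ps) (simp add: norm_mult)
      moreover have "(\<lambda>j. F \<zeta> * (a j * (of_real r * \<zeta>) ^ j)) = (\<lambda>j. f j \<zeta>)" by (simp add: f_def fun_eq_iff power_mult_distrib mult_ac)
      ultimately show ?case by (simp add: sums_iff)
    qed
  qed (use fi in \<open>auto simp: f_def[abs_def]\<close>)
  ultimately show ?thesis by (simp add: f_def a_def mult.assoc)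
qed

text \<open>On the circle \<open>\<zeta> * cnj (K v \<zeta>) = \<zeta> + v * cnj (K v
  \<zeta>)\<close>, and the first term on the right meets a vanishing Fourier coefficient of
  \<open>f\<close>; each power of \<zeta> thus turns into a factor \<open>v\<close>.\<close>

lemma Hardy2_K_monomial:
  assumes f: "f \<in> Hardy2" and v: "cmod v < 1"
  shows "(LINT \<zeta>|circle_measure. f \<zeta> * cnj (K v \<zeta>) * \<zeta> ^ n) = v ^ n * hinner f (K v)"
proof (induction n)
  case 0 thus ?case by (simp add: hinner_def)
next
  case (Suc n)
  note [measurable] = Hardy2_measurable[OF f]
  have fK: "(\<lambda>\<zeta>. f \<zeta> * cnj (K v \<zeta>)) \<in> L2_circle"
    using L2_circle_bounded_mult[OF Hardy2_L2[OF f], of "\<lambda>\<zeta>. cnj (K v \<zeta>)" "1 / (1 - cmod v)"] AE_K_bound[OF v] by (simp add: mult.commute)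
  have "(LINT \<zeta>|circle_measure. f \<zeta> * cnj (K v \<zeta>) * \<zeta> ^ Suc n) = (LINT \<zeta>|circle_measure. f \<zeta> * \<zeta> ^ Suc n + v * (f \<zeta> * cnj (K v \<zeta>) * \<zeta> ^ n))"
  proof (rule integral_cong_AE)
    show "AE \<zeta> in circle_measure. f \<zeta> * cnj (K v \<zeta>) * \<zeta> ^ Suc n = f \<zeta> * \<zeta> ^ Suc n + v * (f \<zeta> * cnj (K v \<zeta>) * \<zeta> ^ n)"
      using AE_circle_norm_1
    proof eventually_elim
      case (elim \<zeta>)
      have zz: "\<zeta> * cnj \<zeta> = 1" using elim by (simp add: complex_norm_square[symmetric])
      have "cmod (v * cnj \<zeta>) < 1" using v elim by (simp add: norm_mult)
      hence ne: "1 - v * cnj \<zeta> \<noteq> 0" by auto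
      have K: "cnj (K v \<zeta>) = 1 / (1 - v * cnj \<zeta>)" by (simp add: K_def inverse_eq_divide)
      have "\<zeta> * cnj (K v \<zeta>) = \<zeta> + v * cnj (K v \<zeta>)"
      proof -
        have "\<zeta> * (1 - v * cnj \<zeta>) + v = \<zeta> - v * (\<zeta> * cnj \<zeta>) + v" by (simp add: algebra_simps)
        hence "\<zeta> * (1 - v * cnj \<zeta>) + v = \<zeta>" by (simp add: zz)
        thus ?thesis unfolding K using ne by (simp add: field_simps)
      qed
      hence "f \<zeta> * (\<zeta> * cnj (K v \<zeta>)) * \<zeta> ^ n = f \<zeta> * (\<zeta> + v * cnj (K v \<zeta>)) * \<zeta> ^ n" by simp
      thus ?case by (simp add: algebra_simps)
    qed
  qed measurable
  also have "\<dots> = (LINT \<zeta>|circle_measure. f \<zeta> * \<zeta> ^ Suc n) + v * (LINT \<zeta>|circle_measure. f \<zeta> * cnj (K v \<zeta>) * \<zeta> ^ n)"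
    using integrable_L2_monomial[OF Hardy2_L2[OF f], of "Suc n"] integrable_L2_monomial[OF fK, of n]
    by (subst Bochner_Integration.integral_add) auto
  also have "(LINT \<zeta>|circle_measure. f \<zeta> * \<zeta> ^ Suc n) = 0" using f by (simp only: Hardy2_def) auto
  finally show ?case using Suc.IH by simp
qed

text \<open>The Taylor series of \<open>Q\<close> is inserted: against
  \<open>f \<zeta> * \<zeta> ^ n\<close> every term vanishes, against
  \<open>f \<zeta> * cnj (K v \<zeta>)\<close> the terms resum to the value of \<open>Q\<close> at
  the dilated point.\<close>

lemma Hardy2_dilation:
  assumes f: "f \<in> Hardy2" and hol: "Q holomorphic_on ball 0 1" and r: "0 \<le> r" "r < 1"
    and Q[measurable]: "Q \<in> borel_measurable borel"
  shows "n \<ge> 1 \<Longrightarrow> (LINT \<zeta>|circle_measure. f \<zeta> * Q (of_real r * \<zeta>) * \<zeta> ^ n) = 0"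
    and "cmod v < 1 \<Longrightarrow> (LINT \<zeta>|circle_measure. f \<zeta> * Q (of_real r * \<zeta>) * cnj (K v \<zeta>)) = Q (of_real r * v) * hinner f (K v)"
proof -
  assume n: "n \<ge> 1"
  have "(\<lambda>j. ((deriv ^^ j) Q 0 / fact j) * of_real r ^ j * (LINT \<zeta>|circle_measure. (f \<zeta> * \<zeta> ^ n) * \<zeta> ^ j)) sums (LINT \<zeta>|circle_measure. (f \<zeta> * \<zeta> ^ n) * Q (of_real r * \<zeta>))"
    by (intro integral_power_series_sums integrable_L2_monomial Hardy2_L2 f hol r Q)
  moreover have "(LINT \<zeta>|circle_measure. (f \<zeta> * \<zeta> ^ n) * \<zeta> ^ j) = 0" for j
  proof -
    have "(LINT \<zeta>|circle_measure. f \<zeta> * \<zeta> ^ (n + j)) = 0" using f n by (simp only: Hardy2_def) auto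
    thus ?thesis by (simp add: power_add mult.assoc)
  qed
  ultimately have "(LINT \<zeta>|circle_measure. (f \<zeta> * \<zeta> ^ n) * Q (of_real r * \<zeta>)) = 0" by (simp add: sums_iff)
  thus "(LINT \<zeta>|circle_measure. f \<zeta> * Q (of_real r * \<zeta>) * \<zeta> ^ n) = 0" by (simp add: mult_ac)
next
  assume v: "cmod v < 1"
  have fK: "integrable circle_measure (\<lambda>\<zeta>. f \<zeta> * cnj (K v \<zeta>))" by (intro integrable_L2_mult Hardy2_L2 f K_L2 v)
  have "(\<lambda>j. ((deriv ^^ j) Q 0 / fact j) * of_real r ^ j * (LINT \<zeta>|circle_measure. (f \<zeta> * cnj (K v \<zeta>)) * \<zeta> ^ j)) sums (LINT \<zeta>|circle_measure. (f \<zeta> * cnj (K v \<zeta>)) * Q (of_real r * \<zeta>))"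
    by (intro integral_power_series_sums fK hol r Q)
  hence "(\<lambda>j. ((deriv ^^ j) Q 0 / fact j) * (of_real r * v) ^ j * hinner f (K v)) sums (LINT \<zeta>|circle_measure. f \<zeta> * Q (of_real r * \<zeta>) * cnj (K v \<zeta>))"
    unfolding Hardy2_K_monomial[OF f v] by (simp add: power_mult_distrib mult_ac)
  moreover have "(\<lambda>j. ((deriv ^^ j) Q 0 / fact j) * (of_real r * v) ^ j * hinner f (K v)) sums (Q (of_real r * v) * hinner f (K v))"
  proof (rule sums_mult2)
    have "r * cmod v < 1 * 1" using r v by (intro mult_strict_mono') auto
    thus "(\<lambda>j. ((deriv ^^ j) Q 0 / fact j) * (of_real r * v) ^ j) sums Q (of_real r * v)"
      using holomorphic_power_series[OF hol, of "of_real r * v"] r by (simp add: norm_mult)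
  qed
  ultimately show "(LINT \<zeta>|circle_measure. f \<zeta> * Q (of_real r * \<zeta>) * cnj (K v \<zeta>)) = Q (of_real r * v) * hinner f (K v)"
    by (rule sums_unique2)
qed

text \<open>A bounded outer function is a multiplier, since its dilations converge boundedly to the
  boundary function. The second claim says that values in the disc multiply; values of Hardy
  functions appear as inner products with \<open>K v\<close>, so the functions themselves are never
  extended inside.\<close>

lemma Hardy2_outer_mult:
  assumes f: "f \<in> Hardy2" and k: "integrable circle_measure k" and C: "AE \<zeta> in circle_measure. k \<zeta> \<le> C"
  shows "(\<lambda>\<zeta>. radial_limit (outer k) \<zeta> * f \<zeta>) \<in> Hardy2"
    and "cmod v < 1 \<Longrightarrow> hinner (\<lambda>\<zeta>. radial_limit (outer k) \<zeta> * f \<zeta>) (K v) = outer k v * hinner f (K v)"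
proof -
  note [measurable] = measurable_radial_limit_outer[OF k] Hardy2_measurable[OF f]
  have [measurable]: "k \<in> borel_measurable borel" using borel_measurable_integrable[OF k] by simp
  have Qm[measurable]: "outer k \<in> borel_measurable borel" by (rule measurable_outer) measurable
  have hol: "outer k holomorphic_on ball 0 1" using holomorphic_on_outer[OF k] by (rule holomorphic_on_subset) auto
  define x where "x n = 1 - 1 / (real n + 2)" for n
  have x: "0 \<le> x n" "x n < 1" for n by (auto simp: x_def field_simps)
  have xl: "filterlim x (at_left 1) sequentially" unfolding x_def by real_asymp
  have xl1: "x \<longlonglongrightarrow> 1" unfolding x_def by real_asymp
  have lim: "(\<lambda>n. LINT \<zeta>|circle_measure. f \<zeta> * outer k (of_real (x n) * \<zeta>) * g \<zeta>) \<longlonglongrightarrow> (LINT \<zeta>|circle_measure. f \<zeta> * radial_limit (outer k) \<zeta> * g \<zeta>)"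
    if fg: "integrable circle_measure (\<lambda>\<zeta>. f \<zeta> * g \<zeta>)" and [measurable]: "g \<in> borel_measurable borel" for g
  proof (rule integral_dominated_convergence[where w="\<lambda>\<zeta>. exp (C / 2) * cmod (f \<zeta> * g \<zeta>)"])
    show "integrable circle_measure (\<lambda>\<zeta>. exp (C / 2) * cmod (f \<zeta> * g \<zeta>))" using fg by auto
    show "AE \<zeta> in circle_measure. (\<lambda>n. f \<zeta> * outer k (of_real (x n) * \<zeta>) * g \<zeta>) \<longlonglongrightarrow> f \<zeta> * radial_limit (outer k) \<zeta> * g \<zeta>"
      using AE_outer_radial_limit_upper[OF k C]
    proof eventually_elim
      case (elim \<zeta>)
      hence "(\<lambda>n. outer k (of_real (x n) * \<zeta>)) \<longlonglongrightarrow> radial_limit (outer k) \<zeta>" by (auto intro: filterlim_compose[OF _ xl])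
      thus ?case by (intro tendsto_intros)
    qed
    show "AE \<zeta> in circle_measure. norm (f \<zeta> * outer k (of_real (x n) * \<zeta>) * g \<zeta>) \<le> exp (C / 2) * cmod (f \<zeta> * g \<zeta>)" for n
      using AE_circle_norm_1
    proof eventually_elim
      case (elim \<zeta>)
      have "cmod (outer k (of_real (x n) * \<zeta>)) \<le> exp (C / 2)" using x[of n] elim by (intro norm_outer_le[OF k C]) (simp add: norm_mult)
      hence "cmod (outer k (of_real (x n) * \<zeta>)) * cmod (f \<zeta> * g \<zeta>) \<le> exp (C / 2) * cmod (f \<zeta> * g \<zeta>)" by (intro mult_right_mono) auto
      thus ?case by (simp add: norm_mult mult_ac)
    qed
  qed measurable
  have bound: "AE \<zeta> in circle_measure. cmod (radial_limit (outer k) \<zeta>) \<le> exp (C / 2)"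
    using AE_outer_radial_limit_upper[OF k C] C
  proof eventually_elim
    case (elim \<zeta>)
    hence "(cmod (radial_limit (outer k) \<zeta>))\<^sup>2 \<le> exp C" by simp
    also have "exp C = (exp (C / 2))\<^sup>2" by (simp add: power2_eq_square exp_add[symmetric])
    finally show ?case by (rule power2_le_imp_le) simp
  qed
  show "(\<lambda>\<zeta>. radial_limit (outer k) \<zeta> * f \<zeta>) \<in> Hardy2"
    unfolding Hardy2_def
  proof (intro CollectI conjI allI impI)
    show "(\<lambda>\<zeta>. radial_limit (outer k) \<zeta> * f \<zeta>) \<in> L2_circle"
      by (rule L2_circle_bounded_mult[OF Hardy2_L2[OF f] _ bound]) measurable
    fix n :: nat assume n: "n \<ge> 1"
    have "(\<lambda>i. 0) \<longlonglongrightarrow> (LINT \<zeta>|circle_measure. f \<zeta> * radial_limit (outer k) \<zeta> * \<zeta> ^ n)"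
      using lim[of "\<lambda>\<zeta>. \<zeta> ^ n"] integrable_L2_monomial[OF Hardy2_L2[OF f], of n] Hardy2_dilation(1)[OF f hol x Qm n] by simp
    hence "(LINT \<zeta>|circle_measure. f \<zeta> * radial_limit (outer k) \<zeta> * \<zeta> ^ n) = 0" by (simp add: LIMSEQ_const_iff)
    thus "(LINT \<zeta>|circle_measure. radial_limit (outer k) \<zeta> * f \<zeta> * \<zeta> ^ n) = 0" by (simp add: mult.commute)
  qed
  assume v: "cmod v < 1"
  have "(\<lambda>n. outer k (of_real (x n) * v) * hinner f (K v)) \<longlonglongrightarrow> (LINT \<zeta>|circle_measure. f \<zeta> * radial_limit (outer k) \<zeta> * cnj (K v \<zeta>))"
    using lim[of "\<lambda>\<zeta>. cnj (K v \<zeta>)"] integrable_L2_mult[OF Hardy2_L2[OF f] K_L2[OF v]] Hardy2_dilation(2)[OF f hol x Qm v] by simp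
  moreover have "(\<lambda>n. outer k (of_real (x n) * v) * hinner f (K v)) \<longlonglongrightarrow> outer k v * hinner f (K v)"
  proof (intro tendsto_mult tendsto_const)
    have "isCont (outer k) v"
      using holomorphic_on_imp_continuous_on[OF hol] v by (auto simp: continuous_on_eq_continuous_at)
    moreover have "(\<lambda>n. of_real (x n) * v) \<longlonglongrightarrow> of_real 1 * v" using xl1 by (intro tendsto_intros)
    ultimately show "(\<lambda>n. outer k (of_real (x n) * v)) \<longlonglongrightarrow> outer k v"
      using isCont_tendsto_compose[of v "outer k" "\<lambda>n. of_real (x n) * v" sequentially] by simp
  qed
  ultimately show "hinner (\<lambda>\<zeta>. radial_limit (outer k) \<zeta> * f \<zeta>) (K v) = outer k v * hinner f (K v)"
    unfolding hinner_def by (metis (no_types, lifting) LIMSEQ_unique mult.commute Bochner_Integration.integral_cong)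
qed

lemma integral_holomorphic_circle:
  assumes "f \<in> borel_measurable borel" "f holomorphic_on ball 0 R" "1 < R"
  shows "(LINT \<zeta>|circle_measure. f \<zeta>) = f 0"
proof -
  have "H 0 = 1" by (simp add: H_def)
  thus ?thesis using poisson_formula[OF assms, of 0] by simp
qed

lemma one_Hardy2: "(\<lambda>_. 1) \<in> Hardy2"
  unfolding Hardy2_def
proof (intro CollectI conjI allI impI L2_circle_const)
  fix n :: nat assume n: "n \<ge> 1"
  show "(LINT \<zeta>|circle_measure. 1 * \<zeta> ^ n) = 0"
  proof -
    have "(\<lambda>\<zeta>::complex. \<zeta> ^ n) holomorphic_on ball 0 2" by (intro holomorphic_intros)
    from integral_holomorphic_circle[OF _ this] n show ?thesis by (simp add: power_0_left)
  qed
qed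

lemma K_holomorphic:
  assumes "cmod u < 1"
  shows "\<exists>R>1. (\<lambda>z::complex. inverse (1 - cnj u * z)) holomorphic_on ball 0 R"
proof (intro exI conjI)
  let ?R = "if u = 0 then 2 else 1 / cmod u"
  show "?R > 1" using assms by simp
  show "(\<lambda>z::complex. inverse (1 - cnj u * z)) holomorphic_on ball 0 ?R"
  proof (intro holomorphic_intros)
    fix z :: complex assume z: "z \<in> ball 0 ?R"
    have "cmod (cnj u * z) < 1" using z by (cases "u = 0") (auto simp: norm_mult field_simps)
    thus "1 - cnj u * z \<noteq> 0" by auto
  qed
qed

lemma hinner_one_K: 
  assumes "cmod v < 1"
  shows "hinner (\<lambda>_. 1) (K v) = 1"
proof -
  obtain R where R: "R > 1" "(\<lambda>z. inverse (1 - cnj v * z)) holomorphic_on ball 0 R" using K_holomorphic[OF assms] by blast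
  have "(LINT \<zeta>|circle_measure. inverse (1 - cnj v * \<zeta>)) = inverse (1 - cnj v * 0)"
    by (rule integral_holomorphic_circle[OF _ R(2,1)]) measurable
  hence "hinner (K v) (\<lambda>_. 1) = 1" by (simp add: hinner_def K_def)
  thus ?thesis using hinner_commute[of "\<lambda>_. 1" "K v"] by simp
qed

text \<open>\<open>K u\<close> is the dilation, by some \<open>r\<close> between
  \<open>cmod u\<close> and 1, of a kernel \<open>Q\<close> still holomorphic in the disc, so
  everything follows from the dilation lemma applied to the constant 1.\<close>

lemma K_Hardy2: "cmod u < 1 \<Longrightarrow> K u \<in> Hardy2"
  and hinner_K_K: "cmod u < 1 \<Longrightarrow> cmod v < 1 \<Longrightarrow> hinner (K u) (K v) = K u v"
proof -
  assume u: "cmod u < 1"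
  define r where "r = (1 + cmod u) / 2"
  have r: "cmod u < r" "r < 1" "0 < r" using u by (auto simp: r_def intro: add_pos_nonneg)
  define Q where "Q w = inverse (1 - (cnj u / of_real r) * w)" for w
  have hol: "Q holomorphic_on ball 0 1" unfolding Q_def
  proof (intro holomorphic_intros)
    fix z assume z: "z \<in> ball (0::complex) 1"
    have "cmod (cnj u / of_real r * z) \<le> 1 * cmod z" unfolding norm_mult norm_divide using r by (intro mult_right_mono) auto
    also have "\<dots> < 1" using z by simp
    finally show "1 - cnj u / of_real r * z \<noteq> 0" by auto
  qed
  have Qm: "Q \<in> borel_measurable borel" unfolding Q_def by measurable
  have QK: "Q (of_real r * z) = K u z" for z unfolding Q_def K_def using r by simp
  show "K u \<in> Hardy2" unfolding Hardy2_def
    using Hardy2_dilation(1)[OF one_Hardy2 hol _ r(2) Qm] r K_L2[OF u] by (simp add: QK)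
  assume v: "cmod v < 1"
  show "hinner (K u) (K v) = K u v"
    using Hardy2_dilation(2)[OF one_Hardy2 hol _ r(2) Qm v] r hinner_one_K[OF v] by (simp add: QK hinner_def)
qed

section \<open>The logarithm of the shifted symbol\<close>

lemma outer_F_eq_outer: "outer_F \<omega> \<mu> = outer (\<lambda>\<zeta>. ln (\<omega> \<zeta> - \<mu>))"
  by (simp add: outer_F_def outer_def fun_eq_iff)

lemma AE_ess_inf_le: "AE x in M. ess_inf M f \<le> f x"
proof -
  have "AE x in M. - f x \<le> esssup M (\<lambda>x. - f x)" by (rule esssup_AE)
  thus ?thesis by eventually_elim (simp add: ess_inf_def ereal_uminus_le_reorder)
qed

lemma ess_inf_gap:
  assumes "ereal \<mu> < ess_inf M (\<lambda>x. ereal (\<omega> x))"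
  obtains \<delta> where "\<delta> > 0" "AE x in M. \<mu> + \<delta> \<le> \<omega> x"
proof -
  obtain c where c: "ereal \<mu> < c" "c < ess_inf M (\<lambda>x. ereal (\<omega> x))" using dense[OF assms] by blast
  then obtain c' where c': "c = ereal c'" by (cases c) auto
  show ?thesis
  proof (rule that)
    show "c' - \<mu> > 0" using c c' by simp
    show "AE x in M. \<mu> + (c' - \<mu>) \<le> \<omega> x"
      using AE_ess_inf_le[of M "\<lambda>x. ereal (\<omega> x)"]
    proof eventually_elim
      case (elim x)
      hence "c < ereal (\<omega> x)" using c by simp
      thus ?case using c' by simp
    qed
  qed
qed

text \<open>The logarithm is bounded below by \<open>ln \<delta>\<close> and above by its argument,
  so integrability of \<omega> is enough.\<close>

lemma integrable_ln_shift:
  fixes \<omega> :: "'a \<Rightarrow> real"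
  assumes M: "finite_measure M" and w: "integrable M \<omega>" and d: "\<delta> > 0" "AE x in M. \<mu> + \<delta> \<le> \<omega> x"
  shows "integrable M (\<lambda>x. ln (\<omega> x - \<mu>))" "AE x in M. ln \<delta> \<le> ln (\<omega> x - \<mu>)"
proof -
  interpret finite_measure M by fact
  show lo: "AE x in M. ln \<delta> \<le> ln (\<omega> x - \<mu>)" using d(2) by eventually_elim (use d(1) in auto)
  show "integrable M (\<lambda>x. ln (\<omega> x - \<mu>))"
  proof (rule Bochner_Integration.integrable_bound)
    show "integrable M (\<lambda>x. \<bar>ln \<delta>\<bar> + \<bar>\<omega> x\<bar> + \<bar>\<mu>\<bar>)" using w by auto
    show "AE x in M. norm (ln (\<omega> x - \<mu>)) \<le> norm (\<bar>ln \<delta>\<bar> + \<bar>\<omega> x\<bar> + \<bar>\<mu>\<bar>)"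
      using lo d(2)
    proof eventually_elim
      case (elim x)
      have "ln (\<omega> x - \<mu>) \<le> \<omega> x - \<mu>" using elim d ln_le_minus_one[of "\<omega> x - \<mu>"] by auto
      thus ?case using elim by auto
    qed
  qed (use w in measurable)
qed

section \<open>The Toeplitz form, its domain and its graph\<close>

locale toeplitz =
  fixes \<omega> :: "complex \<Rightarrow> real"
  assumes \<omega>_int: "integrable circle_measure \<omega>"
begin

lemma \<omega>_measurable[measurable]: "\<omega> \<in> borel_measurable borel"
  using borel_measurable_integrable[OF \<omega>_int] by simp

abbreviation \<gamma> :: ereal where "\<gamma> \<equiv> ess_inf circle_measure (\<lambda>\<zeta>. ereal (\<omega> \<zeta>))"

definition bdry :: "real \<Rightarrow> complex \<Rightarrow> complex" where
  "bdry \<mu> = radial_limit (outer_F \<omega> \<mu>)"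

text \<open>The boundary function of \<open>1 / F\<close>, introduced through the opposite
  logarithm: for \<open>\<mu>\<close> below the essential infimum that logarithm is bounded above,
  so the multiplier lemma applies directly.\<close>

definition inv_bdry :: "real \<Rightarrow> complex \<Rightarrow> complex" where
  "inv_bdry \<mu> = radial_limit (outer (\<lambda>\<zeta>. - ln (\<omega> \<zeta> - \<mu>)))"

lemma ln_int: "ereal \<mu> < \<gamma> \<Longrightarrow> integrable circle_measure (\<lambda>\<zeta>. ln (\<omega> \<zeta> - \<mu>))"
  by (elim ess_inf_gap) (rule integrable_ln_shift[OF _ \<omega>_int], unfold_locales)

lemma ln_lower: "ereal \<mu> < \<gamma> \<Longrightarrow> \<exists>C. AE \<zeta> in circle_measure. C \<le> ln (\<omega> \<zeta> - \<mu>)"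
  by (elim ess_inf_gap) (use integrable_ln_shift(2)[OF circle.finite_measure_axioms \<omega>_int] in blast)

lemma AE_gt: "ereal \<mu> < \<gamma> \<Longrightarrow> AE \<zeta> in circle_measure. \<mu> < \<omega> \<zeta>"
  by (elim ess_inf_gap) (auto elim!: eventually_mono)

lemma bdry_measurable: "ereal \<mu> < \<gamma> \<Longrightarrow> bdry \<mu> \<in> borel_measurable borel"
  unfolding bdry_def outer_F_eq_outer by (intro measurable_radial_limit_outer ln_int)

lemma inv_bdry_measurable: "ereal \<mu> < \<gamma> \<Longrightarrow> inv_bdry \<mu> \<in> borel_measurable borel"
  unfolding inv_bdry_def using ln_int by (intro measurable_radial_limit_outer) simp

lemma AE_bdry:
  assumes \<mu>: "ereal \<mu> < \<gamma>"
  shows "AE \<zeta> in circle_measure. ((\<lambda>r. outer_F \<omega> \<mu> (of_real r * \<zeta>)) \<longlongrightarrow> bdry \<mu> \<zeta>) (at_left 1) \<and>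
     of_real (\<omega> \<zeta> - \<mu>) = bdry \<mu> \<zeta> * cnj (bdry \<mu> \<zeta>) \<and> inv_bdry \<mu> \<zeta> * bdry \<mu> \<zeta> = 1"
proof -
  obtain C where "AE \<zeta> in circle_measure. C \<le> ln (\<omega> \<zeta> - \<mu>)" using ln_lower[OF \<mu>] by blast
  from AE_outer_radial_limit_lower[OF ln_int[OF \<mu>] this] AE_gt[OF \<mu>] show ?thesis
  proof eventually_elim
    case (elim \<zeta>)
    hence b: "((\<lambda>r. outer_F \<omega> \<mu> (of_real r * \<zeta>)) \<longlongrightarrow> bdry \<mu> \<zeta>) (at_left 1)" "(cmod (bdry \<mu> \<zeta>))\<^sup>2 = \<omega> \<zeta> - \<mu>"
      by (simp_all add: bdry_def outer_F_eq_outer)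
    have b0: "bdry \<mu> \<zeta> \<noteq> 0" using b(2) elim by auto
    have "((\<lambda>r. outer (\<lambda>\<zeta>. - ln (\<omega> \<zeta> - \<mu>)) (of_real r * \<zeta>)) \<longlongrightarrow> inverse (bdry \<mu> \<zeta>)) (at_left 1)"
      using tendsto_inverse[OF b(1) b0] by (simp add: outer_uminus outer_F_eq_outer)
    hence "inv_bdry \<mu> \<zeta> = inverse (bdry \<mu> \<zeta>)" unfolding inv_bdry_def by (rule radial_limitI)
    thus ?case using b b0 complex_norm_square[of "bdry \<mu> \<zeta>"] by simp
  qed
qed

lemma form_dom_iff: "f \<in> form_dom \<omega> \<longleftrightarrow> f \<in> Hardy2 \<and> (\<forall>\<mu>. ereal \<mu> < \<gamma> \<longrightarrow> (\<lambda>\<zeta>. bdry \<mu> \<zeta> * f \<zeta>) \<in> Hardy2)"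
  by (simp add: form_dom_def bdry_def)

lemma form_dom_add: "f \<in> form_dom \<omega> \<Longrightarrow> g \<in> form_dom \<omega> \<Longrightarrow> (\<lambda>\<zeta>. f \<zeta> + g \<zeta>) \<in> form_dom \<omega>"
  unfolding form_dom_iff distrib_left by (auto intro: Hardy2_add)

lemma form_dom_scale: "f \<in> form_dom \<omega> \<Longrightarrow> (\<lambda>\<zeta>. c * f \<zeta>) \<in> form_dom \<omega>"
  unfolding form_dom_iff mult.left_commute[of _ c] by (auto intro: Hardy2_scale)

text \<open>This is the factorization of \<omega> - \<mu> as the squared modulus of the boundary
  function. It also shows that the integral defining the form converges on the form domain.\<close>

lemma form_eq:
  assumes f: "f \<in> form_dom \<omega>" and g: "g \<in> form_dom \<omega>" and \<mu>: "ereal \<mu> < \<gamma>"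
  shows "toeplitz_form \<omega> f g = hinner (\<lambda>\<zeta>. bdry \<mu> \<zeta> * f \<zeta>) (\<lambda>\<zeta>. bdry \<mu> \<zeta> * g \<zeta>) + \<mu> * hinner f g"
proof -
  have fH: "f \<in> Hardy2" "(\<lambda>\<zeta>. bdry \<mu> \<zeta> * f \<zeta>) \<in> Hardy2" "g \<in> Hardy2" "(\<lambda>\<zeta>. bdry \<mu> \<zeta> * g \<zeta>) \<in> Hardy2"
    using f g \<mu> by (auto simp: form_dom_iff)
  note [measurable] = Hardy2_measurable[OF fH(1)] Hardy2_measurable[OF fH(3)] bdry_measurable[OF \<mu>]
  have "toeplitz_form \<omega> f g = (LINT \<zeta>|circle_measure. (bdry \<mu> \<zeta> * f \<zeta>) * cnj (bdry \<mu> \<zeta> * g \<zeta>) + \<mu> * (f \<zeta> * cnj (g \<zeta>)))"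
    unfolding toeplitz_form_def
  proof (rule integral_cong_AE)
    show "AE \<zeta> in circle_measure. of_real (\<omega> \<zeta>) * f \<zeta> * cnj (g \<zeta>) = (bdry \<mu> \<zeta> * f \<zeta>) * cnj (bdry \<mu> \<zeta> * g \<zeta>) + \<mu> * (f \<zeta> * cnj (g \<zeta>))"
      using AE_bdry[OF \<mu>]
    proof eventually_elim
      case (elim \<zeta>)
      have "of_real (\<omega> \<zeta>) = bdry \<mu> \<zeta> * cnj (bdry \<mu> \<zeta>) + of_real \<mu>" using elim by (metis of_real_add diff_add_cancel)
      thus ?case by (simp add: algebra_simps)
    qed
  qed measurable
  also have "\<dots> = hinner (\<lambda>\<zeta>. bdry \<mu> \<zeta> * f \<zeta>) (\<lambda>\<zeta>. bdry \<mu> \<zeta> * g \<zeta>) + \<mu> * hinner f g"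
    unfolding hinner_def
    by (subst Bochner_Integration.integral_add) (use integrable_L2_mult[OF fH(2,4)[THEN Hardy2_L2]] integrable_L2_mult[OF fH(1,3)[THEN Hardy2_L2]] in auto)
  finally show ?thesis .
qed

lemma toeplitz_graphD:
  assumes "toeplitz_graph \<omega> f h"
  shows "f \<in> form_dom \<omega>" "f \<in> Hardy2" "h \<in> Hardy2" "\<And>g. g \<in> form_dom \<omega> \<Longrightarrow> hinner h g = toeplitz_form \<omega> f g"
  using assms by (auto simp: toeplitz_graph_def form_dom_iff)

end

locale semibounded_toeplitz = toeplitz +
  assumes \<gamma>_gt: "\<gamma> > -\<infinity>"
begin

lemma ex_below: "\<exists>\<mu>::real. ereal \<mu> < \<gamma>"
  using \<gamma>_gt ereal_dense2[of "-\<infinity>" \<gamma>] by auto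

lemma form_hermitian:
  assumes f: "f \<in> form_dom \<omega>" and g: "g \<in> form_dom \<omega>"
  shows "toeplitz_form \<omega> f g = cnj (toeplitz_form \<omega> g f)"
proof -
  obtain \<mu> :: real where \<mu>: "ereal \<mu> < \<gamma>" using ex_below by blast
  show ?thesis unfolding form_eq[OF f g \<mu>] form_eq[OF g f \<mu>]
    by (simp flip: hinner_commute)
qed

lemma form_add_left:
  assumes f: "f \<in> form_dom \<omega>" and g: "g \<in> form_dom \<omega>" and k: "k \<in> form_dom \<omega>"
  shows "toeplitz_form \<omega> (\<lambda>\<zeta>. f \<zeta> + c * g \<zeta>) k = toeplitz_form \<omega> f k + c * toeplitz_form \<omega> g k"
proof -
  obtain \<mu> :: real where \<mu>: "ereal \<mu> < \<gamma>" using ex_below by blast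
  have L: "f \<in> L2_circle" "g \<in> L2_circle" "k \<in> L2_circle" "(\<lambda>\<zeta>. bdry \<mu> \<zeta> * f \<zeta>) \<in> L2_circle" "(\<lambda>\<zeta>. bdry \<mu> \<zeta> * g \<zeta>) \<in> L2_circle" "(\<lambda>\<zeta>. bdry \<mu> \<zeta> * k \<zeta>) \<in> L2_circle"
    using f g k \<mu> by (auto simp: form_dom_iff intro: Hardy2_L2)
  have fg: "(\<lambda>\<zeta>. f \<zeta> + c * g \<zeta>) \<in> form_dom \<omega>" by (intro form_dom_add form_dom_scale f g)
  have e: "(\<lambda>\<zeta>. bdry \<mu> \<zeta> * (f \<zeta> + c * g \<zeta>)) = (\<lambda>\<zeta>. bdry \<mu> \<zeta> * f \<zeta> + c * (bdry \<mu> \<zeta> * g \<zeta>))" by (simp add: algebra_simps)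
  have 1: "hinner (\<lambda>\<zeta>. bdry \<mu> \<zeta> * (f \<zeta> + c * g \<zeta>)) (\<lambda>\<zeta>. bdry \<mu> \<zeta> * k \<zeta>)
      = hinner (\<lambda>\<zeta>. bdry \<mu> \<zeta> * f \<zeta>) (\<lambda>\<zeta>. bdry \<mu> \<zeta> * k \<zeta>) + c * hinner (\<lambda>\<zeta>. bdry \<mu> \<zeta> * g \<zeta>) (\<lambda>\<zeta>. bdry \<mu> \<zeta> * k \<zeta>)"
    unfolding e by (simp add: hinner_add_left hinner_scale_left L L2_circle_scale)
  have 2: "hinner (\<lambda>\<zeta>. f \<zeta> + c * g \<zeta>) k = hinner f k + c * hinner g k"
    by (simp add: hinner_add_left hinner_scale_left L L2_circle_scale)
  show ?thesis unfolding form_eq[OF fg k \<mu>] form_eq[OF f k \<mu>] form_eq[OF g k \<mu>] 1 2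
    by (simp add: distrib_left mult.left_commute)
qed

lemma toeplitz_graph_add:
  assumes 1: "toeplitz_graph \<omega> f1 h1" and 2: "toeplitz_graph \<omega> f2 h2"
  shows "toeplitz_graph \<omega> (\<lambda>\<zeta>. f1 \<zeta> + c * f2 \<zeta>) (\<lambda>\<zeta>. h1 \<zeta> + c * h2 \<zeta>)"
  unfolding toeplitz_graph_def
proof (intro conjI ballI)
  note d1 = toeplitz_graphD[OF 1] and d2 = toeplitz_graphD[OF 2]
  show "(\<lambda>\<zeta>. f1 \<zeta> + c * f2 \<zeta>) \<in> form_dom \<omega>" by (intro form_dom_add form_dom_scale d1 d2)
  show "(\<lambda>\<zeta>. h1 \<zeta> + c * h2 \<zeta>) \<in> Hardy2" by (intro Hardy2_add Hardy2_scale d1 d2)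
  fix g assume g: "g \<in> form_dom \<omega>"
  hence "g \<in> L2_circle" by (auto simp: form_dom_iff intro: Hardy2_L2)
  thus "toeplitz_form \<omega> (\<lambda>\<zeta>. f1 \<zeta> + c * f2 \<zeta>) g = hinner (\<lambda>\<zeta>. h1 \<zeta> + c * h2 \<zeta>) g"
    using d1(4)[OF g] d2(4)[OF g] d1(3) d2(3)
    by (simp add: form_add_left d1(1) d2(1) g hinner_add_left hinner_scale_left L2_circle_scale Hardy2_L2)
qed

lemma toeplitz_graph_symmetric:
  assumes "toeplitz_graph \<omega> f1 h1" "toeplitz_graph \<omega> f2 h2"
  shows "hinner h1 f2 = hinner f1 h2"
  using toeplitz_graphD[OF assms(1)] toeplitz_graphD[OF assms(2)] form_hermitian[of f1 f2] hinner_commute[of f1 h2] by simp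

lemma toeplitz_graph_bounded_below:
  assumes f: "toeplitz_graph \<omega> f h" and \<mu>: "ereal \<mu> < \<gamma>"
  shows "\<mu> * Re (hinner f f) \<le> Re (hinner h f)"
proof -
  note d = toeplitz_graphD[OF f]
  have "hinner h f = hinner (\<lambda>\<zeta>. bdry \<mu> \<zeta> * f \<zeta>) (\<lambda>\<zeta>. bdry \<mu> \<zeta> * f \<zeta>) + \<mu> * hinner f f"
    using d(4)[OF d(1)] form_eq[OF d(1) d(1) \<mu>] by simp
  moreover have "Re (hinner (\<lambda>\<zeta>. bdry \<mu> \<zeta> * f \<zeta>) (\<lambda>\<zeta>. bdry \<mu> \<zeta> * f \<zeta>)) \<ge> 0" unfolding hinner_self by simp
  ultimately show ?thesis by simp
qed

subsection \<open>The resolvent on the reproducing kernels\<close>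

text \<open>Formally \<open>T - \<mu>\<close> is multiplication by \<open>F\<close> followed by its
  adjoint. For the inverse, the adjoint of multiplication by \<open>1 / F\<close> comes first and
  sends \<open>K u\<close> to \<open>cnj (1 / F u)\<close> times \<open>K u\<close>; then
  multiplication by \<open>1 / F\<close> remains.\<close>

definition resolvent_K :: "real \<Rightarrow> complex \<Rightarrow> complex \<Rightarrow> complex" where
  "resolvent_K \<mu> u \<zeta> = cnj (inverse (outer_F \<omega> \<mu> u)) * (inv_bdry \<mu> \<zeta> * K u \<zeta>)"

text \<open>The form domain demands that the boundary function for every admissible
  \<open>\<nu>\<close> multiplies into the Hardy space, while the resolvent divides by the one for
  \<open>\<mu>\<close>. The quotient of the two is again outer and bounded, as
  \<open>(\<omega> \<zeta> - \<nu>) / (\<omega> \<zeta> - \<mu>)\<close> is bounded above.\<close>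

lemma bdry_inv_bdry_bounded:
  assumes \<mu>: "ereal \<mu> < \<gamma>" and \<nu>: "ereal \<nu> < \<gamma>" and f: "f \<in> Hardy2"
  shows "(\<lambda>\<zeta>. bdry \<nu> \<zeta> * (inv_bdry \<mu> \<zeta> * f \<zeta>)) \<in> Hardy2"
proof -
  note [measurable] = Hardy2_measurable[OF f] bdry_measurable[OF \<nu>] inv_bdry_measurable[OF \<mu>]
  define k where "k \<zeta> = ln (\<omega> \<zeta> - \<nu>) + - ln (\<omega> \<zeta> - \<mu>)" for \<zeta>
  have ki: "integrable circle_measure k" unfolding k_def using ln_int[OF \<mu>] ln_int[OF \<nu>] by auto
  obtain \<delta> where d: "\<delta> > 0" "AE \<zeta> in circle_measure. \<mu> + \<delta> \<le> \<omega> \<zeta>" using ess_inf_gap[OF \<mu>] by blast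
  have kC: "AE \<zeta> in circle_measure. k \<zeta> \<le> \<bar>\<mu> - \<nu>\<bar> / \<delta>"
    using d(2) AE_gt[OF \<nu>]
  proof eventually_elim
    case (elim \<zeta>)
    have p: "\<omega> \<zeta> - \<mu> \<ge> \<delta>" "\<omega> \<zeta> - \<nu> > 0" using elim by auto
    have "k \<zeta> = ln ((\<omega> \<zeta> - \<nu>) / (\<omega> \<zeta> - \<mu>))" unfolding k_def using p d(1) by (subst ln_div) auto
    also have "\<dots> \<le> (\<omega> \<zeta> - \<nu>) / (\<omega> \<zeta> - \<mu>) - 1" using p d(1) by (intro ln_le_minus_one) auto
    also have "\<dots> = (\<mu> - \<nu>) / (\<omega> \<zeta> - \<mu>)" using p d(1) by (simp add: field_simps)
    also have "\<dots> \<le> \<bar>\<mu> - \<nu>\<bar> / \<delta>" using p d(1) by (intro frac_le) auto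
    finally show ?case .
  qed
  have ok: "outer k z = outer_F \<omega> \<nu> z * inverse (outer_F \<omega> \<mu> z)" if "cmod z \<noteq> 1" for z
  proof -
    have "outer k z = outer (\<lambda>\<zeta>. ln (\<omega> \<zeta> - \<nu>)) z * outer (\<lambda>\<zeta>. - ln (\<omega> \<zeta> - \<mu>)) z"
      unfolding k_def using ln_int[OF \<mu>] ln_int[OF \<nu>] that by (intro outer_add) auto
    thus ?thesis by (simp add: outer_uminus outer_F_eq_outer)
  qed
  have "AE \<zeta> in circle_measure. radial_limit (outer k) \<zeta> * f \<zeta> = bdry \<nu> \<zeta> * (inv_bdry \<mu> \<zeta> * f \<zeta>)"
    using AE_bdry[OF \<mu>] AE_bdry[OF \<nu>] AE_circle_norm_1
  proof eventually_elim
    case (elim \<zeta>)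
    have b0: "bdry \<mu> \<zeta> \<noteq> 0" using elim by auto
    have ib: "inv_bdry \<mu> \<zeta> = inverse (bdry \<mu> \<zeta>)" using elim b0 by (simp add: field_simps)
    have "((\<lambda>r. outer_F \<omega> \<nu> (of_real r * \<zeta>) * inverse (outer_F \<omega> \<mu> (of_real r * \<zeta>))) \<longlongrightarrow> bdry \<nu> \<zeta> * inverse (bdry \<mu> \<zeta>)) (at_left 1)"
      using elim b0 by (intro tendsto_intros) auto
    moreover have "\<forall>\<^sub>F r in at_left 1. outer_F \<omega> \<nu> (of_real r * \<zeta>) * inverse (outer_F \<omega> \<mu> (of_real r * \<zeta>)) = outer k (of_real r * \<zeta>)"
      unfolding eventually_at_left_field by (intro exI[of _ 0]) (use elim in \<open>auto simp: ok norm_mult\<close>)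
    ultimately have "((\<lambda>r. outer k (of_real r * \<zeta>)) \<longlongrightarrow> bdry \<nu> \<zeta> * inverse (bdry \<mu> \<zeta>)) (at_left 1)"
      by (rule Lim_transform_eventually)
    thus ?case by (simp add: radial_limitI ib)
  qed
  thus ?thesis by (intro Hardy2_cong_AE[OF Hardy2_outer_mult(1)[OF f ki kC]]) measurable
qed

lemma inv_bdry_mult:
  assumes \<mu>: "ereal \<mu> < \<gamma>" and f: "f \<in> Hardy2"
  shows "(\<lambda>\<zeta>. inv_bdry \<mu> \<zeta> * f \<zeta>) \<in> Hardy2"
    and "cmod v < 1 \<Longrightarrow> hinner (\<lambda>\<zeta>. inv_bdry \<mu> \<zeta> * f \<zeta>) (K v) = inverse (outer_F \<omega> \<mu> v) * hinner f (K v)"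
proof -
  obtain C where "AE \<zeta> in circle_measure. C \<le> ln (\<omega> \<zeta> - \<mu>)" using ln_lower[OF \<mu>] by blast
  hence C: "AE \<zeta> in circle_measure. - ln (\<omega> \<zeta> - \<mu>) \<le> - C" by eventually_elim simp
  have i: "integrable circle_measure (\<lambda>\<zeta>. - ln (\<omega> \<zeta> - \<mu>))" using ln_int[OF \<mu>] by simp
  show "(\<lambda>\<zeta>. inv_bdry \<mu> \<zeta> * f \<zeta>) \<in> Hardy2" unfolding inv_bdry_def by (rule Hardy2_outer_mult(1)[OF f i C])
  assume v: "cmod v < 1"
  show "hinner (\<lambda>\<zeta>. inv_bdry \<mu> \<zeta> * f \<zeta>) (K v) = inverse (outer_F \<omega> \<mu> v) * hinner f (K v)"
    unfolding inv_bdry_def Hardy2_outer_mult(2)[OF f i C v] by (simp add: outer_uminus outer_F_eq_outer)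
qed

lemma resolvent_K_graph:
  assumes \<mu>: "ereal \<mu> < \<gamma>" and u: "cmod u < 1"
  shows "toeplitz_graph \<omega> (resolvent_K \<mu> u) (\<lambda>\<zeta>. K u \<zeta> + \<mu> * resolvent_K \<mu> u \<zeta>)"
  unfolding toeplitz_graph_def
proof (intro conjI ballI)
  have gH: "resolvent_K \<mu> u \<in> Hardy2" unfolding resolvent_K_def[abs_def]
    by (intro Hardy2_scale inv_bdry_mult K_Hardy2 \<mu> u)
  show gD: "resolvent_K \<mu> u \<in> form_dom \<omega>"
    unfolding form_dom_iff
  proof (intro conjI allI impI gH)
    fix \<nu> :: real assume \<nu>: "ereal \<nu> < \<gamma>"
    have "(\<lambda>\<zeta>. cnj (inverse (outer_F \<omega> \<mu> u)) * (bdry \<nu> \<zeta> * (inv_bdry \<mu> \<zeta> * K u \<zeta>))) \<in> Hardy2"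
      by (intro Hardy2_scale bdry_inv_bdry_bounded \<mu> \<nu> K_Hardy2 u)
    thus "(\<lambda>\<zeta>. bdry \<nu> \<zeta> * resolvent_K \<mu> u \<zeta>) \<in> Hardy2" by (simp add: resolvent_K_def mult_ac)
  qed
  show "(\<lambda>\<zeta>. K u \<zeta> + \<mu> * resolvent_K \<mu> u \<zeta>) \<in> Hardy2" by (intro Hardy2_add Hardy2_scale gH K_Hardy2 u)
  fix f assume f: "f \<in> form_dom \<omega>"
  define h where "h \<zeta> = bdry \<mu> \<zeta> * f \<zeta>" for \<zeta>
  have fH: "f \<in> Hardy2" and hH: "h \<in> Hardy2" using f \<mu> by (auto simp: form_dom_iff h_def[abs_def])
  note [measurable] = Hardy2_measurable[OF fH] Hardy2_measurable[OF hH] Hardy2_measurable[OF gH] bdry_measurable[OF \<mu>] inv_bdry_measurable[OF \<mu>]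
  have "toeplitz_form \<omega> (resolvent_K \<mu> u) f = hinner (\<lambda>\<zeta>. bdry \<mu> \<zeta> * resolvent_K \<mu> u \<zeta>) h + \<mu> * hinner (resolvent_K \<mu> u) f"
    unfolding h_def by (rule form_eq[OF gD f \<mu>])
  also have "hinner (\<lambda>\<zeta>. bdry \<mu> \<zeta> * resolvent_K \<mu> u \<zeta>) h = hinner (\<lambda>\<zeta>. cnj (inverse (outer_F \<omega> \<mu> u)) * K u \<zeta>) h"
  proof (rule hinner_cong_AE)
    show "AE \<zeta> in circle_measure. bdry \<mu> \<zeta> * resolvent_K \<mu> u \<zeta> = cnj (inverse (outer_F \<omega> \<mu> u)) * K u \<zeta>"
      using AE_bdry[OF \<mu>]
    proof eventually_elim
      case (elim \<zeta>)
      have "bdry \<mu> \<zeta> * resolvent_K \<mu> u \<zeta> = cnj (inverse (outer_F \<omega> \<mu> u)) * K u \<zeta> * (inv_bdry \<mu> \<zeta> * bdry \<mu> \<zeta>)"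
        by (simp add: resolvent_K_def mult_ac)
      thus ?case using elim by simp
    qed
    show "AE \<zeta> in circle_measure. h \<zeta> = h \<zeta>" by simp
  qed measurable
  also have "\<dots> = cnj (inverse (outer_F \<omega> \<mu> u) * hinner h (K u))"
    using hinner_commute[of "K u" h] by (simp add: hinner_scale_left)
  \<comment> \<open>Moving the scalar into the inner product with \<open>K u\<close> divides
    \<open>h\<close> by the boundary function, which returns \<open>f\<close>.\<close>
  also have "inverse (outer_F \<omega> \<mu> u) * hinner h (K u) = hinner (\<lambda>\<zeta>. inv_bdry \<mu> \<zeta> * h \<zeta>) (K u)"
    by (rule inv_bdry_mult(2)[symmetric]) (use \<mu> u hH in auto)
  also have "\<dots> = hinner f (K u)"
  proof (rule hinner_cong_AE)
    show "AE \<zeta> in circle_measure. inv_bdry \<mu> \<zeta> * h \<zeta> = f \<zeta>"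
      using AE_bdry[OF \<mu>] by eventually_elim (simp add: h_def mult.assoc[symmetric])
    show "AE \<zeta> in circle_measure. K u \<zeta> = K u \<zeta>" by simp
  qed measurable
  also have "cnj (hinner f (K u)) = hinner (K u) f" using hinner_commute[of "K u" f] by simp
  also have "hinner (K u) f + \<mu> * hinner (resolvent_K \<mu> u) f = hinner (\<lambda>\<zeta>. K u \<zeta> + \<mu> * resolvent_K \<mu> u \<zeta>) f"
    by (simp add: hinner_add_left hinner_scale_left L2_circle_scale Hardy2_L2 fH gH K_Hardy2 u)
  finally show "toeplitz_form \<omega> (resolvent_K \<mu> u) f = hinner (\<lambda>\<zeta>. K u \<zeta> + \<mu> * resolvent_K \<mu> u \<zeta>) f" .
qed

lemma hinner_resolvent_K:
  assumes "ereal \<mu> < \<gamma>" "cmod u < 1" "cmod v < 1"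
  shows "hinner (resolvent_K \<mu> u) (K v) = cnj (inverse (outer_F \<omega> \<mu> u)) * inverse (outer_F \<omega> \<mu> v) * K u v"
  unfolding resolvent_K_def[abs_def] hinner_scale_left
  using assms by (simp add: inv_bdry_mult(2) K_Hardy2 hinner_K_K)

end

subsection \<open>The scalar spectral measures\<close>

text \<open>An identity of measures known set by set passes to integrals through the superlevel
  sets, so no sum of measures has to be formed.\<close>

lemma nn_integral_setwise_sum:
  fixes u :: "'a \<Rightarrow> real"
  assumes fin: "finite_measure M1" "finite_measure M2" "finite_measure M3"
    and sets: "sets M2 = sets M1" "sets M3 = sets M1"
    and sum: "\<And>A. A \<in> sets M1 \<Longrightarrow> emeasure M1 A = emeasure M2 A + emeasure M3 A"
    and u: "u \<in> borel_measurable M1" "\<And>x. 0 \<le> u x"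
  shows "(\<integral>\<^sup>+x. ennreal (u x) \<partial>M1) = (\<integral>\<^sup>+x. ennreal (u x) \<partial>M2) + (\<integral>\<^sup>+x. ennreal (u x) \<partial>M3)"
proof -
  have sf: "sigma_finite_measure M1" "sigma_finite_measure M2" "sigma_finite_measure M3"
    using fin by (auto simp: finite_measure_def)
  have sp: "space M2 = space M1" "space M3 = space M1" using sets by (auto dest: sets_eq_imp_space_eq)
  have um: "u \<in> borel_measurable M2" "u \<in> borel_measurable M3" using u(1) sets by (auto cong: measurable_cong_sets)
  have lev: "{x \<in> space M1. y < u x} \<in> sets M1" for y using u(1) by measurable
  have "(\<integral>\<^sup>+x. ennreal (u x) \<partial>M1) = (\<integral>\<^sup>+y. emeasure M1 {x\<in>space M1. y < u x} * indicator {0..} y \<partial>lborel)"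
    by (rule nn_integral_layer_cake[OF sf(1) u])
  also have "\<dots> = (\<integral>\<^sup>+y. emeasure M2 {x\<in>space M1. y < u x} * indicator {0..} y + emeasure M3 {x\<in>space M1. y < u x} * indicator {0..} y \<partial>lborel)"
    by (simp add: sum[OF lev] distrib_right)
  also have "\<dots> = (\<integral>\<^sup>+y. emeasure M2 {x\<in>space M2. y < u x} * indicator {0..} y \<partial>lborel) + (\<integral>\<^sup>+y. emeasure M3 {x\<in>space M3. y < u x} * indicator {0..} y \<partial>lborel)"
    unfolding sp[symmetric]
    using measurable_emeasure_superlevel[OF sf(2) um(1)] measurable_emeasure_superlevel[OF sf(3) um(2)]
    by (subst nn_integral_add) (auto simp: sp)
  also have "\<dots> = (\<integral>\<^sup>+x. ennreal (u x) \<partial>M2) + (\<integral>\<^sup>+x. ennreal (u x) \<partial>M3)"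
    using nn_integral_layer_cake[OF sf(2) um(1) u(2)] nn_integral_layer_cake[OF sf(3) um(2) u(2)] by simp
  finally show ?thesis .
qed

locale toeplitz_spectral = semibounded_toeplitz +
  fixes E
  assumes spectral: "is_spectral_measure (toeplitz_graph \<omega>) E"
begin

abbreviation "A \<equiv> toeplitz_graph \<omega>"
abbreviation "\<nu> \<equiv> scalar_measure E"

lemma resolution: "resolution_of_identity E"
  using spectral by (simp add: is_spectral_measure_def)

lemma E_Hardy2[intro]: "B \<in> sets borel \<Longrightarrow> f \<in> Hardy2 \<Longrightarrow> E B f \<in> Hardy2"
  using resolution by (auto simp: resolution_of_identity_def orth_projection_def)

lemma E_sym: "B \<in> sets borel \<Longrightarrow> f \<in> Hardy2 \<Longrightarrow> g \<in> Hardy2 \<Longrightarrow> hinner (E B f) g = hinner f (E B g)"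
  using resolution by (auto simp: resolution_of_identity_def orth_projection_def)

lemma hinner_cong_left:
  assumes "f \<in> Hardy2" "f' \<in> Hardy2" "g \<in> Hardy2" "AE \<zeta> in circle_measure. f \<zeta> = f' \<zeta>"
  shows "hinner f g = hinner f' g"
  using assms by (intro hinner_cong_AE) (auto intro: Hardy2_measurable)

lemma E_comp:
  assumes B: "B \<in> sets borel" and C: "C \<in> sets borel" and f: "f \<in> Hardy2" and g: "g \<in> Hardy2"
  shows "hinner (E C (E B f)) g = hinner (E (C \<inter> B) f) g"
proof (rule hinner_cong_left)
  have "AE \<zeta> in circle_measure. E (C \<inter> B) f \<zeta> = E C (E B f) \<zeta>"
    using resolution B C f by (auto simp: resolution_of_identity_def)
  thus "AE \<zeta> in circle_measure. E C (E B f) \<zeta> = E (C \<inter> B) f \<zeta>" by eventually_elim simp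
qed (use B C f g in auto)

lemma E_comp2:
  assumes B: "B \<in> sets borel" and C: "C \<in> sets borel" and f: "f \<in> Hardy2" and g: "g \<in> Hardy2"
  shows "hinner (E C f) (E B g) = hinner (E (C \<inter> B) f) g"
proof -
  have "hinner (E C f) (E B g) = hinner (E B (E C f)) g" using E_sym[OF B E_Hardy2[OF C f] g, symmetric] .
  thus ?thesis using E_comp[of C B f g] assms by (simp add: Int_commute)
qed

lemma E_UNIV: "f \<in> Hardy2 \<Longrightarrow> g \<in> Hardy2 \<Longrightarrow> hinner (E UNIV f) g = hinner f g"
  by (rule hinner_cong_left) (use resolution in \<open>auto simp: resolution_of_identity_def\<close>)

lemma E_empty: "f \<in> Hardy2 \<Longrightarrow> g \<in> Hardy2 \<Longrightarrow> hinner (E {} f) g = 0"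
proof -
  assume f: "f \<in> Hardy2" and g: "g \<in> Hardy2"
  have "hinner (E {} f) g = hinner (\<lambda>\<zeta>. 0 * f \<zeta>) g"
    by (rule hinner_cong_left) (use f g resolution in \<open>auto simp: resolution_of_identity_def intro: Hardy2_scale[of f 0, simplified]\<close>)
  thus ?thesis unfolding hinner_scale_left by simp
qed

lemma E_quadratic_nonneg: "B \<in> sets borel \<Longrightarrow> f \<in> Hardy2 \<Longrightarrow> 0 \<le> Re (hinner (E B f) f)"
proof -
  assume "B \<in> sets borel" "f \<in> Hardy2"
  hence "Re (hinner (E B f) f) = Re (hinner (E B f) (E B f))" using E_comp2[of B B f f] by simp
  also have "\<dots> \<ge> 0" unfolding hinner_self by simp
  finally show ?thesis .
qed

lemma sets_\<nu>[simp, measurable_cong]: "sets (\<nu> f) = sets borel"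
  unfolding scalar_measure_def using sets.sigma_sets_eq[of borel] by (simp add: sets_measure_of_conv)

lemma space_\<nu>[simp]: "space (\<nu> f) = UNIV"
  unfolding scalar_measure_def by (simp add: space_measure_of_conv)

text \<open>\<open>measure_of\<close> yields the zero measure when its set function fails to be
  countably additive, so additivity is verified here before any value is used.\<close>

lemma emeasure_\<nu>:
  assumes f: "f \<in> Hardy2" and B: "B \<in> sets borel"
  shows "emeasure (\<nu> f) B = ennreal (Re (hinner (E B f) f))"
  unfolding scalar_measure_def
proof (rule emeasure_measure_of_sigma)
  show "sigma_algebra UNIV (sets borel)" using sets.sigma_algebra_axioms[of borel] by simp
  show "positive (sets borel) (\<lambda>B. ennreal (Re (hinner (E B f) f)))"
    using f by (simp add: positive_def E_empty)
  show "countably_additive (sets borel) (\<lambda>B. ennreal (Re (hinner (E B f) f)))"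
  proof (rule countably_additiveI)
    fix X :: "nat \<Rightarrow> real set" assume X: "range X \<subseteq> sets borel" "disjoint_family X" "(\<Union>i. X i) \<in> sets borel"
    have "(\<lambda>n. hinner (E (X n) f) f) sums hinner (E (\<Union>n. X n) f) f"
      using resolution X f by (simp add: resolution_of_identity_def)
    hence "(\<lambda>n. Re (hinner (E (X n) f) f)) sums Re (hinner (E (\<Union>n. X n) f) f)" by (rule sums_Re)
    thus "(\<Sum>i. ennreal (Re (hinner (E (X i) f) f))) = ennreal (Re (hinner (E (\<Union>i. X i) f) f))"
      using X f by (intro suminf_ennreal_eq E_quadratic_nonneg) auto
  qed
qed fact

lemma finite_\<nu>: "f \<in> Hardy2 \<Longrightarrow> finite_measure (\<nu> f)"
  by (rule finite_measureI) (simp add: emeasure_\<nu>)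

lemma measure_\<nu>: "f \<in> Hardy2 \<Longrightarrow> B \<in> sets borel \<Longrightarrow> measure (\<nu> f) B = Re (hinner (E B f) f)"
  by (simp add: measure_def emeasure_\<nu> E_quadratic_nonneg)

lemma measure_\<nu>_E: 
  assumes "f \<in> Hardy2" "B \<in> sets borel" "C \<in> sets borel"
  shows "emeasure (\<nu> (E B f)) C = emeasure (\<nu> f) (C \<inter> B)"
proof -
  have "hinner (E C (E B f)) (E B f) = hinner (E (C \<inter> B) (E B f)) f" using assms by (intro E_comp2) auto
  also have "\<dots> = hinner (E (C \<inter> B \<inter> B) f) f" using assms by (intro E_comp) auto
  finally show ?thesis using assms by (simp add: emeasure_\<nu> E_Hardy2 Int_assoc)
qed

text \<open>The scalar measure of \<open>E B f\<close> lives on the bounded set \<open>B\<close>, so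
  its second moment is finite, which is the criterion for the domain.\<close>

lemma dom_E_bounded:
  assumes f: "f \<in> Hardy2" and B: "B \<in> sets borel" "bounded B"
  shows "\<exists>h. A (E B f) h"
proof -
  obtain b where b: "\<And>x. x \<in> B \<Longrightarrow> \<bar>x\<bar> \<le> b" using B(2) by (auto simp: bounded_iff)
  interpret finite_measure "\<nu> (E B f)" using f B by (intro finite_\<nu>) auto
  have "emeasure (\<nu> (E B f)) (- B) = emeasure (\<nu> f) (- B \<inter> B)" using f B by (intro measure_\<nu>_E) auto
  hence "- B \<in> null_sets (\<nu> (E B f))" using B by (auto simp: null_sets_def)
  hence "AE x in \<nu> (E B f). x \<in> B" by (auto dest: AE_not_in)
  hence "AE x in \<nu> (E B f). norm (x\<^sup>2) \<le> b\<^sup>2"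
    by eventually_elim (use b in \<open>auto simp: abs_le_square_iff[symmetric] intro: order_trans[OF _ abs_ge_self]\<close>)
  hence "integrable (\<nu> (E B f)) (\<lambda>x. x\<^sup>2)" by (intro integrable_const_bound[of _ "b\<^sup>2"]) auto
  thus ?thesis using spectral f B by (simp add: is_spectral_measure_def E_Hardy2)
qed

lemma graph_integral:
  assumes "A f h"
  shows "Re (hinner h f) = (LINT x|\<nu> f. x)" "integrable (\<nu> f) (\<lambda>x. x)"
proof -
  have f: "f \<in> Hardy2" using toeplitz_graphD[OF assms] by simp
  interpret finite_measure "\<nu> f" using f by (rule finite_\<nu>)
  have "hinner h f = of_real (LINT x|\<nu> f. x)" using spectral assms by (simp add: is_spectral_measure_def)
  thus "Re (hinner h f) = (LINT x|\<nu> f. x)" by simp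
  have "integrable (\<nu> f) (\<lambda>x. x\<^sup>2)" using spectral assms f by (auto simp: is_spectral_measure_def)
  hence "integrable (\<nu> f) (\<lambda>x. 1 + x\<^sup>2)" by simp
  thus "integrable (\<nu> f) (\<lambda>x. x)"
  proof (rule Bochner_Integration.integrable_bound)
    show "AE x in \<nu> f. norm x \<le> norm (1 + x\<^sup>2)"
    proof (rule AE_I2)
      fix x :: real
      have "2 * (1 * \<bar>x\<bar>) \<le> 1\<^sup>2 + \<bar>x\<bar>\<^sup>2" using sum_squares_bound[of 1 "\<bar>x\<bar>"] by simp
      thus "norm x \<le> norm (1 + x\<^sup>2)" using abs_ge_zero[of x] by simp
    qed
  qed simp
qed

text \<open>For \<open>p = E B f\<close> the quadratic form is at most \<open>c\<close> times the
  squared norm, as the scalar measure of \<open>p\<close> lives on \<open>B\<close>, and at least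
  \<open>c1\<close> times it by the lower bound of the operator, with \<open>c\<close> below
  \<open>c1\<close>. Hence \<open>p\<close> vanishes. Boundedness of \<open>B\<close> puts
  \<open>p\<close> into the domain.\<close>

lemma \<nu>_null_below:
  assumes f: "f \<in> Hardy2" and c: "ereal c < \<gamma>" and B: "B \<in> sets borel" "bounded B" "B \<subseteq> {..c}"
  shows "emeasure (\<nu> f) B = 0"
proof -
  obtain c1 where c1: "ereal c < ereal c1" "ereal c1 < \<gamma>" using ereal_dense2[OF c] by blast
  define p where "p = E B f"
  have p: "p \<in> Hardy2" using f B by (auto simp: p_def)
  interpret finite_measure "\<nu> p" using p by (rule finite_\<nu>)
  obtain h where h: "A p h" using dom_E_bounded[OF f B(1,2)] by (auto simp: p_def)
  have "emeasure (\<nu> p) (- B) = emeasure (\<nu> f) (- B \<inter> B)" unfolding p_def using f B by (intro measure_\<nu>_E) auto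
  hence "- B \<in> null_sets (\<nu> p)" using B by (auto simp: null_sets_def)
  hence "AE x in \<nu> p. x \<in> B" by (auto dest: AE_not_in)
  hence "AE x in \<nu> p. x \<le> c" by eventually_elim (use B in auto)
  hence "(LINT x|\<nu> p. x) \<le> (LINT x|\<nu> p. c)" using graph_integral(2)[OF h] by (intro integral_mono_AE) auto
  also have "\<dots> = c * measure (\<nu> p) UNIV" by simp
  also have "measure (\<nu> p) UNIV = Re (hinner p p)" using p by (simp add: measure_\<nu> E_UNIV)
  finally have "c1 * Re (hinner p p) \<le> c * Re (hinner p p)"
    using graph_integral(1)[OF h] toeplitz_graph_bounded_below[OF h c1(2)] by simp
  moreover have "Re (hinner p p) \<ge> 0" by (simp add: hinner_self)
  ultimately have "Re (hinner p p) = 0" using c1(1) by (simp add: mult_le_cancel_right)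
  moreover have "hinner p p = hinner (E B f) f" unfolding p_def using f B E_comp2[of B B f f] by simp
  ultimately show ?thesis using f B by (simp add: emeasure_\<nu>)
qed

lemma AE_\<nu>_ge:
  assumes f: "f \<in> Hardy2" and c: "ereal c < \<gamma>"
  shows "AE x in \<nu> f. c < x"
proof -
  have "(\<Union>n::nat. {- real n..c}) \<in> null_sets (\<nu> f)"
    using \<nu>_null_below[OF f c] by (intro null_sets_UN) (auto simp: null_sets_def)
  hence "AE x in \<nu> f. x \<notin> (\<Union>n::nat. {- real n..c})" by (rule AE_not_in)
  thus ?thesis
  proof eventually_elim
    case (elim x)
    obtain n :: nat where "- x \<le> real n" using real_arch_simple by blast
    moreover have "x \<notin> {- real n..c}" using elim by blast
    ultimately show ?case by auto
  qed
qed

text \<open>The \<open>max\<close> makes the integrand nonnegative everywhere, so that the identity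
  becomes one of extended nonnegative integrals; almost everywhere the integrand is
  \<open>x - c\<close>.\<close>

lemma nn_graph_integral:
  assumes h: "A f h" and c: "ereal c < \<gamma>"
  shows "(\<integral>\<^sup>+x. ennreal (max 0 (x - c)) \<partial>\<nu> f) = ennreal (Re (hinner h f) - c * Re (hinner f f))"
    "0 \<le> Re (hinner h f) - c * Re (hinner f f)"
proof -
  have f: "f \<in> Hardy2" using toeplitz_graphD[OF h] by simp
  interpret finite_measure "\<nu> f" using f by (rule finite_\<nu>)
  have ae: "AE x in \<nu> f. max 0 (x - c) = x - c" using AE_\<nu>_ge[OF f c] by eventually_elim simp
  have eq: "(LINT x|\<nu> f. x - c) = Re (hinner h f) - c * Re (hinner f f)"
    using graph_integral[OF h] f by (simp add: measure_\<nu>[OF f, of UNIV, simplified] E_UNIV)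
  have "(\<integral>\<^sup>+x. ennreal (max 0 (x - c)) \<partial>\<nu> f) = (\<integral>\<^sup>+x. ennreal (x - c) \<partial>\<nu> f)"
    by (rule nn_integral_cong_AE) (use ae in \<open>auto elim: eventually_mono\<close>)
  also have "\<dots> = ennreal (LINT x|\<nu> f. x - c)"
    by (rule nn_integral_eq_integral) (use graph_integral(2)[OF h] AE_\<nu>_ge[OF f c] in \<open>auto elim: eventually_mono\<close>)
  finally show "(\<integral>\<^sup>+x. ennreal (max 0 (x - c)) \<partial>\<nu> f) = ennreal (Re (hinner h f) - c * Re (hinner f f))" unfolding eq .
  have "0 \<le> (LINT x|\<nu> f. x - c)" by (rule integral_nonneg_AE) (use AE_\<nu>_ge[OF f c] in \<open>auto elim: eventually_mono\<close>)
  thus "0 \<le> Re (hinner h f) - c * Re (hinner f f)" unfolding eq .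
qed

lemma Re_hinner_polar:
  assumes L: "a \<in> L2_circle" "b \<in> L2_circle" "a' \<in> L2_circle" "b' \<in> L2_circle"
  shows "Re (hinner (\<lambda>\<zeta>. a \<zeta> + 1 * b \<zeta>) (\<lambda>\<zeta>. a' \<zeta> + 1 * b' \<zeta>)) - Re (hinner (\<lambda>\<zeta>. a \<zeta> + (-1) * b \<zeta>) (\<lambda>\<zeta>. a' \<zeta> + (-1) * b' \<zeta>))
    = 2 * (Re (hinner a b') + Re (hinner b a'))"
proof -
  have "hinner (\<lambda>\<zeta>. a \<zeta> + c * b \<zeta>) (\<lambda>\<zeta>. a' \<zeta> + c * b' \<zeta>) = hinner a a' + cnj c * hinner a b' + c * hinner b a' + c * cnj c * hinner b b'" for c
    using L by (simp add: hinner_add_left hinner_add_right hinner_scale_left hinner_scale_right L2_circle_scale L2_circle_add algebra_simps)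
  from this[of 1] this[of "-1"] show ?thesis by (simp only:) simp
qed

lemma E_linear:
  assumes H: "a \<in> Hardy2" "b \<in> Hardy2" "k \<in> Hardy2" and C: "C \<in> sets borel"
  shows "hinner (E C (\<lambda>\<zeta>. a \<zeta> + c * b \<zeta>)) k = hinner (E C a) k + c * hinner (E C b) k"
proof -
  have ab: "(\<lambda>\<zeta>. a \<zeta> + c * b \<zeta>) \<in> Hardy2" using H by (intro Hardy2_add Hardy2_scale)
  have "hinner (E C (\<lambda>\<zeta>. a \<zeta> + c * b \<zeta>)) k = hinner a (E C k) + c * hinner b (E C k)"
    using E_sym[OF C ab H(3)] H C by (simp add: hinner_add_left hinner_scale_left Hardy2_L2 L2_circle_scale E_Hardy2)
  thus ?thesis using E_sym[OF C] H by simp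
qed

text \<open>Taking only the coefficients 1 and -1 yields real parts, which is all that the measures
  below use.\<close>

lemma E_polar:
  assumes H: "a \<in> Hardy2" "b \<in> Hardy2" and C: "C \<in> sets borel"
  shows "Re (hinner (E C (\<lambda>\<zeta>. a \<zeta> + 1 * b \<zeta>)) (\<lambda>\<zeta>. a \<zeta> + 1 * b \<zeta>)) - Re (hinner (E C (\<lambda>\<zeta>. a \<zeta> + (-1) * b \<zeta>)) (\<lambda>\<zeta>. a \<zeta> + (-1) * b \<zeta>))
    = 4 * Re (hinner (E C a) b)"
proof -
  have lin: "hinner (E C (\<lambda>\<zeta>. a \<zeta> + c * b \<zeta>)) k = hinner (\<lambda>\<zeta>. E C a \<zeta> + c * E C b \<zeta>) k" if k: "k \<in> Hardy2" for k c
    using E_linear[OF H k C] H k C by (simp add: hinner_add_left hinner_scale_left Hardy2_L2 L2_circle_scale E_Hardy2)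
  have "Re (hinner (E C b) a) = Re (hinner (E C a) b)"
    using E_sym[OF C H(2) H(1)] hinner_commute[of b "E C a"] by simp
  thus ?thesis
    using Re_hinner_polar[of "E C a" "E C b" a b] H C
    by (subst lin, intro Hardy2_add Hardy2_scale H, subst lin, intro Hardy2_add Hardy2_scale H) (auto intro: Hardy2_L2)
qed

text \<open>If the real part of the complex measure \<open>(E(\<cdot>)a, b)\<close> is a positive measure \<open>M\<close> (up to the
  factor \<open>4\<close>), then \<open>((T - c)a, b) = \<integral> (x - c) dM\<close>: polarization writes it as a difference of two
  scalar measures, and moving one of them to the other side keeps everything nonnegative.\<close>

lemma polarized_graph_integral:
  assumes a: "A a ha" and b: "A b hb" and c: "ereal c < \<gamma>"
    and M: "sets M = sets borel"
    and eM: "\<And>C. C \<in> sets borel \<Longrightarrow> 0 \<le> Re (hinner (E C a) b) \<and> emeasure M C = ennreal (4 * Re (hinner (E C a) b))"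
  shows "(\<integral>\<^sup>+x. ennreal (max 0 (x - c)) \<partial>M) = ennreal (4 * (Re (hinner ha b) - c * Re (hinner a b)))"
    "0 \<le> Re (hinner ha b) - c * Re (hinner a b)"
proof -
  note da = toeplitz_graphD[OF a] and db = toeplitz_graphD[OF b]
  define p where "p = (\<lambda>\<zeta>. a \<zeta> + 1 * b \<zeta>)"
  define q where "q = (\<lambda>\<zeta>. a \<zeta> + (-1) * b \<zeta>)"
  have p: "A p (\<lambda>\<zeta>. ha \<zeta> + 1 * hb \<zeta>)" and q: "A q (\<lambda>\<zeta>. ha \<zeta> + (-1) * hb \<zeta>)"
    unfolding p_def q_def using a b by (intro toeplitz_graph_add; simp)+
  note Hp = toeplitz_graphD(2)[OF p] and Hq = toeplitz_graphD(2)[OF q]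
  have pol: "emeasure (\<nu> p) C = emeasure (\<nu> q) C + emeasure M C" if C: "C \<in> sets borel" for C
  proof -
    have "Re (hinner (E C p) p) = Re (hinner (E C q) q) + 4 * Re (hinner (E C a) b)"
      using E_polar[OF da(2) db(2) C, folded p_def q_def] by linarith
    thus ?thesis using eM[OF C] E_quadratic_nonneg[OF C Hq] C Hp Hq by (simp add: emeasure_\<nu>)
  qed
  have finM: "finite_measure M" 
    by (rule finite_measureI) (use eM[of UNIV] sets_eq_imp_space_eq[OF M] in simp)
  define rp rq where "rp = Re (hinner (\<lambda>\<zeta>. ha \<zeta> + 1 * hb \<zeta>) p) - c * Re (hinner p p)"
    and "rq = Re (hinner (\<lambda>\<zeta>. ha \<zeta> + (-1) * hb \<zeta>) q) - c * Re (hinner q q)"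
  note np = nn_graph_integral[OF p c, folded rp_def] and nq = nn_graph_integral[OF q c, folded rq_def]
  have "ennreal rp = ennreal rq + (\<integral>\<^sup>+x. ennreal (max 0 (x - c)) \<partial>M)"
    unfolding np(1)[symmetric] nq(1)[symmetric]
    by (rule nn_integral_setwise_sum) (use pol M finM Hp Hq in \<open>auto intro: finite_\<nu>\<close>)
  moreover have rpq: "rp - rq = 4 * (Re (hinner ha b) - c * Re (hinner a b))"
  proof -
    have s: "Re (hinner hb a) = Re (hinner ha b)"
      using toeplitz_graph_symmetric[OF b a] hinner_commute[of b ha] by simp
    have s2: "Re (hinner b a) = Re (hinner a b)" using hinner_commute[of b a] by simp
    have "rp - rq = 2 * (Re (hinner ha b) + Re (hinner hb a)) - c * (2 * (Re (hinner a b) + Re (hinner b a)))"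
      using Re_hinner_polar[of ha hb a b] Re_hinner_polar[of a b a b] da(2,3) db(2,3)
      unfolding rp_def rq_def p_def q_def by (simp add: Hardy2_L2 algebra_simps)
    thus ?thesis using s s2 by (simp add: algebra_simps)
  qed
  ultimately have e: "ennreal rq + (\<integral>\<^sup>+x. ennreal (max 0 (x - c)) \<partial>M) = ennreal rp" by simp
  have "rq \<le> rp" using e np(2) nq(2) by (metis ennreal_le_iff le_iff_add)
  thus "0 \<le> Re (hinner ha b) - c * Re (hinner a b)" using rpq by simp
  have "ennreal rp = ennreal rq + ennreal (rp - rq)" using \<open>rq \<le> rp\<close> nq(2) by (simp add: ennreal_plus[symmetric] del: ennreal_plus)
  thus "(\<integral>\<^sup>+x. ennreal (max 0 (x - c)) \<partial>M) = ennreal (4 * (Re (hinner ha b) - c * Re (hinner a b)))"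
    using e unfolding rpq[symmetric] by (simp add: ennreal_add_left_cancel)
qed

section \<open>The scalar measure of \<open>f = (T - c) g\<close> in terms of that of
  \<open>g\<close>\<close>

context
  fixes f g :: "complex \<Rightarrow> complex" and c :: real
  assumes f: "f \<in> Hardy2" and g: "A g (\<lambda>\<zeta>. f \<zeta> + c * g \<zeta>)" and c: "ereal c < \<gamma>"
begin

lemma g_H: "g \<in> Hardy2" using toeplitz_graphD[OF g] by simp

lemma hinner_shift: "k \<in> Hardy2 \<Longrightarrow> Re (hinner (\<lambda>\<zeta>. f \<zeta> + c * g \<zeta>) k) - c * Re (hinner g k) = Re (hinner f k)"
  using f g_H by (simp add: hinner_add_left hinner_scale_left Hardy2_L2 L2_circle_scale)

text \<open>Since \<open>f = (T - c) g\<close>, the mixed measure of \<open>f\<close> and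
  \<open>g\<close> should have density \<open>x - c\<close> with respect to \<open>\<nu> g\<close>.
  This comes from the polarized identity for \<open>g\<close> and \<open>E B g\<close>, both in the
  domain; the measure \<open>M\<close> fed into it is four times the restriction of
  \<open>\<nu> g\<close> to \<open>B\<close>.\<close>

lemma mixed_measure:
  assumes B: "B \<in> sets borel" "bounded B"
  shows "(\<integral>\<^sup>+x. ennreal (max 0 (x - c)) * indicator B x \<partial>\<nu> g) = ennreal (Re (hinner (E B f) g))"
    "0 \<le> Re (hinner (E B f) g)"
proof -
  define q where "q = E B g"
  have q: "q \<in> Hardy2" using g_H B by (auto simp: q_def)
  obtain hq where hq: "A q hq" using dom_E_bounded[OF g_H B] by (auto simp: q_def)
  define M where "M = density (\<nu> g) (\<lambda>x. 4 * indicator B x)"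
  have M: "sets M = sets borel" by (simp add: M_def)
  have eM: "0 \<le> Re (hinner (E C g) q) \<and> emeasure M C = ennreal (4 * Re (hinner (E C g) q))" if C: "C \<in> sets borel" for C
  proof -
    have r: "Re (hinner (E C g) q) = Re (hinner (E (C \<inter> B) g) g)" unfolding q_def using E_comp2[of B C g g] B C g_H by simp
    have "emeasure M C = (\<integral>\<^sup>+x. 4 * indicator (C \<inter> B) x \<partial>\<nu> g)"
      unfolding M_def using B C by (subst emeasure_density) (auto intro!: nn_integral_cong simp: indicator_def)
    also have "\<dots> = 4 * emeasure (\<nu> g) (C \<inter> B)" using B C by (subst nn_integral_cmult_indicator) auto
    also have "\<dots> = ennreal (4 * Re (hinner (E (C \<inter> B) g) g))"
      using B C g_H E_quadratic_nonneg[of "C \<inter> B" g] by (simp add: emeasure_\<nu> ennreal_mult)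
    finally show ?thesis unfolding r using B C g_H E_quadratic_nonneg[of "C \<inter> B" g] by simp
  qed
  note pg = polarized_graph_integral[OF g hq c M eM]
  have fq: "hinner f q = hinner (E B f) g" unfolding q_def using E_sym[of B f g] B f g_H by simp
  have "(\<integral>\<^sup>+x. ennreal (max 0 (x - c)) \<partial>M) = (\<integral>\<^sup>+x. 4 * (ennreal (max 0 (x - c)) * indicator B x) \<partial>\<nu> g)"
    unfolding M_def using B by (subst nn_integral_density) (auto intro!: nn_integral_cong simp: mult_ac)
  also have "\<dots> = 4 * (\<integral>\<^sup>+x. ennreal (max 0 (x - c)) * indicator B x \<partial>\<nu> g)"
    using B by (intro nn_integral_cmult) auto
  finally have "4 * (\<integral>\<^sup>+x. ennreal (max 0 (x - c)) * indicator B x \<partial>\<nu> g) = 4 * ennreal (Re (hinner (E B f) g))"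
    using pg(1) pg(2) unfolding hinner_shift[OF q] fq by (simp add: ennreal_mult)
  thus "(\<integral>\<^sup>+x. ennreal (max 0 (x - c)) * indicator B x \<partial>\<nu> g) = ennreal (Re (hinner (E B f) g))"
    by (simp add: ennreal_mult_cancel_left)
  show "0 \<le> Re (hinner (E B f) g)" using pg(2) unfolding hinner_shift[OF q] fq .
qed

text \<open>A second factor \<open>x - c\<close> appears. As \<open>f\<close> itself may lie outside
  the domain, it is replaced by \<open>p = E B f\<close>, and \<open>g\<close> by
  \<open>q = E B g\<close>: symmetry gives \<open>(E B f, f) = ((T - c) p, g)\<close>, the part of
  \<open>g\<close> off \<open>B\<close> contributes nothing, and \<open>((T - c) p, q)\<close> is
  the integral of \<open>x - c\<close> against the mixed measure on \<open>B\<close>.\<close>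

lemma \<nu>_bounded_eq:
  assumes B: "B \<in> sets borel" "bounded B"
  shows "emeasure (\<nu> f) B = (\<integral>\<^sup>+x. ennreal ((max 0 (x - c))\<^sup>2) * indicator B x \<partial>\<nu> g)"
proof -
  define p q where "p = E B f" and "q = E B g"
  have H: "p \<in> Hardy2" "q \<in> Hardy2" using f g_H B by (auto simp: p_def q_def)
  obtain hp where hp: "A p hp" using dom_E_bounded[OF f B] by (auto simp: p_def)
  obtain hq where hq: "A q hq" using dom_E_bounded[OF g_H B] by (auto simp: q_def)
  note Hhp = toeplitz_graphD(3)[OF hp]
  have gq: "A (\<lambda>\<zeta>. g \<zeta> + (-1) * q \<zeta>) (\<lambda>\<zeta>. (f \<zeta> + c * g \<zeta>) + (-1) * hq \<zeta>)" by (rule toeplitz_graph_add[OF g hq])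
  have split: "hinner k (\<lambda>\<zeta>. g \<zeta> + (-1) * q \<zeta>) = hinner k g - hinner k q" if k: "k \<in> Hardy2" for k
  proof -
    have "hinner k (\<lambda>\<zeta>. g \<zeta> + (-1) * q \<zeta>) = hinner k g + cnj (-1) * hinner k q"
      using hinner_add_right[OF Hardy2_L2[OF g_H] L2_circle_scale[OF Hardy2_L2[OF H(2)], of "-1"] Hardy2_L2[OF k]]
      unfolding hinner_scale_right .
    thus ?thesis by simp
  qed
  have cross: "hinner (E C p) (\<lambda>\<zeta>. g \<zeta> + (-1) * q \<zeta>) = 0" if C: "C \<in> sets borel" for C
  proof -
    have "hinner (E C p) q = hinner (E (C \<inter> B) p) g" unfolding q_def using C B H g_H by (intro E_comp2) auto
    also have "\<dots> = hinner (E (C \<inter> B \<inter> B) f) g" unfolding p_def using C B f g_H by (intro E_comp) auto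
    also have "\<dots> = hinner (E C p) g" unfolding p_def using C B f g_H by (subst E_comp) (auto simp: Int_assoc)
    finally show ?thesis using split[of "E C p"] C H by auto
  qed
  \<comment> \<open>The mixed measure of \<open>p\<close> and \<open>g - q\<close> is zero, so the
    polarized identity with the null measure says that the real part of
    \<open>((T - c) p, g - q)\<close> vanishes.\<close>
  have "(\<integral>\<^sup>+x. ennreal (max 0 (x - c)) \<partial>null_measure borel) = ennreal (4 * (Re (hinner hp (\<lambda>\<zeta>. g \<zeta> + (-1) * q \<zeta>)) - c * Re (hinner p (\<lambda>\<zeta>. g \<zeta> + (-1) * q \<zeta>))))"
    and "0 \<le> Re (hinner hp (\<lambda>\<zeta>. g \<zeta> + (-1) * q \<zeta>)) - c * Re (hinner p (\<lambda>\<zeta>. g \<zeta> + (-1) * q \<zeta>))"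
    using polarized_graph_integral[OF hp gq c, of "null_measure borel"] cross by (simp_all del: mult_minus1)
  hence "Re (hinner hp (\<lambda>\<zeta>. g \<zeta> + (-1) * q \<zeta>)) - c * Re (hinner p (\<lambda>\<zeta>. g \<zeta> + (-1) * q \<zeta>)) = 0"
    by (simp del: mult_minus1 add: nn_integral_null_measure ennreal_eq_0_iff)
  hence cr: "Re (hinner hp g) - c * Re (hinner p g) = Re (hinner hp q) - c * Re (hinner p q)"
    unfolding split[OF Hhp] split[OF H(1)] by (simp add: right_diff_distrib)
  have pp: "Re (hinner (E B f) f) = Re (hinner hp g) - c * Re (hinner p g)"
  proof -
    have "hinner (\<lambda>\<zeta>. f \<zeta> + c * g \<zeta>) p = hinner g hp" by (rule toeplitz_graph_symmetric[OF g hp])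
    hence "Re (hinner hp g) = Re (hinner (\<lambda>\<zeta>. f \<zeta> + c * g \<zeta>) p)" using hinner_commute[of hp g] by simp
    hence "Re (hinner hp g) - c * Re (hinner p g) = Re (hinner f p)"
      using hinner_shift[OF H(1)] hinner_commute[of p g] by simp
    thus ?thesis using hinner_commute[of p f] by (simp add: p_def)
  qed
  define M where "M = density (\<nu> g) (\<lambda>x. 4 * (ennreal (max 0 (x - c)) * indicator B x))"
  have M: "sets M = sets borel" by (simp add: M_def)
  have eM: "0 \<le> Re (hinner (E C p) q) \<and> emeasure M C = ennreal (4 * Re (hinner (E C p) q))" if C: "C \<in> sets borel" for C
  proof -
    have "hinner (E C p) q = hinner (E (C \<inter> B) p) g" unfolding q_def using C B H g_H by (intro E_comp2) auto
    also have "\<dots> = hinner (E (C \<inter> B \<inter> B) f) g" unfolding p_def using C B f g_H by (intro E_comp) auto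
    finally have r: "hinner (E C p) q = hinner (E (C \<inter> B) f) g" by (simp add: Int_assoc)
    have bd: "bounded (C \<inter> B)" "C \<inter> B \<in> sets borel" using B C by auto
    have "emeasure M C = (\<integral>\<^sup>+x. 4 * (ennreal (max 0 (x - c)) * indicator (C \<inter> B) x) \<partial>\<nu> g)"
      unfolding M_def using B C by (subst emeasure_density) (auto intro!: nn_integral_cong simp: indicator_def)
    also have "\<dots> = 4 * (\<integral>\<^sup>+x. ennreal (max 0 (x - c)) * indicator (C \<inter> B) x \<partial>\<nu> g)"
      using B C by (intro nn_integral_cmult) auto
    finally show ?thesis unfolding r mixed_measure(1)[OF bd(2,1)] using mixed_measure(2)[OF bd(2,1)] by (simp add: ennreal_mult)
  qed
  note pg = polarized_graph_integral[OF hp hq c M eM]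
  have "(\<integral>\<^sup>+x. ennreal (max 0 (x - c)) \<partial>M) = (\<integral>\<^sup>+x. 4 * (ennreal ((max 0 (x - c))\<^sup>2) * indicator B x) \<partial>\<nu> g)"
    unfolding M_def using B
    by (subst nn_integral_density) (auto intro!: nn_integral_cong simp: indicator_def power2_eq_square ennreal_mult mult_ac)
  also have "\<dots> = 4 * (\<integral>\<^sup>+x. ennreal ((max 0 (x - c))\<^sup>2) * indicator B x \<partial>\<nu> g)"
    using B by (intro nn_integral_cmult) auto
  finally have "4 * (\<integral>\<^sup>+x. ennreal ((max 0 (x - c))\<^sup>2) * indicator B x \<partial>\<nu> g) = ennreal (4 * Re (hinner (E B f) f))"
    using pg(1) unfolding pp cr by simp
  also have "\<dots> = 4 * ennreal (Re (hinner (E B f) f))"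
    using E_quadratic_nonneg[OF B(1) f] by (simp add: ennreal_mult)
  finally have "4 * (\<integral>\<^sup>+x. ennreal ((max 0 (x - c))\<^sup>2) * indicator B x \<partial>\<nu> g) = 4 * ennreal (Re (hinner (E B f) f))" .
  thus ?thesis using f B by (simp add: emeasure_\<nu> ennreal_mult_cancel_left)
qed

lemma \<nu>_eq_density: "\<nu> f = density (\<nu> g) (\<lambda>x. ennreal ((max 0 (x - c))\<^sup>2))"
proof (rule measure_eqI)
  fix B assume "B \<in> sets (\<nu> f)"
  hence B: "B \<in> sets borel" by simp
  \<comment> \<open>Shells \<open>i - 1 < \<bar>x\<bar> \<le> i\<close>, with the origin as the
    piece of index 0: bounded, disjoint and covering the line, so that countable additivity extends
    the identity to all Borel sets.\<close>
  define D where "D i = (if i = 0 then B \<inter> {0} else B \<inter> ({real i - 1<..real i} \<union> {- real i..<1 - real i}))" for i :: nat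
  have D: "D i \<in> sets borel" for i using B by (auto simp: D_def)
  have Db: "bounded (D i)" for i
    by (rule bounded_subset[of "{-real i..real i}"]) (auto simp: D_def)
  have disj: "disjoint_family D"
  proof -
    have "x \<notin> D j" if "x \<in> D i" "i < j" for i j x
    proof -
      have "real i + 1 \<le> real j" using that by linarith
      thus ?thesis using that by (cases "i = 0") (auto simp: D_def)
    qed
    thus ?thesis unfolding disjoint_family_on_def by (metis disjoint_iff nat_neq_iff)
  qed
  have U: "(\<Union>i. D i) = B"
  proof
    show "B \<subseteq> (\<Union>i. D i)"
    proof
      fix x assume x: "x \<in> B"
      define i where "i = nat \<lceil>\<bar>x\<bar>\<rceil>"
      have "real i = of_int \<lceil>\<bar>x\<bar>\<rceil>" by (simp add: i_def)
      hence i: "\<bar>x\<bar> \<le> real i" "real i - 1 < \<bar>x\<bar>" using ceiling_correct[of "\<bar>x\<bar>"] by auto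
      have "x \<in> D i" using i x by (cases "i = 0") (auto simp: D_def)
      thus "x \<in> (\<Union>i. D i)" by blast
    qed
  qed (auto simp: D_def split: if_splits)
  have "emeasure (\<nu> f) B = (\<Sum>i. emeasure (\<nu> f) (D i))"
    using D disj by (subst suminf_emeasure) (auto simp: U)
  also have "\<dots> = (\<Sum>i. emeasure (density (\<nu> g) (\<lambda>x. ennreal ((max 0 (x - c))\<^sup>2))) (D i))"
    using D Db by (simp add: \<nu>_bounded_eq emeasure_density)
  also have "\<dots> = emeasure (density (\<nu> g) (\<lambda>x. ennreal ((max 0 (x - c))\<^sup>2))) B"
    using D disj by (subst suminf_emeasure) (auto simp: U)
  finally show "emeasure (\<nu> f) B = emeasure (density (\<nu> g) (\<lambda>x. ennreal ((max 0 (x - c))\<^sup>2))) B" .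
qed simp

text \<open>One of the two factors \<open>x - c\<close> of the density cancels against the
  integrand, leaving the integral of \<open>x - c\<close> against \<open>\<nu> g\<close>, that is
  \<open>((T - c) g, g) = (f, g)\<close>.\<close>

lemma resolvent_integral: "(LINT x|\<nu> f. 1 / (x - c)) = Re (hinner f g)"
proof -
  have "(LINT x|\<nu> f. 1 / (x - c)) = enn2real (\<integral>\<^sup>+x. ennreal (1 / (x - c)) \<partial>\<nu> f)"
    by (rule integral_eq_nn_integral) (use AE_\<nu>_ge[OF f c] in \<open>auto elim: eventually_mono\<close>)
  also have "(\<integral>\<^sup>+x. ennreal (1 / (x - c)) \<partial>\<nu> f) = (\<integral>\<^sup>+x. ennreal ((max 0 (x - c))\<^sup>2) * ennreal (1 / (x - c)) \<partial>\<nu> g)"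
    unfolding \<nu>_eq_density by (rule nn_integral_density) auto
  also have "\<dots> = (\<integral>\<^sup>+x. ennreal (max 0 (x - c)) \<partial>\<nu> g)"
    by (rule nn_integral_cong_AE)
       (use AE_\<nu>_ge[OF g_H c] in \<open>auto elim!: eventually_mono simp: ennreal_mult[symmetric] power2_eq_square\<close>)
  also have "\<dots> = ennreal (Re (hinner f g))"
    using nn_graph_integral(1)[OF g c] unfolding hinner_shift[OF g_H] .
  finally show ?thesis using nn_graph_integral(2)[OF g c] unfolding hinner_shift[OF g_H] by simp
qed

end

end

subsection \<open>Integrability of the logarithmic singularity\<close>

text \<open>A majorant with integrable singularity: the bound of a logarithm by its argument is used
  for \<open>s\<close> and for \<open>s powr (-1/2)\<close>.\<close>

lemma abs_ln_le:
  fixes s :: real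
  assumes "s > 0"
  shows "\<bar>ln s\<bar> \<le> s + 2 * s powr (-1/2)"
proof -
  have "ln s \<le> s" using ln_le_minus_one[OF assms] by simp
  moreover have "- ln s \<le> 2 * s powr (-1/2)"
  proof -
    have "ln (s powr (-1/2)) \<le> s powr (-1/2)" using ln_le_minus_one[of "s powr (-1/2)"] assms by simp
    thus ?thesis using assms by (simp add: ln_powr)
  qed
  moreover have "0 \<le> s powr (-1/2)" by simp
  ultimately show ?thesis using assms by linarith
qed

lemma nn_integral_inv_sqrt: "(\<integral>\<^sup>+y. ennreal (\<bar>y\<bar> powr (-1/2)) * indicator {-1..1} y \<partial>lborel) \<le> 4"
proof -
  have "((\<lambda>x::real. x powr (-1/2)) has_integral (1 powr (-1/2 + 1) / (-1/2 + 1))) {0..1}"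
    by (rule has_integral_powr_from_0) auto
  hence "((\<lambda>x::real. if x \<in> {0..1} then x powr (-1/2) else 0) has_integral 2) UNIV"
    unfolding has_integral_restrict_UNIV by simp
  hence h: "(\<integral>\<^sup>+x. ennreal (if x \<in> {0..1::real} then x powr (-1/2) else 0) \<partial>lborel) = ennreal 2"
    by (intro nn_integral_has_integral_lborel) auto
  have "(\<integral>\<^sup>+y. ennreal (\<bar>y\<bar> powr (-1/2)) * indicator {-1..1} y \<partial>lborel)
      \<le> (\<integral>\<^sup>+y. ennreal (if y \<in> {0..1::real} then y powr (-1/2) else 0) + ennreal (if - y \<in> {0..1::real} then (- y) powr (-1/2) else 0) \<partial>lborel)"
    by (intro nn_integral_mono) (auto simp: indicator_def abs_if)
  also have "\<dots> = ennreal 2 + (\<integral>\<^sup>+y. ennreal (if - y \<in> {0..1::real} then (- y) powr (-1/2) else 0) \<partial>lborel)"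
    unfolding h[symmetric] by (rule nn_integral_add) auto
  also have "(\<integral>\<^sup>+y. ennreal (if - y \<in> {0..1::real} then (- y) powr (-1/2) else 0) \<partial>lborel) = ennreal 2"
    using nn_integral_real_affine[of "\<lambda>x. ennreal (if x \<in> {0..1::real} then x powr (-1/2) else 0)" "-1" 0]
    unfolding h by (simp cong: if_cong)
  finally show ?thesis by (simp add: ennreal_plus[symmetric] del: ennreal_plus)
qed

text \<open>Linear growth in \<open>\<bar>x\<bar>\<close> is what makes the double integral over
  \<mu> and the circle finite for merely integrable \<omega>. The singular power is kept only within
  distance 1; further away it is at most 1.\<close>

lemma nn_integral_abs_ln_le:
  fixes x :: real
  shows "(\<integral>\<^sup>+\<mu>. ennreal \<bar>ln \<bar>x - \<mu>\<bar>\<bar> * indicator {-real n..real n} \<mu> \<partial>lborel) \<le> ennreal (2 * real n * (\<bar>x\<bar> + real n) + 8 + 4 * real n)"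
proof -
  let ?I = "indicator {-real n..real n} :: real \<Rightarrow> ennreal"
  have pt: "ennreal \<bar>ln \<bar>x - \<mu>\<bar>\<bar> * ?I \<mu> \<le> ennreal (\<bar>x\<bar> + real n + 2) * ?I \<mu> + 2 * (ennreal (\<bar>x - \<mu>\<bar> powr (-1/2)) * indicator {-1..1} (x - \<mu>))" for \<mu>
  proof (cases "\<mu> \<in> {-real n..real n} \<and> x \<noteq> \<mu>")
    case True
    hence s: "\<bar>x - \<mu>\<bar> > 0" "\<bar>x - \<mu>\<bar> \<le> \<bar>x\<bar> + real n" by auto
    show ?thesis
    proof (cases "\<bar>x - \<mu>\<bar> \<le> 1")
      case le: True
      have "\<bar>ln \<bar>x - \<mu>\<bar>\<bar> \<le> (\<bar>x\<bar> + real n + 2) + 2 * \<bar>x - \<mu>\<bar> powr (-1/2)" using abs_ln_le[OF s(1)] s(2) by linarith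
      hence "ennreal \<bar>ln \<bar>x - \<mu>\<bar>\<bar> \<le> ennreal ((\<bar>x\<bar> + real n + 2) + 2 * \<bar>x - \<mu>\<bar> powr (-1/2))" by (rule ennreal_leI)
      also have "\<dots> = ennreal (\<bar>x\<bar> + real n + 2) + ennreal (2 * \<bar>x - \<mu>\<bar> powr (-1/2))" by (rule ennreal_plus) auto
      also have "ennreal (2 * \<bar>x - \<mu>\<bar> powr (-1/2)) = 2 * ennreal (\<bar>x - \<mu>\<bar> powr (-1/2))" by (simp add: ennreal_mult)
      finally show ?thesis using True le by (auto simp: indicator_def)
    next
      case gt: False
      have "1 \<le> \<bar>x - \<mu>\<bar> powr (1/2)" using gt by (intro ge_one_powr_ge_zero) auto
      hence "\<bar>x - \<mu>\<bar> powr (-1/2) \<le> 1" using powr_minus[of "\<bar>x - \<mu>\<bar>" "1/2"] by (simp add: inverse_le_1_iff)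
      hence "\<bar>ln \<bar>x - \<mu>\<bar>\<bar> \<le> \<bar>x\<bar> + real n + 2" using abs_ln_le[OF s(1)] s(2) by linarith
      hence "ennreal \<bar>ln \<bar>x - \<mu>\<bar>\<bar> \<le> ennreal (\<bar>x\<bar> + real n + 2)" by (rule ennreal_leI)
      thus ?thesis using True gt by (auto simp: indicator_def)
    qed
  qed auto
  have "(\<integral>\<^sup>+\<mu>. ennreal \<bar>ln \<bar>x - \<mu>\<bar>\<bar> * ?I \<mu> \<partial>lborel) \<le>
      (\<integral>\<^sup>+\<mu>. ennreal (\<bar>x\<bar> + real n + 2) * ?I \<mu> + 2 * (ennreal (\<bar>x - \<mu>\<bar> powr (-1/2)) * indicator {-1..1} (x - \<mu>)) \<partial>lborel)"
    using pt by (intro nn_integral_mono)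
  also have "\<dots> = (\<integral>\<^sup>+\<mu>. ennreal (\<bar>x\<bar> + real n + 2) * ?I \<mu> \<partial>lborel) + (\<integral>\<^sup>+\<mu>. 2 * (ennreal (\<bar>x - \<mu>\<bar> powr (-1/2)) * indicator {-1..1} (x - \<mu>)) \<partial>lborel)"
    by (rule nn_integral_add) measurable
  also have "(\<integral>\<^sup>+\<mu>. ennreal (\<bar>x\<bar> + real n + 2) * ?I \<mu> \<partial>lborel) = ennreal (\<bar>x\<bar> + real n + 2) * ennreal (2 * real n)"
    by (subst nn_integral_cmult_indicator) auto
  also have "(\<integral>\<^sup>+\<mu>. 2 * (ennreal (\<bar>x - \<mu>\<bar> powr (-1/2)) * indicator {-1..1} (x - \<mu>)) \<partial>lborel)
      = 2 * (\<integral>\<^sup>+\<mu>. ennreal (\<bar>x - \<mu>\<bar> powr (-1/2)) * indicator {-1..1} (x - \<mu>) \<partial>lborel)"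
    by (rule nn_integral_cmult) measurable
  also have "(\<integral>\<^sup>+\<mu>. ennreal (\<bar>x - \<mu>\<bar> powr (-1/2)) * indicator {-1..1} (x - \<mu>) \<partial>lborel) = (\<integral>\<^sup>+y. ennreal (\<bar>y\<bar> powr (-1/2)) * indicator {-1..1} y \<partial>lborel)"
    using nn_integral_real_affine[of "\<lambda>y. ennreal (\<bar>y\<bar> powr (-1/2)) * indicator {-1..1} y" "-1" x] by simp
  also have "ennreal (\<bar>x\<bar> + real n + 2) * ennreal (2 * real n) + 2 * (\<integral>\<^sup>+y. ennreal (\<bar>y\<bar> powr (-1/2)) * indicator {-1..1} y \<partial>lborel)
      \<le> ennreal (\<bar>x\<bar> + real n + 2) * ennreal (2 * real n) + 2 * 4"
    by (intro add_left_mono mult_left_mono nn_integral_inv_sqrt) simp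
  also have "\<dots> = ennreal (2 * real n * (\<bar>x\<bar> + real n) + 8 + 4 * real n)"
  proof -
    have "ennreal (\<bar>x\<bar> + real n + 2) * ennreal (2 * real n) = ennreal ((\<bar>x\<bar> + real n + 2) * (2 * real n))"
      by (rule ennreal_mult[symmetric]) auto
    moreover have "(2::ennreal) * 4 = ennreal 8" by simp
    moreover have "ennreal ((\<bar>x\<bar> + real n + 2) * (2 * real n)) + ennreal 8 = ennreal ((\<bar>x\<bar> + real n + 2) * (2 * real n) + 8)"
      by (rule ennreal_plus[symmetric]) auto
    ultimately show ?thesis by (simp only:) (simp add: algebra_simps)
  qed
  finally show ?thesis .
qed

text \<open>By Tonelli the double integral over a bounded range of \<mu> is finite, hence so is the
  inner one for almost every \<mu>. Level sets are null for almost every \<mu> because each point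
  lies on only one of them.\<close>

lemma AE_integrable_ln_abs_diff:
  fixes \<omega> :: "'a \<Rightarrow> real"
  assumes M: "finite_measure M" and w: "integrable M \<omega>"
  shows "AE \<mu> in lborel. integrable M (\<lambda>x. ln \<bar>\<omega> x - \<mu>\<bar>) \<and> (AE x in M. \<omega> x \<noteq> \<mu>)"
proof -
  interpret finite_measure M by fact
  interpret pair_sigma_finite M "lborel :: real measure" ..
  have [measurable]: "\<omega> \<in> borel_measurable M" using w by auto
  have "AE \<mu> in lborel. \<mu> \<in> {-real n..real n} \<longrightarrow> integrable M (\<lambda>x. ln \<bar>\<omega> x - \<mu>\<bar>)" for n :: nat
  proof -
    have "(\<integral>\<^sup>+\<mu>. (\<integral>\<^sup>+x. ennreal \<bar>ln \<bar>\<omega> x - \<mu>\<bar>\<bar> * indicator {-real n..real n} \<mu> \<partial>M) \<partial>lborel)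
        = (\<integral>\<^sup>+x. (\<integral>\<^sup>+\<mu>. ennreal \<bar>ln \<bar>\<omega> x - \<mu>\<bar>\<bar> * indicator {-real n..real n} \<mu> \<partial>lborel) \<partial>M)"
      by (rule Fubini') measurable
    also have "\<dots> \<le> (\<integral>\<^sup>+x. ennreal (2 * real n * (\<bar>\<omega> x\<bar> + real n) + 8 + 4 * real n) \<partial>M)"
      by (intro nn_integral_mono nn_integral_abs_ln_le)
    also have "\<dots> < \<infinity>"
    proof -
      have "integrable M (\<lambda>x. 2 * real n * (\<bar>\<omega> x\<bar> + real n) + 8 + 4 * real n)" using w by simp
      thus ?thesis by (subst nn_integral_eq_integral) auto
    qed
    finally have "AE \<mu> in lborel. (\<integral>\<^sup>+x. ennreal \<bar>ln \<bar>\<omega> x - \<mu>\<bar>\<bar> * indicator {-real n..real n} \<mu> \<partial>M) \<noteq> \<infinity>"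
      by (intro nn_integral_PInf_AE) (auto simp: less_top)
    thus ?thesis
    proof eventually_elim
      case (elim \<mu>)
      show ?case
      proof
        assume "\<mu> \<in> {-real n..real n}"
        hence "(\<integral>\<^sup>+x. ennreal \<bar>ln \<bar>\<omega> x - \<mu>\<bar>\<bar> \<partial>M) < \<infinity>" using elim by (simp add: less_top)
        thus "integrable M (\<lambda>x. ln \<bar>\<omega> x - \<mu>\<bar>)" by (intro integrableI_bounded) auto
      qed
    qed
  qed
  hence "AE \<mu> in lborel. \<forall>n::nat. \<mu> \<in> {-real n..real n} \<longrightarrow> integrable M (\<lambda>x. ln \<bar>\<omega> x - \<mu>\<bar>)"
    unfolding AE_all_countable by blast
  moreover have "AE \<mu> in lborel. AE x in M. \<omega> x \<noteq> \<mu>"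
  proof -
    have "AE x in M. AE \<mu> in lborel. \<omega> x \<noteq> \<mu>"
    proof (rule AE_I2)
      fix x
      show "AE \<mu> in lborel. \<omega> x \<noteq> \<mu>" using AE_lborel_singleton[of "\<omega> x"] by eventually_elim auto
    qed
    thus ?thesis by (subst AE_commute[symmetric]) measurable
  qed
  ultimately show ?thesis
  proof eventually_elim
    case (elim \<mu>)
    obtain n :: nat where "\<bar>\<mu>\<bar> \<le> real n" using real_arch_simple by blast
    hence "\<mu> \<in> {-real n..real n}" by auto
    thus ?case using elim by blast
  qed
qed

subsection \<open>Arcs and partial fractions\<close>

text \<open>Rotation lets an arc start at 1, so that its angles form an interval inside
  \<open>{0..<2 * pi}\<close>. The proof moves the part of the integral that passes
  \<open>2 * pi\<close> back by periodicity.\<close>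

lemma distr_circle_rotate:
  assumes a: "cmod a = 1"
  shows "distr circle_measure borel (\<lambda>\<zeta>. a * \<zeta>) = circle_measure"
proof (rule measure_eqI)
  define s where "s = Arg2pi a"
  have s: "0 \<le> s" "s < 2 * pi" using Arg2pi[of a] by (auto simp: s_def)
  have as: "a = cis s" using complex_norm_eq_1_exp[of a] a by (simp add: s_def cis_conv_exp)
  fix B assume "B \<in> sets (distr circle_measure borel (\<lambda>\<zeta>. a * \<zeta>))"
  hence B[measurable]: "B \<in> sets borel" by simp
  have em: "emeasure circle_measure C = ennreal (1 / (2 * pi)) * (\<integral>\<^sup>+t. indicator C (cis t) * indicator {0..<2 * pi} t \<partial>lborel)"
    if [measurable]: "C \<in> sets borel" for C
  proof -
    have "emeasure circle_measure C = emeasure (uniform_measure lborel {0..<2 * pi}) (cis -` C)"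
      unfolding circle_measure_def by (subst emeasure_distr) auto
    also have "\<dots> = (\<integral>\<^sup>+t. ennreal (indicator {0..<2 * pi} t / (2 * pi)) * indicator (cis -` C) t \<partial>lborel)"
      unfolding uniform_2pi_eq_density
    proof (rule emeasure_density)
      have "cis -` C \<inter> space borel \<in> sets borel" by (rule measurable_sets[OF measurable_cis]) fact
      thus "cis -` C \<in> sets lborel" by simp
    qed auto
    also have "\<dots> = (\<integral>\<^sup>+t. ennreal (1 / (2 * pi)) * (indicator C (cis t) * indicator {0..<2 * pi} t) \<partial>lborel)"
      by (intro nn_integral_cong) (auto simp: indicator_def)
    also have "\<dots> = ennreal (1 / (2 * pi)) * (\<integral>\<^sup>+t. indicator C (cis t) * indicator {0..<2 * pi} t \<partial>lborel)"
      by (rule nn_integral_cmult) measurable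
    finally show ?thesis .
  qed
  let ?g = "\<lambda>t. indicator B (cis t) :: ennreal"
  have per: "?g (t + 2 * pi) = ?g t" for t by (simp add: cis_mult[symmetric])
  have split: "(\<integral>\<^sup>+t. ?g t * indicator {p..<r} t \<partial>lborel) = (\<integral>\<^sup>+t. ?g t * indicator {p..<q} t \<partial>lborel) + (\<integral>\<^sup>+t. ?g t * indicator {q..<r} t \<partial>lborel)"
    if "p \<le> q" "q \<le> r" for p q r :: real
  proof -
    have "(\<integral>\<^sup>+t. ?g t * indicator {p..<r} t \<partial>lborel) = (\<integral>\<^sup>+t. ?g t * indicator {p..<q} t + ?g t * indicator {q..<r} t \<partial>lborel)"
      using that by (intro nn_integral_cong) (auto simp: indicator_def)
    also have "\<dots> = (\<integral>\<^sup>+t. ?g t * indicator {p..<q} t \<partial>lborel) + (\<integral>\<^sup>+t. ?g t * indicator {q..<r} t \<partial>lborel)"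
      by (rule nn_integral_add) measurable
    finally show ?thesis .
  qed
  have "emeasure (distr circle_measure borel (\<lambda>\<zeta>. a * \<zeta>)) B = emeasure circle_measure ((\<lambda>\<zeta>. a * \<zeta>) -` B)"
    by (subst emeasure_distr) auto
  also have "\<dots> = ennreal (1 / (2 * pi)) * (\<integral>\<^sup>+t. indicator ((\<lambda>\<zeta>. a * \<zeta>) -` B) (cis t) * indicator {0..<2 * pi} t \<partial>lborel)"
  proof (rule em)
    have "(\<lambda>\<zeta>. a * \<zeta>) -` B \<inter> space borel \<in> sets borel" by (rule measurable_sets[OF _ B]) measurable
    thus "(\<lambda>\<zeta>. a * \<zeta>) -` B \<in> sets borel" by simp
  qed
  also have "(\<lambda>t. indicator ((\<lambda>\<zeta>. a * \<zeta>) -` B) (cis t) * indicator {0..<2 * pi} t) = (\<lambda>t. ?g (s + 1 * t) * indicator {s..<s + 2 * pi} (s + 1 * t))"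
    by (auto simp: fun_eq_iff indicator_def as cis_mult)
  also have "(\<integral>\<^sup>+t. ?g (s + 1 * t) * indicator {s..<s + 2 * pi} (s + 1 * t) \<partial>lborel) = (\<integral>\<^sup>+t. ?g t * indicator {s..<s + 2 * pi} t \<partial>lborel)"
    using nn_integral_real_affine[of "\<lambda>t. ?g t * indicator {s..<s + 2 * pi} t" 1 s] by simp
  also have "\<dots> = (\<integral>\<^sup>+t. ?g t * indicator {s..<2 * pi} t \<partial>lborel) + (\<integral>\<^sup>+t. ?g t * indicator {2 * pi..<s + 2 * pi} t \<partial>lborel)"
    using s by (intro split) auto
  also have "(\<integral>\<^sup>+t. ?g t * indicator {2 * pi..<s + 2 * pi} t \<partial>lborel) = (\<integral>\<^sup>+t. ?g (2 * pi + 1 * t) * indicator {2 * pi..<s + 2 * pi} (2 * pi + 1 * t) \<partial>lborel)"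
    using nn_integral_real_affine[of "\<lambda>t. ?g t * indicator {2 * pi..<s + 2 * pi} t" 1 "2 * pi"] by simp
  also have "\<dots> = (\<integral>\<^sup>+t. ?g t * indicator {0..<s} t \<partial>lborel)"
    using per by (intro nn_integral_cong) (auto simp: indicator_def add.commute)
  also have "(\<integral>\<^sup>+t. ?g t * indicator {s..<2 * pi} t \<partial>lborel) + (\<integral>\<^sup>+t. ?g t * indicator {0..<s} t \<partial>lborel) = (\<integral>\<^sup>+t. ?g t * indicator {0..<2 * pi} t \<partial>lborel)"
    using split[of 0 s "2 * pi"] s by (simp add: add.commute)
  also have "ennreal (1 / (2 * pi)) * \<dots> = emeasure circle_measure B" by (rule em[symmetric]) fact
  finally show "emeasure (distr circle_measure borel (\<lambda>\<zeta>. a * \<zeta>)) B = emeasure circle_measure B" .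
qed simp

lemma cis_Arg2pi_div:
  assumes "cmod a = 1" "cmod b = 1"
  shows "b = a * cis (Arg2pi (b / a))"
proof -
  have "cmod (b / a) = 1" using assms by (simp add: norm_divide)
  hence "cis (Arg2pi (b / a)) = b / a" using complex_norm_eq_1_exp[of "b / a"] by (simp add: cis_conv_exp)
  thus ?thesis using assms by auto
qed

lemma cis_eq_cis_2pi:
  assumes "cis t = cis s" "0 \<le> t" "t < 2 * pi" "0 \<le> s" "s < 2 * pi"
  shows "t = s"
proof -
  have "Arg2pi (cis x) = x" if "0 \<le> x" "x < 2 * pi" for x using that by (simp add: cis_conv_exp Arg2pi_exp)
  thus ?thesis using assms by metis
qed

lemma open_arc_iff:
  assumes a: "cmod a = 1" and t: "0 \<le> t" "t < 2 * pi"
  shows "a * cis t \<in> open_arc a b \<longleftrightarrow> 0 < t \<and> t < Arg2pi (b / a)"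
proof
  assume "a * cis t \<in> open_arc a b"
  then obtain t' where t': "a * cis t = a * cis t'" "0 < t'" "t' < Arg2pi (b / a)" by (auto simp: open_arc_def)
  have "cis t = cis t'" using t'(1) a by auto
  moreover have "t' < 2 * pi" using t' Arg2pi[of "b / a"] by auto
  ultimately have "t = t'" using t t' by (intro cis_eq_cis_2pi) auto
  thus "0 < t \<and> t < Arg2pi (b / a)" using t' by simp
qed (auto simp: open_arc_def)

lemma closed_arc_subset_closure:
  assumes ab: "cmod a = 1" "cmod b = 1" "a \<noteq> b" and t: "0 \<le> t" "t \<le> Arg2pi (b / a)"
  shows "a * cis t \<in> closure (open_arc a b)"
proof -
  have "Arg2pi (b / a) \<noteq> 0" using cis_Arg2pi_div[OF ab(1,2)] ab(3) by auto
  hence pos: "0 < Arg2pi (b / a)" using Arg2pi[of "b / a"] by linarith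
  have "(\<lambda>t. a * cis t) ` closure {0<..<Arg2pi (b / a)} \<subseteq> closure ((\<lambda>t. a * cis t) ` {0<..<Arg2pi (b / a)})"
    by (intro continuous_image_closure_subset[of UNIV] continuous_intros) auto
  moreover have "(\<lambda>t. a * cis t) ` {0<..<Arg2pi (b / a)} = open_arc a b" by (auto simp: open_arc_def)
  moreover have "closure {0<..<Arg2pi (b / a)} = {0..Arg2pi (b / a)}" using pos by simp
  ultimately have "(\<lambda>t. a * cis t) ` {0..Arg2pi (b / a)} \<subseteq> closure (open_arc a b)" by simp
  moreover have "a * cis t \<in> (\<lambda>t. a * cis t) ` {0..Arg2pi (b / a)}" using t by (intro imageI) simp
  ultimately show ?thesis by blast
qed

lemma measurable_open_arc:
  assumes a: "cmod a = 1"
  shows "open_arc a b \<in> sets borel"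
proof -
  have "open_arc a b = {\<zeta> \<in> space borel. cmod \<zeta> = 1 \<and> 0 < Arg2pi (\<zeta> / a) \<and> Arg2pi (\<zeta> / a) < Arg2pi (b / a)}"
  proof (intro set_eqI iffI)
    fix \<zeta> assume "\<zeta> \<in> open_arc a b"
    then obtain t where t: "\<zeta> = a * cis t" "0 < t" "t < Arg2pi (b / a)" by (auto simp: open_arc_def)
    have "Arg2pi (\<zeta> / a) = t" using a t Arg2pi[of "b / a"] by (auto simp: cis_conv_exp Arg2pi_exp)
    thus "\<zeta> \<in> {\<zeta> \<in> space borel. cmod \<zeta> = 1 \<and> 0 < Arg2pi (\<zeta> / a) \<and> Arg2pi (\<zeta> / a) < Arg2pi (b / a)}" using t a by (simp add: norm_mult)
  next
    fix \<zeta> assume z: "\<zeta> \<in> {\<zeta> \<in> space borel. cmod \<zeta> = 1 \<and> 0 < Arg2pi (\<zeta> / a) \<and> Arg2pi (\<zeta> / a) < Arg2pi (b / a)}"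
    have "\<zeta> = a * cis (Arg2pi (\<zeta> / a))" using z a by (intro cis_Arg2pi_div) auto
    thus "\<zeta> \<in> open_arc a b" using z by (auto simp: open_arc_def)
  qed
  also have "\<dots> \<in> sets borel" by measurable
  finally show ?thesis .
qed

text \<open>After rotation the integrand is \<open>H (w * cis (- t))\<close> with
  \<open>cmod w < 1\<close>, whose primitive is
  \<open>t - 2 * \<i> * Ln (1 - w * cis (- t))\<close>; the argument of \<open>Ln\<close> has
  positive real part and never meets the cut.\<close>

lemma integral_H_arc:
  assumes ab: "cmod a = 1" "cmod b = 1" and z: "cmod z < 1"
  shows "(LINT \<zeta>|circle_measure. indicator (open_arc a b) \<zeta> * H (z * cnj \<zeta>)) =
    1 / (2 * pi) * (Arg2pi (b / a) - 2 * \<i> * (Ln (1 - z * cnj b) - Ln (1 - z * cnj a)))"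
proof -
  define \<theta> where "\<theta> = Arg2pi (b / a)"
  have th: "0 \<le> \<theta>" "\<theta> < 2 * pi" using Arg2pi[of "b / a"] by (auto simp: \<theta>_def)
  define w where "w = z * cnj a"
  have w: "cmod w < 1" using z ab by (simp add: w_def norm_mult)
  have wb: "w * cis (- \<theta>) = z * cnj b"
    using cis_Arg2pi_div[OF ab] by (metis \<theta>_def w_def cis_cnj complex_cnj_mult mult.assoc)
  have [measurable]: "H \<in> borel_measurable borel" unfolding H_def by measurable
  have [measurable]: "open_arc a b \<in> sets borel" by (rule measurable_open_arc[OF ab(1)])
  have "(LINT \<zeta>|circle_measure. indicator (open_arc a b) \<zeta> * H (z * cnj \<zeta>)) = (LINT \<zeta>|distr circle_measure borel (\<lambda>\<zeta>. a * \<zeta>). indicator (open_arc a b) \<zeta> * H (z * cnj \<zeta>))"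
    by (simp add: distr_circle_rotate[OF ab(1)])
  also have "\<dots> = (LINT \<zeta>|circle_measure. indicator (open_arc a b) (a * \<zeta>) * H (z * cnj (a * \<zeta>)))"
    by (rule integral_distr) measurable
  also have "\<dots> = (1 / (2 * pi)) *\<^sub>R (LINT t:{0..<2 * pi}|lborel. indicator (open_arc a b) (a * cis t) * H (z * cnj (a * cis t)))"
    by (rule integral_circle) measurable
  also have "(LINT t:{0..<2 * pi}|lborel. indicator (open_arc a b) (a * cis t) * H (z * cnj (a * cis t))) = (LINT t|lborel. indicator {0..\<theta>} t *\<^sub>R H (w * cis (- t)))"
    unfolding set_lebesgue_integral_def
  proof (rule integral_cong_AE)
    show "AE t in lborel. indicator {0..<2 * pi} t *\<^sub>R (indicator (open_arc a b) (a * cis t) * H (z * cnj (a * cis t))) = indicator {0..\<theta>} t *\<^sub>R H (w * cis (- t))"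
      using AE_lborel_singleton[of 0] AE_lborel_singleton[of \<theta>]
    proof eventually_elim
      case (elim t)
      have "z * cnj (a * cis t) = w * cis (- t)" by (simp add: w_def cis_cnj mult.assoc)
      thus ?case using elim open_arc_iff[OF ab(1), of t b] th by (auto simp: indicator_def \<theta>_def)
    qed
  qed measurable
  also have "\<dots> = (\<theta> - 2 * \<i> * Ln (1 - w * cis (- \<theta>))) - (0 - 2 * \<i> * Ln (1 - w * cis (- 0)))"
  proof (rule has_bochner_integral_integral_eq, rule has_bochner_integral_FTC_Icc[OF th(1), where F="\<lambda>t. t - 2 * \<i> * Ln (1 - w * cis (- t))", simplified of_real_0])
    fix t :: real
    have n: "cmod (w * cis (- t)) < 1" using w by (simp add: norm_mult)
    have Re1: "Re (1 - w * cis (- t)) > 0" using n abs_Re_le_cmod[of "w * cis (- t)"] by simp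
    hence nn: "1 - w * cis (- t) \<notin> \<real>\<^sub>\<le>\<^sub>0" using complex_nonpos_Reals_iff by auto
    have ne: "1 - w * cis (- t) \<noteq> 0"
    proof
      assume "1 - w * cis (- t) = 0"
      hence "w * cis (- t) = 1" by simp
      thus False using n by (metis norm_one less_irrefl)
    qed
    have c: "((\<lambda>t. cis (- t)) has_vector_derivative - \<i> * cis (- t)) (at t within {0..\<theta>})"
    proof -
      have e: "((\<lambda>x. exp (\<i> * x)) has_field_derivative \<i> * exp (\<i> * of_real (- t))) (at (of_real (- t)))"
        by (auto intro!: derivative_eq_intros)
      have m: "((\<lambda>t. complex_of_real (- t)) has_vector_derivative complex_of_real (- 1)) (at t within {0..\<theta>})"
        by (rule has_vector_derivative_of_real) (auto intro!: derivative_eq_intros)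
      have "((\<lambda>x. exp (\<i> * x)) \<circ> (\<lambda>t. complex_of_real (- t)) has_vector_derivative complex_of_real (- 1) * (\<i> * exp (\<i> * of_real (- t)))) (at t within {0..\<theta>})"
        by (rule field_vector_diff_chain_within[OF m has_field_derivative_at_within[OF e]])
      thus ?thesis by (simp add: o_def cis_conv_exp)
    qed
    have inner: "((\<lambda>t. 1 - w * cis (- t)) has_vector_derivative (- (w * (- \<i> * cis (- t))))) (at t within {0..\<theta>})"
      using c by (auto intro!: derivative_eq_intros)
    have "(Ln has_field_derivative inverse (1 - w * cis (- t))) (at (1 - w * cis (- t)))"
      by (rule has_field_derivative_Ln[OF nn])
    from field_vector_diff_chain_within[OF inner has_field_derivative_at_within[OF this]]
    have "((\<lambda>t. Ln (1 - w * cis (- t))) has_vector_derivative (- (w * (- \<i> * cis (- t)))) * inverse (1 - w * cis (- t))) (at t within {0..\<theta>})"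
      by (simp add: o_def)
    hence "((\<lambda>t. of_real t - 2 * \<i> * Ln (1 - w * cis (- t))) has_vector_derivative (1 - 2 * \<i> * ((- (w * (- \<i> * cis (- t)))) * inverse (1 - w * cis (- t))))) (at t within {0..\<theta>})"
      by (auto intro!: derivative_eq_intros)
    moreover have "1 - 2 * \<i> * ((- (w * (- \<i> * cis (- t)))) * inverse (1 - w * cis (- t))) = H (w * cis (- t))"
      unfolding H_def using ne by (simp add: field_simps)
    ultimately show "((\<lambda>t. of_real t - 2 * \<i> * Ln (1 - w * cis (- t))) has_vector_derivative H (w * cis (- t))) (at t within {0..\<theta>})"
      by simp
  next
    show "continuous_on {0..\<theta>} (\<lambda>t. H (w * cis (- t)))" unfolding H_def
    proof (intro continuous_intros ballI)
      fix t
      have "cmod (w * cis (- t)) < 1" using w by (simp add: norm_mult)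
      thus "1 - w * cis (- t) \<noteq> 0" by auto
    qed
  qed
  finally show ?thesis unfolding wb by (simp add: scaleR_conv_of_real \<theta>_def w_def algebra_simps)
qed

text \<open>Induction over the poles with \<open>z\<close> arbitrary: the factor of a new pole
  \<open>x\<close> splits each old fraction in two, and the coefficients collected at
  \<open>x\<close> add up to the induction hypothesis evaluated at
  \<open>z = 1 / q x\<close>.\<close>

lemma partial_fractions_prod:
  fixes p q :: "'i \<Rightarrow> 'a::field"
  assumes "finite S" "inj_on q S" "\<And>l. l \<in> S \<Longrightarrow> q l \<noteq> 0" "\<And>l. l \<in> S \<Longrightarrow> z * q l \<noteq> 1"
  shows "(\<Prod>l\<in>S. (1 - z * p l) / (1 - z * q l)) = (\<Prod>l\<in>S. p l / q l) +
    (\<Sum>j\<in>S. ((\<Prod>l\<in>S. 1 - p l / q j) / (\<Prod>l\<in>S - {j}. 1 - q l / q j)) / (1 - z * q j))"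
  using assms
proof (induction S arbitrary: z rule: finite_induct)
  case empty thus ?case by simp
next
  case (insert x S)
  define A where "A = (\<Prod>l\<in>S. p l / q l)"
  define r where "r j = (\<Prod>l\<in>S. 1 - p l / q j) / (\<Prod>l\<in>S - {j}. 1 - q l / q j)" for j
  have qx: "q x \<noteq> 0" "z * q x \<noteq> 1" using insert.prems by auto
  have qj: "q j \<noteq> 0" "z * q j \<noteq> 1" "q j \<noteq> q x" if "j \<in> S" for j
    using insert.prems insert.hyps that by (auto simp: inj_on_def)
  have IH: "(\<Prod>l\<in>S. (1 - z * p l) / (1 - z * q l)) = A + (\<Sum>j\<in>S. r j / (1 - z * q j))"
    if "\<And>l. l \<in> S \<Longrightarrow> z * q l \<noteq> 1" for z
    unfolding A_def r_def using insert.prems that by (intro insert.IH) auto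
  have at: "(\<Prod>l\<in>S. (1 - p l / q x) / (1 - q l / q x)) = A + (\<Sum>j\<in>S. r j / (1 - q j / q x))"
    using IH[of "1 / q x"] qx qj by (simp add: field_simps)
  have "(\<Prod>l\<in>insert x S. (1 - z * p l) / (1 - z * q l)) = (1 - z * p x) / (1 - z * q x) * (A + (\<Sum>j\<in>S. r j / (1 - z * q j)))"
    using insert.hyps IH[of z] qj by simp
  also have "(1 - z * p x) / (1 - z * q x) = p x / q x + (1 - p x / q x) / (1 - z * q x)"
    using qx by (simp add: divide_simps) (simp add: algebra_simps)
  also have "(p x / q x + (1 - p x / q x) / (1 - z * q x)) * (A + (\<Sum>j\<in>S. r j / (1 - z * q j)))
      = p x / q x * A + (1 - p x / q x) / (1 - z * q x) * A + (\<Sum>j\<in>S. (p x / q x + (1 - p x / q x) / (1 - z * q x)) * (r j / (1 - z * q j)))"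
    by (simp add: distrib_left distrib_right sum_distrib_left sum.distrib add_ac)
  also have "(\<Sum>j\<in>S. (p x / q x + (1 - p x / q x) / (1 - z * q x)) * (r j / (1 - z * q j)))
      = (\<Sum>j\<in>S. r j * ((1 - p x / q j) / (1 - q x / q j)) / (1 - z * q j) + (1 - p x / q x) / (1 - z * q x) * (r j / (1 - q j / q x)))"
  proof (intro sum.cong refl)
    fix j assume j: "j \<in> S"
    have swap: "r * (P / D) = P * (r / D)" for r P D :: 'a by (simp add: mult.commute)
    have n: "q j \<noteq> 0" "q x \<noteq> 0" "1 - z * q j \<noteq> 0" "1 - z * q x \<noteq> 0" "q j - q x \<noteq> 0" "q x - q j \<noteq> 0"
      using qj[OF j] qx by auto
    have e1: "1 - q x / q j = (q j - q x) / q j" "1 - q j / q x = (q x - q j) / q x" "1 - p x / q j = (q j - p x) / q j" "1 - p x / q x = (q x - p x) / q x"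
      using n by (simp_all add: field_simps)
    have "(p x / q x + ((q x - p x) / q x) / (1 - z * q x)) / (1 - z * q j) = ((q j - p x) / (q j - q x)) / (1 - z * q j) + ((q x - p x) / (1 - z * q x)) / (q x - q j)"
      using n by (simp add: divide_simps) (simp add: algebra_simps)
    hence "r j * ((p x / q x + ((q x - p x) / q x) / (1 - z * q x)) / (1 - z * q j)) = r j * (((q j - p x) / (q j - q x)) / (1 - z * q j)) + r j * (((q x - p x) / (1 - z * q x)) / (q x - q j))"
      by (simp only: distrib_left)
    moreover have "r j * ((p x / q x + ((q x - p x) / q x) / (1 - z * q x)) / (1 - z * q j)) = (p x / q x + ((q x - p x) / q x) / (1 - z * q x)) * (r j / (1 - z * q j))"
      by (rule swap)
    moreover have "r j * (((q j - p x) / (q j - q x)) / (1 - z * q j)) = r j * (((q j - p x) / q j) / ((q j - q x) / q j)) / (1 - z * q j)"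
      using n by simp
    moreover have "r j * (((q x - p x) / (1 - z * q x)) / (q x - q j)) = ((q x - p x) / q x) / (1 - z * q x) * (r j / ((q x - q j) / q x))"
      using n by simp
    ultimately show "(p x / q x + (1 - p x / q x) / (1 - z * q x)) * (r j / (1 - z * q j)) =
        r j * ((1 - p x / q j) / (1 - q x / q j)) / (1 - z * q j) + (1 - p x / q x) / (1 - z * q x) * (r j / (1 - q j / q x))"
      unfolding e1 by (simp only:)
  qed
  also have "p x / q x * A + (1 - p x / q x) / (1 - z * q x) * A + \<dots>
      = p x / q x * A + (\<Sum>j\<in>S. r j * ((1 - p x / q j) / (1 - q x / q j)) / (1 - z * q j)) + (1 - p x / q x) / (1 - z * q x) * (A + (\<Sum>j\<in>S. r j / (1 - q j / q x)))"
    by (simp add: sum.distrib sum_distrib_left distrib_left add_ac)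
  also have "\<dots> = (\<Prod>l\<in>insert x S. p l / q l) + (\<Sum>j\<in>insert x S. ((\<Prod>l\<in>insert x S. 1 - p l / q j) / (\<Prod>l\<in>insert x S - {j}. 1 - q l / q j)) / (1 - z * q j))"
  proof -
    have x: "insert x S - {x} = S" using insert.hyps by auto
    have "((\<Prod>l\<in>insert x S. 1 - p l / q j) / (\<Prod>l\<in>insert x S - {j}. 1 - q l / q j)) / (1 - z * q j) = r j * ((1 - p x / q j) / (1 - q x / q j)) / (1 - z * q j)" if j: "j \<in> S" for j
    proof -
      have "insert x S - {j} = insert x (S - {j})" using j insert.hyps by auto
      thus ?thesis using insert.hyps by (simp add: r_def mult_ac)
    qed
    hence s: "(\<Sum>j\<in>S. ((\<Prod>l\<in>insert x S. 1 - p l / q j) / (\<Prod>l\<in>insert x S - {j}. 1 - q l / q j)) / (1 - z * q j)) = (\<Sum>j\<in>S. r j * ((1 - p x / q j) / (1 - q x / q j)) / (1 - z * q j))"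
      by (intro sum.cong refl) auto
    have "(1 - p x / q x) / (1 - z * q x) * (A + (\<Sum>j\<in>S. r j / (1 - q j / q x))) = ((\<Prod>l\<in>insert x S. 1 - p l / q x) / (\<Prod>l\<in>insert x S - {x}. 1 - q l / q x)) / (1 - z * q x)"
      unfolding at[symmetric] x using insert.hyps by (simp add: prod_dividef)
    thus ?thesis unfolding sum.insert[OF insert.hyps] s using insert.hyps by (simp add: A_def add_ac)
  qed
  finally show ?case .
qed

lemma one_minus_cis: "1 - cis t = of_real (2 * sin (t / 2)) * (- \<i> * cis (t / 2))"
proof -
  have "cos t = 1 - 2 * (sin (t / 2))\<^sup>2" using cos_double_sin[of "t / 2"] by simp
  moreover have "sin t = 2 * sin (t / 2) * cos (t / 2)" using sin_double[of "t / 2"] by simp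
  ultimately show ?thesis by (simp add: complex_eq_iff power2_eq_square)
qed

text \<open>The argument of \<open>1 - cis t\<close> is \<open>(t - pi) / 2\<close> for
  \<open>t\<close> between 0 and \<open>2 * pi\<close>; here \<open>t\<close> is the opening angle
  of the arc.\<close>

lemma phase_same_arc:
  assumes ab: "cmod a = 1" "cmod b = 1"
  shows "1 - b * cnj a = - \<i> * cis (Arg2pi (b / a) / 2) * of_real (cmod (b - a))"
proof -
  define \<theta> where "\<theta> = Arg2pi (b / a)"
  have th: "0 \<le> \<theta>" "\<theta> < 2 * pi" using Arg2pi[of "b / a"] by (auto simp: \<theta>_def)
  have aa: "a * cnj a = 1" using ab by (simp add: complex_norm_square[symmetric])
  have "b * cnj a = cis \<theta> * (a * cnj a)" using cis_Arg2pi_div[OF ab] by (simp add: \<theta>_def mult_ac)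
  hence e: "1 - b * cnj a = of_real (2 * sin (\<theta> / 2)) * (- \<i> * cis (\<theta> / 2))" using one_minus_cis[of \<theta>] aa by simp
  have sn: "sin (\<theta> / 2) \<ge> 0" using th by (intro sin_ge_zero) auto
  have "cmod (b - a) = cmod ((b - a) * cnj a)" using ab by (simp add: norm_mult)
  also have "(b - a) * cnj a = - (1 - b * cnj a)" using aa by (simp add: algebra_simps)
  also have "cmod \<dots> = 2 * sin (\<theta> / 2)" unfolding norm_minus_cancel e using sn by (simp add: norm_mult)
  finally have "cmod (b - a) = 2 * sin (\<theta> / 2)" .
  thus ?thesis unfolding e by (simp add: \<theta>_def mult_ac)
qed

text \<open>Inscribed angle theorem: from any point of the circle off the closed arc, the chord is
  seen under half the opening angle, so the phase of the quotient does not depend on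
  \<open>x\<close>. Both sines are positive because the angle of \<open>x\<close>, counted from
  \<open>a\<close>, exceeds that of \<open>b\<close>.\<close>

lemma phase_other_arc:
  assumes ab: "cmod a = 1" "cmod b = 1" and x: "cmod x = 1"
    and out: "\<And>t. 0 \<le> t \<Longrightarrow> t \<le> Arg2pi (b / a) \<Longrightarrow> x \<noteq> a * cis t"
  shows "(1 - x * cnj a) / (1 - x * cnj b) = cis (Arg2pi (b / a) / 2) * of_real (cmod (x - a) / cmod (x - b))"
proof -
  define \<theta> where "\<theta> = Arg2pi (b / a)"
  define \<tau> where "\<tau> = Arg2pi (x / a)"
  have b: "0 \<le> \<theta>" "\<theta> < 2 * pi" "0 \<le> \<tau>" "\<tau> < 2 * pi" using Arg2pi[of "b / a"] Arg2pi[of "x / a"] by (auto simp: \<theta>_def \<tau>_def)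
  have xa: "x = a * cis \<tau>" and ba: "b = a * cis \<theta>" unfolding \<tau>_def \<theta>_def by (intro cis_Arg2pi_div ab x)+
  have lt: "\<theta> < \<tau>" using out[of \<tau>] b xa by (force simp: \<theta>_def)
  have aa: "a * cnj a = 1" "b * cnj b = 1" using ab by (simp_all add: complex_norm_square[symmetric])
  have "x * cnj a = cis \<tau> * (a * cnj a)" unfolding xa by (simp add: mult_ac)
  hence e1: "1 - x * cnj a = of_real (2 * sin (\<tau> / 2)) * (- \<i> * cis (\<tau> / 2))" using one_minus_cis[of \<tau>] aa by simp
  have "x * cnj b = cis (\<tau> - \<theta>) * (a * cnj a)" unfolding xa ba by (simp add: cis_divide[symmetric] divide_inverse cis_inverse cis_cnj mult_ac)
  hence e2: "1 - x * cnj b = of_real (2 * sin ((\<tau> - \<theta>) / 2)) * (- \<i> * cis ((\<tau> - \<theta>) / 2))" using one_minus_cis[of "\<tau> - \<theta>"] aa by simp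
  have s1: "sin (\<tau> / 2) > 0" using b lt by (intro sin_gt_zero) auto
  have s2: "sin ((\<tau> - \<theta>) / 2) > 0" using b lt by (intro sin_gt_zero) auto
  have "cmod (x - a) = cmod ((x - a) * cnj a)" using ab by (simp add: norm_mult)
  also have "(x - a) * cnj a = - (1 - x * cnj a)" using aa by (simp add: algebra_simps)
  also have "cmod \<dots> = 2 * sin (\<tau> / 2)" unfolding norm_minus_cancel e1 using s1 by (simp add: norm_mult)
  finally have n1: "cmod (x - a) = 2 * sin (\<tau> / 2)" .
  have "cmod (x - b) = cmod ((x - b) * cnj b)" using ab by (simp add: norm_mult)
  also have "(x - b) * cnj b = - (1 - x * cnj b)" using aa by (simp add: algebra_simps)
  also have "cmod \<dots> = 2 * sin ((\<tau> - \<theta>) / 2)" unfolding norm_minus_cancel e2 using s2 by (simp add: norm_mult)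
  finally have n2: "cmod (x - b) = 2 * sin ((\<tau> - \<theta>) / 2)" .
  have "cis (\<tau> / 2) = cis (\<theta> / 2) * cis ((\<tau> - \<theta>) / 2)" by (simp add: cis_mult diff_divide_distrib)
  thus ?thesis unfolding e1 e2 n1 n2 using s2 by (simp add: \<theta>_def)
qed

subsection \<open>The jump formula for finitely many arcs\<close>

locale disjoint_arcs =
  fixes m :: nat and a b :: "nat \<Rightarrow> complex"
  assumes unit: "\<And>j. j \<in> {1..m} \<Longrightarrow> cmod (a j) = 1 \<and> cmod (b j) = 1 \<and> a j \<noteq> b j"
    and disj: "disjoint_family_on (\<lambda>j. closure (open_arc (a j) (b j))) {1..m}"
begin

abbreviation "\<theta> l \<equiv> Arg2pi (b l / a l)"

definition "\<Theta> = (\<Sum>l = 1..m. \<theta> l)"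

definition \<Gamma> :: "complex set" where "\<Gamma> = (\<Union>j\<in>{1..m}. open_arc (a j) (b j))"

definition Q :: "complex \<Rightarrow> complex" where
  "Q z = (\<Prod>l = 1..m. (1 - z * cnj (a l)) powr (- 1/2) * (1 - z * cnj (b l)) powr (1/2))"

text \<open>The rational function with \<open>Q z * Q z * P z = 1\<close>; unlike \<open>Q\<close>
  it is accessible to partial fractions.\<close>

definition P :: "complex \<Rightarrow> complex" where
  "P z = (\<Prod>l = 1..m. (1 - z * cnj (a l)) / (1 - z * cnj (b l)))"

text \<open>Disjointness of the closures, and not only of the open arcs, enters here: an endpoint
  must not touch another arc.\<close>

lemma end_not_in_other_arc:
  assumes j: "j \<in> {1..m}" and l: "l \<in> {1..m}" "l \<noteq> j" and t: "0 \<le> t" "t \<le> \<theta> l"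
  shows "b j \<noteq> a l * cis t"
proof
  assume eq: "b j = a l * cis t"
  have "b j \<in> closure (open_arc (a l) (b l))"
    unfolding eq using unit[OF l(1)] t by (intro closed_arc_subset_closure) auto
  moreover have "b j = a j * cis (\<theta> j)" using unit[OF j] by (intro cis_Arg2pi_div) auto
  hence "b j \<in> closure (open_arc (a j) (b j))"
    using closed_arc_subset_closure[of "a j" "b j" "\<theta> j"] unit[OF j] Arg2pi[of "b j / a j"] by simp
  ultimately show False using disj j l unfolding disjoint_family_on_def by blast
qed

lemma b_inj: "inj_on b {1..m}"
proof (rule inj_onI, rule ccontr)
  fix j l assume h: "j \<in> {1..m}" "l \<in> {1..m}" "b j = b l" "j \<noteq> l"
  have "b l = a l * cis (\<theta> l)" using unit[OF h(2)] by (intro cis_Arg2pi_div) auto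
  thus False using end_not_in_other_arc[of j l "\<theta> l"] h Arg2pi[of "b l / a l"] by auto
qed

lemma one_minus_nz:
  assumes "cmod z < 1" "cmod w = 1"
  shows "1 - z * cnj w \<noteq> 0"
proof
  assume "1 - z * cnj w = 0"
  hence "cmod (z * cnj w) = 1" by simp
  thus False using assms by (simp add: norm_mult)
qed

lemma Q_sq_P: "cmod z < 1 \<Longrightarrow> Q z * Q z * P z = 1"
proof -
  assume z: "cmod z < 1"
  have "Q z * Q z * P z = (\<Prod>l = 1..m. 1)"
    unfolding Q_def P_def prod.distrib[symmetric]
  proof (intro prod.cong refl)
    fix l assume l: "l \<in> {1..m}"
    have nz: "1 - z * cnj (a l) \<noteq> 0" "1 - z * cnj (b l) \<noteq> 0" using one_minus_nz z unit[OF l] by auto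
    have h: "w powr (1/2) * w powr (1/2) = w" "w powr (-1/2) * w powr (-1/2) = 1 / w" if "w \<noteq> 0" for w :: complex
    proof -
      have "w powr (1/2) * w powr (1/2) = w powr (1/2 + 1/2)" by (rule powr_add[symmetric])
      thus "w powr (1/2) * w powr (1/2) = w" using that by simp
      have "w powr (-1/2) * w powr (-1/2) = w powr (-1/2 + -1/2)" by (rule powr_add[symmetric])
      also have "\<dots> = w powr (- 1)" by simp
      also have "\<dots> = 1 / w" using that by (simp only: powr_minus powr_to_1 inverse_eq_divide)
      finally show "w powr (-1/2) * w powr (-1/2) = 1 / w" .
    qed
    have "(1 - z * cnj (a l)) powr (-1/2) * (1 - z * cnj (b l)) powr (1/2) * ((1 - z * cnj (a l)) powr (-1/2) * (1 - z * cnj (b l)) powr (1/2))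
      = ((1 - z * cnj (a l)) powr (-1/2) * (1 - z * cnj (a l)) powr (-1/2)) * ((1 - z * cnj (b l)) powr (1/2) * (1 - z * cnj (b l)) powr (1/2))"
      by (simp only: mult_ac)
    also have "\<dots> = (1 / (1 - z * cnj (a l))) * (1 - z * cnj (b l))" unfolding h(1)[OF nz(2)] h(2)[OF nz(1)] ..
    finally show "(1 - z * cnj (a l)) powr (-1/2) * (1 - z * cnj (b l)) powr (1/2) * ((1 - z * cnj (a l)) powr (-1/2) * (1 - z * cnj (b l)) powr (1/2)) *
        ((1 - z * cnj (a l)) / (1 - z * cnj (b l))) = 1" using nz by simp
  qed
  thus ?thesis by simp
qed

text \<open>Multiplication by \<open>cis (- \<Theta> / 2)\<close> removes the common phase of the
  residues: at \<open>b j\<close> the own arc contributes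
  \<open>- \<i> * cis (\<theta> j / 2)\<close> and every other arc
  \<open>cis (\<theta> l / 2)\<close>, together \<open>- \<i> * cis (\<Theta> / 2)\<close>. The
  moduli that remain are \<open>2 * pi\<close> times \<open>c_coeff\<close>.\<close>

lemma P_eq:
  assumes z: "cmod z < 1"
  shows "cis (- \<Theta> / 2) * P z = cis (\<Theta> / 2) - 2 * pi * \<i> * (\<Sum>j = 1..m. c_coeff m a b j / (1 - z * cnj (b j)))"
proof -
  have nb: "cnj (b l) \<noteq> 0" if "l \<in> {1..m}" for l using unit[OF that] by auto
  have inv: "1 / cnj (b l) = b l" "cnj (b l) * b l = 1" if "l \<in> {1..m}" for l
  proof -
    show "cnj (b l) * b l = 1" using unit[OF that] complex_norm_square[of "b l"] by (simp add: mult.commute)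
    hence "cnj (b l) * b l / cnj (b l) = 1 / cnj (b l)" by (simp only:)
    thus "1 / cnj (b l) = b l" using nb[OF that] by (metis nonzero_mult_div_cancel_left)
  qed
  have "P z = (\<Prod>l = 1..m. cnj (a l) / cnj (b l)) +
    (\<Sum>j = 1..m. ((\<Prod>l = 1..m. 1 - cnj (a l) / cnj (b j)) / (\<Prod>l\<in>{1..m} - {j}. 1 - cnj (b l) / cnj (b j))) / (1 - z * cnj (b j)))"
    unfolding P_def
  proof (rule partial_fractions_prod[where p="\<lambda>l. cnj (a l)" and q="\<lambda>l. cnj (b l)" and S="{1..m}" and z=z])
    show "inj_on (\<lambda>l. cnj (b l)) {1..m}"
      by (rule inj_onI, rule inj_onD[OF b_inj]) (simp_all only: complex_cnj_cancel_iff)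
    fix l assume l: "l \<in> {1..m}"
    show "cnj (b l) \<noteq> 0" by (rule nb[OF l])
    show "z * cnj (b l) \<noteq> 1" using one_minus_nz[OF z, of "b l"] unit[OF l] by auto
  qed (rule finite_atLeastAtMost)
  \<comment> \<open>The value of \<open>P\<close> at infinity; each quotient is the rotation by the
    opening angle of its arc.\<close>
  also have "(\<Prod>l = 1..m. cnj (a l) / cnj (b l)) = cis \<Theta>"
  proof -
    have "cnj (a l) / cnj (b l) = cis (\<theta> l)" if l: "l \<in> {1..m}" for l
    proof -
      have e: "b l = a l * cis (\<theta> l)" using unit[OF l] by (intro cis_Arg2pi_div) auto
      have aa: "a l * cnj (a l) = 1" using unit[OF l] complex_norm_square[of "a l"] by simp
      have "cis (\<theta> l) = (a l * cnj (a l)) * cis (\<theta> l)" unfolding aa by simp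
      also have "\<dots> = cnj (a l) * (a l * cis (\<theta> l))" by (simp only: mult_ac)
      also have "\<dots> = cnj (a l) * b l" by (simp only: e[symmetric])
      also have "cnj (a l) * b l = cnj (a l) * (1 / cnj (b l))" by (simp only: inv(1)[OF l])
      finally show ?thesis by simp
    qed
    hence "(\<Prod>l = 1..m. cnj (a l) / cnj (b l)) = (\<Prod>l = 1..m. cis (\<theta> l))" by (intro prod.cong) auto
    also have "\<dots> = cis \<Theta>" unfolding \<Theta>_def by (induction m) (auto simp: cis_mult)
    finally show ?thesis .
  qed
  finally have PP: "P z = cis \<Theta> + (\<Sum>j = 1..m. ((\<Prod>l = 1..m. 1 - cnj (a l) / cnj (b j)) / (\<Prod>l\<in>{1..m} - {j}. 1 - cnj (b l) / cnj (b j))) / (1 - z * cnj (b j)))" .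
  have res: "(\<Prod>l = 1..m. 1 - cnj (a l) / cnj (b j)) / (\<Prod>l\<in>{1..m} - {j}. 1 - cnj (b l) / cnj (b j)) = cis (\<Theta> / 2) * (- 2 * pi * \<i> * c_coeff m a b j)"
    if j: "j \<in> {1..m}" for j
  proof -
    let ?S = "{1..m} - {j}"
    have d: "x / cnj (b j) = b j * x" for x
    proof -
      have "x / cnj (b j) = x * (1 / cnj (b j))" by simp
      thus ?thesis unfolding inv(1)[OF j] by (simp only: mult.commute)
    qed
    have "(\<Prod>l = 1..m. 1 - cnj (a l) / cnj (b j)) / (\<Prod>l\<in>?S. 1 - cnj (b l) / cnj (b j))
        = (1 - b j * cnj (a j)) * (\<Prod>l\<in>?S. (1 - b j * cnj (a l)) / (1 - b j * cnj (b l)))"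
      unfolding d prod_dividef by (subst prod.remove[OF _ j]) auto
    also have "(\<Prod>l\<in>?S. (1 - b j * cnj (a l)) / (1 - b j * cnj (b l))) = (\<Prod>l\<in>?S. cis (\<theta> l / 2) * of_real (cmod (b j - a l) / cmod (b j - b l)))"
    proof (intro prod.cong refl)
      fix l assume l: "l \<in> ?S"
      show "(1 - b j * cnj (a l)) / (1 - b j * cnj (b l)) = cis (\<theta> l / 2) * of_real (cmod (b j - a l) / cmod (b j - b l))"
        using l unit[of l] unit[OF j] end_not_in_other_arc[OF j, of l] by (intro phase_other_arc) auto
    qed
    also have "1 - b j * cnj (a j) = - \<i> * cis (\<theta> j / 2) * of_real (cmod (b j - a j))" using unit[OF j] by (intro phase_same_arc) auto
    also have "- \<i> * cis (\<theta> j / 2) * of_real (cmod (b j - a j)) * (\<Prod>l\<in>?S. cis (\<theta> l / 2) * of_real (cmod (b j - a l) / cmod (b j - b l)))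
        = - \<i> * (cis (\<theta> j / 2) * (\<Prod>l\<in>?S. cis (\<theta> l / 2))) * of_real (cmod (b j - a j) * (\<Prod>l\<in>?S. cmod (b j - a l)) * (\<Prod>l\<in>?S. inverse (cmod (b j - b l))))"
      unfolding prod.distrib divide_inverse of_real_mult of_real_prod by (simp only: mult_ac)
    also have "cis (\<theta> j / 2) * (\<Prod>l\<in>?S. cis (\<theta> l / 2)) = (\<Prod>l = 1..m. cis (\<theta> l / 2))" by (subst prod.remove[OF _ j]) auto
    also have "\<dots> = cis (\<Theta> / 2)" unfolding \<Theta>_def sum_divide_distrib by (induction m) (auto simp: cis_mult)
    also have "cmod (b j - a j) * (\<Prod>l\<in>?S. cmod (b j - a l)) = (\<Prod>l = 1..m. cmod (b j - a l))" by (subst prod.remove[OF _ j]) auto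
    also have "(\<Prod>l = 1..m. cmod (b j - a l)) * (\<Prod>l\<in>?S. inverse (cmod (b j - b l))) = 2 * pi * c_coeff m a b j" by (simp add: c_coeff_def)
    finally show ?thesis by simp
  qed
  have "cis (- \<Theta> / 2) * P z = cis (- \<Theta> / 2) * cis \<Theta> + (\<Sum>j = 1..m. cis (- \<Theta> / 2) * (cis (\<Theta> / 2) * (- 2 * pi * \<i> * c_coeff m a b j) / (1 - z * cnj (b j))))"
    unfolding PP distrib_left sum_distrib_left by (intro arg_cong2[where f="(+)"] refl sum.cong) (simp_all only: res)
  also have "cis (- \<Theta> / 2) * cis \<Theta> = cis (\<Theta> / 2)" by (simp add: cis_mult)
  also have "(\<Sum>j = 1..m. cis (- \<Theta> / 2) * (cis (\<Theta> / 2) * (- 2 * pi * \<i> * c_coeff m a b j) / (1 - z * cnj (b j)))) = - 2 * pi * \<i> * (\<Sum>j = 1..m. c_coeff m a b j / (1 - z * cnj (b j)))"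
  proof -
    have "cis (- \<Theta> / 2) * cis (\<Theta> / 2) = 1" by (simp add: cis_mult)
    hence e: "cis (- \<Theta> / 2) * (cis (\<Theta> / 2) * x / y) = x / y" for x y by (metis mult.assoc mult_1 times_divide_eq_right)
    show ?thesis unfolding e by (simp add: sum_distrib_left)
  qed
  finally show ?thesis by simp
qed

lemma measurable_\<Gamma>: "\<Gamma> \<in> sets borel"
  unfolding \<Gamma>_def using unit by (intro sets.finite_UN) (auto intro: measurable_open_arc)

definition J :: "complex \<Rightarrow> complex" where
  "J z = (LINT \<zeta>|circle_measure. indicator \<Gamma> \<zeta> * H (z * cnj \<zeta>))"

text \<open>Over one arc the integral of \<open>H\<close> is a constant plus a difference of
  logarithms of linear factors; the factor \<open>\<i> * pi / 2\<close> turns their coefficients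
  into the exponents -1/2 and 1/2 of \<open>Q\<close>.\<close>

lemma exp_J:
  assumes z: "cmod z < 1"
  shows "exp (\<i> * pi / 2 * J z) = cis (\<Theta> / 4) * Q z"
proof -
  have disj': "disjoint_family_on (\<lambda>j. open_arc (a j) (b j)) {1..m}"
    using disj closure_subset unfolding disjoint_family_on_def by blast
  have ind: "(indicator \<Gamma> \<zeta> :: complex) = (\<Sum>l = 1..m. indicator (open_arc (a l) (b l)) \<zeta>)" for \<zeta>
    unfolding \<Gamma>_def using indicator_UN_disjoint[OF _ disj'] by (simp add: indicator_UN_disjoint[OF _ disj'])
  have "J z = (LINT \<zeta>|circle_measure. (\<Sum>l = 1..m. indicator (open_arc (a l) (b l)) \<zeta> * H (z * cnj \<zeta>)))"
    unfolding J_def ind sum_distrib_right ..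
  also have "\<dots> = (\<Sum>l = 1..m. (LINT \<zeta>|circle_measure. indicator (open_arc (a l) (b l)) \<zeta> * H (z * cnj \<zeta>)))"
  proof (rule Bochner_Integration.integral_sum)
    fix l assume l: "l \<in> {1..m}"
    have [measurable]: "open_arc (a l) (b l) \<in> sets borel" using unit[OF l] by (intro measurable_open_arc) auto
    have "integrable circle_measure (indicator (open_arc (a l) (b l)) :: complex \<Rightarrow> complex)"
      by (rule circle.integrable_const_bound[of _ 1]) (auto simp: indicator_def)
    thus "integrable circle_measure (\<lambda>\<zeta>. indicator (open_arc (a l) (b l)) \<zeta> * H (z * cnj \<zeta>))" using z by (intro integrable_mult_H) auto
  qed
  also have "\<dots> = (\<Sum>l = 1..m. 1 / (2 * pi) * (\<theta> l - 2 * \<i> * (Ln (1 - z * cnj (b l)) - Ln (1 - z * cnj (a l)))))"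
    using unit z by (intro sum.cong refl integral_H_arc) auto
  finally have "\<i> * pi / 2 * J z = (\<Sum>l = 1..m. \<i> * (\<theta> l / 4) + (- 1/2 * Ln (1 - z * cnj (a l)) + 1/2 * Ln (1 - z * cnj (b l))))"
    by (simp only: sum_distrib_left) (intro sum.cong refl, simp add: field_simps)
  hence "exp (\<i> * pi / 2 * J z) = (\<Prod>l = 1..m. exp (\<i> * (\<theta> l / 4)) * (exp (- 1/2 * Ln (1 - z * cnj (a l))) * exp (1/2 * Ln (1 - z * cnj (b l)))))"
    by (simp only: exp_sum[OF finite_atLeastAtMost] exp_add)
  also have "\<dots> = (\<Prod>l = 1..m. cis (\<theta> l / 4)) * Q z"
    unfolding Q_def prod.distrib[symmetric]
  proof (intro prod.cong refl)
    fix l assume l: "l \<in> {1..m}"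
    have nz: "1 - z * cnj (a l) \<noteq> 0" "1 - z * cnj (b l) \<noteq> 0" using one_minus_nz z unit[OF l] by auto
    show "exp (\<i> * (\<theta> l / 4)) * (exp (- 1/2 * Ln (1 - z * cnj (a l))) * exp (1/2 * Ln (1 - z * cnj (b l)))) =
      cis (\<theta> l / 4) * ((1 - z * cnj (a l)) powr (- 1/2) * (1 - z * cnj (b l)) powr (1/2))"
      using nz by (simp add: powr_def cis_conv_exp)
  qed
  also have "(\<Prod>l = 1..m. cis (\<theta> l / 4)) = cis (\<Theta> / 4)" unfolding \<Theta>_def sum_divide_distrib by (induction m) (auto simp: cis_mult)
  finally show ?thesis .
qed

text \<open>The left side is the jump without the factors \<open>\<xi>\<close>. By the relation
  between \<open>Q\<close> and \<open>P\<close> both exponentials become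
  \<open>cnj (Q u) * Q v\<close> times a rotated value of \<open>P\<close>, and the expansions of
  \<open>P\<close> at \<open>u\<close>, \<open>v\<close> and 0 combine so that a factor
  \<open>1 - cnj u * v\<close> cancels \<open>K u v\<close>.\<close>

theorem density_formula:
  assumes u: "cmod u < 1" and v: "cmod v < 1"
  shows "1 / (2 * pi * \<i>) * K u v * (exp (\<i> * pi / 2 * (cnj (J u) + J v)) - exp (- \<i> * pi / 2 * (cnj (J u) + J v)))
    = (\<Sum>j = 1..m. c_coeff m a b j * cnj (Q u * inverse (1 - u * cnj (b j))) * (Q v * inverse (1 - v * cnj (b j))))"
proof -
  have Q0: "Q u \<noteq> 0" "Q v \<noteq> 0" using Q_sq_P[OF u] Q_sq_P[OF v] by auto
  have cu: "exp (- \<i> * pi / 2 * cnj (J u)) = cis (- \<Theta> / 4) * cnj (Q u)"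
  proof -
    have "exp (- \<i> * pi / 2 * cnj (J u)) = cnj (exp (\<i> * pi / 2 * J u))" by (simp add: exp_cnj)
    also have "\<dots> = cnj (cis (\<Theta> / 4) * Q u)" by (simp only: exp_J[OF u])
    finally show ?thesis by (simp add: cis_cnj)
  qed
  have ep: "exp (\<i> * pi / 2 * (cnj (J u) + J v)) = cis (\<Theta> / 2) * (Q v / cnj (Q u))"
  proof -
    have "exp (\<i> * pi / 2 * cnj (J u)) = inverse (exp (- \<i> * pi / 2 * cnj (J u)))" by (simp flip: exp_minus)
    also have "\<dots> = inverse (cis (- \<Theta> / 4)) * inverse (cnj (Q u))" unfolding cu by (rule inverse_mult_distrib)
    also have "inverse (cis (- \<Theta> / 4)) = cis (\<Theta> / 4)" by (simp add: cis_inverse)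
    finally have i: "exp (\<i> * pi / 2 * cnj (J u)) = cis (\<Theta> / 4) * inverse (cnj (Q u))" .
    have "exp (\<i> * pi / 2 * (cnj (J u) + J v)) = (cis (\<Theta> / 4) * inverse (cnj (Q u))) * (cis (\<Theta> / 4) * Q v)"
      by (simp only: distrib_left exp_add i exp_J[OF v])
    also have "\<dots> = (cis (\<Theta> / 4) * cis (\<Theta> / 4)) * (Q v / cnj (Q u))" by (simp only: divide_inverse mult_ac)
    also have "cis (\<Theta> / 4) * cis (\<Theta> / 4) = cis (\<Theta> / 2)" by (simp add: cis_mult)
    finally show ?thesis .
  qed
  have em: "exp (- \<i> * pi / 2 * (cnj (J u) + J v)) = cis (- \<Theta> / 2) * (cnj (Q u) / Q v)"
  proof -
    have "exp (- \<i> * pi / 2 * (cnj (J u) + J v)) = inverse (exp (\<i> * pi / 2 * (cnj (J u) + J v)))" by (simp flip: exp_minus)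
    also have "\<dots> = inverse (cis (\<Theta> / 2)) * inverse (Q v / cnj (Q u))" unfolding ep by (rule inverse_mult_distrib)
    also have "inverse (cis (\<Theta> / 2)) = cis (- \<Theta> / 2)" by (simp add: cis_inverse)
    also have "inverse (Q v / cnj (Q u)) = cnj (Q u) / Q v" by (rule inverse_divide)
    finally show ?thesis .
  qed
  have up: "cis (\<Theta> / 2) * (Q v / cnj (Q u)) = cnj (Q u) * Q v * cnj (cis (- \<Theta> / 2) * P u)"
  proof -
    have "cnj (Q u * Q u * P u) = 1" unfolding Q_sq_P[OF u] by simp
    hence "cnj (Q u) * (cnj (Q u) * cnj (P u)) = 1" by (simp only: complex_cnj_mult mult.assoc)
    hence "inverse (cnj (Q u)) = cnj (Q u) * cnj (P u)" by (rule inverse_unique)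
    hence "Q v / cnj (Q u) = Q v * (cnj (Q u) * cnj (P u))" by (simp only: divide_inverse)
    moreover have "cnj (cis (- \<Theta> / 2)) = cis (\<Theta> / 2)" by (simp add: cis_cnj)
    ultimately show ?thesis by (simp only: complex_cnj_mult mult_ac)
  qed
  have vp: "cis (- \<Theta> / 2) * (cnj (Q u) / Q v) = cnj (Q u) * Q v * (cis (- \<Theta> / 2) * P v)"
  proof -
    have "Q v * (Q v * P v) = 1" using Q_sq_P[OF v] by (simp only: mult.assoc)
    hence "inverse (Q v) = Q v * P v" by (rule inverse_unique)
    hence "cnj (Q u) / Q v = cnj (Q u) * (Q v * P v)" by (simp only: divide_inverse)
    thus ?thesis by (simp only: mult_ac)
  qed
  define x where "x j = inverse (1 - cnj u * b j)" for j
  define y where "y j = inverse (1 - v * cnj (b j))" for j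
  define C where "C j = complex_of_real (c_coeff m a b j)" for j
  have Gv: "cis (- \<Theta> / 2) * P v = cis (\<Theta> / 2) - 2 * pi * \<i> * (\<Sum>j = 1..m. C j * y j)"
    unfolding P_eq[OF v] by (simp add: y_def C_def inverse_eq_divide)
  have Gu: "cnj (cis (- \<Theta> / 2) * P u) = cis (- \<Theta> / 2) + 2 * pi * \<i> * (\<Sum>j = 1..m. C j * x j)"
    unfolding P_eq[OF u] by (simp add: x_def C_def inverse_eq_divide cis_cnj)
  \<comment> \<open>The expansion at 0, where \<open>P\<close> is 1, relates the two constant terms
    and eliminates them.\<close>
  have G0: "cis (- \<Theta> / 2) = cis (\<Theta> / 2) - 2 * pi * \<i> * (\<Sum>j = 1..m. C j)"
    using P_eq[of 0] by (simp add: P_def C_def)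
  \<comment> \<open>Because \<open>b j * cnj (b j) = 1\<close>, the numerator collapses to
    \<open>1 - cnj u * v\<close>, the same for every pole.\<close>
  have xy: "x j + y j - 1 = (1 - cnj u * v) * (x j * y j)" if j: "j \<in> {1..m}" for j
  proof -
    have n1: "1 - v * cnj (b j) \<noteq> 0" using one_minus_nz v unit[OF j] by auto
    have "1 - u * cnj (b j) \<noteq> 0" using one_minus_nz u unit[OF j] by auto
    hence "cnj (1 - u * cnj (b j)) \<noteq> 0" by (simp only: complex_cnj_zero_iff not_False_eq_True)
    hence n2: "1 - cnj u * b j \<noteq> 0" by simp
    have bb: "b j * cnj (b j) = 1" using unit[OF j] by (simp add: complex_norm_square[symmetric])
    have "(1 - v * cnj (b j)) + (1 - cnj u * b j) - (1 - cnj u * b j) * (1 - v * cnj (b j)) = 1 - cnj u * v * (b j * cnj (b j))"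
      by (simp add: algebra_simps)
    hence e: "(1 - v * cnj (b j)) + (1 - cnj u * b j) - (1 - cnj u * b j) * (1 - v * cnj (b j)) = 1 - cnj u * v" unfolding bb by simp
    have "x j + y j - 1 = ((1 - v * cnj (b j)) + (1 - cnj u * b j) - (1 - cnj u * b j) * (1 - v * cnj (b j))) * (x j * y j)"
      unfolding x_def y_def using n1 n2 by (simp add: divide_simps)
    thus ?thesis unfolding e .
  qed
  have "cnj (cis (- \<Theta> / 2) * P u) - cis (- \<Theta> / 2) * P v = 2 * pi * \<i> * (\<Sum>j = 1..m. C j * (x j + y j - 1))"
  proof -
    have S: "(\<Sum>j = 1..m. C j * (x j + y j - 1)) = (\<Sum>j = 1..m. C j * x j) + (\<Sum>j = 1..m. C j * y j) - (\<Sum>j = 1..m. C j)"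
      by (simp add: distrib_left right_diff_distrib sum.distrib sum_subtractf)
    show ?thesis unfolding S Gv Gu by (subst G0) (simp add: algebra_simps)
  qed
  also have "(\<Sum>j = 1..m. C j * (x j + y j - 1)) = (1 - cnj u * v) * (\<Sum>j = 1..m. C j * (x j * y j))"
    unfolding sum_distrib_left by (intro sum.cong refl) (simp add: xy)
  finally have main: "cnj (cis (- \<Theta> / 2) * P u) - cis (- \<Theta> / 2) * P v = 2 * pi * \<i> * ((1 - cnj u * v) * (\<Sum>j = 1..m. C j * (x j * y j)))" .
  have nK: "1 - cnj u * v \<noteq> 0"
  proof
    assume "1 - cnj u * v = 0"
    hence "cmod (cnj u * v) = 1" by simp
    moreover have "cmod u * cmod v < 1 * 1" using u v by (intro mult_strict_mono') auto
    ultimately show False by (simp add: norm_mult)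
  qed
  have "1 / (2 * pi * \<i>) * K u v * (exp (\<i> * pi / 2 * (cnj (J u) + J v)) - exp (- \<i> * pi / 2 * (cnj (J u) + J v)))
      = 1 / (2 * pi * \<i>) * K u v * (cnj (Q u) * Q v * (cnj (cis (- \<Theta> / 2) * P u) - cis (- \<Theta> / 2) * P v))"
    unfolding ep em up vp by (simp only: right_diff_distrib)
  also have "\<dots> = (1 / (2 * pi * \<i>) * (2 * pi * \<i>)) * (K u v * (1 - cnj u * v)) * (cnj (Q u) * Q v * (\<Sum>j = 1..m. C j * (x j * y j)))"
    unfolding main by (simp only: mult_ac)
  also have "\<dots> = cnj (Q u) * Q v * (\<Sum>j = 1..m. C j * (x j * y j))"
    using nK by (simp add: K_def)
  also have "\<dots> = (\<Sum>j = 1..m. c_coeff m a b j * cnj (Q u * inverse (1 - u * cnj (b j))) * (Q v * inverse (1 - v * cnj (b j))))"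
    unfolding sum_distrib_left
    by (intro sum.cong refl) (simp only: C_def x_def y_def complex_cnj_mult complex_cnj_inverse complex_cnj_diff complex_cnj_one complex_cnj_cnj mult_ac)
  finally show ?thesis .
qed

end

subsection \<open>Analytic continuation to the slit plane\<close>

text \<open>The complement of the closed real ray from \<open>c\<close> to the right, where both
  sides of the resolvent identity are holomorphic for \<open>c\<close> below the essential
  infimum.\<close>

definition slit :: "real \<Rightarrow> complex set" where
  "slit c = {z. Im z \<noteq> 0 \<or> Re z < c}"

lemma open_slit: "open (slit c)"
  unfolding slit_def by (intro open_Collect_disj open_Collect_neq open_Collect_less continuous_intros)

lemma slit_distance:
  assumes z0: "z0 \<in> slit c"
  obtains r where "r > 0" "\<And>z x. z \<in> ball z0 r \<Longrightarrow> c \<le> x \<Longrightarrow> r \<le> cmod (of_real x - z)"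
proof -
  obtain e where e: "e > 0" "ball z0 e \<subseteq> slit c" using open_slit z0 open_contains_ball by blast
  show ?thesis
  proof (rule that[of "e / 2"])
    fix z x assume z: "z \<in> ball z0 (e / 2)" and x: "c \<le> (x::real)"
    have "of_real x \<notin> slit c" using x by (simp add: slit_def)
    hence "e \<le> dist z0 (of_real x)" using e(2) by (metis mem_ball not_less subsetD)
    also have "\<dots> \<le> dist z0 z + dist z (of_real x)" by (rule dist_triangle)
    finally show "e / 2 \<le> cmod (of_real x - z)" using z by (simp add: dist_norm norm_minus_commute)
  qed (use e in simp)
qed

text \<open>The left half-plane together with the upper or the lower half-plane is a union of two
  intersecting convex sets, hence connected, and it contains the real ray where the functions agree.
  Treating the two unions separately bypasses connectedness of the slit plane itself.\<close>

lemma holomorphic_eq_on_slit: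
  assumes f: "f holomorphic_on slit c" and g: "g holomorphic_on slit c"
    and eq: "\<And>x::real. x < c \<Longrightarrow> f (of_real x) = g (of_real x)" and w: "w \<in> slit c"
  shows "f w = g w"
proof -
  have main: "f w = g w" if S: "open S" "connected S" "S \<subseteq> slit c" "{z. Re z < c} \<subseteq> S" "w \<in> S" for S
  proof -
    have "f w - g w = 0"
    proof (rule analytic_continuation[where f="\<lambda>z. f z - g z" and S=S and U="{z. Im z = 0 \<and> Re z < c}" and \<xi>="of_real (c - 1)"])
      show "(\<lambda>z. f z - g z) holomorphic_on S"
        using f g S(3) by (intro holomorphic_on_diff) (auto intro: holomorphic_on_subset)
      show "{z. Im z = 0 \<and> Re z < c} \<subseteq> S" using S(4) by auto
      show "of_real (c - 1) \<in> S" using S(4) by auto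
      show "complex_of_real (c - 1) islimpt {z. Im z = 0 \<and> Re z < c}"
        unfolding islimpt_approachable
      proof (intro allI impI)
        fix e :: real assume "e > 0"
        thus "\<exists>z'\<in>{z. Im z = 0 \<and> Re z < c}. z' \<noteq> of_real (c - 1) \<and> dist z' (of_real (c - 1)) < e"
          by (intro bexI[of _ "of_real (c - 1 - e / 2)"]) (auto simp: dist_norm simp flip: of_real_diff)
      qed
      fix z assume "z \<in> {z. Im z = 0 \<and> Re z < c}"
      hence "z = of_real (Re z)" "Re z < c" by (auto simp: complex_eq_iff)
      thus "f z - g z = 0" using eq by (metis diff_self)
    qed (use S in auto)
    thus ?thesis by simp
  qed
  have conn: "connected ({z. Re z < c} \<union> T)" if "connected T" "{z. Re z < c} \<inter> T \<noteq> {}" for T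
    by (rule connected_Un[OF convex_connected[OF convex_halfspace_Re_lt] that])
  show ?thesis
  proof (cases "Im w > 0")
    case True
    show ?thesis
    proof (rule main[of "{z. Re z < c} \<union> {z. Im z > 0}"])
      show "connected ({z. Re z < c} \<union> {z. Im z > 0})"
      proof (rule conn)
        have "Complex (c - 1) 1 \<in> {z. Re z < c} \<inter> {z. Im z > 0}" by simp
        thus "{z. Re z < c} \<inter> {z. Im z > 0} \<noteq> {}" by blast
      qed (intro convex_connected convex_halfspace_Im_gt)
    qed (use True in \<open>auto simp: slit_def open_halfspace_Re_lt open_halfspace_Im_gt\<close>)
  next
    case False
    show ?thesis
    proof (rule main[of "{z. Re z < c} \<union> {z. Im z < 0}"])
      show "connected ({z. Re z < c} \<union> {z. Im z < 0})"
      proof (rule conn)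
        have "Complex (c - 1) (-1) \<in> {z. Re z < c} \<inter> {z. Im z < 0}" by simp
        thus "{z. Re z < c} \<inter> {z. Im z < 0} \<noteq> {}" by blast
      qed (intro convex_connected convex_halfspace_Im_lt)
      show "w \<in> {z. Re z < c} \<union> {z. Im z < 0}" using w False by (auto simp: slit_def)
    qed (auto simp: slit_def open_halfspace_Re_lt open_halfspace_Im_lt)
  qed
qed

lemma norm_Ln_le:
  assumes r: "0 < r" "r \<le> cmod z" and m: "cmod z \<le> m"
  shows "cmod (Ln z) \<le> \<bar>ln r\<bar> + m + pi"
proof -
  have z: "z \<noteq> 0" using r by auto
  have "cmod (Ln z) \<le> \<bar>Re (Ln z)\<bar> + \<bar>Im (Ln z)\<bar>" by (rule cmod_le)
  also have "Re (Ln z) = ln (cmod z)" using z by simp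
  also have "\<bar>ln (cmod z)\<bar> \<le> \<bar>ln r\<bar> + m"
  proof -
    have "ln r \<le> ln (cmod z)" using r z by (subst ln_le_cancel_iff) auto
    moreover have "ln (cmod z) \<le> m" using ln_le_minus_one[of "cmod z"] z m by auto
    moreover have "0 \<le> m" using m norm_ge_zero order_trans by blast
    ultimately show ?thesis by linarith
  qed
  also have "\<bar>Im (Ln z)\<bar> \<le> pi" using mpi_less_Im_Ln[OF z] Im_Ln_le_pi[OF z] by auto
  finally show ?thesis by simp
qed

text \<open>The logarithms of the two outer functions in \<open>((T - c)^-1 K u, K v)\<close> merge
  into one integral with this kernel. The conjugation sits on the kernel and not on the logarithm,
  which keeps the exponent holomorphic in the spectral parameter.\<close>

definition W :: "complex \<Rightarrow> complex \<Rightarrow> complex \<Rightarrow> complex" where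
  "W u v \<zeta> = cnj (H (u * cnj \<zeta>)) + H (v * cnj \<zeta>)"

lemma measurable_W[measurable]: "W u v \<in> borel_measurable borel"
  unfolding W_def by measurable

lemma W_bounded:
  assumes "cmod u < 1" "cmod v < 1"
  obtains B where "0 \<le> B" "AE \<zeta> in circle_measure. cmod (W u v \<zeta>) \<le> B"
proof -
  have "cmod u \<noteq> 1" "cmod v \<noteq> 1" using assms by auto
  note AE_norm_H_circle_le[OF this(1)] AE_norm_H_circle_le[OF this(2)]
  hence "AE \<zeta> in circle_measure. cmod (W u v \<zeta>) \<le> (1 + cmod u) / \<bar>1 - cmod u\<bar> + (1 + cmod v) / \<bar>1 - cmod v\<bar>"
  proof eventually_elim
    case (elim \<zeta>)
    have "cmod (W u v \<zeta>) \<le> cmod (cnj (H (u * cnj \<zeta>))) + cmod (H (v * cnj \<zeta>))" unfolding W_def by (rule norm_triangle_ineq)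
    thus ?case using elim by simp
  qed
  thus ?thesis by (intro that) auto
qed

lemma integrable_mult_W:
  fixes k :: "complex \<Rightarrow> complex"
  assumes k: "integrable circle_measure k" and uv: "cmod u < 1" "cmod v < 1"
  shows "integrable circle_measure (\<lambda>\<zeta>. k \<zeta> * W u v \<zeta>)"
proof -
  obtain B where B: "AE \<zeta> in circle_measure. cmod (W u v \<zeta>) \<le> B" using W_bounded[OF uv] by blast
  have [measurable]: "k \<in> borel_measurable borel" using borel_measurable_integrable[OF k] by simp
  show ?thesis
  proof (rule Bochner_Integration.integrable_bound)
    show "integrable circle_measure (\<lambda>\<zeta>. B * cmod (k \<zeta>))" using k by auto
    show "AE \<zeta> in circle_measure. norm (k \<zeta> * W u v \<zeta>) \<le> norm (B * cmod (k \<zeta>))" using B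
    proof eventually_elim
      case (elim \<zeta>)
      have "cmod (W u v \<zeta>) * cmod (k \<zeta>) \<le> B * cmod (k \<zeta>)" using elim by (intro mult_right_mono) auto
      also have "\<dots> \<le> norm (B * cmod (k \<zeta>))" by simp
      finally show ?case by (simp add: norm_mult mult.commute)
    qed
  qed measurable
qed

lemma integral_real_mult_W:
  fixes k :: "complex \<Rightarrow> real"
  assumes k: "integrable circle_measure k" and uv: "cmod u < 1" "cmod v < 1"
  shows "(LINT \<zeta>|circle_measure. of_real (k \<zeta>) * W u v \<zeta>) =
    cnj (LINT \<zeta>|circle_measure. of_real (k \<zeta>) * H (u * cnj \<zeta>)) + (LINT \<zeta>|circle_measure. of_real (k \<zeta>) * H (v * cnj \<zeta>))"
proof -
  have i: "integrable circle_measure (\<lambda>\<zeta>. of_real (k \<zeta>) * H (u * cnj \<zeta>))" "integrable circle_measure (\<lambda>\<zeta>. of_real (k \<zeta>) * H (v * cnj \<zeta>))"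
    using k uv by (auto intro!: integrable_mult_H)
  have "(LINT \<zeta>|circle_measure. of_real (k \<zeta>) * W u v \<zeta>) = (LINT \<zeta>|circle_measure. cnj (of_real (k \<zeta>) * H (u * cnj \<zeta>)) + of_real (k \<zeta>) * H (v * cnj \<zeta>))"
    by (simp add: W_def distrib_left)
  also have "\<dots> = (LINT \<zeta>|circle_measure. cnj (of_real (k \<zeta>) * H (u * cnj \<zeta>))) + (LINT \<zeta>|circle_measure. of_real (k \<zeta>) * H (v * cnj \<zeta>))"
    using i(1) by (intro Bochner_Integration.integral_add i(2) integrable_cnj)
  finally show ?thesis by (simp only: Bochner_Integration.integral_cnj)
qed

text \<open>\<open>Ln\<close> jumps across the negative axis; reflecting a negative \<open>x\<close>
  to \<open>- x\<close>, where it is continuous, and restoring the shift by \<open>\<i> * pi\<close>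
  treats both sides of the cut alike.\<close>

lemma Ln_limit_below:
  assumes "x \<noteq> 0"
  shows "(\<lambda>n. Ln (of_real x - \<i> * of_real (1 / (real n + 1)))) \<longlonglongrightarrow> of_real (ln \<bar>x\<bar>) - \<i> * pi * (if x < 0 then 1 else 0)"
    and "(\<lambda>n. Ln (of_real x + \<i> * of_real (1 / (real n + 1)))) \<longlonglongrightarrow> of_real (ln \<bar>x\<bar>) + \<i> * pi * (if x < 0 then 1 else 0)"
proof -
  have e: "(\<lambda>n. 1 / (real n + 1)) \<longlonglongrightarrow> 0" by real_asymp
  have t1: "(\<lambda>n. complex_of_real y - \<i> * of_real (1 / (real n + 1))) \<longlonglongrightarrow> of_real y - \<i> * of_real 0"
    and t2: "(\<lambda>n. complex_of_real y + \<i> * of_real (1 / (real n + 1))) \<longlonglongrightarrow> of_real y + \<i> * of_real 0" for y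
    using e by (intro tendsto_intros; simp)+
  have L: "(\<lambda>n. Ln (z n)) \<longlonglongrightarrow> of_real (ln y)" if y: "y > 0" and z: "z \<longlonglongrightarrow> complex_of_real y" for y and z :: "nat \<Rightarrow> complex"
  proof -
    have "(\<lambda>n. Ln (z n)) \<longlonglongrightarrow> Ln (of_real y)" using y by (intro tendsto_Ln z) auto
    thus ?thesis using y by (simp add: Ln_of_real)
  qed
  show "(\<lambda>n. Ln (of_real x - \<i> * of_real (1 / (real n + 1)))) \<longlonglongrightarrow> of_real (ln \<bar>x\<bar>) - \<i> * pi * (if x < 0 then 1 else 0)"
  proof (cases "x > 0")
    case True
    thus ?thesis using L[OF True, of "\<lambda>n. of_real x - \<i> * of_real (1 / (real n + 1))"] t1[of x] by simp
  next
    case False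
    hence x: "x < 0" using assms by simp
    have eq: "Ln (of_real x - \<i> * of_real (1 / (real n + 1))) = Ln (of_real (- x) + \<i> * of_real (1 / (real n + 1))) - \<i> * pi" for n
    proof -
      have "Ln (- (of_real (- x) + \<i> * of_real (1 / (real n + 1)))) = Ln (of_real (- x) + \<i> * of_real (1 / (real n + 1))) - \<i> * pi"
        by (subst Ln_minus) (use x in \<open>auto simp: complex_eq_iff\<close>)
      thus ?thesis by simp
    qed
    have "(\<lambda>n. Ln (of_real (- x) + \<i> * of_real (1 / (real n + 1))) - \<i> * pi) \<longlonglongrightarrow> of_real (ln (- x)) - \<i> * pi"
      using L[of "- x" "\<lambda>n. of_real (- x) + \<i> * of_real (1 / (real n + 1))"] t2[of "- x"] x by (intro tendsto_diff tendsto_const) simp_all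
    thus ?thesis unfolding eq using x by simp
  qed
  show "(\<lambda>n. Ln (of_real x + \<i> * of_real (1 / (real n + 1)))) \<longlonglongrightarrow> of_real (ln \<bar>x\<bar>) + \<i> * pi * (if x < 0 then 1 else 0)"
  proof (cases "x > 0")
    case True
    thus ?thesis using L[OF True, of "\<lambda>n. of_real x + \<i> * of_real (1 / (real n + 1))"] t2[of x] by simp
  next
    case False
    hence x: "x < 0" using assms by simp
    have eq: "Ln (of_real x + \<i> * of_real (1 / (real n + 1))) = Ln (of_real (- x) - \<i> * of_real (1 / (real n + 1))) + \<i> * pi" for n
    proof -
      have "Ln (- (of_real (- x) - \<i> * of_real (1 / (real n + 1)))) = Ln (of_real (- x) - \<i> * of_real (1 / (real n + 1))) + \<i> * pi"
        by (subst Ln_minus) (use x in \<open>auto simp: complex_eq_iff\<close>)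
      thus ?thesis by (simp add: add.commute)
    qed
    have "(\<lambda>n. Ln (of_real (- x) - \<i> * of_real (1 / (real n + 1))) + \<i> * pi) \<longlonglongrightarrow> of_real (ln (- x)) + \<i> * pi"
      using L[of "- x" "\<lambda>n. of_real (- x) - \<i> * of_real (1 / (real n + 1))"] t1[of "- x"] x by (intro tendsto_add tendsto_const) simp_all
    thus ?thesis unfolding eq using x by simp
  qed
qed

text \<open>The bound does not depend on the height \<open>e\<close>, as dominated convergence at
  the boundary requires.\<close>

lemma norm_Ln_shift_le:
  assumes x: "x \<noteq> 0" and e: "\<bar>e\<bar> \<le> 1"
  shows "cmod (Ln (of_real x + \<i> * of_real e)) \<le> \<bar>ln \<bar>x\<bar>\<bar> + \<bar>x\<bar> + 1 + pi"
proof -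
  have "\<bar>x\<bar> \<le> cmod (of_real x + \<i> * of_real e)" using abs_Re_le_cmod[of "of_real x + \<i> * of_real e"] by simp
  moreover have "cmod (of_real x + \<i> * of_real e) \<le> \<bar>x\<bar> + 1"
    using norm_triangle_ineq[of "of_real x" "\<i> * of_real e"] e by (simp add: norm_mult)
  ultimately show ?thesis using norm_Ln_le[of "\<bar>x\<bar>" "of_real x + \<i> * of_real e" "\<bar>x\<bar> + 1"] x by simp
qed

subsection \<open>The Poisson kernel of the half-plane\<close>

text \<open>The half-plane kernel at height \<open>1 / (n + 1)\<close> decreases with the distance
  from \<mu> on the whole line, and its mass on \<open>{-d..d}\<close> is
  \<open>2 / pi * arctan (d * (n + 1))\<close>.\<close>

lemma half_plane_poisson_tendsto:
  fixes M :: "real measure"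
  assumes M: "sets M = sets borel" "finite_measure M"
    and der: "((\<lambda>t. measure M {..<t}) has_real_derivative D) (at \<mu>)"
  shows "(\<lambda>n. LINT x|M. (1 / (real n + 1) / pi) / ((x - \<mu>)\<^sup>2 + (1 / (real n + 1))\<^sup>2)) \<longlonglongrightarrow> D"
proof (rule kernel_integral_tendsto[OF M der, where \<psi>="\<lambda>n s. (1 / (real n + 1) / pi) / (s\<^sup>2 + (1 / (real n + 1))\<^sup>2)" and ?d0.0=1])
  have pos: "0 < s\<^sup>2 + (1 / (real n + 1))\<^sup>2" for s :: real and n :: nat
    by (intro add_nonneg_pos) auto
  show "\<forall>\<^sub>F n in sequentially. antimono_on {0..1} (\<lambda>s. (1 / (real n + 1) / pi) / (s\<^sup>2 + (1 / (real n + 1))\<^sup>2)) \<and>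
    continuous_on {0..1} (\<lambda>s. (1 / (real n + 1) / pi) / (s\<^sup>2 + (1 / (real n + 1))\<^sup>2)) \<and>
    (\<lambda>x. (1 / (real n + 1) / pi) / ((x - \<mu>)\<^sup>2 + (1 / (real n + 1))\<^sup>2)) \<in> borel_measurable borel \<and>
    (\<forall>s\<in>{0..1}. 0 \<le> (1 / (real n + 1) / pi) / (s\<^sup>2 + (1 / (real n + 1))\<^sup>2))"
  proof (intro always_eventually allI conjI ballI)
    fix n
    show "antimono_on {0..1} (\<lambda>s. (1 / (real n + 1) / pi) / (s\<^sup>2 + (1 / (real n + 1))\<^sup>2))"
      using pos by (intro monotone_onI divide_left_mono add_right_mono power_mono mult_pos_pos) auto
    show "continuous_on {0..1} (\<lambda>s. (1 / (real n + 1) / pi) / (s\<^sup>2 + (1 / (real n + 1))\<^sup>2))"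
      by (intro continuous_intros ballI less_imp_neq[OF pos, symmetric]) auto
    show "(\<lambda>x. (1 / (real n + 1) / pi) / ((x - \<mu>)\<^sup>2 + (1 / (real n + 1))\<^sup>2)) \<in> borel_measurable borel" by measurable
    fix s :: real
    show "0 \<le> (1 / (real n + 1) / pi) / (s\<^sup>2 + (1 / (real n + 1))\<^sup>2)" using pos[of s n] by (intro divide_nonneg_pos) auto
  qed
  show "\<forall>\<^sub>F n in sequentially. \<forall>t. \<bar>t - \<mu>\<bar> < 1 \<longrightarrow> (1 / (real n + 1) / pi) / ((t - \<mu>)\<^sup>2 + (1 / (real n + 1))\<^sup>2) = (1 / (real n + 1) / pi) / (\<bar>t - \<mu>\<bar>\<^sup>2 + (1 / (real n + 1))\<^sup>2)"
    by simp
  fix d :: real assume d: "0 < d" "d < 1"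
  show "\<forall>\<^sub>F n in sequentially. AE t in M. d \<le> \<bar>t - \<mu>\<bar> \<longrightarrow> 0 \<le> (1 / (real n + 1) / pi) / ((t - \<mu>)\<^sup>2 + (1 / (real n + 1))\<^sup>2) \<and>
      (1 / (real n + 1) / pi) / ((t - \<mu>)\<^sup>2 + (1 / (real n + 1))\<^sup>2) \<le> (1 / (real n + 1) / pi) / (d\<^sup>2 + (1 / (real n + 1))\<^sup>2)"
  proof (intro always_eventually allI AE_I2 impI conjI)
    fix n t assume a: "d \<le> \<bar>t - \<mu>\<bar>"
    show "0 \<le> (1 / (real n + 1) / pi) / ((t - \<mu>)\<^sup>2 + (1 / (real n + 1))\<^sup>2)" using pos[of "t - \<mu>" n] by (intro divide_nonneg_pos) auto
    have "d\<^sup>2 \<le> \<bar>t - \<mu>\<bar>\<^sup>2" using a d by (intro power_mono) auto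
    thus "(1 / (real n + 1) / pi) / ((t - \<mu>)\<^sup>2 + (1 / (real n + 1))\<^sup>2) \<le> (1 / (real n + 1) / pi) / (d\<^sup>2 + (1 / (real n + 1))\<^sup>2)"
      using pos by (intro divide_left_mono mult_pos_pos) auto
  qed
  show "(\<lambda>n. (1 / (real n + 1) / pi) / (d\<^sup>2 + (1 / (real n + 1))\<^sup>2)) \<longlonglongrightarrow> 0"
  proof -
    have "(\<lambda>n. 1 / (real n + 1)) \<longlonglongrightarrow> 0" by real_asymp
    hence "(\<lambda>n. (1 / (real n + 1) / pi) / (d\<^sup>2 + (1 / (real n + 1))\<^sup>2)) \<longlonglongrightarrow> (0 / pi) / (d\<^sup>2 + 0\<^sup>2)"
      using d by (intro tendsto_intros) auto
    thus ?thesis by simp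
  qed
  show "(\<lambda>n. LINT t:{- d..d}|lborel. (1 / (real n + 1) / pi) / (\<bar>t\<bar>\<^sup>2 + (1 / (real n + 1))\<^sup>2)) \<longlonglongrightarrow> 1"
  proof -
    have eq: "(LINT t:{- d..d}|lborel. (1 / (real n + 1) / pi) / (\<bar>t\<bar>\<^sup>2 + (1 / (real n + 1))\<^sup>2)) = 2 / pi * arctan (d * (real n + 1))" for n :: nat
    proof -
      define e where "e = real n + 1"
      have e: "e > 0" by (simp add: e_def)
      have c: "(1 / e / pi) / (\<bar>t\<bar>\<^sup>2 + (1 / e)\<^sup>2) = (inverse (1 + (t * e)\<^sup>2) * e) / pi" for t
      proof -
        have "t\<^sup>2 + (1 / e)\<^sup>2 = (1 + (t * e)\<^sup>2) / e\<^sup>2" using e by (simp add: field_simps power_mult_distrib)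
        moreover have "1 + (t * e)\<^sup>2 > 0" by (intro add_pos_nonneg) auto
        ultimately show ?thesis using e by (simp add: power2_eq_square field_simps)
      qed
      have "has_bochner_integral lborel (\<lambda>t. indicator {-d..d} t *\<^sub>R ((1 / e / pi) / (\<bar>t\<bar>\<^sup>2 + (1 / e)\<^sup>2))) (arctan (d * e) / pi - arctan (- d * e) / pi)"
      proof (rule has_bochner_integral_FTC_Icc)
        show "((\<lambda>t. arctan (t * e) / pi) has_vector_derivative (1 / e / pi) / (\<bar>t\<bar>\<^sup>2 + (1 / e)\<^sup>2)) (at t within {-d..d})" for t
          unfolding c by (auto intro!: derivative_eq_intros simp: has_real_derivative_iff_has_vector_derivative[symmetric])
        show "continuous_on {-d..d} (\<lambda>t. (1 / e / pi) / (\<bar>t\<bar>\<^sup>2 + (1 / e)\<^sup>2))"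
        proof (intro continuous_intros ballI)
          fix t :: real
          have "0 < \<bar>t\<bar>\<^sup>2 + (1 / e)\<^sup>2" using e by (intro add_nonneg_pos) auto
          thus "\<bar>t\<bar>\<^sup>2 + (1 / e)\<^sup>2 \<noteq> 0" by (rule less_imp_neq[symmetric])
        qed
      qed (use d in auto)
      hence "(LINT t:{- d..d}|lborel. (1 / e / pi) / (\<bar>t\<bar>\<^sup>2 + (1 / e)\<^sup>2)) = arctan (d * e) / pi - arctan (- d * e) / pi"
        unfolding set_lebesgue_integral_def by (rule has_bochner_integral_integral_eq)
      thus ?thesis by (simp add: e_def arctan_minus)
    qed
    have "filterlim (\<lambda>n. d * (real n + 1)) at_top sequentially"
      by (intro filterlim_tendsto_pos_mult_at_top[OF tendsto_const d(1)]) real_asymp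
    from filterlim_compose[OF tendsto_arctan_at_top this]
    have "(\<lambda>n. 2 / pi * arctan (d * (real n + 1))) \<longlonglongrightarrow> 2 / pi * (pi / 2)" by (intro tendsto_intros)
    thus ?thesis unfolding eq by simp
  qed
qed auto

subsection \<open>Boundary values of the resolvent\<close>

context toeplitz_spectral
begin

text \<open>The continued matrix element of the resolvent. Below the essential infimum the principal
  logarithm is the real one, and in the slit plane \<open>\<omega> \<zeta> - z\<close> avoids the
  cut of \<open>Ln\<close> for almost every \<zeta>.\<close>

definition R :: "complex \<Rightarrow> complex \<Rightarrow> complex \<Rightarrow> complex" where
  "R u v z = K u v * exp (- 1/2 * (LINT \<zeta>|circle_measure. Ln (of_real (\<omega> \<zeta>) - z) * W u v \<zeta>))"

lemma hinner_resolvent_K_eq_R: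
  assumes l: "ereal l < \<gamma>" and uv: "cmod u < 1" "cmod v < 1"
  shows "hinner (resolvent_K l u) (K v) = R u v (of_real l)"
proof -
  have "(LINT \<zeta>|circle_measure. Ln (of_real (\<omega> \<zeta>) - of_real l) * W u v \<zeta>) = (LINT \<zeta>|circle_measure. of_real (ln (\<omega> \<zeta> - l)) * W u v \<zeta>)"
  proof (rule integral_cong_AE)
    show "AE \<zeta> in circle_measure. Ln (of_real (\<omega> \<zeta>) - of_real l) * W u v \<zeta> = of_real (ln (\<omega> \<zeta> - l)) * W u v \<zeta>"
      using AE_gt[OF l] by eventually_elim (simp add: Ln_of_real flip: of_real_diff)
  qed measurable
  also have "\<dots> = cnj (LINT \<zeta>|circle_measure. of_real (ln (\<omega> \<zeta> - l)) * H (u * cnj \<zeta>)) + (LINT \<zeta>|circle_measure. of_real (ln (\<omega> \<zeta> - l)) * H (v * cnj \<zeta>))"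
    by (rule integral_real_mult_W[OF ln_int[OF l] uv])
  finally have e: "- 1/2 * (LINT \<zeta>|circle_measure. Ln (of_real (\<omega> \<zeta>) - of_real l) * W u v \<zeta>)
      = cnj (- (1/2 * (LINT \<zeta>|circle_measure. of_real (ln (\<omega> \<zeta> - l)) * H (u * cnj \<zeta>)))) + - (1/2 * (LINT \<zeta>|circle_measure. of_real (ln (\<omega> \<zeta> - l)) * H (v * cnj \<zeta>)))"
    by (simp add: algebra_simps)
  have "exp (- 1/2 * (LINT \<zeta>|circle_measure. Ln (of_real (\<omega> \<zeta>) - of_real l) * W u v \<zeta>))
      = cnj (inverse (outer_F \<omega> l u)) * inverse (outer_F \<omega> l v)"
    unfolding e exp_add exp_minus[symmetric] outer_F_def exp_cnj by simp
  thus ?thesis unfolding R_def hinner_resolvent_K[OF l uv] by simp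
qed

text \<open>For \<open>z\<close> near a point of the slit plane the distance to the values of
  \<omega> is bounded below almost everywhere, so the logarithm is dominated by the modulus of
  \<omega> plus constants.\<close>

lemma R_holomorphic:
  assumes c: "ereal c < \<gamma>" and uv: "cmod u < 1" "cmod v < 1"
  shows "R u v holomorphic_on slit c"
proof -
  obtain B where B: "0 \<le> B" "AE \<zeta> in circle_measure. cmod (W u v \<zeta>) \<le> B" using W_bounded[OF uv] by blast
  have "(\<lambda>z. LINT \<zeta>|circle_measure. Ln (of_real (\<omega> \<zeta>) - z) * W u v \<zeta>) holomorphic_on slit c"
  proof (rule holomorphic_on_lebesgue_integral[OF open_slit])
    show "(\<lambda>\<zeta>. Ln (of_real (\<omega> \<zeta>) - z) * W u v \<zeta>) \<in> borel_measurable circle_measure" for z by measurable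
    show "AE \<zeta> in circle_measure. (\<lambda>z. Ln (of_real (\<omega> \<zeta>) - z) * W u v \<zeta>) holomorphic_on slit c"
      using AE_gt[OF c]
    proof eventually_elim
      case (elim \<zeta>)
      have "of_real (\<omega> \<zeta>) - z \<notin> \<real>\<^sub>\<le>\<^sub>0" if "z \<in> slit c" for z
        using that elim by (auto simp: complex_nonpos_Reals_iff slit_def)
      thus ?case by (intro holomorphic_intros)
    qed
    fix z0 assume "z0 \<in> slit c"
    then obtain r where r: "r > 0" "\<And>z x. z \<in> ball z0 r \<Longrightarrow> c \<le> x \<Longrightarrow> r \<le> cmod (of_real x - z)" using slit_distance by blast
    show "\<exists>r>0. \<exists>w. integrable circle_measure w \<and> (AE \<zeta> in circle_measure. \<forall>z\<in>ball z0 r \<inter> slit c. cmod (Ln (of_real (\<omega> \<zeta>) - z) * W u v \<zeta>) \<le> w \<zeta>)"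
    proof (intro exI conjI)
      show "integrable circle_measure (\<lambda>\<zeta>. (\<bar>ln r\<bar> + (\<bar>\<omega> \<zeta>\<bar> + cmod z0 + r) + pi) * B)" using \<omega>_int by auto
      show "AE \<zeta> in circle_measure. \<forall>z\<in>ball z0 r \<inter> slit c. cmod (Ln (of_real (\<omega> \<zeta>) - z) * W u v \<zeta>) \<le> (\<bar>ln r\<bar> + (\<bar>\<omega> \<zeta>\<bar> + cmod z0 + r) + pi) * B"
        using AE_gt[OF c] B(2)
      proof eventually_elim
        case (elim \<zeta>)
        show ?case
        proof
          fix z assume z: "z \<in> ball z0 r \<inter> slit c"
          have "cmod z \<le> cmod z0 + r" using z norm_triangle_ineq2[of z z0] by (simp add: dist_norm norm_minus_commute)
          hence "cmod (of_real (\<omega> \<zeta>) - z) \<le> \<bar>\<omega> \<zeta>\<bar> + cmod z0 + r" using norm_triangle_ineq4[of "of_real (\<omega> \<zeta>)" z] by simp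
          moreover have "r \<le> cmod (of_real (\<omega> \<zeta>) - z)" using z elim by (intro r(2)) auto
          ultimately have "cmod (Ln (of_real (\<omega> \<zeta>) - z)) \<le> \<bar>ln r\<bar> + (\<bar>\<omega> \<zeta>\<bar> + cmod z0 + r) + pi" using r(1) by (intro norm_Ln_le)
          thus "cmod (Ln (of_real (\<omega> \<zeta>) - z) * W u v \<zeta>) \<le> (\<bar>ln r\<bar> + (\<bar>\<omega> \<zeta>\<bar> + cmod z0 + r) + pi) * B"
            unfolding norm_mult using elim r(1) by (intro mult_mono) auto
        qed
      qed
    qed (rule r(1))
  qed
  thus ?thesis unfolding R_def by (intro holomorphic_intros)
qed

lemma cauchy_transform_holomorphic:
  assumes f: "f \<in> Hardy2" and c: "ereal c < \<gamma>"
  shows "(\<lambda>z. LINT x|\<nu> f. 1 / (of_real x - z)) holomorphic_on slit c"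
proof (rule holomorphic_on_lebesgue_integral[OF open_slit])
  interpret finite_measure "\<nu> f" using f by (rule finite_\<nu>)
  show "(\<lambda>x. 1 / (of_real x - z)) \<in> borel_measurable (\<nu> f)" for z :: complex by measurable
  show "AE x in \<nu> f. (\<lambda>z. 1 / (of_real x - z)) holomorphic_on slit c"
    using AE_\<nu>_ge[OF f c]
  proof eventually_elim
    case (elim x)
    have "of_real x - z \<noteq> 0" if "z \<in> slit c" for z using that elim by (auto simp: slit_def)
    thus ?case by (intro holomorphic_intros)
  qed
  fix z0 assume "z0 \<in> slit c"
  then obtain r where r: "r > 0" "\<And>z x. z \<in> ball z0 r \<Longrightarrow> c \<le> x \<Longrightarrow> r \<le> cmod (of_real x - z)" using slit_distance by blast
  show "\<exists>r>0. \<exists>w. integrable (\<nu> f) w \<and> (AE x in \<nu> f. \<forall>z\<in>ball z0 r \<inter> slit c. cmod (1 / (of_real x - z)) \<le> w x)"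
  proof (intro exI conjI)
    show "integrable (\<nu> f) (\<lambda>_. 1 / r)" by simp
    show "AE x in \<nu> f. \<forall>z\<in>ball z0 r \<inter> slit c. cmod (1 / (of_real x - z)) \<le> 1 / r"
      using AE_\<nu>_ge[OF f c]
    proof eventually_elim
      case (elim x)
      show ?case
      proof
        fix z assume "z \<in> ball z0 r \<inter> slit c"
        hence "r \<le> cmod (of_real x - z)" using elim by (intro r(2)) auto
        thus "cmod (1 / (of_real x - z)) \<le> 1 / r" unfolding norm_divide norm_one using r(1) by (intro frac_le) auto
      qed
    qed
  qed (rule r(1))
qed

section \<open>Matrix elements in the vectors \<open>K u + s * K v\<close>\<close>

context
  fixes u v :: complex
  assumes uv: "cmod u < 1" "cmod v < 1"
begin

definition fs :: "complex \<Rightarrow> complex \<Rightarrow> complex" where "fs s = (\<lambda>\<zeta>. K u \<zeta> + s * K v \<zeta>)"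

text \<open>The quadratic form at \<open>K u + s * K v\<close> of a form known only through its
  values \<open>B\<close> on pairs of kernels; it is used for inner products, resolvents and
  boundary values alike.\<close>

definition quad :: "(complex \<Rightarrow> complex \<Rightarrow> complex) \<Rightarrow> complex \<Rightarrow> complex" where
  "quad B s = B u u + s * B v u + cnj s * B u v + s * cnj s * B v v"

text \<open>Averaging \<open>s * quad B s\<close> over the fourth roots of unity keeps exactly the
  coefficient of \<open>cnj s\<close>.\<close>

lemma polarization: "1/4 * (quad B 1 - quad B (-1) + \<i> * quad B \<i> - \<i> * quad B (-\<i>)) = B u v"
  by (simp add: quad_def algebra_simps)

lemma fs_Hardy2: "fs s \<in> Hardy2"
  unfolding fs_def by (intro Hardy2_add Hardy2_scale K_Hardy2 uv)

lemma hinner_fs: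
  assumes "g1 \<in> Hardy2" "g2 \<in> Hardy2"
  shows "hinner (\<lambda>\<zeta>. g1 \<zeta> + s * g2 \<zeta>) (fs s) = hinner g1 (K u) + s * hinner g2 (K u) + cnj s * hinner g1 (K v) + s * cnj s * hinner g2 (K v)"
  unfolding fs_def using assms uv
  by (simp add: hinner_add_left hinner_add_right hinner_scale_left hinner_scale_right L2_circle_add L2_circle_scale Hardy2_L2 K_Hardy2 algebra_simps)

text \<open>By linearity of the graph, \<open>g\<close> is the resolvent applied to
  \<open>fs s\<close>, assembled from the two explicit resolvents of the kernels.\<close>

lemma resolvent_real:
  assumes l: "ereal l < \<gamma>"
  shows "(LINT x|\<nu> (fs s). 1 / (of_real x - complex_of_real l)) = quad (\<lambda>a b. R a b (of_real l)) s"
proof -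
  define g where "g = (\<lambda>\<zeta>. resolvent_K l u \<zeta> + s * resolvent_K l v \<zeta>)"
  have gr: "A g (\<lambda>\<zeta>. fs s \<zeta> + l * g \<zeta>)"
  proof -
    have "A g (\<lambda>\<zeta>. (K u \<zeta> + l * resolvent_K l u \<zeta>) + s * (K v \<zeta> + l * resolvent_K l v \<zeta>))"
      unfolding g_def by (intro toeplitz_graph_add resolvent_K_graph l uv)
    thus ?thesis by (simp add: fs_def g_def algebra_simps)
  qed
  have gH: "g \<in> Hardy2" using toeplitz_graphD[OF gr] by simp
  have RH: "resolvent_K l u \<in> Hardy2" "resolvent_K l v \<in> Hardy2"
    using toeplitz_graphD(2)[OF resolvent_K_graph[OF l]] uv by auto
  \<comment> \<open>\<open>resolvent_integral\<close> only delivers a real part; the inner product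
    is real because the quadratic form of the operator is.\<close>
  have real: "hinner (fs s) g = of_real (Re (hinner (fs s) g))"
  proof -
    have "hinner (\<lambda>\<zeta>. fs s \<zeta> + l * g \<zeta>) g = of_real (LINT x|\<nu> g. x)" using spectral gr by (simp add: is_spectral_measure_def)
    hence "hinner (fs s) g = of_real (LINT x|\<nu> g. x) - l * hinner g g"
      using fs_Hardy2[of s] gH by (simp add: hinner_add_left hinner_scale_left Hardy2_L2 L2_circle_scale algebra_simps)
    also have "\<dots> \<in> \<real>" unfolding hinner_self by (intro Reals_diff Reals_mult Reals_of_real)
    finally show ?thesis by (simp add: of_real_Re)
  qed
  have "(LINT x|\<nu> (fs s). 1 / (of_real x - complex_of_real l)) = (LINT x|\<nu> (fs s). complex_of_real (1 / (x - l)))" by simp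
  also have "\<dots> = of_real (LINT x|\<nu> (fs s). 1 / (x - l))" by (rule integral_complex_of_real)
  also have "\<dots> = of_real (Re (hinner (fs s) g))" using resolvent_integral[OF fs_Hardy2 gr l] by simp
  also have "\<dots> = cnj (hinner (fs s) g)" using real by (metis complex_cnj_complex_of_real)
  also have "\<dots> = hinner g (fs s)" using hinner_commute[of g "fs s"] by simp
  also have "\<dots> = quad (\<lambda>a b. R a b (of_real l)) s"
    unfolding g_def hinner_fs[OF RH] quad_def using l uv by (simp add: hinner_resolvent_K_eq_R)
  finally show ?thesis .
qed

text \<open>Both sides are holomorphic in the slit plane for some \<open>c\<close> below the
  essential infimum and agree on the real ray to its left.\<close>

lemma cauchy_transform_eq:
  assumes z: "Im z \<noteq> 0"
  shows "(LINT x|\<nu> (fs s). 1 / (of_real x - z)) = quad (\<lambda>a b. R a b z) s"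
proof -
  obtain c :: real where c: "ereal c < \<gamma>" using ex_below by blast
  show ?thesis
  proof (rule holomorphic_eq_on_slit[where c=c and w=z and f="\<lambda>z. LINT x|\<nu> (fs s). 1 / (of_real x - z)" and g="\<lambda>z. quad (\<lambda>a b. R a b z) s"])
    show "(\<lambda>z. LINT x|\<nu> (fs s). 1 / (of_real x - z)) holomorphic_on slit c"
      by (rule cauchy_transform_holomorphic[OF fs_Hardy2 c])
    show "(\<lambda>z. quad (\<lambda>a b. R a b z) s) holomorphic_on slit c"
      unfolding quad_def by (intro holomorphic_intros R_holomorphic[OF c] uv)
    show "z \<in> slit c" using z by (simp add: slit_def)
    fix x :: real assume "x < c"
    hence "ereal x < \<gamma>" using c by (metis less_ereal.simps(1) less_trans)
    thus "(LINT y|\<nu> (fs s). 1 / (of_real y - complex_of_real x)) = quad (\<lambda>a b. R a b (of_real x)) s" by (rule resolvent_real)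
  qed
qed

end

text \<open>\<open>\<sigma>\<close> is the sign of the imaginary part on the side of approach; it
  enters only through the phase that the logarithm acquires where
  \<open>\<omega> \<zeta> < \<mu>\<close>.\<close>

definition Rlim :: "real \<Rightarrow> complex \<Rightarrow> complex \<Rightarrow> real \<Rightarrow> complex" where
  "Rlim \<sigma> u v \<mu> = K u v * (cnj (\<xi> \<omega> u \<mu>) * \<xi> \<omega> v \<mu>) *
     exp (\<sigma> * \<i> * pi / 2 * (LINT \<zeta>|circle_measure. (if \<omega> \<zeta> < \<mu> then 1 else 0) * W u v \<zeta>))"

text \<open>Dominated convergence under the logarithm. Coming from above,
  \<open>\<omega> \<zeta> - z\<close> has negative imaginary part, so where
  \<open>\<omega> \<zeta> < \<mu>\<close> its logarithm tends to a value with imaginary part -pi;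
  the factor -1/2 in the exponent turns this into a phase of positive sign.\<close>

lemma R_boundary:
  assumes uv: "cmod u < 1" "cmod v < 1"
    and li: "integrable circle_measure (\<lambda>\<zeta>. ln \<bar>\<omega> \<zeta> - \<mu>\<bar>)" and ne: "AE \<zeta> in circle_measure. \<omega> \<zeta> \<noteq> \<mu>"
    and \<sigma>: "\<sigma> = 1 \<or> \<sigma> = -1"
  shows "(\<lambda>n. R u v (of_real \<mu> + \<i> * of_real (\<sigma> * (1 / (real n + 1))))) \<longlonglongrightarrow> Rlim \<sigma> u v \<mu>"
proof -
  obtain B where B: "0 \<le> B" "AE \<zeta> in circle_measure. cmod (W u v \<zeta>) \<le> B" using W_bounded[OF uv] by blast
  define g where "g \<zeta> = of_real (ln \<bar>\<omega> \<zeta> - \<mu>\<bar>) - \<sigma> * \<i> * pi * (if \<omega> \<zeta> < \<mu> then 1 else 0)" for \<zeta>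
  have [measurable]: "g \<in> borel_measurable borel" unfolding g_def by measurable
  have "(\<lambda>n. LINT \<zeta>|circle_measure. Ln (of_real (\<omega> \<zeta>) - (of_real \<mu> + \<i> * of_real (\<sigma> * (1 / (real n + 1))))) * W u v \<zeta>) \<longlonglongrightarrow> (LINT \<zeta>|circle_measure. g \<zeta> * W u v \<zeta>)"
  proof (rule integral_dominated_convergence[where w="\<lambda>\<zeta>. (\<bar>ln \<bar>\<omega> \<zeta> - \<mu>\<bar>\<bar> + \<bar>\<omega> \<zeta> - \<mu>\<bar> + 1 + pi) * B"])
    show "integrable circle_measure (\<lambda>\<zeta>. (\<bar>ln \<bar>\<omega> \<zeta> - \<mu>\<bar>\<bar> + \<bar>\<omega> \<zeta> - \<mu>\<bar> + 1 + pi) * B)" using \<omega>_int li by auto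
    show "AE \<zeta> in circle_measure. (\<lambda>n. Ln (of_real (\<omega> \<zeta>) - (of_real \<mu> + \<i> * of_real (\<sigma> * (1 / (real n + 1))))) * W u v \<zeta>) \<longlonglongrightarrow> g \<zeta> * W u v \<zeta>"
      using ne
    proof eventually_elim
      case (elim \<zeta>)
      hence x: "\<omega> \<zeta> - \<mu> \<noteq> 0" by simp
      have "(\<lambda>n. Ln (of_real (\<omega> \<zeta>) - (of_real \<mu> + \<i> * of_real (\<sigma> * (1 / (real n + 1)))))) \<longlonglongrightarrow> g \<zeta>"
        using \<sigma>
      proof
        assume s: "\<sigma> = 1"
        have "of_real (\<omega> \<zeta>) - (of_real \<mu> + \<i> * of_real (\<sigma> * (1 / (real n + 1)))) = of_real (\<omega> \<zeta> - \<mu>) - \<i> * of_real (1 / (real n + 1))" for n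
          unfolding s by simp
        thus ?thesis using Ln_limit_below(1)[OF x] by (simp only: g_def s) simp
      next
        assume s: "\<sigma> = -1"
        have "of_real (\<omega> \<zeta>) - (of_real \<mu> + \<i> * of_real (\<sigma> * (1 / (real n + 1)))) = of_real (\<omega> \<zeta> - \<mu>) + \<i> * of_real (1 / (real n + 1))" for n
          unfolding s by simp
        thus ?thesis using Ln_limit_below(2)[OF x] by (simp only: g_def s) simp
      qed
      thus ?case by (intro tendsto_intros)
    qed
    show "AE \<zeta> in circle_measure. norm (Ln (of_real (\<omega> \<zeta>) - (of_real \<mu> + \<i> * of_real (\<sigma> * (1 / (real n + 1))))) * W u v \<zeta>) \<le> (\<bar>ln \<bar>\<omega> \<zeta> - \<mu>\<bar>\<bar> + \<bar>\<omega> \<zeta> - \<mu>\<bar> + 1 + pi) * B" for n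
      using ne B(2)
    proof eventually_elim
      case (elim \<zeta>)
      have e: "of_real (\<omega> \<zeta>) - (of_real \<mu> + \<i> * of_real (\<sigma> * (1 / (real n + 1)))) = of_real (\<omega> \<zeta> - \<mu>) + \<i> * of_real (- \<sigma> * (1 / (real n + 1)))"
        by simp
      have "\<bar>- \<sigma> * (1 / (real n + 1))\<bar> \<le> 1" using \<sigma> by auto
      hence "cmod (Ln (of_real (\<omega> \<zeta> - \<mu>) + \<i> * of_real (- \<sigma> * (1 / (real n + 1))))) \<le> \<bar>ln \<bar>\<omega> \<zeta> - \<mu>\<bar>\<bar> + \<bar>\<omega> \<zeta> - \<mu>\<bar> + 1 + pi"
        using elim by (intro norm_Ln_shift_le) auto
      thus ?case unfolding norm_mult e using elim by (intro mult_mono) auto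
    qed
  qed measurable
  hence "(\<lambda>n. R u v (of_real \<mu> + \<i> * of_real (\<sigma> * (1 / (real n + 1))))) \<longlonglongrightarrow> K u v * exp (- 1/2 * (LINT \<zeta>|circle_measure. g \<zeta> * W u v \<zeta>))"
    unfolding R_def by (intro tendsto_intros)
  also have "K u v * exp (- 1/2 * (LINT \<zeta>|circle_measure. g \<zeta> * W u v \<zeta>)) = Rlim \<sigma> u v \<mu>"
  proof -
    define I where "I = (LINT \<zeta>|circle_measure. (if \<omega> \<zeta> < \<mu> then 1 else 0) * W u v \<zeta>)"
    have ind: "integrable circle_measure (\<lambda>\<zeta>. (if \<omega> \<zeta> < \<mu> then 1 else 0) * W u v \<zeta>)"
      by (rule integrable_mult_W[OF _ uv], rule circle.integrable_const_bound[of _ 1]) auto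
    have lW: "integrable circle_measure (\<lambda>\<zeta>. of_real (ln \<bar>\<omega> \<zeta> - \<mu>\<bar>) * W u v \<zeta>)"
      using li by (intro integrable_mult_W[OF _ uv]) auto
    have "(LINT \<zeta>|circle_measure. g \<zeta> * W u v \<zeta>) = (LINT \<zeta>|circle_measure. of_real (ln \<bar>\<omega> \<zeta> - \<mu>\<bar>) * W u v \<zeta> - \<sigma> * \<i> * pi * ((if \<omega> \<zeta> < \<mu> then 1 else 0) * W u v \<zeta>))"
      by (simp only: g_def left_diff_distrib mult.assoc)
    also have "\<dots> = (LINT \<zeta>|circle_measure. of_real (ln \<bar>\<omega> \<zeta> - \<mu>\<bar>) * W u v \<zeta>) - \<sigma> * \<i> * pi * I"
      unfolding I_def by (subst Bochner_Integration.integral_diff[OF lW integrable_mult_right[OF ind]]) simp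
    also have "(LINT \<zeta>|circle_measure. of_real (ln \<bar>\<omega> \<zeta> - \<mu>\<bar>) * W u v \<zeta>) = cnj (LINT \<zeta>|circle_measure. of_real (ln \<bar>\<omega> \<zeta> - \<mu>\<bar>) * H (u * cnj \<zeta>)) + (LINT \<zeta>|circle_measure. of_real (ln \<bar>\<omega> \<zeta> - \<mu>\<bar>) * H (v * cnj \<zeta>))"
      by (rule integral_real_mult_W[OF li uv])
    finally have e: "- 1/2 * (LINT \<zeta>|circle_measure. g \<zeta> * W u v \<zeta>) = (cnj (- 1/2 * (LINT \<zeta>|circle_measure. of_real (ln \<bar>\<omega> \<zeta> - \<mu>\<bar>) * H (u * cnj \<zeta>))) +
        - 1/2 * (LINT \<zeta>|circle_measure. of_real (ln \<bar>\<omega> \<zeta> - \<mu>\<bar>) * H (v * cnj \<zeta>))) + \<sigma> * \<i> * pi / 2 * I"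
      by (simp add: field_simps)
    show ?thesis unfolding e exp_add Rlim_def \<xi>_def I_def[symmetric] exp_cnj by (simp only: mult.assoc)
  qed
  finally show ?thesis .
qed

context
  fixes u v :: complex and \<mu> :: real
  assumes uv: "cmod u < 1" "cmod v < 1"
    and li: "integrable circle_measure (\<lambda>\<zeta>. ln \<bar>\<omega> \<zeta> - \<mu>\<bar>)" and ne: "AE \<zeta> in circle_measure. \<omega> \<zeta> \<noteq> \<mu>"
begin

text \<open>Stieltjes inversion: the Cauchy transforms at \<open>\<mu> + \<i> * e\<close> and
  \<open>\<mu> - \<i> * e\<close> differ by \<open>2 * pi * \<i>\<close> times the half-plane
  Poisson integral of the measure, which tends to its derivative; the explicit side tends to the
  difference of the boundary values.\<close>

lemma quad_derivative:
  assumes der: "((\<lambda>t. measure (\<nu> (fs u v s)) {..<t}) has_real_derivative D) (at \<mu>)"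
  shows "of_real D = 1 / (2 * pi * \<i>) * (quad u v (\<lambda>a b. Rlim 1 a b \<mu>) s - quad u v (\<lambda>a b. Rlim (-1) a b \<mu>) s)"
proof -
  let ?f = "fs u v s"
  have f: "?f \<in> Hardy2" by (rule fs_Hardy2[OF uv])
  interpret finite_measure "\<nu> ?f" using f by (rule finite_\<nu>)
  define z where "z \<sigma> n = complex_of_real \<mu> + \<i> * of_real (\<sigma> * (1 / (real n + 1)))" for \<sigma> n
  have Im: "Im (z \<sigma> n) \<noteq> 0" if "\<sigma> = 1 \<or> \<sigma> = -1" for \<sigma> n using that by (auto simp: z_def)
  have quad_lim: "(\<lambda>n. quad u v (\<lambda>a b. R a b (z \<sigma> n)) s) \<longlonglongrightarrow> quad u v (\<lambda>a b. Rlim \<sigma> a b \<mu>) s" if "\<sigma> = 1 \<or> \<sigma> = -1" for \<sigma>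
    unfolding quad_def[OF uv] z_def using that by (intro tendsto_intros R_boundary uv li ne)
  have int: "integrable (\<nu> ?f) (\<lambda>x. 1 / (of_real x - w))" if w: "Im w \<noteq> 0" for w
  proof (rule integrable_const_bound[of _ "1 / \<bar>Im w\<bar>"])
    show "AE x in \<nu> ?f. norm (1 / (complex_of_real x - w)) \<le> 1 / \<bar>Im w\<bar>"
    proof (rule AE_I2)
      fix x
      have "\<bar>Im w\<bar> \<le> cmod (of_real x - w)" using abs_Im_le_cmod[of "of_real x - w"] by simp
      thus "norm (1 / (complex_of_real x - w)) \<le> 1 / \<bar>Im w\<bar>" unfolding norm_divide norm_one using w by (intro frac_le) auto
    qed
  qed measurable
  have poisson: "1 / (2 * pi * \<i>) * (quad u v (\<lambda>a b. R a b (z 1 n)) s - quad u v (\<lambda>a b. R a b (z (-1) n)) s)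
      = of_real (LINT x|\<nu> ?f. (1 / (real n + 1) / pi) / ((x - \<mu>)\<^sup>2 + (1 / (real n + 1))\<^sup>2))" for n
  proof -
    define e where "e = 1 / (real n + 1)"
    have e: "e > 0" by (simp add: e_def)
    have zz: "z 1 n = of_real \<mu> + \<i> * of_real e" "z (-1) n = of_real \<mu> - \<i> * of_real e" by (simp_all add: z_def e_def)
    have "quad u v (\<lambda>a b. R a b (z 1 n)) s - quad u v (\<lambda>a b. R a b (z (-1) n)) s = (LINT x|\<nu> ?f. 1 / (of_real x - z 1 n) - 1 / (of_real x - z (-1) n))"
      using cauchy_transform_eq[OF uv Im, of 1 s n] cauchy_transform_eq[OF uv Im, of "-1" s n] int[OF Im] 
      by (subst Bochner_Integration.integral_diff) auto
    also have "\<dots> = (LINT x|\<nu> ?f. (2 * pi * \<i>) * of_real ((e / pi) / ((x - \<mu>)\<^sup>2 + e\<^sup>2)))"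
    proof (intro Bochner_Integration.integral_cong refl)
      fix x
      have p: "(x - \<mu>)\<^sup>2 + e\<^sup>2 \<noteq> 0" using e by (simp add: add_nonneg_eq_0_iff)
      have m: "(of_real x - z 1 n) * (of_real x - z (-1) n) = of_real ((x - \<mu>)\<^sup>2 + e\<^sup>2)"
        unfolding zz by (simp add: complex_eq_iff power2_eq_square algebra_simps)
      hence nz: "of_real x - z 1 n \<noteq> 0" "of_real x - z (-1) n \<noteq> 0" using p by (metis mult_zero_left mult_zero_right of_real_eq_0_iff)+
      have "1 / (of_real x - z 1 n) - 1 / (of_real x - z (-1) n) = (z 1 n - z (-1) n) / ((of_real x - z 1 n) * (of_real x - z (-1) n))"
        using nz by (simp add: diff_frac_eq)
      also have "z 1 n - z (-1) n = 2 * \<i> * of_real e" unfolding zz by simp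
      finally show "1 / (of_real x - z 1 n) - 1 / (of_real x - z (-1) n) = (2 * pi * \<i>) * of_real ((e / pi) / ((x - \<mu>)\<^sup>2 + e\<^sup>2))"
        unfolding m by simp
    qed
    also have "\<dots> = (2 * pi * \<i>) * of_real (LINT x|\<nu> ?f. (e / pi) / ((x - \<mu>)\<^sup>2 + e\<^sup>2))"
      by (simp only: integral_mult_right_zero integral_complex_of_real)
    finally show ?thesis by (simp add: e_def)
  qed
  have "(\<lambda>n. complex_of_real (LINT x|\<nu> ?f. (1 / (real n + 1) / pi) / ((x - \<mu>)\<^sup>2 + (1 / (real n + 1))\<^sup>2))) \<longlonglongrightarrow> of_real D"
    by (intro tendsto_of_real half_plane_poisson_tendsto[OF _ _ der]) (auto intro: finite_measure_axioms)
  moreover have "(\<lambda>n. 1 / (2 * pi * \<i>) * (quad u v (\<lambda>a b. R a b (z 1 n)) s - quad u v (\<lambda>a b. R a b (z (-1) n)) s))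
      \<longlonglongrightarrow> 1 / (2 * pi * \<i>) * (quad u v (\<lambda>a b. Rlim 1 a b \<mu>) s - quad u v (\<lambda>a b. Rlim (-1) a b \<mu>) s)"
    by (intro tendsto_mult tendsto_diff tendsto_const quad_lim) auto
  ultimately show ?thesis unfolding poisson by (rule LIMSEQ_unique)
qed

text \<open>Differentiation is available for positive measures, so four of them are differentiated
  and the complex function is reassembled by polarization; the same combination of the boundary
  values isolates the pair \<open>u\<close>, \<open>v\<close>.\<close>

lemma spectral_family_derivative:
  assumes der: "\<And>s. s \<in> {1, -1, \<i>, -\<i>} \<Longrightarrow> \<exists>D. ((\<lambda>t. measure (\<nu> (fs u v s)) {..<t}) has_real_derivative D) (at \<mu>)"
  shows "((\<lambda>t. hinner (E {..<t} (K u)) (K v)) has_vector_derivative 1 / (2 * pi * \<i>) * (Rlim 1 u v \<mu> - Rlim (-1) u v \<mu>)) (at \<mu>)"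
proof -
  define q where "q s t = complex_of_real (measure (\<nu> (fs u v s)) {..<t})" for s t
  define d where "d s = 1 / (2 * pi * \<i>) * (quad u v (\<lambda>a b. Rlim 1 a b \<mu>) s - quad u v (\<lambda>a b. Rlim (-1) a b \<mu>) s)" for s
  have qd: "(q s has_vector_derivative d s) (at \<mu>)" if s: "s \<in> {1, -1, \<i>, -\<i>}" for s
  proof -
    obtain D where D: "((\<lambda>t. measure (\<nu> (fs u v s)) {..<t}) has_real_derivative D) (at \<mu>)" using der[OF s] by blast
    have "((\<lambda>t. measure (\<nu> (fs u v s)) {..<t}) has_vector_derivative D) (at \<mu>)" using D by (simp add: has_real_derivative_iff_has_vector_derivative)
    hence "(q s has_vector_derivative of_real D) (at \<mu>)" unfolding q_def by (rule bounded_linear.has_vector_derivative[OF bounded_linear_of_real])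
    thus ?thesis unfolding d_def quad_derivative[OF D] .
  qed
  have qq: "q s t = quad u v (\<lambda>a b. hinner (E {..<t} (K a)) (K b)) s" for s t
  proof -
    have KH: "K u \<in> Hardy2" "K v \<in> Hardy2" using uv by (auto intro: K_Hardy2)
    have fH: "fs u v s \<in> Hardy2" by (rule fs_Hardy2[OF uv])
    have "hinner (E {..<t} (fs u v s)) (fs u v s) = hinner (E {..<t} (K u)) (fs u v s) + s * hinner (E {..<t} (K v)) (fs u v s)"
      using E_linear[OF KH fH, of "{..<t}" s] by (simp add: fs_def[OF uv])
    also have "\<dots> = hinner (\<lambda>\<zeta>. E {..<t} (K u) \<zeta> + s * E {..<t} (K v) \<zeta>) (fs u v s)"
      using KH fH by (simp add: hinner_add_left hinner_scale_left Hardy2_L2 L2_circle_scale E_Hardy2)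
    also have "\<dots> = quad u v (\<lambda>a b. hinner (E {..<t} (K a)) (K b)) s"
      unfolding quad_def[OF uv] using KH by (intro hinner_fs[OF uv]) auto
    finally have h: "hinner (E {..<t} (fs u v s)) (fs u v s) = quad u v (\<lambda>a b. hinner (E {..<t} (K a)) (K b)) s" .
    \<comment> \<open>As a squared norm the quadratic form of a projection is real, so the real part
      in \<open>measure_\<nu>\<close> loses nothing.\<close>
    have "hinner (E {..<t} (fs u v s)) (fs u v s) = hinner (E {..<t} (fs u v s)) (E {..<t} (fs u v s))"
      using E_comp2[of "{..<t}" "{..<t}" "fs u v s" "fs u v s"] fH by simp
    hence "of_real (Re (hinner (E {..<t} (fs u v s)) (fs u v s))) = hinner (E {..<t} (fs u v s)) (fs u v s)"
      unfolding hinner_self by simp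
    thus ?thesis unfolding q_def h[symmetric] using fH by (simp add: measure_\<nu>)
  qed
  have "((\<lambda>t. 1/4 * (q 1 t - q (-1) t + \<i> * q \<i> t - \<i> * q (-\<i>) t)) has_vector_derivative 1/4 * (d 1 - d (-1) + \<i> * d \<i> - \<i> * d (-\<i>))) (at \<mu>)"
    by (intro has_vector_derivative_mult_right has_vector_derivative_diff has_vector_derivative_add qd) auto
  also have "(\<lambda>t. 1/4 * (q 1 t - q (-1) t + \<i> * q \<i> t - \<i> * q (-\<i>) t)) = (\<lambda>t. hinner (E {..<t} (K u)) (K v))"
    unfolding qq polarization[OF uv] ..
  also have "1/4 * (d 1 - d (-1) + \<i> * d \<i> - \<i> * d (-\<i>)) = 1 / (2 * pi * \<i>) *
     (1/4 * (quad u v (\<lambda>a b. Rlim 1 a b \<mu>) 1 - quad u v (\<lambda>a b. Rlim 1 a b \<mu>) (-1) + \<i> * quad u v (\<lambda>a b. Rlim 1 a b \<mu>) \<i> - \<i> * quad u v (\<lambda>a b. Rlim 1 a b \<mu>) (-\<i>))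
     - 1/4 * (quad u v (\<lambda>a b. Rlim (-1) a b \<mu>) 1 - quad u v (\<lambda>a b. Rlim (-1) a b \<mu>) (-1) + \<i> * quad u v (\<lambda>a b. Rlim (-1) a b \<mu>) \<i> - \<i> * quad u v (\<lambda>a b. Rlim (-1) a b \<mu>) (-\<i>)))"
    unfolding d_def by (simp only: right_diff_distrib distrib_left mult_ac) (simp only: diff_conv_add_uminus minus_add_distrib minus_minus add_ac)
  also have "\<dots> = 1 / (2 * pi * \<i>) * (Rlim 1 u v \<mu> - Rlim (-1) u v \<mu>)" unfolding polarization[OF uv] ..
  finally show ?thesis .
qed

text \<open>The arcs replace the sublevel set under the integral, which becomes
  \<open>cnj (J u) + J v\<close>; the nonnegative coefficient \<open>c_coeff\<close> is then split
  as a square of \<open>\<rho>\<close> between the two factors.\<close>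

lemma Rlim_arcs:
  assumes arcs: "disjoint_arcs m a b" and \<Gamma>: "AE \<zeta> in circle_measure. \<omega> \<zeta> < \<mu> \<longleftrightarrow> \<zeta> \<in> (\<Union>j\<in>{1..m}. open_arc (a j) (b j))"
  shows "1 / (2 * pi * \<i>) * (Rlim 1 u v \<mu> - Rlim (-1) u v \<mu>) = (\<Sum>j = 1..m. cnj (\<phi> \<omega> m a b j u \<mu>) * \<phi> \<omega> m a b j v \<mu>)"
proof -
  interpret disjoint_arcs m a b by fact
  note [measurable] = measurable_\<Gamma>
  have "(LINT \<zeta>|circle_measure. (if \<omega> \<zeta> < \<mu> then 1 else 0) * W u v \<zeta>) = (LINT \<zeta>|circle_measure. of_real (indicator \<Gamma> \<zeta>) * W u v \<zeta>)"
  proof (rule integral_cong_AE)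
    show "AE \<zeta> in circle_measure. (if \<omega> \<zeta> < \<mu> then 1 else 0) * W u v \<zeta> = of_real (indicator \<Gamma> \<zeta>) * W u v \<zeta>"
      using assms(2) by eventually_elim (auto simp: \<Gamma>_def indicator_def)
  qed measurable
  also have "\<dots> = cnj (LINT \<zeta>|circle_measure. of_real (indicator \<Gamma> \<zeta>) * H (u * cnj \<zeta>)) + (LINT \<zeta>|circle_measure. of_real (indicator \<Gamma> \<zeta>) * H (v * cnj \<zeta>))"
    by (rule integral_real_mult_W[OF _ uv], rule circle.integrable_const_bound[of _ 1]) auto
  also have "\<dots> = cnj (J u) + J v" by (simp add: J_def of_real_indicator)
  finally have I: "(LINT \<zeta>|circle_measure. (if \<omega> \<zeta> < \<mu> then 1 else 0) * W u v \<zeta>) = cnj (J u) + J v" .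
  have c: "\<rho> m a b j * \<rho> m a b j = c_coeff m a b j" for j
    unfolding \<rho>_def by (intro real_sqrt_mult_self[THEN trans] abs_of_nonneg) (auto simp: c_coeff_def intro!: mult_nonneg_nonneg divide_nonneg_nonneg prod_nonneg)
  have "1 / (2 * pi * \<i>) * (Rlim 1 u v \<mu> - Rlim (-1) u v \<mu>)
      = (cnj (\<xi> \<omega> u \<mu>) * \<xi> \<omega> v \<mu>) * (1 / (2 * pi * \<i>) * K u v * (exp (\<i> * pi / 2 * (cnj (J u) + J v)) - exp (- \<i> * pi / 2 * (cnj (J u) + J v))))"
    unfolding Rlim_def I by (simp add: algebra_simps)
  also have "\<dots> = (cnj (\<xi> \<omega> u \<mu>) * \<xi> \<omega> v \<mu>) * (\<Sum>j = 1..m. c_coeff m a b j * cnj (Q u * inverse (1 - u * cnj (b j))) * (Q v * inverse (1 - v * cnj (b j))))"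
    unfolding density_formula[OF uv] ..
  also have "\<dots> = (\<Sum>j = 1..m. cnj (\<phi> \<omega> m a b j u \<mu>) * \<phi> \<omega> m a b j v \<mu>)"
    unfolding sum_distrib_left
  proof (intro sum.cong refl)
    fix j
    have p: "\<phi> \<omega> m a b j z \<mu> = of_real (\<rho> m a b j) * (\<xi> \<omega> z \<mu> * (Q z * inverse (1 - z * cnj (b j))))" for z
      by (simp only: \<phi>_def Q_def mult_ac)
    have "cnj (\<phi> \<omega> m a b j u \<mu>) * \<phi> \<omega> m a b j v \<mu> = of_real (\<rho> m a b j * \<rho> m a b j) *
        (cnj (\<xi> \<omega> u \<mu>) * \<xi> \<omega> v \<mu> * (cnj (Q u * inverse (1 - u * cnj (b j))) * (Q v * inverse (1 - v * cnj (b j)))))"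
      unfolding p complex_cnj_mult complex_cnj_complex_of_real of_real_mult by (simp only: mult_ac)
    thus "cnj (\<xi> \<omega> u \<mu>) * \<xi> \<omega> v \<mu> * (c_coeff m a b j * cnj (Q u * inverse (1 - u * cnj (b j))) * (Q v * inverse (1 - v * cnj (b j))))
       = cnj (\<phi> \<omega> m a b j u \<mu>) * \<phi> \<omega> m a b j v \<mu>" unfolding c by (simp only: mult_ac)
  qed
  finally show ?thesis .
qed

end

end

section \<open>The derivative of the spectral family for almost every \<mu>\<close>

theorem theorem4p6:
  fixes \<omega> :: "complex \<Rightarrow> real"
    and \<Lambda> :: "real set"
    and m :: nat
    and \<alpha> \<beta> :: "nat \<Rightarrow> real \<Rightarrow> complex"
    and E :: "real set \<Rightarrow> (complex \<Rightarrow> complex) \<Rightarrow> (complex \<Rightarrow> complex)"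
    and \<gamma>1 \<gamma>2 :: ereal
    and u v :: complex
  assumes "integrable circle_measure \<omega>"
    and "\<not> (\<exists>c. AE \<zeta> in circle_measure. \<omega> \<zeta> = c)"
    and "\<gamma>1 = ess_inf circle_measure (\<lambda>\<zeta>. ereal (\<omega> \<zeta>))"
    and "\<gamma>2 = esssup circle_measure (\<lambda>\<zeta>. ereal (\<omega> \<zeta>))"
    and "\<gamma>1 > - \<infinity>"
    and "is_interval \<Lambda>"
    and "\<And>\<mu>. \<mu> \<in> \<Lambda> \<Longrightarrow> \<gamma>1 < ereal \<mu> \<and> ereal \<mu> < \<gamma>2"
    and "AE \<mu> in lborel. \<mu> \<in> \<Lambda> \<longrightarrow>
           (\<forall>j \<in> {1..m}. cmod (\<alpha> j \<mu>) = 1 \<and> cmod (\<beta> j \<mu>) = 1 \<and> \<alpha> j \<mu> \<noteq> \<beta> j \<mu>) \<and>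
           disjoint_family_on (\<lambda>j. closure (open_arc (\<alpha> j \<mu>) (\<beta> j \<mu>))) {1..m} \<and>
           (AE \<zeta> in circle_measure.
              \<omega> \<zeta> < \<mu> \<longleftrightarrow> \<zeta> \<in> (\<Union>j \<in> {1..m}. open_arc (\<alpha> j \<mu>) (\<beta> j \<mu>)))"
    and "is_spectral_measure (toeplitz_graph \<omega>) E"
    and "u \<in> ball 0 1"
    and "v \<in> ball 0 1"
  shows "AE \<mu> in lborel. \<mu> \<in> \<Lambda> \<longrightarrow>
           ((\<lambda>t. hinner (E {..<t} (K u)) (K v)) has_vector_derivative
              (\<Sum>j = 1..m. cnj (\<phi> \<omega> m (\<lambda>l. \<alpha> l \<mu>) (\<lambda>l. \<beta> l \<mu>) j u \<mu>)
                            * \<phi> \<omega> m (\<lambda>l. \<alpha> l \<mu>) (\<lambda>l. \<beta> l \<mu>) j v \<mu>)) (at \<mu>)"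
proof -
  interpret toeplitz_spectral \<omega> E
    using assms(1,3,5,9) by unfold_locales auto
  have uv: "cmod u < 1" "cmod v < 1" using assms(10,11) by auto
  \<comment> \<open>For each fixed \<open>s\<close> the exceptional set depends on \<open>u\<close>,
    \<open>v\<close> and \<open>s\<close>; the four values used by polarization leave a null
    set.\<close>
  have der: "AE \<mu> in lborel. \<exists>D. ((\<lambda>t. measure (scalar_measure E (fs u v s)) {..<t}) has_real_derivative D) (at \<mu>)" for s
    by (rule AE_differentiable_cdf) (auto intro: finite_\<nu> fs_Hardy2 uv)
  have "AE \<mu> in lborel. \<forall>s\<in>{1, -1, \<i>, -\<i>}. \<exists>D. ((\<lambda>t. measure (scalar_measure E (fs u v s)) {..<t}) has_real_derivative D) (at \<mu>)"
    using der by (intro AE_finite_allI) auto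
  with AE_integrable_ln_abs_diff[OF circle.finite_measure_axioms assms(1)] assms(8)
  show ?thesis
  proof eventually_elim
    case (elim \<mu>)
    show ?case
    proof
      assume \<mu>: "\<mu> \<in> \<Lambda>"
      have arcs: "disjoint_arcs m (\<lambda>l. \<alpha> l \<mu>) (\<lambda>l. \<beta> l \<mu>)" using elim \<mu> by unfold_locales auto
      have li: "integrable circle_measure (\<lambda>\<zeta>. ln \<bar>\<omega> \<zeta> - \<mu>\<bar>)" and ne: "AE \<zeta> in circle_measure. \<omega> \<zeta> \<noteq> \<mu>"
        and \<Gamma>: "AE \<zeta> in circle_measure. \<omega> \<zeta> < \<mu> \<longleftrightarrow> \<zeta> \<in> (\<Union>j \<in> {1..m}. open_arc (\<alpha> j \<mu>) (\<beta> j \<mu>))"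
        using elim \<mu> by auto
      show "((\<lambda>t. hinner (E {..<t} (K u)) (K v)) has_vector_derivative
              (\<Sum>j = 1..m. cnj (\<phi> \<omega> m (\<lambda>l. \<alpha> l \<mu>) (\<lambda>l. \<beta> l \<mu>) j u \<mu>)
                            * \<phi> \<omega> m (\<lambda>l. \<alpha> l \<mu>) (\<lambda>l. \<beta> l \<mu>) j v \<mu>)) (at \<mu>)"
        using spectral_family_derivative[OF uv li ne] elim(3) unfolding Rlim_arcs[OF uv li ne arcs \<Gamma>] by blast
    qed
  qed
qed

end
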